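(* Let $\kappa_\Phi(x,y,z) = -x^2-y^2+z^2+xyz-2$ on $\mathbb{R}^3$, and let $\Gamma$ be the group of polynomial automorphisms of $\mathbb{R}^3$ described in the context. Define $$\mathfrak{F}(C_{0,2}) := \{(x,y,z)\in\mathbb{R}^3 \mid z\le -2,\ xy+z\ge 2\},$$ $$\mathfrak{F}'(C_{1,1}) := \{(x,y,z)\in\mathbb{R}^3 \mid z< -2,\ xyz> x^2+y^2\}.$$ (1) Suppose $k<2$. Then $\Gamma$ acts properly on $\Gamma\cdot\mathfrak{F}(C_{0,2})$, and the action of $\Gamma$ on the complement $\kappa_\Phi^{-1}(k)\setminus \Gamma\cdot\mathfrak{F}(C_{0,2})$ is ergodic. (2) When $k=2$, the action of $\Gamma$ on $\kappa_\Phi^{-1}(2)$ is ergodic. (3) Suppose $k>2$. Then $\Gamma$ acts properly on $\Gamma\cdot\mathfrak{F}'(C_{1,1})$, and the set $\kappa_\Phi^{-1}(k)\setminus\Gamma\cdot\mathfrak{F}'(C_{1,1})$ has empty interior in $\kappa_\Phi^{-1}(k)$.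
   Context: $\Gamma$ is the (discrete) group of polynomial automorphisms of $\mathbb{R}^3$ generated by the Vieta involutions $(x,y,z)\mapsto(yz-x,y,z)$, $(x,y,z)\mapsto(x,xz-y,z)$, $(x,y,z)\mapsto(x,y,-xy-z)$, the sign-changes $(x,y,z)\mapsto(x,-y,-z)$, $(-x,y,-z)$, $(-x,-y,z)$, and the transposition $(x,y,z)\mapsto(y,x,z)$. It preserves $\kappa_\Phi$. (It arises as follows: the map $(x,y,z)\mapsto(ix,iy,z)$ embeds $\mathbb{R}^3$ in $\mathbb{C}^3$, the $\mathrm{SL}(2,\mathbb{C})$-character variety of the free group of rank two with trace coordinates $\operatorname{tr}\rho(X),\operatorname{tr}\rho(Y),\operatorname{tr}\rho(XY)$, and $\kappa_\Phi$ is the trace of the commutator $[\rho(X),\rho(Y)]$.) For $S\subset\mathbb{R}^3$, $\Gamma\cdot S=\bigcup_{\gamma\in\Gamma}\gamma(S)$. Up to sign, $\Gamma$ preserves the bivector field $(2z+xy)\,\partial_x\wedge\partial_y+(-2x+yz)\,\partial_y\wedge\partial_z+(-2y+zx)\,\partial_z\wedge\partial_x$, which is tangent to the level sets of $\kappa_\Phi$ and defines an area form, invariant up to sign, on the smooth part of each level set $\kappa_\Phi^{-1}(k)$ (the only critical point of $\kappa_\Phi$ is the origin, where $\kappa_\Phi=-2$). Ergodicity is with respect to the $\Gamma$-invariant measure on $\kappa_\Phi^{-1}(k)$ given by this area form (which lies in the smooth Lebesgue measure class): every $\Gamma$-invariant measurable subset is null or has null complement. *)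

theory Defs
  imports "HOL-Analysis.Analysis" "HOL-Algebra.Bij" "HOL-Algebra.Generated_Groups"
begin

type_synonym point = "real \<times> real \<times> real"

section \<open>The function kappa and the group Gamma\<close>

fun kappa :: "point \<Rightarrow> real" where
  "kappa (x, y, z) = - (x^2) - y^2 + z^2 + x * y * z - 2"

definition level :: "real \<Rightarrow> point set" where
  "level k = {p. kappa p = k}"

definition Gamma_gens :: "(point \<Rightarrow> point) set" where
  "Gamma_gens =
    {\<lambda>(x, y, z). (y * z - x, y, z),
     \<lambda>(x, y, z). (x, x * z - y, z),
     \<lambda>(x, y, z). (x, y, - (x * y) - z),
     \<lambda>(x, y, z). (x, - y, - z),
     \<lambda>(x, y, z). (- x, y, - z),
     \<lambda>(x, y, z). (- x, - y, z),
     \<lambda>(x, y, z). (y, x, z)}"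

definition Gamma_group :: "(point \<Rightarrow> point) set" where
  "Gamma_group = generate (BijGroup UNIV) Gamma_gens"

definition orbit_set :: "('a \<Rightarrow> 'a) set \<Rightarrow> 'a set \<Rightarrow> 'a set" where
  "orbit_set G S = (\<Union>g\<in>G. g ` S)"

definition F_C02 :: "point set" where
  "F_C02 = {(x, y, z). z \<le> -2 \<and> x * y + z \<ge> 2}"

definition F'_C11 :: "point set" where
  "F'_C11 = {(x, y, z). z < -2 \<and> x * y * z > x^2 + y^2}"

section \<open>Proper and ergodic actions\<close>

text \<open>Properness of the action on S of the discrete group G; S carries the subspace topology.
  It is meant for G-invariant S.\<close>

definition acts_properly :: "('a::topological_space \<Rightarrow> 'a) set \<Rightarrow> 'a set \<Rightarrow> bool" where
  "acts_properly G S \<longleftrightarrow>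
    (\<forall>K. K \<subseteq> S \<and> compact K \<longrightarrow> finite {g \<in> G. g ` K \<inter> K \<noteq> {}})"

definition ergodic_on :: "('a \<Rightarrow> 'a) set \<Rightarrow> 'a measure \<Rightarrow> 'a set \<Rightarrow> bool" where
  "ergodic_on G M S \<longleftrightarrow>
    (\<forall>A\<in>sets M. A \<subseteq> S \<and> (\<forall>g\<in>G. g ` A = A) \<longrightarrow> A \<in> null_sets M \<or> S - A \<in> null_sets M)"

section \<open>The area measure on a level set\<close>

text \<open>Coefficients of the bivector
  B = Bxy (d/dx ^ d/dy) + Byz (d/dy ^ d/dz) + Bzx (d/dz ^ d/dx);
  (Byz, Bzx, Bxy) is the gradient of kappa.\<close>

fun Bxy :: "point \<Rightarrow> real" where "Bxy (x, y, z) = 2 * z + x * y"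
fun Byz :: "point \<Rightarrow> real" where "Byz (x, y, z) = - 2 * x + y * z"
fun Bzx :: "point \<Rightarrow> real" where "Bzx (x, y, z) = - 2 * y + z * x"

text \<open>The area form omega of a level set is the form with omega(B) = 1.  Where Bxy is nonzero the
  level set is locally a graph over the (x,y)-plane and omega = dx dy / Bxy; likewise
  omega = dy dz / Byz and omega = dz dx / Bzx where Byz, respectively Bzx, is nonzero.
  For a set A contained in a level set on which w is nonzero, \<open>chart_area\<close> integrates |omega| over A
  by projecting A to a coordinate plane and summing over the fibres, which have at most two points
  because kappa is quadratic in each variable.  For arbitrary A the smooth part of the level set is
  split into three disjoint pieces, each covered by one of these charts; the remaining set
  Bxy = Byz = Bzx = 0 is the critical point of kappa and gets measure zero.\<close>

definition chart_area ::
  "(real \<times> real \<Rightarrow> real \<Rightarrow> point) \<Rightarrow> (point \<Rightarrow> real) \<Rightarrow> point set \<Rightarrow> ennreal" where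
  "chart_area P w A = (\<integral>\<^sup>+ p. (\<Sum>t | P p t \<in> A. ennreal (1 / \<bar>w (P p t)\<bar>)) \<partial>lborel)"

definition area :: "point set \<Rightarrow> ennreal" where
  "area A =
     chart_area (\<lambda>(x, y) z. (x, y, z)) Bxy {p \<in> A. Bxy p \<noteq> 0} +
     chart_area (\<lambda>(y, z) x. (x, y, z)) Byz {p \<in> A. Bxy p = 0 \<and> Byz p \<noteq> 0} +
     chart_area (\<lambda>(z, x) y. (x, y, z)) Bzx {p \<in> A. Bxy p = 0 \<and> Byz p = 0 \<and> Bzx p \<noteq> 0}"

text \<open>The Borel measure; its \<open>completion\<close> has the Lebesgue measurable subsets of the level set.\<close>

definition area_measure :: "real \<Rightarrow> point measure" where
  "area_measure k = measure_of (level k) {A \<in> sets borel. A \<subseteq> level k} area"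

section \<open>Gamma is a group of bijections preserving kappa\<close>

lemma Gamma_gens_involution:
  assumes "g \<in> Gamma_gens" shows "g (g p) = p"
  using assms by (cases p) (auto simp: Gamma_gens_def algebra_simps)

lemma Gamma_gens_kappa:
  assumes "g \<in> Gamma_gens" shows "kappa (g p) = kappa p"
  using assms by (cases p) (auto simp: Gamma_gens_def algebra_simps power2_eq_square)

lemma Gamma_gens_Bij: "Gamma_gens \<subseteq> carrier (BijGroup UNIV)"
  by (auto simp: BijGroup_def Bij_def extensional_def intro!: o_bij ext dest: Gamma_gens_involution)

lemma Gamma_subgroup: "subgroup Gamma_group (BijGroup UNIV)"
  unfolding Gamma_group_def by (rule group.generate_is_subgroup[OF group_BijGroup Gamma_gens_Bij])

lemma Gamma_bij: "g \<in> Gamma_group \<Longrightarrow> bij g"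
  using subgroup.subset[OF Gamma_subgroup] by (auto simp: BijGroup_def Bij_def)

lemma Gamma_gens_inv:
  assumes "g \<in> Gamma_gens" shows "inv\<^bsub>BijGroup UNIV\<^esub> g = g"
proof -
  have "g \<in> Bij UNIV" using assms Gamma_gens_Bij by (auto simp: BijGroup_def)
  moreover have "Hilbert_Choice.inv g = g"
    by (rule inv_equality) (auto simp: Gamma_gens_involution[OF assms])
  ultimately show ?thesis by (simp add: inv_BijGroup restrict_def)
qed

lemma Gamma_induct [consumes 1, case_names id gen]:
  assumes "g \<in> Gamma_group" "P id" "\<And>g h. g \<in> Gamma_gens \<Longrightarrow> P h \<Longrightarrow> P (g \<circ> h)"
  shows "P g"
proof -
  have "g \<in> Bij UNIV \<and> (\<forall>h. P h \<longrightarrow> P (g \<circ> h))"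
    using assms(1) unfolding Gamma_group_def
  proof (induction rule: generate.induct)
    case one
    then show ?case using bij_id by (auto simp: BijGroup_def Bij_def extensional_def o_def id_def)
  next
    case (incl h)
    then have "h \<in> Bij UNIV" using Gamma_gens_Bij by (auto simp: BijGroup_def)
    then show ?case using assms(3)[OF incl] by (simp add: o_def)
  next
    case (inv h)
    then have "h \<in> Bij UNIV" using Gamma_gens_Bij by (auto simp: BijGroup_def)
    then show ?case using assms(3)[OF inv] Gamma_gens_inv[OF inv] by (simp add: o_def)
  next
    case (eng h1 h2)
    then have "h1 \<otimes>\<^bsub>BijGroup UNIV\<^esub> h2 = h1 \<circ> h2"
      by (auto simp: BijGroup_def compose_def o_def)
    moreover have "h1 \<circ> h2 \<in> Bij UNIV"
      using eng by (auto simp: Bij_def extensional_def intro: bij_comp)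
    ultimately show ?case using eng by (simp add: o_def)
  qed
  then show ?thesis using assms(2) by (metis comp_id)
qed

lemma Gamma_kappa: "g \<in> Gamma_group \<Longrightarrow> kappa (g p) = kappa p"
  by (induction g arbitrary: p rule: Gamma_induct) (auto simp: Gamma_gens_kappa)

section \<open>Well-definedness of the area measure\<close>

lemma continuous_kappa [continuous_intros]: "continuous_on UNIV kappa"
proof -
  have "kappa = (\<lambda>p. - (fst p)\<^sup>2 - (fst (snd p))\<^sup>2 + (snd (snd p))\<^sup>2 + fst p * fst (snd p) * snd (snd p) - 2)"
    by auto
  show ?thesis by (subst \<open>kappa = _\<close>) (intro continuous_intros)
qed

lemma measurable_B [measurable]:
  "Bxy \<in> borel_measurable borel" "Byz \<in> borel_measurable borel" "Bzx \<in> borel_measurable borel"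
proof -
  have *: "Bxy = (\<lambda>p. 2 * snd (snd p) + fst p * fst (snd p))"
    "Byz = (\<lambda>p. - 2 * fst p + fst (snd p) * snd (snd p))"
    "Bzx = (\<lambda>p. - 2 * fst (snd p) + snd (snd p) * fst p)"
    by auto
  show "Bxy \<in> borel_measurable borel" "Byz \<in> borel_measurable borel" "Bzx \<in> borel_measurable borel"
    by (subst *, intro borel_measurable_continuous_onI continuous_intros)+
qed

lemma closed_level: "closed (level k)"
proof -
  have "level k = kappa -` {k}" by (auto simp: level_def)
  then show ?thesis using continuous_kappa by (simp add: continuous_on_eq_continuous_at closed_vimage)
qed

lemma sigma_algebra_level: "sigma_algebra (level k) {A \<in> sets borel. A \<subseteq> level k}"
proof -
  have "level k \<in> sets borel" using closed_level by auto
  then have "{A \<in> sets borel. A \<subseteq> level k} = sets (restrict_space borel (level k))"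
    by (auto simp: sets_restrict_space_iff)
  moreover have "space (restrict_space borel (level k)) = level k"
    by (simp add: space_restrict_space)
  ultimately show ?thesis using sets.sigma_algebra_axioms[of "restrict_space borel (level k)"] by simp
qed

lemma sets_area_measure [simp]: "sets (area_measure k) = {A \<in> sets borel. A \<subseteq> level k}"
  unfolding area_measure_def
  using sigma_algebra.sigma_sets_eq[OF sigma_algebra_level] by (simp add: sets_measure_of_conv) blast

lemma space_area_measure [simp]: "space (area_measure k) = level k"
  unfolding area_measure_def by (rule space_measure_of) auto

lemma chart_area_eq_emeasure:
  fixes P :: "real \<times> real \<Rightarrow> real \<Rightarrow> point" and w :: "point \<Rightarrow> real"
  assumes r [measurable]: "r1 \<in> borel_measurable borel" "r2 \<in> borel_measurable borel"
    and P [measurable]: "(\<lambda>p. P p (r1 p)) \<in> borel_measurable borel" "(\<lambda>p. P p (r2 p)) \<in> borel_measurable borel"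
    and w [measurable]: "w \<in> borel_measurable borel"
    and roots: "\<And>p t. P p t \<in> level k \<Longrightarrow> t = r1 p \<or> t = r2 p"
    and A [measurable]: "A \<in> sets borel" and AL: "A \<subseteq> level k"
  shows "chart_area P w A =
    emeasure (distr (density lborel (\<lambda>p. ennreal (1 / \<bar>w (P p (r1 p))\<bar>))) borel (\<lambda>p. P p (r1 p))) A +
    emeasure (distr (density lborel (\<lambda>p. ennreal (1 / \<bar>w (P p (r2 p))\<bar>) * indicator {p. r1 p \<noteq> r2 p} p))
      borel (\<lambda>p. P p (r2 p))) A"
proof -
  have eq: "(\<Sum>t | P p t \<in> A. ennreal (1 / \<bar>w (P p t)\<bar>)) =
      ennreal (1 / \<bar>w (P p (r1 p))\<bar>) * indicator ((\<lambda>p. P p (r1 p)) -` A) p +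
      ennreal (1 / \<bar>w (P p (r2 p))\<bar>) * indicator {p. r1 p \<noteq> r2 p} p * indicator ((\<lambda>p. P p (r2 p)) -` A) p" for p
  proof -
    have "{t. P p t \<in> A} = {t \<in> {r1 p, r2 p}. P p t \<in> A}" using roots AL by blast
    then have "(\<Sum>t | P p t \<in> A. ennreal (1 / \<bar>w (P p t)\<bar>)) =
        (\<Sum>t\<in>{r1 p, r2 p}. if P p t \<in> A then ennreal (1 / \<bar>w (P p t)\<bar>) else 0)"
      by (simp only:) (subst sum.inter_filter[symmetric], auto)
    then show ?thesis by (cases "r1 p = r2 p") (auto simp: indicator_def)
  qed
  have [measurable]: "(\<lambda>p. P p (r1 p)) -` A \<in> sets borel" "(\<lambda>p. P p (r2 p)) -` A \<in> sets borel"
    using measurable_sets[OF P(1) A] measurable_sets[OF P(2) A] by auto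
  have [measurable]: "{p. r1 p \<noteq> r2 p} \<in> sets borel" by measurable
  show ?thesis
    unfolding chart_area_def eq
    by (subst nn_integral_add) (auto simp: emeasure_distr emeasure_density)
qed

lemma quadratic_roots:
  fixes t b c :: real
  assumes "t^2 + b * t + c = 0"
  shows "t = (- b + sqrt (b^2 - 4 * c)) / 2 \<or> t = (- b - sqrt (b^2 - 4 * c)) / 2"
proof -
  have "(2 * t + b)^2 = b^2 - 4 * c" using assms by (simp add: power2_eq_square algebra_simps)
  then have "\<bar>2 * t + b\<bar> = sqrt (b^2 - 4 * c)" by (metis real_sqrt_abs)
  then show ?thesis by (auto simp: abs_if split: if_splits)
qed

lemma chart_area_measure:
  fixes P :: "real \<times> real \<Rightarrow> real \<Rightarrow> point" and b c :: "real \<times> real \<Rightarrow> real"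
  assumes "continuous_on UNIV b" "continuous_on UNIV c"
    and "continuous_on UNIV (\<lambda>(p, t). P p t)"
    and w [measurable]: "w \<in> borel_measurable borel"
    and q: "\<And>p t. P p t \<in> level k \<Longrightarrow> t^2 + b p * t + c p = 0"
  obtains M N where "sets M = sets borel" "sets N = sets borel"
    "\<And>A. A \<in> sets borel \<Longrightarrow> A \<subseteq> level k \<Longrightarrow> chart_area P w A = emeasure M A + emeasure N A"
proof -
  have *: "continuous_on UNIV (\<lambda>p. P p (r p))" if "continuous_on UNIV r" for r
    using continuous_on_compose2[OF assms(3), of UNIV "\<lambda>p. (p, r p)"] that
    by (simp add: continuous_on_Pair)
  have r: "continuous_on UNIV (\<lambda>p. (- b p + sqrt ((b p)^2 - 4 * c p)) / 2)"
    "continuous_on UNIV (\<lambda>p. (- b p - sqrt ((b p)^2 - 4 * c p)) / 2)"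
    using assms by (auto intro!: continuous_intros)
  let ?r = "\<lambda>p. (- b p + sqrt ((b p)^2 - 4 * c p)) / 2"
  let ?s = "\<lambda>p. (- b p - sqrt ((b p)^2 - 4 * c p)) / 2"
  let ?M = "distr (density lborel (\<lambda>p. ennreal (1 / \<bar>w (P p (?r p))\<bar>))) borel (\<lambda>p. P p (?r p))"
  let ?N = "distr (density lborel (\<lambda>p. ennreal (1 / \<bar>w (P p (?s p))\<bar>) * indicator {p. ?r p \<noteq> ?s p} p))
    borel (\<lambda>p. P p (?s p))"
  show ?thesis
  proof (rule that[of ?M ?N])
    fix A assume A: "A \<in> sets borel" "A \<subseteq> level k"
    show "chart_area P w A = emeasure ?M A + emeasure ?N A"
      by (rule chart_area_eq_emeasure[OF _ _ _ _ w _ A])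
        (use r *[OF r(1)] *[OF r(2)] q quadratic_roots in
          \<open>auto intro!: borel_measurable_continuous_onI\<close>)
  qed simp_all
qed

lemma emeasure_area_measure:
  assumes "A \<in> sets borel" "A \<subseteq> level k"
  shows "emeasure (area_measure k) A = area A"
proof -
  obtain M1 N1 where 1: "sets M1 = sets borel" "sets N1 = sets borel"
    "\<And>A. A \<in> sets borel \<Longrightarrow> A \<subseteq> level k \<Longrightarrow>
      chart_area (\<lambda>(x, y) z. (x, y, z)) Bxy A = emeasure M1 A + emeasure N1 A"
    by (rule chart_area_measure[where k = k and P = "\<lambda>(x, y) z. (x, y, z)" and w = Bxy and
      b = "\<lambda>p. fst p * snd p" and c = "\<lambda>p. - ((fst p)^2 + (snd p)^2 + 2 + k)"])
      (auto simp: case_prod_beta level_def algebra_simps intro!: continuous_intros)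
  obtain M2 N2 where 2: "sets M2 = sets borel" "sets N2 = sets borel"
    "\<And>A. A \<in> sets borel \<Longrightarrow> A \<subseteq> level k \<Longrightarrow>
      chart_area (\<lambda>(y, z) x. (x, y, z)) Byz A = emeasure M2 A + emeasure N2 A"
    by (rule chart_area_measure[where k = k and P = "\<lambda>(y, z) x. (x, y, z)" and w = Byz and
      b = "\<lambda>p. - (fst p * snd p)" and c = "\<lambda>p. (fst p)^2 - (snd p)^2 + 2 + k"])
      (auto simp: case_prod_beta level_def algebra_simps intro!: continuous_intros)
  obtain M3 N3 where 3: "sets M3 = sets borel" "sets N3 = sets borel"
    "\<And>A. A \<in> sets borel \<Longrightarrow> A \<subseteq> level k \<Longrightarrow>
      chart_area (\<lambda>(z, x) y. (x, y, z)) Bzx A = emeasure M3 A + emeasure N3 A"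
    by (rule chart_area_measure[where k = k and P = "\<lambda>(z, x) y. (x, y, z)" and w = Bzx and
      b = "\<lambda>p. - (fst p * snd p)" and c = "\<lambda>p. (snd p)^2 - (fst p)^2 + 2 + k"])
      (auto simp: case_prod_beta level_def algebra_simps intro!: continuous_intros)
  define R1 where "R1 = {p. Bxy p \<noteq> 0}"
  define R2 where "R2 = {p. Bxy p = 0 \<and> Byz p \<noteq> 0}"
  define R3 where "R3 = {p. Bxy p = 0 \<and> Byz p = 0 \<and> Bzx p \<noteq> 0}"
  have R [measurable]: "R1 \<in> sets borel" "R2 \<in> sets borel" "R3 \<in> sets borel"
    unfolding R1_def R2_def R3_def by measurable
  have area_eq: "area A =
      emeasure M1 (A \<inter> R1) + emeasure N1 (A \<inter> R1) +
      (emeasure M2 (A \<inter> R2) + emeasure N2 (A \<inter> R2)) +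
      (emeasure M3 (A \<inter> R3) + emeasure N3 (A \<inter> R3))"
    if "A \<in> sets borel" "A \<subseteq> level k" for A
  proof -
    have "{p \<in> A. Bxy p \<noteq> 0} = A \<inter> R1" "{p \<in> A. Bxy p = 0 \<and> Byz p \<noteq> 0} = A \<inter> R2"
      "{p \<in> A. Bxy p = 0 \<and> Byz p = 0 \<and> Bzx p \<noteq> 0} = A \<inter> R3"
      by (auto simp: R1_def R2_def R3_def)
    moreover have "A \<inter> R1 \<in> sets borel" "A \<inter> R2 \<in> sets borel" "A \<inter> R3 \<in> sets borel"
      "A \<inter> R1 \<subseteq> level k" "A \<inter> R2 \<subseteq> level k" "A \<inter> R3 \<subseteq> level k"
      using that R by auto
    ultimately show ?thesis unfolding area_def by (simp add: 1(3) 2(3) 3(3))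
  qed
  show ?thesis
    unfolding area_measure_def
  proof (rule emeasure_measure_of_sigma[OF sigma_algebra_level])
    show "positive {A \<in> sets borel. A \<subseteq> level k} area"
      by (simp add: positive_def area_eq)
    show "countably_additive {A \<in> sets borel. A \<subseteq> level k} area"
    proof (rule countably_additiveI)
      fix F :: "nat \<Rightarrow> point set"
      assume F: "range F \<subseteq> {A \<in> sets borel. A \<subseteq> level k}" "disjoint_family F"
      have ca: "(\<Sum>i. emeasure M (F i \<inter> R)) = emeasure M ((\<Union>i. F i) \<inter> R)"
        if M: "sets M = sets borel" and "R \<in> sets borel" for M R
      proof -
        have "disjoint_family (\<lambda>i. F i \<inter> R)" using F(2) by (auto simp: disjoint_family_on_def)
        moreover have "range (\<lambda>i. F i \<inter> R) \<subseteq> sets M" using F(1) that by auto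
        ultimately show ?thesis by (subst suminf_emeasure) auto
      qed
      have U: "(\<Union>i. F i) \<in> sets borel" "(\<Union>i. F i) \<subseteq> level k" using F(1) by auto
      have Fi: "F i \<in> sets borel" "F i \<subseteq> level k" for i using F(1) by auto
      show "(\<Sum>i. area (F i)) = area (\<Union>i. F i)"
        unfolding area_eq[OF U] area_eq[OF Fi]
        by (simp add: suminf_add[symmetric] ca R 1 2 3)
    qed
  qed (use assms in auto)
qed

end

theory Submission
  imports Defs
begin

text \<open>
  Properness comes from normal forms: Gamma is the free product of the three Vieta involutions
  extended by finitely many sign changes and transpositions, and a reduced word that leaves the
  given region never comes back to it.

  For k < 2, let z' = - x y - z.  Then z z' < 0 off the orbit of the region where both traces are
  at most -2, and a descent of |z| shows that almost every orbit in the complement meets |z| < 2.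
  There the level set is fibred into ellipses on which V1 and the transposition induce a rotation by an angle
  determined by z, so an invariant set is a union of ellipses up to a null set; the element
  (x, y, z) to (- x, y, z + x y) relates different ellipses and Fubini gives ergodicity.

  For k = 2, the sheet z < 0 is parametrized by (2 sinh s, 2 sinh t, - 2 cosh (s + t)), where Gamma
  acts linearly by the extended theta group.  This linear action on the plane is ergodic: the
  measure of the part of an invariant set in a window of log radii is a Lipschitz function of the
  log radius on each ray, and density points, pulled back along the continued fraction expansion of the
  direction, show that it is constant.

  For k > 2, suppose the complement of the orbit contains an open piece U of the level set.  On all
  images of U the coordinates vanish nowhere and |z| > sqrt (k + 2), so their signs are constant, and the
  same greedy sequence of elements decreases |z| at every point of U, uniformly towards sqrt (k + 2).
  This forces x and y to 0, so the images of U have arbitrarily small area in the chart (x, y),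
  whereas Gamma preserves the area form dx dy / |2 z + x y|.
\<close>

text \<open>The two roots z and z' = - x y - z of \<open>kappa\<close> = k have product - (k + 2 +
  x^2 + y^2). Where z z' < 0 and xyz < 0, \<open>V3\<close> lowers |z| by exactly |xy|; where xyz >
  0, moves at fixed z must first change the sign. Both descents rest on this. They run over real
  values, so they need more than strict decrease: for k < 2 the decrement is at least 2 - k, and for
  k > 2 the limit of |z| is identified and made uniform by compactness. Ergodicity depends on the
  measure class only, so for k <= 2 null sets are tested by projection to the (x, y)-plane; the
  density of the area form enters only for k > 2. On the level 2, |z| >= 2 everywhere, so there are
  no ellipses and no rotations. Parabolic elements take their place: they shift log radii by amounts
  depending on the direction. A Farey matrix with comparable columns distorts directions by a
  bounded factor, so a set of positive measure can be seen through it at almost full density. Farey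
  matrices fall into three cosets of the theta group, and passing to the right one costs only a
  constant.\<close>

definition V1 :: "point \<Rightarrow> point" where "V1 = (\<lambda>(x, y, z). (y * z - x, y, z))"
definition V2 :: "point \<Rightarrow> point" where "V2 = (\<lambda>(x, y, z). (x, x * z - y, z))"
definition V3 :: "point \<Rightarrow> point" where "V3 = (\<lambda>(x, y, z). (x, y, - (x * y) - z))"
definition S1 :: "point \<Rightarrow> point" where "S1 = (\<lambda>(x, y, z). (x, - y, - z))"
definition S2 :: "point \<Rightarrow> point" where "S2 = (\<lambda>(x, y, z). (- x, y, - z))"
definition S3 :: "point \<Rightarrow> point" where "S3 = (\<lambda>(x, y, z). (- x, - y, z))"
definition Sw :: "point \<Rightarrow> point" where "Sw = (\<lambda>(x, y, z). (y, x, z))"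

lemma Gamma_gens_eq: "Gamma_gens = {V1, V2, V3, S1, S2, S3, Sw}"
  by (simp add: Gamma_gens_def V1_def V2_def V3_def S1_def S2_def S3_def Sw_def)

lemma gen_apply [simp]:
  "V1 (x, y, z) = (y * z - x, y, z)" "V2 (x, y, z) = (x, x * z - y, z)"
  "V3 (x, y, z) = (x, y, - (x * y) - z)" "S1 (x, y, z) = (x, - y, - z)"
  "S2 (x, y, z) = (- x, y, - z)" "S3 (x, y, z) = (- x, - y, z)" "Sw (x, y, z) = (y, x, z)"
  by (simp_all add: V1_def V2_def V3_def S1_def S2_def S3_def Sw_def)

section \<open>Inverses, countability, continuity and orbits of Gamma\<close>

lemma Gamma_id: "id \<in> Gamma_group"
proof -
  have "\<one>\<^bsub>BijGroup UNIV\<^esub> \<in> Gamma_group" unfolding Gamma_group_def by (rule generate.one)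
  then show ?thesis by (simp add: BijGroup_def id_def restrict_def)
qed

lemma Gamma_gens_subset: "Gamma_gens \<subseteq> Gamma_group"
  unfolding Gamma_group_def by (auto intro: generate.incl)

lemma Gamma_comp:
  assumes "g \<in> Gamma_group" "h \<in> Gamma_group" shows "g \<circ> h \<in> Gamma_group"
proof -
  have Bij: "f \<in> Gamma_group \<Longrightarrow> f \<in> Bij UNIV" for f
    using subgroup.subset[OF Gamma_subgroup] by (auto simp: BijGroup_def)
  have "g \<otimes>\<^bsub>BijGroup UNIV\<^esub> h \<in> Gamma_group"
    using assms subgroup.m_closed[OF Gamma_subgroup] by blast
  moreover have "g \<otimes>\<^bsub>BijGroup UNIV\<^esub> h = g \<circ> h"
    using Bij assms by (auto simp: BijGroup_def compose_def o_def)
  ultimately show ?thesis by simp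
qed

lemma Gamma_comp_apply:
  "g \<in> Gamma_group \<Longrightarrow> h \<in> Gamma_group \<Longrightarrow> \<exists>f\<in>Gamma_group. \<forall>p. f p = g (h p)"
  using Gamma_comp[of g h] by (intro bexI[of _ "g \<circ> h"]) auto

lemma gens_in_Gamma:
  "V1 \<in> Gamma_group" "V2 \<in> Gamma_group" "V3 \<in> Gamma_group" "S1 \<in> Gamma_group"
  "S2 \<in> Gamma_group" "S3 \<in> Gamma_group" "Sw \<in> Gamma_group"
  using Gamma_gens_subset by (auto simp: Gamma_gens_eq)

lemma Gamma_inverse:
  assumes "g \<in> Gamma_group"
  obtains h where "h \<in> Gamma_group" "\<And>p. h (g p) = p" "\<And>p. g (h p) = p"
proof -
  have "\<exists>h\<in>Gamma_group. (\<forall>p. h (g p) = p) \<and> (\<forall>p. g (h p) = p)"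
    using assms
  proof (induction rule: Gamma_induct)
    case id
    show ?case by (rule bexI[OF _ Gamma_id]) simp
  next
    case (gen g f)
    then obtain h where h: "h \<in> Gamma_group" "\<forall>p. h (f p) = p" "\<forall>p. f (h p) = p" by blast
    have "h \<circ> g \<in> Gamma_group" using h(1) gen(1) Gamma_gens_subset by (intro Gamma_comp) auto
    moreover have "(h \<circ> g) ((g \<circ> f) p) = p" "(g \<circ> f) ((h \<circ> g) p) = p" for p
      unfolding comp_apply Gamma_gens_involution[OF gen(1)] using h(2,3) Gamma_gens_involution[OF gen(1)] by metis+
    ultimately show ?case by blast
  qed
  then show ?thesis using that by blast
qed

text \<open>Makes the union of all translates of a null set null, which is used to saturate
  exceptional sets and to test null sets on a part that meets every orbit.\<close>

lemma countable_Gamma: "countable Gamma_group"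
proof (rule countable_subset)
  let ?w = "\<lambda>l :: (point \<Rightarrow> point) list. foldr (\<circ>) l id"
  have "\<exists>l\<in>lists Gamma_gens. g = ?w l" if "g \<in> Gamma_group" for g
    using that
  proof (induction rule: Gamma_induct)
    case id
    show ?case by (rule bexI[of _ "[]"]) simp_all
  next
    case (gen g h)
    then obtain l where l: "l \<in> lists Gamma_gens" "h = ?w l" by (elim bexE)
    have "g \<circ> h = ?w (g # l)" by (simp only: foldr.simps comp_apply l(2))
    moreover have "g # l \<in> lists Gamma_gens" using l gen(1) by simp
    ultimately show ?case by blast
  qed
  then show "Gamma_group \<subseteq> ?w ` lists Gamma_gens" by (intro subsetI) (simp only: image_iff)
  have "countable Gamma_gens" by (simp add: Gamma_gens_eq)
  then show "countable (?w ` lists Gamma_gens)" by (intro countable_image countable_lists)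
qed

lemma continuous_Gamma: "g \<in> Gamma_group \<Longrightarrow> continuous_on UNIV g"
proof (induction rule: Gamma_induct)
  case id
  then show ?case by (simp add: id_def)
next
  case (gen g h)
  have "continuous_on UNIV g"
    using gen(1) unfolding Gamma_gens_def
    by (auto simp: case_prod_beta intro!: continuous_intros)
  then show ?case using gen(2) continuous_on_compose continuous_on_subset by blast
qed

lemma Gamma_image_level: "g \<in> Gamma_group \<Longrightarrow> g ` level k = level k"
proof
  assume g: "g \<in> Gamma_group"
  show "g ` level k \<subseteq> level k" using Gamma_kappa[OF g] by (auto simp: level_def)
  obtain h where h: "h \<in> Gamma_group" "\<And>p. g (h p) = p" using Gamma_inverse[OF g] by metis
  show "level k \<subseteq> g ` level k"
  proof
    fix p assume "p \<in> level k"
    then show "p \<in> g ` level k"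
      using h Gamma_kappa[OF h(1)] by (intro image_eqI[of _ _ "h p"]) (auto simp: level_def)
  qed
qed

lemma Gamma_level: "g \<in> Gamma_group \<Longrightarrow> p \<in> level k \<Longrightarrow> g p \<in> level k"
  using Gamma_kappa by (simp add: level_def)

lemma orbit_set_mem: "p \<in> orbit_set Gamma_group F \<longleftrightarrow> (\<exists>g\<in>Gamma_group. g p \<in> F)"
proof
  assume "p \<in> orbit_set Gamma_group F"
  then obtain g q where g: "g \<in> Gamma_group" "q \<in> F" "p = g q" by (auto simp: orbit_set_def)
  then show "\<exists>g\<in>Gamma_group. g p \<in> F" using Gamma_inverse[OF g(1)] by metis
next
  assume "\<exists>g\<in>Gamma_group. g p \<in> F"
  then obtain g where g: "g \<in> Gamma_group" "g p \<in> F" by blast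
  then obtain h where "h \<in> Gamma_group" "h (g p) = p" using Gamma_inverse[OF g(1)] by metis
  then show "p \<in> orbit_set Gamma_group F" using g unfolding orbit_set_def
    by (intro UN_I[of h]) (auto intro!: image_eqI[of _ _ "g p"])
qed

lemma orbit_set_invariant:
  assumes "g \<in> Gamma_group"
  shows "g p \<in> orbit_set Gamma_group F \<longleftrightarrow> p \<in> orbit_set Gamma_group F"
proof -
  have *: "p \<in> orbit_set Gamma_group F" if g: "g \<in> Gamma_group" and gp: "g p \<in> orbit_set Gamma_group F" for g p
  proof -
    obtain f where f: "f \<in> Gamma_group" "f (g p) \<in> F" using gp unfolding orbit_set_mem by blast
    then show ?thesis using Gamma_comp_apply[of f g] g unfolding orbit_set_mem by metis
  qed
  obtain h where h: "h \<in> Gamma_group" "\<And>p. h (g p) = p" using Gamma_inverse[OF assms] by metis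
  show ?thesis using *[OF assms, of p] *[OF h(1), of "g p"] h(2)[of p] by argo
qed

section \<open>Null subsets of a level set, seen in coordinate projections\<close>

definition pxy :: "point \<Rightarrow> real \<times> real" where "pxy = (\<lambda>(x, y, z). (x, y))"
text \<open>A second test projection: \<open>V1\<close> changes x only, so it leaves images under
  \<open>pyz\<close> unchanged, while in the image under \<open>pxy\<close> it acts
  nonlinearly.\<close>

definition pyz :: "point \<Rightarrow> real \<times> real" where "pyz = (\<lambda>(x, y, z). (y, z))"

lemma proj_apply [simp]: "pxy (x, y, z) = (x, y)" "pyz (x, y, z) = (y, z)"
  by (simp_all add: pxy_def pyz_def)

lemma continuous_proj: "continuous_on UNIV pxy" "continuous_on UNIV pyz"
  unfolding pxy_def pyz_def case_prod_beta by (intro continuous_intros)+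

text \<open>Fubini; closedness supplies the measurability. It is applied to algebraic curves that
  are quadratic in the second coordinate.\<close>

lemma negligible_finite_slices:
  fixes S :: "(real \<times> real) set"
  assumes "closed S" "\<And>x. finite {y. (x, y) \<in> S}"
  shows "negligible S"
proof -
  have S: "S \<in> sets (lborel \<Otimes>\<^sub>M lborel)"
    using borel_closed[OF assms(1)] by (subst lborel_prod) simp
  have "emeasure (lborel \<Otimes>\<^sub>M lborel) S = (\<integral>\<^sup>+ x. emeasure lborel (Pair x -` S) \<partial>(lborel :: real measure))"
    by (rule lborel.emeasure_pair_measure_alt[OF S])
  also have "\<dots> = (\<integral>\<^sup>+ x. 0 \<partial>(lborel :: real measure))"
    using assms(2) by (intro nn_integral_cong emeasure_lborel_countable countable_finite) (auto simp: vimage_def)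
  finally have "S \<in> null_sets lborel" using assms(1) by (auto simp: lborel_prod)
  then show ?thesis by (simp add: negligible_iff_null_sets null_sets_completionI)
qed

lemma negligible_differentiable_image:
  fixes f :: "real \<times> real \<Rightarrow> real \<times> real"
  assumes "negligible S" "\<And>p. p \<in> S \<Longrightarrow> f differentiable (at p)"
  shows "negligible (f ` S)"
  by (rule negligible_differentiable_image_negligible)
    (use assms in \<open>auto simp: differentiable_on_def intro: differentiable_at_withinI\<close>)

lemma differentiable_fst_snd:
  "fst differentiable (at p)" "snd differentiable (at p)"
  unfolding differentiable_def by (rule exI, rule derivative_intros, rule has_derivative_ident)+

lemma negligible_swap:
  fixes S :: "(real \<times> real) set"
  assumes "negligible S" shows "negligible (prod.swap ` S)"
  unfolding prod.swap_def
  by (intro negligible_differentiable_image assms differentiable_Pair differentiable_fst_snd)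

text \<open>On a level set each coordinate is a root of a quadratic in the other two. Where the
  discriminant d is positive its square root is differentiable, so changing the projection preserves
  null sets, for either root.\<close>

lemma negligible_root_image:
  fixes a b d :: "real \<times> real \<Rightarrow> real"
  assumes "negligible S" "\<And>p. a differentiable (at p)" "\<And>p. b differentiable (at p)"
    "\<And>p. d differentiable (at p)" "\<And>p. p \<in> S \<Longrightarrow> d p > 0"
  shows "negligible ((\<lambda>p. (a p, (b p + sqrt (d p)) / 2)) ` S)"
    "negligible ((\<lambda>p. (a p, (b p - sqrt (d p)) / 2)) ` S)"
proof -
  have s: "(\<lambda>p. sqrt (d p)) differentiable (at p)" if "p \<in> S" for p
  proof -
    have "sqrt differentiable (at (d p))"
      using DERIV_real_sqrt[OF assms(5)[OF that]] by (auto simp: differentiable_def has_field_derivative_def)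
    then show ?thesis using differentiable_compose[of sqrt d p UNIV] assms(4) by simp
  qed
  show "negligible ((\<lambda>p. (a p, (b p + sqrt (d p)) / 2)) ` S)"
    "negligible ((\<lambda>p. (a p, (b p - sqrt (d p)) / 2)) ` S)"
    by (intro negligible_differentiable_image[OF assms(1)] differentiable_Pair assms(2,3) s
      differentiable_divide differentiable_add differentiable_diff differentiable_const; simp)+
qed

text \<open>\<open>Bxy\<close> is the z-derivative of \<open>kappa\<close>, so its square is the
  discriminant of \<open>kappa\<close> = k as a quadratic in z. \<open>Byz_square\<close> is the
  same for x.\<close>

lemma Bxy_square: "(x, y, z) \<in> level k \<Longrightarrow> (Bxy (x, y, z))\<^sup>2 = x\<^sup>2 * y\<^sup>2 + 4 * (x\<^sup>2 + y\<^sup>2 + k + 2)"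
  unfolding level_def by (auto simp: power2_eq_square algebra_simps)

lemma Byz_square: "(x, y, z) \<in> level k \<Longrightarrow> (Byz (x, y, z))\<^sup>2 = y\<^sup>2 * z\<^sup>2 - 4 * (y\<^sup>2 - z\<^sup>2 + k + 2)"
  unfolding level_def by (auto simp: power2_eq_square algebra_simps)

lemma finite_real_square: "finite {y::real. y\<^sup>2 * a = b}" if "a \<noteq> 0"
proof -
  have "{y::real. y\<^sup>2 * a = b} \<subseteq> {sqrt (b / a), - sqrt (b / a)}"
  proof
    fix y assume "y \<in> {y::real. y\<^sup>2 * a = b}"
    then have "y\<^sup>2 = b / a" using that by (simp add: field_simps)
    then have "\<bar>y\<bar> = sqrt (b / a)" by (metis real_sqrt_abs)
    then show "y \<in> {sqrt (b / a), - sqrt (b / a)}" by auto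
  qed
  then show ?thesis by (rule finite_subset) simp
qed

text \<open>Over this set the level set fails to be a graph over the (x, y)-plane. Eliminating z,
  respectively x, leaves a curve on which the second coordinate solves a nondegenerate quadratic, so
  its slices are finite.\<close>

lemma negligible_Bxy_zero:
  "negligible (pxy ` {p \<in> level k. Bxy p = 0})" "negligible (pyz ` {p \<in> level k. Bxy p = 0})"
proof -
  let ?S = "{p :: real \<times> real. (snd p)\<^sup>2 * ((fst p)\<^sup>2 + 4) = - 4 * ((fst p)\<^sup>2 + k + 2)}"
  have "negligible ?S"
  proof (rule negligible_finite_slices)
    show "closed ?S" by (intro closed_Collect_eq continuous_intros)
    show "finite {y. (x, y) \<in> ?S}" for x
      using finite_real_square[of "x\<^sup>2 + 4" "- 4 * (x\<^sup>2 + k + 2)"] by (simp add: add_nonneg_eq_0_iff)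
  qed
  moreover have "pxy ` {p \<in> level k. Bxy p = 0} \<subseteq> ?S"
  proof (rule image_subsetI)
    fix p assume p: "p \<in> {p \<in> level k. Bxy p = 0}"
    obtain x y z where xyz: "p = (x, y, z)" by (cases p)
    then have "x\<^sup>2 * y\<^sup>2 + 4 * (x\<^sup>2 + y\<^sup>2 + k + 2) = 0" using p Bxy_square[of x y z k] by auto
    then show "pxy p \<in> ?S" by (simp add: algebra_simps xyz)
  qed
  ultimately show "negligible (pxy ` {p \<in> level k. Bxy p = 0})" by (rule negligible_subset)
  let ?T = "{p :: real \<times> real. (snd p)\<^sup>2 * ((fst p)\<^sup>2 + 4) = - ((fst p)\<^sup>2 + k + 2) * (fst p)\<^sup>2}"
  have "negligible ?T"
  proof (rule negligible_finite_slices)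
    show "closed ?T" by (intro closed_Collect_eq continuous_intros)
    show "finite {y. (x, y) \<in> ?T}" for x
      using finite_real_square[of "x\<^sup>2 + 4" "- (x\<^sup>2 + k + 2) * x\<^sup>2"] by (simp add: add_nonneg_eq_0_iff)
  qed
  moreover have "z\<^sup>2 * (y\<^sup>2 + 4) = - (y\<^sup>2 + k + 2) * y\<^sup>2"
    if "(x, y, z) \<in> level k" "Bxy (x, y, z) = 0" for x y z
  proof -
    have e: "2 * z = - (x * y)" using that(2) by simp
    have e1: "(2 * z) * (2 * z) = (x * y) * (x * y)" unfolding e by simp
    have "(x * y) * z = - (2 * z) * z" using e by simp
    then have K: "k = - (x * x) - y * y - z * z - 2"
      using that(1) by (simp add: level_def power2_eq_square)
    show ?thesis unfolding K using e1 by (simp add: power2_eq_square algebra_simps)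
  qed
  then have "pyz ` {p \<in> level k. Bxy p = 0} \<subseteq> ?T" by clarsimp
  ultimately show "negligible (pyz ` {p \<in> level k. Bxy p = 0})" by (rule negligible_subset)
qed

lemma negligible_Byz_zero: "negligible (pxy ` {p \<in> level k. Byz p = 0})"
proof -
  let ?S = "{p :: real \<times> real. (snd p)\<^sup>2 * ((fst p)\<^sup>2 + 4) = ((fst p)\<^sup>2 + k + 2) * (fst p)\<^sup>2}"
  have "negligible ?S"
  proof (rule negligible_finite_slices)
    show "closed ?S" by (intro closed_Collect_eq continuous_intros)
    show "finite {y. (x, y) \<in> ?S}" for x
      using finite_real_square[of "x\<^sup>2 + 4" "(x\<^sup>2 + k + 2) * x\<^sup>2"] by (simp add: add_nonneg_eq_0_iff)
  qed
  then have "negligible (prod.swap ` ?S)" by (rule negligible_swap)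
  moreover have "x\<^sup>2 * (y\<^sup>2 + 4) = (y\<^sup>2 + k + 2) * y\<^sup>2"
    if "(x, y, z) \<in> level k" "Byz (x, y, z) = 0" for x y z
  proof -
    have e: "2 * x = y * z" using that(2) by simp
    have e1: "(2 * x) * (2 * x) = (y * z) * (y * z)" unfolding e by simp
    have "x * (y * z) = 2 * (x * x)" unfolding e[symmetric] by simp
    then have K: "k = x * x - y * y + z * z - 2"
      using that(1) unfolding level_def mem_Collect_eq kappa.simps power2_eq_square mult.assoc by linarith
    show ?thesis unfolding K using e1 by (simp add: power2_eq_square algebra_simps)
  qed
  then have "pxy ` {p \<in> level k. Byz p = 0} \<subseteq> prod.swap ` ?S"
    by (clarsimp simp: image_iff)
  ultimately show ?thesis by (rule negligible_subset)
qed

text \<open>Away from \<open>Bxy\<close> = 0 the level set consists of two differentiable graphs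
  over the (x, y)-plane; f and g pass from (x, y) to (y, z) along them.
  \<open>negligible_pxy\<close> goes back by solving for x.\<close>

lemma negligible_pyz:
  assumes S: "S \<subseteq> level k" and neg: "negligible (pxy ` S)"
  shows "negligible (pyz ` S)"
proof -
  define d where "d = (\<lambda>p. (fst p)\<^sup>2 * (snd p)\<^sup>2 + 4 * ((fst p)\<^sup>2 + (snd p)\<^sup>2 + k + 2) :: real)"
  define N where "N = {p \<in> pxy ` S. d p > 0}"
  define f where "f = (\<lambda>p. (snd p, (- (fst p * snd p) + sqrt (d p)) / 2))"
  define g where "g = (\<lambda>p. (snd p, (- (fst p * snd p) - sqrt (d p)) / 2))"
  have N: "negligible N" unfolding N_def by (rule negligible_subset[OF neg]) auto
  have "negligible (f ` N)" "negligible (g ` N)"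
    unfolding f_def g_def by (rule negligible_root_image[OF N]; simp add: d_def N_def differentiable_fst_snd)+
  moreover have "pyz ` S \<subseteq> f ` N \<union> g ` N \<union> pyz ` {p \<in> level k. Bxy p = 0}"
  proof (rule image_subsetI)
    fix p assume p: "p \<in> S"
    obtain x y z where xyz: "p = (x, y, z)" by (cases p)
    show "pyz p \<in> f ` N \<union> g ` N \<union> pyz ` {p \<in> level k. Bxy p = 0}"
    proof (cases "Bxy p = 0")
      case True
      then show ?thesis using p S by blast
    next
      case False
      have d: "d (x, y) = (2 * z + x * y)\<^sup>2"
        using S p Bxy_square[of x y z k] by (auto simp: d_def xyz)
      then have "d (x, y) > 0" using False by (simp add: xyz)
      then have N: "(x, y) \<in> N" using p by (auto simp: N_def xyz intro!: image_eqI[of _ _ "(x, y, z)"])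
      have "sqrt (d (x, y)) = \<bar>2 * z + x * y\<bar>" using d by simp
      then have "pyz p = f (x, y) \<or> pyz p = g (x, y)"
        by (auto simp: abs_if f_def g_def xyz)
      then show ?thesis using N by auto
    qed
  qed
  ultimately show ?thesis
    using negligible_Bxy_zero(2)[of k] by (meson negligible_Un negligible_subset)
qed

lemma negligible_pxy:
  assumes S: "S \<subseteq> level k" and neg: "negligible (pyz ` S)"
  shows "negligible (pxy ` S)"
proof -
  define d where "d = (\<lambda>p. (fst p)\<^sup>2 * (snd p)\<^sup>2 - 4 * ((fst p)\<^sup>2 - (snd p)\<^sup>2 + k + 2) :: real)"
  define N where "N = {p \<in> pyz ` S. d p > 0}"
  define f where "f = (\<lambda>p. (fst p, (fst p * snd p + sqrt (d p)) / 2))"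
  define g where "g = (\<lambda>p. (fst p, (fst p * snd p - sqrt (d p)) / 2))"
  have N: "negligible N" unfolding N_def by (rule negligible_subset[OF neg]) auto
  have "negligible (f ` N)" "negligible (g ` N)"
    unfolding f_def g_def by (rule negligible_root_image[OF N]; simp add: d_def N_def differentiable_fst_snd)+
  then have "negligible (prod.swap ` f ` N)" "negligible (prod.swap ` g ` N)"
    by (auto intro: negligible_swap)
  moreover have "pxy ` S \<subseteq> prod.swap ` f ` N \<union> prod.swap ` g ` N \<union> pxy ` {p \<in> level k. Byz p = 0}"
  proof (rule image_subsetI)
    fix p assume p: "p \<in> S"
    obtain x y z where xyz: "p = (x, y, z)" by (cases p)
    show "pxy p \<in> prod.swap ` f ` N \<union> prod.swap ` g ` N \<union> pxy ` {p \<in> level k. Byz p = 0}"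
    proof (cases "Byz p = 0")
      case True
      then show ?thesis using p S by blast
    next
      case False
      have d: "d (y, z) = (y * z - 2 * x)\<^sup>2"
        using S p Byz_square[of x y z k] by (auto simp: d_def xyz)
      then have "d (y, z) > 0" using False by (simp add: xyz)
      then have N: "(y, z) \<in> N" using p by (auto simp: N_def xyz intro!: image_eqI[of _ _ "(x, y, z)"])
      have "sqrt (d (y, z)) = \<bar>y * z - 2 * x\<bar>" using d by simp
      then have "pxy p = prod.swap (f (y, z)) \<or> pxy p = prod.swap (g (y, z))"
        by (auto simp: abs_if f_def g_def xyz)
      then show ?thesis using N by (auto simp del: swap_simp)
    qed
  qed
  ultimately show ?thesis
    using negligible_Byz_zero[of k] by (meson negligible_Un negligible_subset)
qed

text \<open>Only \<open>V1\<close> needs work: it is trivial in the projection \<open>pyz\<close>,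
  so one passes there and back. \<open>V2\<close> is its conjugate by \<open>Sw\<close>,
  \<open>V3\<close> does not move \<open>pxy\<close>, and the others act linearly on the
  plane.\<close>

lemma negligible_gens:
  assumes "g \<in> Gamma_gens" "S \<subseteq> level k" "negligible (pxy ` S)"
  shows "negligible (pxy ` g ` S)"
proof -
  have sub: "g ` S \<subseteq> level k"
    using Gamma_gens_kappa[OF assms(1)] assms(2) by (auto simp: level_def)
  have V1: "negligible (pxy ` V1 ` T)" if T: "T \<subseteq> level k" "negligible (pxy ` T)" for T
  proof (rule negligible_pxy)
    show "V1 ` T \<subseteq> level k" using Gamma_gens_kappa[of V1] T(1) by (auto simp: Gamma_gens_eq level_def)
    have "pyz ` V1 ` T = pyz ` T" by (auto simp: image_image V1_def pyz_def case_prod_beta)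
    then show "negligible (pyz ` V1 ` T)" using negligible_pyz[OF T] by simp
  qed
  have Sw: "Sw ` T \<subseteq> level k" "negligible (pxy ` Sw ` T)"
    if T: "T \<subseteq> level k" "negligible (pxy ` T)" for T
  proof -
    show "Sw ` T \<subseteq> level k" using Gamma_gens_kappa[of Sw] T(1) by (auto simp: Gamma_gens_eq level_def)
    have "pxy ` Sw ` T = prod.swap ` pxy ` T" by (auto simp: image_image Sw_def pxy_def case_prod_beta)
    then show "negligible (pxy ` Sw ` T)" using negligible_swap[OF T(2)] by simp
  qed
  have sign: "negligible ((\<lambda>p. (a * fst p, b * snd p)) ` pxy ` S)" for a b :: real
    by (intro negligible_differentiable_image assms differentiable_Pair differentiable_mult
      differentiable_const differentiable_fst_snd)
  consider "g = V1" | "g = V2" | "g = V3" | "g = S1" | "g = S2" | "g = S3" | "g = Sw"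
    using assms(1) by (auto simp: Gamma_gens_eq)
  then show ?thesis
  proof cases
    case 1 then show ?thesis using V1 assms by simp
  next
    case 2
    have "V2 = Sw \<circ> V1 \<circ> Sw" by (auto simp: fun_eq_iff)
    then have "V2 ` S = Sw ` V1 ` Sw ` S" by (simp only: image_comp comp_assoc)
    moreover have "V1 ` Sw ` S \<subseteq> level k"
      using Sw(1)[OF assms(2,3)] Gamma_image_level[OF gens_in_Gamma(1), of k] by blast
    ultimately show ?thesis
      using 2 Sw(2)[OF _ V1[OF Sw[OF assms(2,3)]]] by metis
  next
    case 3
    then have "pxy ` g ` S = pxy ` S" by (auto simp: image_image V3_def pxy_def case_prod_beta)
    then show ?thesis using assms by simp
  next
    case 4
    then have "pxy ` g ` S = (\<lambda>p. (1 * fst p, (-1) * snd p)) ` pxy ` S"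
      by (auto simp: image_image S1_def pxy_def case_prod_beta)
    then show ?thesis using sign by metis
  next
    case 5
    then have "pxy ` g ` S = (\<lambda>p. ((-1) * fst p, 1 * snd p)) ` pxy ` S"
      by (auto simp: image_image S2_def pxy_def case_prod_beta)
    then show ?thesis using sign by metis
  next
    case 6
    then have "pxy ` g ` S = (\<lambda>p. ((-1) * fst p, (-1) * snd p)) ` pxy ` S"
      by (auto simp: image_image S3_def pxy_def case_prod_beta)
    then show ?thesis using sign by metis
  next
    case 7 then show ?thesis using Sw assms by simp
  qed
qed

lemma negligible_Gamma:
  assumes "g \<in> Gamma_group" "S \<subseteq> level k" "negligible (pxy ` S)"
  shows "negligible (pxy ` g ` S)"
proof -
  have "g ` S \<subseteq> level k \<and> negligible (pxy ` g ` S)"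
    using assms(1)
  proof (induction g rule: Gamma_induct)
    case id
    then show ?case using assms by simp
  next
    case (gen g h)
    have "(g \<circ> h) ` S = g ` h ` S" by (rule image_comp[symmetric])
    moreover have "g ` h ` S \<subseteq> level k"
      using gen Gamma_image_level[of g k] Gamma_gens_subset by blast
    ultimately show ?case using negligible_gens[OF gen(1), of "h ` S"] gen(2) by metis
  qed
  then show ?thesis by simp
qed

section \<open>The area measure and Lebesgue null sets\<close>

lemma chart_area_zero:
  assumes "negligible (\<Union>t. {p. P p t \<in> A})"
  shows "chart_area P w A = 0"
proof -
  have "AE p in lborel. p \<notin> (\<Union>t. {p. P p t \<in> A})"
    using assms unfolding negligible_iff_null_sets by (metis AE_not_in AE_completion_iff)
  then have "chart_area P w A = (\<integral>\<^sup>+ p. 0 \<partial>(lborel :: (real \<times> real) measure))"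
    unfolding chart_area_def by (intro nn_integral_cong_AE) (auto elim!: eventually_mono)
  then show ?thesis by simp
qed

lemma AE_distr_density_zero:
  fixes f :: "'a::euclidean_space \<Rightarrow> ennreal" and T :: "'a \<Rightarrow> 'b::topological_space"
  assumes f [measurable]: "f \<in> borel_measurable borel" and T [measurable]: "T \<in> borel_measurable borel"
    and X: "X \<in> sets borel"
    and 0: "emeasure (distr (density lborel f) borel T) X = 0"
  shows "AE p in lborel. f p = 0 \<or> T p \<notin> X"
proof -
  have [measurable]: "{p. T p \<in> X} \<in> sets borel"
    using measurable_sets[OF T X] by (simp add: vimage_def)
  have "(\<integral>\<^sup>+ p. f p * indicator {p. T p \<in> X} p \<partial>lborel) = 0"
    using 0 X by (simp add: emeasure_distr emeasure_density vimage_def)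
  then have "AE p in lborel. f p * indicator {p. T p \<in> X} p = 0"
    by (subst (asm) nn_integral_0_iff_AE) measurable
  then show ?thesis by (rule eventually_mono) (auto simp: indicator_def split: if_splits)
qed

text \<open>The densities 1 / |w| are positive and finite where w is nonzero, so area has the
  measure class of the projections; the second and third charts are compared with the first through
  \<open>negligible_pyz\<close> and \<open>Sw\<close>.\<close>

lemma area_zero_iff:
  assumes A: "A \<in> sets borel" "A \<subseteq> level k"
  shows "area A = 0 \<longleftrightarrow> negligible (pxy ` A)"
proof
  assume neg: "negligible (pxy ` A)"
  have sub: "negligible (pxy ` X)" if "X \<subseteq> A" for X
    using neg that by (meson image_mono negligible_subset)
  have 1: "chart_area (\<lambda>(x, y) z. (x, y, z)) Bxy X = 0" if "X \<subseteq> A" for X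
    by (rule chart_area_zero, rule negligible_subset[OF sub[OF that]]) (force simp: pxy_def)
  have 2: "chart_area (\<lambda>(y, z) x. (x, y, z)) Byz X = 0" if "X \<subseteq> A" for X
  proof (rule chart_area_zero, rule negligible_subset)
    show "negligible (pyz ` X)" using that A(2) sub by (intro negligible_pyz[of _ k]) auto
  qed (force simp: pyz_def)
  \<comment> \<open>The projection to (z, x) is \<open>pyz\<close> after \<open>Sw\<close>, with the
    two coordinates exchanged.\<close>
  have 3: "chart_area (\<lambda>(z, x) y. (x, y, z)) Bzx X = 0" if "X \<subseteq> A" for X
  proof (rule chart_area_zero, rule negligible_subset)
    have X: "X \<subseteq> level k" using that A(2) by auto
    then have "Sw ` X \<subseteq> level k" using Gamma_image_level[OF gens_in_Gamma(7), of k] by blast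
    then have "negligible (pyz ` Sw ` X)"
      using negligible_Gamma[OF gens_in_Gamma(7) X sub[OF that]] by (rule negligible_pyz)
    then show "negligible (prod.swap ` pyz ` Sw ` X)" by (rule negligible_swap)
  qed (force simp: pyz_def Sw_def image_iff)
  show "area A = 0" unfolding area_def by (simp add: 1 2 3)
next
  assume "area A = 0"
  \<comment> \<open>The first chart is enough here, because the rest of A lies over the null curve
    of \<open>negligible_Bxy_zero\<close>.\<close>
  define X where "X = {p \<in> A. Bxy p \<noteq> 0}"
  have Xb [measurable]: "X \<in> sets borel"
  proof -
    have "X = A \<inter> {p \<in> space borel. Bxy p \<noteq> 0}" by (auto simp: X_def)
    moreover have "{p \<in> space borel. Bxy p \<noteq> 0} \<in> sets borel" by measurable
    ultimately show ?thesis using A by auto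
  qed
  have XL: "X \<subseteq> level k" using A by (auto simp: X_def)
  define P where "P = (\<lambda>(x, y) z. (x, y, z) :: point)"
  define r1 where "r1 = (\<lambda>p. (- (fst p * snd p) + sqrt ((fst p * snd p)\<^sup>2 - 4 * (- ((fst p)\<^sup>2 + (snd p)\<^sup>2 + 2 + k)))) / 2)"
  define r2 where "r2 = (\<lambda>p. (- (fst p * snd p) - sqrt ((fst p * snd p)\<^sup>2 - 4 * (- ((fst p)\<^sup>2 + (snd p)\<^sup>2 + 2 + k)))) / 2)"
  have cr: "continuous_on UNIV r1" "continuous_on UNIV r2"
    unfolding r1_def r2_def by (intro continuous_intros; simp)+
  then have cP: "continuous_on UNIV (\<lambda>p. P p (r1 p))" "continuous_on UNIV (\<lambda>p. P p (r2 p))"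
    unfolding P_def case_prod_beta by (intro continuous_intros; simp)+
  have mP [measurable]: "(\<lambda>p. P p (r1 p)) \<in> borel_measurable borel" "(\<lambda>p. P p (r2 p)) \<in> borel_measurable borel"
    using cP by (auto intro: borel_measurable_continuous_onI)
  have mr [measurable]: "r1 \<in> borel_measurable borel" "r2 \<in> borel_measurable borel"
    using cr by (auto intro: borel_measurable_continuous_onI)
  have roots: "t = r1 p \<or> t = r2 p" if "P p t \<in> level k" for p t
    unfolding r1_def r2_def
    using that by (intro quadratic_roots) (auto simp: level_def algebra_simps P_def split: prod.splits)
  let ?f = "\<lambda>p. ennreal (1 / \<bar>Bxy (P p (r1 p))\<bar>)"
  let ?g = "\<lambda>p. ennreal (1 / \<bar>Bxy (P p (r2 p))\<bar>) * indicator {p. r1 p \<noteq> r2 p} p"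
  have "chart_area P Bxy X = 0" using \<open>area A = 0\<close> by (simp add: area_def X_def P_def)
  moreover have "chart_area P Bxy X = emeasure (distr (density lborel ?f) borel (\<lambda>p. P p (r1 p))) X +
      emeasure (distr (density lborel ?g) borel (\<lambda>p. P p (r2 p))) X"
    by (rule chart_area_eq_emeasure[OF mr mP measurable_B(1) roots Xb XL])
  ultimately have 0: "emeasure (distr (density lborel ?f) borel (\<lambda>p. P p (r1 p))) X = 0"
    "emeasure (distr (density lborel ?g) borel (\<lambda>p. P p (r2 p))) X = 0" by auto
  have [measurable]: "{p. r1 p \<noteq> r2 p} \<in> sets borel"
    using mr by measurable
  note mB [measurable] = measurable_B(1)
  have "AE p in lborel. ?f p = 0 \<or> P p (r1 p) \<notin> X"
    by (rule AE_distr_density_zero[OF _ mP(1) Xb 0(1)]) measurable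
  \<comment> \<open>Division by zero would make the density 0, but \<open>Bxy\<close> does not
    vanish on X, so a zero density excludes membership in X.\<close>
  then have ae1: "AE p in lborel. P p (r1 p) \<notin> X"
    by (rule eventually_mono) (auto simp: X_def ennreal_eq_0_iff divide_le_0_iff)
  have "AE p in lborel. ?g p = 0 \<or> P p (r2 p) \<notin> X"
    by (rule AE_distr_density_zero[OF _ mP(2) Xb 0(2)]) measurable
  then have ae2: "AE p in lborel. r1 p \<noteq> r2 p \<longrightarrow> P p (r2 p) \<notin> X"
    by (rule eventually_mono) (auto simp: X_def ennreal_eq_0_iff divide_le_0_iff)
  have "AE p in lborel. p \<notin> pxy ` X"
    using ae1 ae2
  proof eventually_elim
    case (elim p)
    show ?case
    proof
      assume "p \<in> pxy ` X"
      then obtain t where t: "P p t \<in> X" by (force simp: pxy_def P_def)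
      then have "t = r1 p \<or> t = r2 p" using roots XL by blast
      then show False using elim t by metis
    qed
  qed
  then have "negligible (pxy ` X)"
    unfolding negligible_iff_null_sets eventually_ae_filter
    using null_sets_completion_iff2[of "pxy ` X" lborel] by (auto simp: subset_eq)
  moreover have "pxy ` A \<subseteq> pxy ` X \<union> pxy ` {p \<in> level k. Bxy p = 0}"
    using A by (auto simp: X_def)
  ultimately show "negligible (pxy ` A)"
    using negligible_Bxy_zero(1)[of k] by (meson negligible_Un negligible_subset)
qed

text \<open>The bridge to the plane: all later null sets of a level set are treated as negligible
  planar sets. In the converse direction a Borel null cover of the projection is pulled
  back.\<close>

lemma null_sets_area_iff:
  assumes "X \<subseteq> level k"
  shows "X \<in> null_sets (completion (area_measure k)) \<longleftrightarrow> negligible (pxy ` X)"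
proof
  assume "X \<in> null_sets (completion (area_measure k))"
  then obtain N where N: "X \<subseteq> N" "N \<in> null_sets (area_measure k)"
    unfolding null_sets_completion_iff2 by auto
  then have "N \<in> sets borel" "N \<subseteq> level k" by (auto dest!: null_setsD2)
  then have "negligible (pxy ` N)"
    using N(2) emeasure_area_measure area_zero_iff by (metis null_setsD1)
  then show "negligible (pxy ` X)" using N(1) by (meson image_mono negligible_subset)
next
  assume "negligible (pxy ` X)"
  then have "pxy ` X \<in> null_sets (completion lborel)" by (simp add: negligible_iff_null_sets)
  then obtain M where M: "pxy ` X \<subseteq> M" "M \<in> null_sets lborel"
    unfolding null_sets_completion_iff2 by auto
  define N where "N = pxy -` M \<inter> level k"
  have "pxy -` M \<in> sets borel"
    using measurable_sets[OF borel_measurable_continuous_onI[OF continuous_proj(1)], of M] M(2) by auto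
  then have N: "N \<in> sets borel" "N \<subseteq> level k" using closed_level by (auto simp: N_def)
  have "negligible (pxy ` N)"
  proof (rule negligible_subset)
    show "negligible M" using M(2) by (simp add: negligible_iff_null_sets null_sets_completionI)
    show "pxy ` N \<subseteq> M" by (auto simp: N_def)
  qed
  then have "N \<in> null_sets (area_measure k)"
    using N area_zero_iff[OF N] emeasure_area_measure[OF N] by (intro null_setsI) simp_all
  moreover have "X \<subseteq> N" using M assms by (auto simp: N_def)
  ultimately show "X \<in> null_sets (completion (area_measure k))"
    unfolding null_sets_completion_iff2 by blast
qed

text \<open>An invariant set of the completion differs from a Borel set by a null set, but that
  Borel set need not be invariant. Removing the saturation of a null set makes it Borel and exactly
  invariant at once.\<close>

lemma ergodic_onI:
  assumes S: "S \<subseteq> level k"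
    and *: "\<And>A. A \<in> sets borel \<Longrightarrow> A \<subseteq> S \<Longrightarrow> (\<And>g p. g \<in> Gamma_group \<Longrightarrow> g p \<in> A \<longleftrightarrow> p \<in> A) \<Longrightarrow>
      negligible (pxy ` A) \<or> negligible (pxy ` (S - A))"
  shows "ergodic_on Gamma_group (completion (area_measure k)) S"
  unfolding ergodic_on_def
proof (intro ballI impI)
  fix A assume A: "A \<in> sets (completion (area_measure k))"
    "A \<subseteq> S \<and> (\<forall>g\<in>Gamma_group. g ` A = A)"
  from A(1) obtain B N N' where BN: "A = B \<union> N" "N \<subseteq> N'" "N' \<in> null_sets (area_measure k)"
    "B \<in> sets (area_measure k)" unfolding sets_completion by blast
  have N': "N' \<in> sets borel" "N' \<subseteq> level k" using BN(3) by (auto dest!: null_setsD2)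
  have neg: "negligible (pxy ` N')"
    using null_sets_area_iff[OF N'(2)] BN(3) null_sets_completionI by blast
  \<comment> \<open>The Gamma-saturation of the exceptional null set; it is null because Gamma is
    countable.\<close>
  define Z where "Z = (\<Union>g\<in>Gamma_group. g -` N')"
  have pre: "g -` N' \<subseteq> level k \<and> g -` N' \<in> sets borel \<and> negligible (pxy ` (g -` N'))"
    if g: "g \<in> Gamma_group" for g
  proof -
    obtain h where h: "h \<in> Gamma_group" "\<And>p. h (g p) = p" "\<And>p. g (h p) = p"
      using Gamma_inverse[OF g] by metis
    have "g -` N' = h ` N'" using h by (auto simp: image_iff) metis
    then have "g -` N' \<subseteq> level k \<and> negligible (pxy ` (g -` N'))"
      using negligible_Gamma[OF h(1) N'(2) neg] Gamma_image_level[OF h(1), of k] N'(2) by auto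
    moreover have "g -` N' \<in> sets borel"
      using measurable_sets[OF borel_measurable_continuous_onI[OF continuous_Gamma[OF g]] N'(1)] by simp
    ultimately show ?thesis by blast
  qed
  have Z: "Z \<subseteq> level k" "Z \<in> sets borel" "negligible (pxy ` Z)"
    unfolding Z_def using pre countable_Gamma
    by (auto simp: image_UN intro!: sets.countable_UN' negligible_countable_Union)
  define A' where "A' = A - Z"
  have "id -` N' \<subseteq> Z" unfolding Z_def using Gamma_id by blast
  then have NZ: "N \<subseteq> Z" using BN(2) by simp
  then have "A' = B - Z" using BN(1) by (auto simp: A'_def)
  then have A'b: "A' \<in> sets borel" using BN(4) Z(2) by auto
  have inv1: "p \<in> Z" if g: "g \<in> Gamma_group" and gp: "g p \<in> Z" for g p
  proof -
    obtain f where "f \<in> Gamma_group" "f (g p) \<in> N'" using gp unfolding Z_def by blast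
    then have "f \<circ> g \<in> Gamma_group" "p \<in> (f \<circ> g) -` N'" using Gamma_comp g by auto
    then show ?thesis unfolding Z_def by blast
  qed
  have inv: "g p \<in> Z \<longleftrightarrow> p \<in> Z" if g: "g \<in> Gamma_group" for g p
  proof -
    obtain h where h: "h \<in> Gamma_group" "\<And>p. h (g p) = p" using Gamma_inverse[OF g] by metis
    then show ?thesis using inv1[OF g] inv1[OF h(1), of "g p"] by metis
  qed
  have invA: "g p \<in> A \<longleftrightarrow> p \<in> A" if g: "g \<in> Gamma_group" for g p
  proof -
    have "g ` A = A" using A(2) g by blast
    moreover have "inj g" using Gamma_bij[OF g] by (rule bij_is_inj)
    ultimately show ?thesis by (metis inj_image_mem_iff)
  qed
  have "negligible (pxy ` A') \<or> negligible (pxy ` (S - A'))"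
    using A(2) A'b inv invA by (intro *) (auto simp: A'_def)
  moreover have "pxy ` A \<subseteq> pxy ` A' \<union> pxy ` Z" "pxy ` (S - A) \<subseteq> pxy ` (S - A')"
    by (auto simp: A'_def)
  ultimately have "negligible (pxy ` A) \<or> negligible (pxy ` (S - A))"
    using Z(3) by (meson negligible_Un negligible_subset)
  moreover have "A \<subseteq> level k" "S - A \<subseteq> level k" using A(2) S by auto
  ultimately show "A \<in> null_sets (completion (area_measure k)) \<or> S - A \<in> null_sets (completion (area_measure k))"
    by (simp add: null_sets_area_iff)
qed

subsection \<open>Words in the Vieta involutions\<close>

datatype letter = La | Lb | Lc

fun vieta :: "letter \<Rightarrow> point \<Rightarrow> point" where
  "vieta La = V1" | "vieta Lb = V2" | "vieta Lc = V3"

text \<open>The head of the list acts last: \<open>hd w\<close> is the most recent letter and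
  \<open>last w\<close> the one applied first.\<close>

fun word_act :: "letter list \<Rightarrow> point \<Rightarrow> point" where
  "word_act [] = id" | "word_act (i # w) = vieta i \<circ> word_act w"

lemma word_act_append: "word_act (u @ w) = word_act u \<circ> word_act w"
  by (induction u) (simp_all add: comp_assoc)

lemma UNIV_letter: "(UNIV :: letter set) = {La, Lb, Lc}"
  using letter.exhaust by auto

text \<open>The dihedral group of order 8 generated by the sign changes and the transposition, with
  the transposition written on the right.\<close>

definition sign_swaps :: "(point \<Rightarrow> point) set" where
  "sign_swaps = {id, S1, S2, S3, Sw, S1 \<circ> Sw, S2 \<circ> Sw, S3 \<circ> Sw}"

lemma finite_sign_swaps: "finite sign_swaps"
  by (simp add: sign_swaps_def)

lemma sign_swaps_mult:
  assumes "s \<in> {S1, S2, S3, Sw}" "u \<in> sign_swaps"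
  shows "s \<circ> u \<in> sign_swaps"
proof -
  have eqs: "S1 \<circ> S1 = id" "S2 \<circ> S2 = id" "S3 \<circ> S3 = id" "Sw \<circ> Sw = id"
    "S1 \<circ> S2 = S3" "S2 \<circ> S1 = S3" "S1 \<circ> S3 = S2" "S3 \<circ> S1 = S2" "S2 \<circ> S3 = S1" "S3 \<circ> S2 = S1"
    "Sw \<circ> S1 = S2 \<circ> Sw" "Sw \<circ> S2 = S1 \<circ> Sw" "Sw \<circ> S3 = S3 \<circ> Sw"
    by (auto simp: fun_eq_iff)
  have eqs2: "f \<circ> (g \<circ> h) = (f \<circ> g) \<circ> h" for f g h :: "point \<Rightarrow> point"
    by (simp add: comp_assoc)
  have "Sw \<circ> (S1 \<circ> Sw) = S2" "Sw \<circ> (S2 \<circ> Sw) = S1" "Sw \<circ> (S3 \<circ> Sw) = S3"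
    by (auto simp: fun_eq_iff)
  then show ?thesis using assms unfolding sign_swaps_def
    by (elim insertE emptyE; hypsubst) (simp_all only: eqs eqs2 comp_id id_comp insert_iff simp_thms)
qed

text \<open>Sign changes commute with all three involutions, and the transposition exchanges
  \<open>V1\<close> with \<open>V2\<close> and commutes with \<open>V3\<close>. Hence the finite
  part of a word can be collected on the left.\<close>

lemma vieta_sign_swaps:
  assumes "u \<in> sign_swaps"
  obtains j where "vieta i \<circ> u = u \<circ> vieta j"
proof -
  have "\<exists>j. vieta i \<circ> u = u \<circ> vieta j"
  proof (cases "u \<in> {id, S1, S2, S3}")
    case True
    then show ?thesis by (intro exI[of _ i]; cases i) (auto simp: fun_eq_iff)
  next
    case False
    then have u: "u \<in> {Sw, S1 \<circ> Sw, S2 \<circ> Sw, S3 \<circ> Sw}" using assms by (auto simp: sign_swaps_def)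
    show ?thesis
    proof (cases i)
      case La then show ?thesis using u by (intro exI[of _ Lb]) (auto simp: fun_eq_iff mult.commute)
    next
      case Lb then show ?thesis using u by (intro exI[of _ La]) (auto simp: fun_eq_iff mult.commute)
    next
      case Lc then show ?thesis using u by (intro exI[of _ Lc]) (auto simp: fun_eq_iff mult.commute)
    qed
  qed
  then show ?thesis using that by blast
qed

lemma vieta_involution: "vieta i \<circ> vieta i = id"
  by (cases i) (auto simp: fun_eq_iff)

lemma Gamma_normal_form:
  assumes "g \<in> Gamma_group"
  obtains u w where "u \<in> sign_swaps" "distinct_adj w" "g = u \<circ> word_act w"
proof -
  have "\<exists>u w. u \<in> sign_swaps \<and> distinct_adj w \<and> g = u \<circ> word_act w"
    using assms
  proof (induction rule: Gamma_induct)
    case id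
    have "id \<in> sign_swaps" unfolding sign_swaps_def by (rule insertI1)
    then show ?case by (intro exI[of _ id] exI[of _ "[]"] conjI) (simp_all only: word_act.simps distinct_adj_Nil comp_id)
  next
    case (gen g h)
    then obtain u w where uw: "u \<in> sign_swaps" "distinct_adj w" "h = u \<circ> word_act w" by blast
    consider "g \<in> {S1, S2, S3, Sw}" | i where "g = vieta i"
      using gen(1) by (auto simp: Gamma_gens_eq) (metis vieta.simps)+
    then show ?case
    proof cases
      case 1
      then have "g \<circ> u \<in> sign_swaps" using sign_swaps_mult uw(1) by blast
      moreover have "g \<circ> h = (g \<circ> u) \<circ> word_act w" by (simp add: uw(3) comp_assoc)
      ultimately show ?thesis using uw(2) by blast
    next
      case 2
      obtain j where "vieta i \<circ> u = u \<circ> vieta j" using vieta_sign_swaps[OF uw(1)] by blast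
      then have e: "g \<circ> h = u \<circ> (vieta j \<circ> word_act w)" by (simp add: 2 uw(3) comp_assoc[symmetric])
      \<comment> \<open>Once it has passed u, the new letter either cancels against the head of w or
        extends the reduced word.\<close>
      show ?thesis
      proof (cases "w \<noteq> [] \<and> hd w = j")
        case True
        then obtain w' where w': "w = j # w'" by (metis list.collapse)
        then have "vieta j \<circ> word_act w = word_act w'"
          by (simp add: comp_assoc[symmetric] vieta_involution)
        moreover have "distinct_adj w'" using uw(2) w' by (cases w') auto
        ultimately show ?thesis using e uw(1) by metis
      next
        case False
        then have "distinct_adj (j # w)" using uw(2) by (cases w) auto
        moreover have "g \<circ> h = u \<circ> word_act (j # w)" using e by simp
        ultimately show ?thesis using uw(1) by blast
      qed
    qed
  qed
  then show ?thesis using that by blast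
qed

text \<open>The state of a point just after the letter i was applied. For \<open>La\<close> and
  \<open>Lb\<close> the coordinate just changed is the larger one; for \<open>Lc\<close> the last
  condition on signs says that undoing \<open>V3\<close> would make the product positive again.
  These are the invariants of a ping-pong argument.\<close>

fun grown :: "real \<Rightarrow> letter \<Rightarrow> point \<Rightarrow> bool" where
  "grown t La (x, y, z) \<longleftrightarrow> x * y * z > 0 \<and> \<bar>y\<bar> \<le> \<bar>x\<bar> \<and> t \<le> \<bar>z\<bar>"
| "grown t Lb (x, y, z) \<longleftrightarrow> x * y * z > 0 \<and> \<bar>x\<bar> \<le> \<bar>y\<bar> \<and> t \<le> \<bar>z\<bar>"
| "grown t Lc (x, y, z) \<longleftrightarrow> x * y * z < 0 \<and> x * y * (x * y + z) < 0 \<and> t \<le> \<bar>z\<bar>"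

lemma abs_diff_opposite: "\<bar>a - x\<bar> = \<bar>a\<bar> + \<bar>x\<bar>" if "x * a < 0" for a x :: real
  using that by (auto simp: abs_if mult_less_0_iff zero_less_mult_iff)

lemma abs_diff_same: "\<bar>a - x\<bar> = \<bar>\<bar>a\<bar> - \<bar>x\<bar>\<bar>" if "x * a > 0" for a x :: real
  using that by (auto simp: abs_if mult_less_0_iff zero_less_mult_iff)

text \<open>Here x and yz have opposite signs, so nothing cancels in yz - x.\<close>

lemma vieta_grow_opposite:
  fixes x y z :: real
  assumes "x * y * z < 0" "2 \<le> t" "t \<le> \<bar>z\<bar>"
  shows "(y * z - x) * y * z > 0" "\<bar>y\<bar> \<le> \<bar>y * z - x\<bar>"
proof -
  have "(y * z - x) * y * z = (y * z)\<^sup>2 - x * y * z" by (simp add: power2_eq_square algebra_simps)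
  moreover have "(y * z)\<^sup>2 \<ge> 0" by simp
  ultimately show "(y * z - x) * y * z > 0" using assms(1) by linarith
  have "\<bar>y * z - x\<bar> = \<bar>y\<bar> * \<bar>z\<bar> + \<bar>x\<bar>"
    using abs_diff_opposite[of x "y * z"] assms(1) by (simp add: abs_mult mult.assoc)
  moreover have "\<bar>y\<bar> * 1 \<le> \<bar>y\<bar> * \<bar>z\<bar>" using assms by (intro mult_left_mono) auto
  ultimately show "\<bar>y\<bar> \<le> \<bar>y * z - x\<bar>" by linarith
qed

text \<open>Some cancellation occurs, but |yz| >= 2 |y| leaves at least 2 |y| - |x| >= |y|. This is
  where the threshold 2 for the trace comes from.\<close>

lemma vieta_grow_same:
  fixes x y z :: real
  assumes "x * y * z > 0" "\<bar>x\<bar> \<le> \<bar>y\<bar>" "2 \<le> t" "t \<le> \<bar>z\<bar>"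
  shows "(y * z - x) * y * z > 0" "\<bar>y\<bar> \<le> \<bar>y * z - x\<bar>"
proof -
  have y: "\<bar>y\<bar> > 0" using assms(1) by auto
  have 2: "\<bar>y\<bar> * 2 \<le> \<bar>y\<bar> * \<bar>z\<bar>" using assms by (intro mult_left_mono) auto
  have xyz: "x * y * z = \<bar>x\<bar> * (\<bar>y\<bar> * \<bar>z\<bar>)"
    using assms(1) by (metis abs_mult abs_of_pos mult.assoc)
  have "(y * z - x) * y * z = (\<bar>y\<bar> * \<bar>z\<bar>) * (\<bar>y\<bar> * \<bar>z\<bar>) - \<bar>x\<bar> * (\<bar>y\<bar> * \<bar>z\<bar>)"
    unfolding xyz[symmetric] by (simp add: abs_mult[symmetric] algebra_simps)
  also have "\<dots> = (\<bar>y\<bar> * \<bar>z\<bar>) * (\<bar>y\<bar> * \<bar>z\<bar> - \<bar>x\<bar>)" by (simp add: algebra_simps)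
  also have "\<dots> > 0" using 2 y assms by (intro mult_pos_pos) linarith+
  finally show "(y * z - x) * y * z > 0" .
  have "\<bar>y * z - x\<bar> = \<bar>\<bar>y\<bar> * \<bar>z\<bar> - \<bar>x\<bar>\<bar>"
    using abs_diff_same[of x "y * z"] assms(1) by (simp add: abs_mult mult.assoc)
  then show "\<bar>y\<bar> \<le> \<bar>y * z - x\<bar>" using 2 assms by linarith
qed

lemma grown_Lc:
  fixes x y z :: real
  assumes "x * y * z > 0" "t \<le> \<bar>z\<bar>"
  shows "grown t Lc (V3 (x, y, z))"
proof -
  have sq: "(x * y) * (x * y) \<ge> 0" by simp
  have "x * y * (- (x * y) - z) = - ((x * y) * (x * y)) - x * y * z" by (simp add: algebra_simps)
  then have "x * y * (- (x * y) - z) < 0" using sq assms(1) by linarith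
  moreover have "\<bar>- (x * y) - z\<bar> = \<bar>- (x * y)\<bar> + \<bar>z\<bar>"
    using assms(1) by (intro abs_diff_opposite) (simp add: mult.commute)
  then have "t \<le> \<bar>- (x * y) - z\<bar>" using assms(2) by linarith
  ultimately show ?thesis using assms(1) by simp
qed

text \<open>The first letter must differ from \<open>Lc\<close>, because at xyz < 0
  \<open>V3\<close> may shrink |z|. After \<open>La\<close> or \<open>Lb\<close> the product is
  positive, and every letter different from the preceding one then leads from one
  \<open>grown\<close> state to another.\<close>

lemma word_act_grown:
  assumes "distinct_adj w" "w \<noteq> []" "last w \<noteq> Lc" "q = (x, y, z)" "x * y * z < 0" "2 \<le> t" "t \<le> \<bar>z\<bar>"
  shows "grown t (hd w) (word_act w q)"
  using assms(1-3)
proof (induction w)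
  case Nil
  then show ?case by simp
next
  case (Cons i w)
  show ?case
  proof (cases "w = []")
    case True
    then have i: "i = La \<or> i = Lb" using Cons.prems letter.exhaust by auto
    have "y * x * z < 0" using assms(5) by (simp add: mult.commute)
    then show ?thesis
      using i vieta_grow_opposite[OF assms(5-7)] vieta_grow_opposite[of y x z t] assms(4-7) True
      by (auto simp: mult.commute mult.left_commute)
  next
    case False
    obtain a b c where abc: "word_act w q = (a, b, c)" by (cases "word_act w q")
    have "distinct_adj w" "hd w \<noteq> i" using Cons.prems(1) False by (cases w; auto)+
    then have g: "grown t (hd w) (a, b, c)" using Cons False abc by auto
    have ba: "b * a * c = a * b * c" by simp
    show ?thesis
    proof (cases i)
      case La
      have "(b * c - a) * b * c > 0 \<and> \<bar>b\<bar> \<le> \<bar>b * c - a\<bar> \<and> t \<le> \<bar>c\<bar>"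
      proof (cases "hd w")
        case Lb
        then show ?thesis using g vieta_grow_same[of a b c t] assms(6) by simp
      next
        case Lc
        then show ?thesis using g vieta_grow_opposite[of a b c t] assms(6) by simp
      qed (use La \<open>hd w \<noteq> i\<close> in simp)
      then show ?thesis using La abc by simp
    next
      case Lb
      have "(a * c - b) * a * c > 0 \<and> \<bar>a\<bar> \<le> \<bar>a * c - b\<bar> \<and> t \<le> \<bar>c\<bar>"
      proof (cases "hd w")
        case La
        then show ?thesis using g vieta_grow_same[of b a c t] assms(6) ba by simp
      next
        case Lc
        then show ?thesis using g vieta_grow_opposite[of b a c t] assms(6) ba by simp
      qed (use Lb \<open>hd w \<noteq> i\<close> in simp)
      moreover have "a * (a * c - b) * c = (a * c - b) * a * c" by (simp only: mult.commute)
      ultimately show ?thesis using Lb abc by (simp only: list.sel grown.simps word_act.simps vieta.simps comp_apply gen_apply)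
    next
      case Lc
      then have "hd w = La \<or> hd w = Lb" using \<open>hd w \<noteq> i\<close> letter.exhaust by metis
      then have "a * b * c > 0" "t \<le> \<bar>c\<bar>" using g by auto
      then show ?thesis using Lc abc grown_Lc by simp
    qed
  qed
qed

lemma word_act_abs_z:
  assumes "distinct_adj w" "last w \<noteq> Lc \<or> w = []" "q = (x, y, z)" "x * y * z < 0" "2 \<le> t" "t \<le> \<bar>z\<bar>"
    "word_act w q = (a, b, c)"
  shows "t \<le> \<bar>c\<bar>"
proof (cases "w = []")
  case False
  have "grown t (hd w) (a, b, c)"
    using word_act_grown[OF assms(1) False _ assms(3-6)] assms(2,7) False by simp
  then show ?thesis by (cases "hd w") auto
qed (use assms in simp)

subsection \<open>Properness\<close>

text \<open>Covers K by finitely many preimages of the sets N. Transport by the corresponding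
  elements turns a return of K to itself into a passage between two of finitely many model sets C,
  D, so finiteness has to be checked for model sets only.\<close>

lemma acts_properly_local:
  assumes inv: "\<And>g p. g \<in> Gamma_group \<Longrightarrow> p \<in> X \<Longrightarrow> g p \<in> X"
    and loc: "\<And>p. p \<in> X \<Longrightarrow> \<exists>g\<in>Gamma_group. \<exists>N C. open N \<and> g p \<in> N \<and> N \<inter> X \<subseteq> C \<and> P C"
    and fin: "\<And>C D. P C \<Longrightarrow> P D \<Longrightarrow> finite {g \<in> Gamma_group. g ` C \<inter> D \<noteq> {}}"
  shows "acts_properly Gamma_group X"
  unfolding acts_properly_def
proof (intro allI impI)
  fix K assume K: "K \<subseteq> X \<and> compact K"
  define \<V> where "\<V> = {g -` N |g N. g \<in> Gamma_group \<and> open N \<and> (\<exists>C. N \<inter> X \<subseteq> C \<and> P C)}"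
  have "\<forall>V\<in>\<V>. open V"
    unfolding \<V>_def using continuous_Gamma by (auto intro: open_vimage)
  moreover have "K \<subseteq> \<Union>\<V>"
  proof
    fix p assume "p \<in> K"
    then obtain g N C where "g \<in> Gamma_group" "open N" "g p \<in> N" "N \<inter> X \<subseteq> C" "P C"
      using loc K by blast
    then show "p \<in> \<Union>\<V>" by (intro UnionI[of "g -` N"]) (auto simp: \<V>_def)
  qed
  ultimately obtain \<W> where W: "\<W> \<subseteq> \<V>" "finite \<W>" "K \<subseteq> \<Union>\<W>"
    using K compactE[of K \<V>] by metis
  have "\<forall>V\<in>\<W>. \<exists>gC. fst gC \<in> Gamma_group \<and> P (snd gC) \<and> (\<forall>p\<in>V \<inter> X. fst gC p \<in> snd gC)"
  proof
    fix V assume "V \<in> \<W>"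
    then obtain g N C where "g \<in> Gamma_group" "V = g -` N" "N \<inter> X \<subseteq> C" "P C"
      using W(1) unfolding \<V>_def by blast
    then show "\<exists>gC. fst gC \<in> Gamma_group \<and> P (snd gC) \<and> (\<forall>p\<in>V \<inter> X. fst gC p \<in> snd gC)"
      using inv by (intro exI[of _ "(g, C)"] conjI ballI; simp only: fst_conv snd_conv) blast
  qed
  then obtain gC where gC: "\<And>V. V \<in> \<W> \<Longrightarrow> fst (gC V) \<in> Gamma_group" "\<And>V. V \<in> \<W> \<Longrightarrow> P (snd (gC V))"
    "\<And>V p. V \<in> \<W> \<Longrightarrow> p \<in> V \<Longrightarrow> p \<in> X \<Longrightarrow> fst (gC V) p \<in> snd (gC V)"
    by (metis IntI)
  define E where "E V W = {f \<in> Gamma_group. f ` snd (gC V) \<inter> snd (gC W) \<noteq> {}}" for V W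
  have "{g \<in> Gamma_group. g ` K \<inter> K \<noteq> {}} \<subseteq>
    (\<Union>V\<in>\<W>. \<Union>W\<in>\<W>. (\<lambda>f. Hilbert_Choice.inv (fst (gC W)) \<circ> f \<circ> fst (gC V)) ` E V W)"
  proof clarify
    fix g assume g: "g \<in> Gamma_group" "g ` K \<inter> K \<noteq> {}"
    then obtain p where p: "p \<in> K" "g p \<in> K" by blast
    then obtain V W' where VW: "V \<in> \<W>" "p \<in> V" "W' \<in> \<W>" "g p \<in> W'" using W(3) by blast
    obtain h where h: "h \<in> Gamma_group" "\<And>p. h (fst (gC V) p) = p" "\<And>p. fst (gC V) (h p) = p"
      using Gamma_inverse[OF gC(1)[OF VW(1)]] by metis
    \<comment> \<open>g followed by transport at its target and preceded by inverse transport at its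
      source; g is recovered from f and the two indices.\<close>
    define f where "f = fst (gC W') \<circ> (g \<circ> h)"
    have fG: "f \<in> Gamma_group" unfolding f_def using gC(1)[OF VW(3)] g(1) h(1) by (intro Gamma_comp)
    have "f (fst (gC V) p) = fst (gC W') (g p)" by (simp add: f_def h)
    moreover have "fst (gC V) p \<in> snd (gC V)" "fst (gC W') (g p) \<in> snd (gC W')"
      using gC(3)[OF VW(1,2)] gC(3)[OF VW(3,4)] p K by blast+
    ultimately have "f \<in> E V W'" using fG by (auto simp: E_def)
    moreover have "g = Hilbert_Choice.inv (fst (gC W')) \<circ> f \<circ> fst (gC V)"
    proof
      fix q
      have "inj (fst (gC W'))" using Gamma_bij[OF gC(1)[OF VW(3)]] by (rule bij_is_inj)
      then show "g q = (Hilbert_Choice.inv (fst (gC W')) \<circ> f \<circ> fst (gC V)) q"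
        by (simp only: f_def comp_apply h(2) inv_f_f)
    qed
    ultimately show "g \<in> (\<Union>V\<in>\<W>. \<Union>W\<in>\<W>. (\<lambda>f. Hilbert_Choice.inv (fst (gC W)) \<circ> f \<circ> fst (gC V)) ` E V W)"
      using VW by blast
  qed
  moreover have "finite (E V W)" if "V \<in> \<W>" "W \<in> \<W>" for V W
    unfolding E_def using fin gC(2) that by blast
  ultimately show "finite {g \<in> Gamma_group. g ` K \<inter> K \<noteq> {}}"
    using W(2) by (elim finite_subset) (auto intro!: finite_UN_I)
qed

text \<open>With z' = - x y - z: both z and z' have absolute value at least 2 and the sign opposite
  to xy. Unlike \<open>F_C02\<close>, where both are negative, this form is symmetric under
  \<open>V3\<close> and all of \<open>sign_swaps\<close>.\<close>

fun edge_like :: "point \<Rightarrow> bool" where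
  "edge_like (x, y, z) \<longleftrightarrow> 2 \<le> \<bar>z\<bar> \<and> 2 \<le> \<bar>x * y + z\<bar> \<and> x * y * z < 0 \<and> x * y * (x * y + z) > 0"

lemma edge_like_F_C02: "p \<in> F_C02 \<Longrightarrow> edge_like p"
proof -
  assume "p \<in> F_C02"
  then obtain x y z where p: "p = (x, y, z)" "z \<le> -2" "x * y + z \<ge> 2" by (auto simp: F_C02_def)
  then have "x * y > 0" by linarith
  moreover from this have "x * y * z < 0" using p by (intro mult_pos_neg[of "x * y" z]) linarith+
  moreover have "x * y * (x * y + z) > 0" using calculation p by (intro mult_pos_pos[of "x * y" "x * y + z"]) linarith+
  ultimately show ?thesis using p by auto
qed

lemma edge_like_V3: "edge_like p \<Longrightarrow> edge_like (V3 p)"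
  by (cases p) (auto simp: algebra_simps)

lemma edge_like_sign_swaps: "u \<in> sign_swaps \<Longrightarrow> edge_like (u p) \<longleftrightarrow> edge_like p"
proof -
  have m: "\<bar>- z - x * y\<bar> = \<bar>x * y + z\<bar>" "\<bar>- (x * y) - z\<bar> = \<bar>x * y + z\<bar>" for x y z :: real by auto
  assume "u \<in> sign_swaps"
  then show ?thesis
    by (cases p) (auto simp: sign_swaps_def mult.commute m algebra_simps)
qed

lemma word_act_split_Lc:
  assumes "distinct_adj w" "w \<noteq> []" "last w = Lc"
  obtains w' where "w = w' @ [Lc]" "distinct_adj w'" "last w' \<noteq> Lc \<or> w' = []"
proof -
  obtain w' where w': "w = w' @ [Lc]" using assms(2,3) by (metis append_butlast_last_id)
  then have "distinct_adj w'" "last w' \<noteq> Lc \<or> w' = []"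
    using assms(1) by (auto simp: distinct_adj_append_iff)
  then show ?thesis using that w' by blast
qed

text \<open>Each \<open>grown\<close> state contradicts \<open>edge_like\<close>: after
  \<open>La\<close> or \<open>Lb\<close> through the sign of xyz, after \<open>Lc\<close> through
  the sign of xyz'. An initial \<open>Lc\<close> is absorbed first, since \<open>V3\<close>
  preserves \<open>edge_like\<close>.\<close>

lemma edge_like_word_act:
  assumes "edge_like p" "distinct_adj w" "edge_like (word_act w p)"
  shows "w = [] \<or> w = [Lc]"
proof -
  have *: "w = []" if "edge_like p" "distinct_adj w" "edge_like (word_act w p)" "last w \<noteq> Lc \<or> w = []" for w p
  proof (rule ccontr)
    assume "w \<noteq> []"
    obtain x y z where p: "p = (x, y, z)" by (cases p)
    obtain a b c where abc: "word_act w p = (a, b, c)" by (cases "word_act w p")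
    have "grown 2 (hd w) (a, b, c)"
      using word_act_grown[OF that(2) \<open>w \<noteq> []\<close> _ p, of 2] that p abc \<open>w \<noteq> []\<close> by auto
    then show False using that(3) abc by (cases "hd w") auto
  qed
  show ?thesis
  proof (cases "last w \<noteq> Lc \<or> w = []")
    case True
    then show ?thesis using * assms by blast
  next
    case False
    then obtain w' where w': "w = w' @ [Lc]" "distinct_adj w'" "last w' \<noteq> Lc \<or> w' = []"
      using word_act_split_Lc assms(2) by metis
    then have "w' = []" using *[of "V3 p" w'] edge_like_V3[OF assms(1)] assms(3) by (simp add: word_act_append)
    then show ?thesis using w' by simp
  qed
qed

text \<open>This gap in the values of z makes the closed set \<open>F_C02\<close> relatively open in
  its orbit.\<close>

lemma orbit_F_C02_abs:
  assumes "(x, y, z) \<in> orbit_set Gamma_group F_C02"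
  shows "2 \<le> \<bar>z\<bar>"
proof -
  obtain g p where g: "g \<in> Gamma_group" "p \<in> F_C02" "(x, y, z) = g p"
    using assms by (auto simp: orbit_set_def)
  obtain u w where uw: "u \<in> sign_swaps" "distinct_adj w" "g = u \<circ> word_act w"
    using Gamma_normal_form[OF g(1)] by blast
  have p: "edge_like p" using edge_like_F_C02 g by blast
  obtain a b c where abc: "word_act w p = (a, b, c)" by (cases "word_act w p")
  have *: "2 \<le> \<bar>c\<bar>" if "edge_like p" "distinct_adj w" "last w \<noteq> Lc \<or> w = []" "word_act w p = (a, b, c)" for w p
    using word_act_abs_z[OF that(2,3), of p _ _ _ 2 a b c] that(1,4) by (cases p) auto
  have "2 \<le> \<bar>c\<bar>"
  proof (cases "last w \<noteq> Lc \<or> w = []")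
    case True
    then show ?thesis using * p uw(2) abc by blast
  next
    case False
    then obtain w' where "w = w' @ [Lc]" "distinct_adj w'" "last w' \<noteq> Lc \<or> w' = []"
      using word_act_split_Lc uw(2) by metis
    then show ?thesis using *[of "V3 p" w'] edge_like_V3[OF p] abc by (simp add: word_act_append)
  qed
  then show ?thesis using g(3) uw(1,3) abc by (auto simp: sign_swaps_def)
qed

theorem acts_properly_F_C02: "acts_properly Gamma_group (orbit_set Gamma_group F_C02)"
proof (rule acts_properly_local[where P = "\<lambda>C. C = F_C02"])
  show "g p \<in> orbit_set Gamma_group F_C02" if "g \<in> Gamma_group" "p \<in> orbit_set Gamma_group F_C02" for g p
    using that orbit_set_invariant by blast
next
  fix p assume "p \<in> orbit_set Gamma_group F_C02"
  then obtain g where g: "g \<in> Gamma_group" "g p \<in> F_C02" unfolding orbit_set_mem by blast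
  \<comment> \<open>Within the orbit z and z' avoid the interval from -2 to 2, so the open
    conditions z < 0 and z' < 0 already cut out \<open>F_C02\<close>.\<close>
  define N :: "point set" where "N = {q. snd (snd q) < 0} \<inter> {q. fst q * fst (snd q) + snd (snd q) > 0}"
  have "open N" unfolding N_def
    by (intro open_Int open_Collect_less continuous_intros)
  moreover have "g p \<in> N" using g(2) by (auto simp: N_def F_C02_def)
  moreover have "N \<inter> orbit_set Gamma_group F_C02 \<subseteq> F_C02"
  proof clarify
    fix x y z assume *: "(x, y, z) \<in> N" "(x, y, z) \<in> orbit_set Gamma_group F_C02"
    then have "V3 (x, y, z) \<in> orbit_set Gamma_group F_C02" using orbit_set_invariant gens_in_Gamma by blast
    then have "2 \<le> \<bar>z\<bar>" "2 \<le> \<bar>- (x * y) - z\<bar>" using *(2) orbit_F_C02_abs by auto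
    then show "(x, y, z) \<in> F_C02" using *(1) by (auto simp: N_def F_C02_def)
  qed
  ultimately show "\<exists>g\<in>Gamma_group. \<exists>N C. open N \<and> g p \<in> N \<and> N \<inter> orbit_set Gamma_group F_C02 \<subseteq> C \<and> C = F_C02"
    using g(1) by blast
next
  fix C D :: "point set" assume CD: "C = F_C02" "D = F_C02"
  have "{g \<in> Gamma_group. g ` C \<inter> D \<noteq> {}} \<subseteq> (\<lambda>(u, w). u \<circ> word_act w) ` (sign_swaps \<times> {[], [Lc]})"
  proof clarify
    fix g assume g: "g \<in> Gamma_group" "g ` C \<inter> D \<noteq> {}"
    then obtain p where p: "edge_like p" "edge_like (g p)" using CD edge_like_F_C02 by blast
    obtain u w where uw: "u \<in> sign_swaps" "distinct_adj w" "g = u \<circ> word_act w"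
      using Gamma_normal_form[OF g(1)] by blast
    then have "w = [] \<or> w = [Lc]" using p edge_like_sign_swaps by (intro edge_like_word_act[of p]) auto
    then show "g \<in> (\<lambda>(u, w). u \<circ> word_act w) ` (sign_swaps \<times> {[], [Lc]})" using uw by force
  qed
  then show "finite {g \<in> Gamma_group. g ` C \<inter> D \<noteq> {}}"
    by (rule finite_subset) (intro finite_imageI finite_SigmaI finite_sign_swaps, simp)
qed

text \<open>A bounded closed piece, insensitive to signs, of the translates of
  \<open>F'_C11\<close>. Such pieces are needed because \<open>V1\<close> and \<open>V2\<close>
  preserve z and xyz - x^2 - y^2: infinitely many elements map \<open>F'_C11\<close> to
  itself.\<close>

fun well_inside :: "nat \<Rightarrow> point \<Rightarrow> bool" where
  "well_inside n (x, y, z) \<longleftrightarrow> 2 + 1 / real n \<le> \<bar>z\<bar> \<and> \<bar>x\<bar> \<le> real n \<and> \<bar>y\<bar> \<le> real n \<and> \<bar>z\<bar> \<le> real n \<and>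
     1 / real n \<le> x * y * z - x\<^sup>2 - y\<^sup>2"

lemma well_inside_mono: "well_inside m p \<Longrightarrow> 0 < m \<Longrightarrow> m \<le> n \<Longrightarrow> well_inside n p"
proof -
  assume *: "well_inside m p" "0 < m" "m \<le> n"
  then have "1 / real n \<le> 1 / real m" "real m \<le> real n" by (auto simp: frac_le)
  then show ?thesis using *(1) by (cases p) auto
qed

lemma well_inside_sign_swaps: "u \<in> sign_swaps \<Longrightarrow> well_inside n (u p) \<longleftrightarrow> well_inside n p"
  by (cases p) (auto simp: sign_swaps_def algebra_simps)

text \<open>Product of the two roots of \<open>kappa\<close> = k as a quadratic in z.\<close>

lemma zz':
  assumes "(x, y, z) \<in> level k"
  shows "z * (- (x * y) - z) = - (k + 2 + x\<^sup>2 + y\<^sup>2)"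
  using assms by (auto simp: level_def algebra_simps power2_eq_square)

text \<open>Inside the region z^2 < k + 2. By the product of the roots, the first \<open>V3\<close>
  raises |z| to at least sqrt (k + 2) and makes the product negative, and by
  \<open>word_act_abs_z\<close> no later letter brings |z| below that bound.\<close>

lemma well_inside_no_Lc:
  assumes w: "distinct_adj w" "Lc \<in> set w" and p: "well_inside n p" "n > 0"
  shows "\<not> well_inside n (word_act w p)"
proof
  assume wi: "well_inside n (word_act w p)"
  \<comment> \<open>Splits at the \<open>Lc\<close> applied first; w2 acts before it and only moves
    x and y at fixed z.\<close>
  obtain w1 w2 where w12: "w = w1 @ Lc # w2" "Lc \<notin> set w2"
    using split_list_last[OF w(2)] by blast
  have pres: "\<exists>a b. word_act v (x, y, z) = (a, b, z) \<and> a * b * z - a\<^sup>2 - b\<^sup>2 = x * y * z - x\<^sup>2 - y\<^sup>2"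
    if "Lc \<notin> set v" for v x y z
    using that
  proof (induction v)
    case (Cons i v)
    then obtain a b where "word_act v (x, y, z) = (a, b, z)"
      "a * b * z - a\<^sup>2 - b\<^sup>2 = x * y * z - x\<^sup>2 - y\<^sup>2" by auto
    then show ?case using Cons.prems
      by (cases i) (auto intro!: exI conjI simp: power2_eq_square algebra_simps simp del: diff_eq_eq eq_diff_eq)
  qed simp
  obtain x y z where xyz: "p = (x, y, z)" by (cases p)
  obtain a b where ab: "word_act w2 p = (a, b, z)" "a * b * z - a\<^sup>2 - b\<^sup>2 = x * y * z - x\<^sup>2 - y\<^sup>2"
    using pres[OF w12(2)] xyz by blast
  define k where "k = kappa (a, b, z)"
  have kab: "k = - (a\<^sup>2) - b\<^sup>2 + z\<^sup>2 + a * b * z - 2" by (simp add: k_def)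
  have n1: "1 / real n > 0" using p(2) by simp
  have pz: "2 + 1 / real n \<le> \<bar>z\<bar>" "1 / real n \<le> x * y * z - x\<^sup>2 - y\<^sup>2"
    using p(1) by (simp_all add: xyz)
  have abz: "a * b * z > 0"
  proof -
    have "a * b * z = a\<^sup>2 + b\<^sup>2 + (x * y * z - x\<^sup>2 - y\<^sup>2)" using ab(2) by simp
    moreover have "x * y * z - x\<^sup>2 - y\<^sup>2 > 0" using pz n1 by linarith
    moreover have "a\<^sup>2 \<ge> 0" "b\<^sup>2 \<ge> 0" by simp_all
    ultimately show ?thesis by linarith
  qed
  have z2: "\<bar>z\<bar> > 2" using pz n1 by linarith
  have zk: "z\<^sup>2 < k + 2" using ab(2) pz n1 kab by linarith
  define c where "c = - (a * b) - z"
  have abc: "a * b * c < 0"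
  proof -
    have "a * b * c = - ((a * b) * (a * b)) - a * b * z" by (simp add: c_def algebra_simps)
    moreover have "(a * b) * (a * b) \<ge> 0" by simp
    ultimately show ?thesis using abz by linarith
  qed
  have "z * c = - (k + 2 + a\<^sup>2 + b\<^sup>2)" unfolding c_def
    by (rule zz') (simp add: level_def k_def)
  then have "\<bar>z\<bar> * \<bar>c\<bar> = \<bar>k + 2 + a\<^sup>2 + b\<^sup>2\<bar>" by (metis abs_minus_cancel abs_mult)
  then have zc: "\<bar>z\<bar> * \<bar>c\<bar> \<ge> k + 2" using zero_le_power2[of a] zero_le_power2[of b] by linarith
  have kp: "k + 2 > 0" using zk zero_le_power2[of z] by linarith
  have lt: "\<bar>z\<bar> < sqrt (k + 2)" using zk by (simp add: real_less_rsqrt)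
  have csq: "sqrt (k + 2) \<le> \<bar>c\<bar>"
  proof (rule ccontr)
    assume "\<not> sqrt (k + 2) \<le> \<bar>c\<bar>"
    then have "\<bar>z\<bar> * \<bar>c\<bar> < sqrt (k + 2) * sqrt (k + 2)" using lt by (intro mult_strict_mono') auto
    then show False using zc kp by simp
  qed
  obtain a' b' c' where abc': "word_act w1 (a, b, c) = (a', b', c')" by (cases "word_act w1 (a, b, c)")
  have "distinct_adj w1" "last w1 \<noteq> Lc \<or> w1 = []"
    using w(1) w12(1) by (auto simp: distinct_adj_append_iff)
  then have "sqrt (k + 2) \<le> \<bar>c'\<bar>"
    using word_act_abs_z[OF _ _ refl abc _ csq abc'] z2 lt by auto
  then have c': "k + 2 \<le> c'\<^sup>2" using kp by (metis real_le_lsqrt abs_ge_zero less_imp_le power2_abs real_sqrt_abs real_sqrt_le_iff)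
  have wp: "word_act w p = (a', b', c')" using abc' ab(1) by (simp add: w12(1) word_act_append c_def)
  have "kappa (a', b', c') = k"
  proof -
    have "kappa (word_act v q) = kappa q" for v q
    proof (induction v)
      case (Cons i v)
      have "vieta i \<in> Gamma_gens" by (cases i) (auto simp: Gamma_gens_eq)
      then show ?case using Cons Gamma_gens_kappa by simp
    qed simp
    then have "kappa (word_act w p) = kappa (word_act w2 p)" by simp
    then show ?thesis using wp ab(1) by (simp add: k_def)
  qed
  then show False using wi wp n1 c' by simp
qed

text \<open>A word without \<open>Lc\<close> alternates \<open>La\<close> and \<open>Lb\<close> and
  moves (a, b) along a hyperbola at fixed z. The monitor E gains at least 1 / n^2 with every letter
  after the first, while it starts at no less than -2 n and ends at no more than 2 n.\<close>

lemma well_inside_length: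
  assumes w: "distinct_adj w" "Lc \<notin> set w" and p: "well_inside n p" "well_inside n (word_act w p)" and n: "n > 0"
  shows "length w \<le> 4 * n ^ 3 + 1"
proof (cases "w = []")
  case False
  obtain x y z where xyz: "p = (x, y, z)" by (cases p)
  have n1: "1 / real n > 0" using n by simp
  \<comment> \<open>The derivative of |a|^2 + |b|^2 - |a| |b| |c| in the coordinate changed last: a
    signed position along the hyperbola. One letter increases it by exactly (|a| + |b|) (|z| -
    2).\<close>
  define E where "E = (\<lambda>i (a, b, c). if i = La then 2 * \<bar>a\<bar> - \<bar>b\<bar> * \<bar>c\<bar> else 2 * \<bar>b\<bar> - \<bar>a\<bar> * \<bar>c\<bar> :: real)"
  have "\<exists>a b. word_act w p = (a, b, z) \<and> 1 / real n \<le> a * b * z - a\<^sup>2 - b\<^sup>2 \<and>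
      (w \<noteq> [] \<longrightarrow> E (hd w) (a, b, z) \<ge> - 2 * real n + (real (length w) - 1) / (real n)\<^sup>2)"
    using w
  proof (induction w)
    case Nil
    then show ?case using p xyz by simp
  next
    case (Cons i w)
    have dw: "distinct_adj w" "w \<noteq> [] \<Longrightarrow> hd w \<noteq> i" using Cons.prems(1) by (cases w; auto)+
    have nLc: "Lc \<notin> set w" "i \<noteq> Lc" using Cons.prems(2) by auto
    obtain a b where ab: "word_act w p = (a, b, z)" "1 / real n \<le> a * b * z - a\<^sup>2 - b\<^sup>2"
      "w \<noteq> [] \<Longrightarrow> E (hd w) (a, b, z) \<ge> - 2 * real n + (real (length w) - 1) / (real n)\<^sup>2"
      using Cons.IH dw nLc by auto
    have z: "2 + 1 / real n \<le> \<bar>z\<bar>" "\<bar>z\<bar> \<le> real n" using p(1) by (auto simp: xyz)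
    have abz: "a * b * z \<ge> 1 / real n + a\<^sup>2 + b\<^sup>2" using ab(2) by linarith
    then have pos: "a * b * z > 0" using n1 zero_le_power2[of a] zero_le_power2[of b] by linarith
    have eq: "a * b * z = \<bar>a\<bar> * \<bar>b\<bar> * \<bar>z\<bar>" using pos by (metis abs_mult abs_of_pos)
    \<comment> \<open>From |a| |b| |z| >= 1 / n and |z| <= n one gets |a| + |b| >= 1 / n; the other
      factor 1 / n is the margin of |z| above 2.\<close>
    have incr: "(\<bar>a\<bar> + \<bar>b\<bar>) * (\<bar>z\<bar> - 2) \<ge> 1 / (real n)\<^sup>2"
    proof -
      have "1 / real n \<le> \<bar>a\<bar> * \<bar>b\<bar> * \<bar>z\<bar>" using abz eq zero_le_power2[of a] zero_le_power2[of b] by linarith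
      also have "\<dots> \<le> \<bar>a\<bar> * \<bar>b\<bar> * real n" using z by (intro mult_left_mono) auto
      finally have "1 / (real n)\<^sup>2 \<le> \<bar>a\<bar> * \<bar>b\<bar>" using n by (simp add: field_simps power2_eq_square)
      moreover have "\<bar>a\<bar> * \<bar>b\<bar> \<le> (\<bar>a\<bar> + \<bar>b\<bar>)\<^sup>2" by (simp add: power2_eq_square algebra_simps)
      ultimately have "(1 / real n)\<^sup>2 \<le> (\<bar>a\<bar> + \<bar>b\<bar>)\<^sup>2" by (simp add: power_divide)
      then have "1 / real n \<le> \<bar>a\<bar> + \<bar>b\<bar>" by (rule power2_le_imp_le) simp
      then have "(1 / real n) * (1 / real n) \<le> (\<bar>a\<bar> + \<bar>b\<bar>) * (\<bar>z\<bar> - 2)"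
        using z n1 by (intro mult_mono) auto
      then show ?thesis by (simp add: power2_eq_square)
    qed
    have sa: "(b * z - a) * (b * z) > 0" "\<bar>b * z - a\<bar> = \<bar>b\<bar> * \<bar>z\<bar> - \<bar>a\<bar>"
      and sb: "(a * z - b) * (a * z) > 0" "\<bar>a * z - b\<bar> = \<bar>a\<bar> * \<bar>z\<bar> - \<bar>b\<bar>"
    proof -
      have ap: "\<bar>a\<bar> > 0" "\<bar>b\<bar> > 0" using pos by auto
      have "\<bar>a\<bar> * \<bar>a\<bar> < \<bar>a\<bar> * (\<bar>b\<bar> * \<bar>z\<bar>)"
        using abz eq n1 zero_le_power2[of b] unfolding power2_eq_square mult.assoc abs_mult_self_eq by linarith
      then have 1: "\<bar>a\<bar> < \<bar>b\<bar> * \<bar>z\<bar>" by (simp only: mult_less_cancel_left_pos[OF ap(1)])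
      have "\<bar>b\<bar> * \<bar>b\<bar> < \<bar>b\<bar> * (\<bar>a\<bar> * \<bar>z\<bar>)"
        using abz eq n1 zero_le_power2[of a] mult.left_commute[of "\<bar>a\<bar>" "\<bar>b\<bar>" "\<bar>z\<bar>"]
        unfolding power2_eq_square mult.assoc abs_mult_self_eq by linarith
      then have 2: "\<bar>b\<bar> < \<bar>a\<bar> * \<bar>z\<bar>" by (simp only: mult_less_cancel_left_pos[OF ap(2)])
      show "\<bar>b * z - a\<bar> = \<bar>b\<bar> * \<bar>z\<bar> - \<bar>a\<bar>" using abs_diff_same[of a "b * z"] pos 1 by (simp add: mult.assoc abs_mult)
      show "\<bar>a * z - b\<bar> = \<bar>a\<bar> * \<bar>z\<bar> - \<bar>b\<bar>" using abs_diff_same[of b "a * z"] pos 2 by (simp add: mult.assoc mult.left_commute abs_mult)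
      have "a * (b * z) < (b * z) * (b * z)"
      proof -
        have "a * (b * z) = \<bar>a\<bar> * (\<bar>b\<bar> * \<bar>z\<bar>)" using eq by (simp add: mult.assoc)
        also have "\<dots> < (\<bar>b\<bar> * \<bar>z\<bar>) * (\<bar>b\<bar> * \<bar>z\<bar>)" using 1 by (intro mult_strict_right_mono) auto
        finally show ?thesis by (simp add: abs_mult[symmetric])
      qed
      then show "(b * z - a) * (b * z) > 0" by (simp add: algebra_simps)
      have "b * (a * z) < (a * z) * (a * z)"
      proof -
        have "b * (a * z) = \<bar>b\<bar> * (\<bar>a\<bar> * \<bar>z\<bar>)" using eq by (simp add: mult.assoc mult.left_commute)
        also have "\<dots> < (\<bar>a\<bar> * \<bar>z\<bar>) * (\<bar>a\<bar> * \<bar>z\<bar>)" using 2 by (intro mult_strict_right_mono) auto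
        finally show ?thesis by (simp add: abs_mult[symmetric])
      qed
      then show "(a * z - b) * (a * z) > 0" by (simp add: algebra_simps)
    qed
    have bnd: "\<bar>a\<bar> \<le> real n \<and> \<bar>b\<bar> \<le> real n" if "w = []" using that ab(1) p(1) xyz by auto
    have len: "(real (length (i # w)) - 1) / (real n)\<^sup>2 = (real (length w) - 1) / (real n)\<^sup>2 + 1 / (real n)\<^sup>2"
      by (simp add: add_divide_distrib[symmetric])
    have nn: "\<bar>a\<bar> * \<bar>z\<bar> \<ge> 0" "\<bar>b\<bar> * \<bar>z\<bar> \<ge> 0" by auto
    show ?case
    proof (cases i)
      case La
      have "E La (b * z - a, b, z) \<ge> - 2 * real n + (real (length (i # w)) - 1) / (real n)\<^sup>2"
      proof (cases "w = []")
        case True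
        then have "(real (length (i # w)) - 1) / (real n)\<^sup>2 = 0" by simp
        moreover have "E La (b * z - a, b, z) = \<bar>b\<bar> * \<bar>z\<bar> - 2 * \<bar>a\<bar>" by (simp add: E_def sa(2))
        ultimately show ?thesis using bnd[OF True] nn by linarith
      next
        case F: False
        then have "hd w = Lb" using dw La nLc letter.exhaust by (metis hd_in_set)
        then have "E (hd w) (a, b, z) = 2 * \<bar>b\<bar> - \<bar>a\<bar> * \<bar>z\<bar>" by (simp add: E_def)
        then show ?thesis using ab(3)[OF F] incr unfolding len by (simp add: E_def sa(2) algebra_simps)
      qed
      moreover have "(b * z - a) * b * z - (b * z - a)\<^sup>2 - b\<^sup>2 = a * b * z - a\<^sup>2 - b\<^sup>2"
        by (simp add: power2_eq_square algebra_simps)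
      ultimately show ?thesis using La ab(1,2) by (intro exI[of _ "b * z - a"] exI[of _ b]) simp
    next
      case Lb
      have "E Lb (a, a * z - b, z) \<ge> - 2 * real n + (real (length (i # w)) - 1) / (real n)\<^sup>2"
      proof (cases "w = []")
        case True
        then have "(real (length (i # w)) - 1) / (real n)\<^sup>2 = 0" by simp
        moreover have "E Lb (a, a * z - b, z) = \<bar>a\<bar> * \<bar>z\<bar> - 2 * \<bar>b\<bar>" by (simp add: E_def sb(2))
        ultimately show ?thesis using bnd[OF True] nn by linarith
      next
        case F: False
        then have "hd w = La" using dw Lb nLc letter.exhaust by (metis hd_in_set)
        then have "E (hd w) (a, b, z) = 2 * \<bar>a\<bar> - \<bar>b\<bar> * \<bar>z\<bar>" by (simp add: E_def)
        then show ?thesis using ab(3)[OF F] incr unfolding len by (simp add: E_def sb(2) algebra_simps)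
      qed
      moreover have "a * (a * z - b) * z - a\<^sup>2 - (a * z - b)\<^sup>2 = a * b * z - a\<^sup>2 - b\<^sup>2"
        by (simp add: power2_eq_square algebra_simps)
      ultimately show ?thesis using Lb ab(1,2) by (intro exI[of _ a] exI[of _ "a * z - b"]) simp
    qed (use nLc in simp)
  qed
  then obtain a b where ab: "word_act w p = (a, b, z)"
    "E (hd w) (a, b, z) \<ge> - 2 * real n + (real (length w) - 1) / (real n)\<^sup>2" using False by auto
  have nn: "\<bar>a\<bar> * \<bar>z\<bar> \<ge> 0" "\<bar>b\<bar> * \<bar>z\<bar> \<ge> 0" by auto
  moreover have "\<bar>a\<bar> \<le> real n" "\<bar>b\<bar> \<le> real n" using p(2) ab(1) by simp_all
  ultimately have "E (hd w) (a, b, z) \<le> 2 * real n" unfolding E_def split_conv by (split if_split, intro conjI impI; linarith)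
  then have "(real (length w) - 1) / (real n)\<^sup>2 \<le> 4 * real n" using ab(2) by linarith
  then have "real (length w) - 1 \<le> 4 * real n * (real n)\<^sup>2" using n by (simp add: divide_le_eq)
  then have "real (length w) \<le> real (4 * n ^ 3 + 1)" by (simp add: power2_eq_square power3_eq_cube)
  then show ?thesis by (simp only: of_nat_le_iff)
qed simp

theorem acts_properly_F'_C11: "acts_properly Gamma_group (orbit_set Gamma_group F'_C11)"
proof (rule acts_properly_local[where P = "\<lambda>C. \<exists>n>0. C = {p. well_inside n p}"])
  show "g p \<in> orbit_set Gamma_group F'_C11" if "g \<in> Gamma_group" "p \<in> orbit_set Gamma_group F'_C11" for g p
    using that orbit_set_invariant by blast
next
  fix p assume "p \<in> orbit_set Gamma_group F'_C11"
  then obtain g where g: "g \<in> Gamma_group" "g p \<in> F'_C11" unfolding orbit_set_mem by blast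
  obtain x y z where xyz: "g p = (x, y, z)" by (cases "g p")
  have *: "z < -2" "x * y * z > x\<^sup>2 + y\<^sup>2" using g(2) xyz by (auto simp: F'_C11_def)
  define e where "e = min (\<bar>z\<bar> - 2) (x * y * z - x\<^sup>2 - y\<^sup>2)"
  have "e > 0" using * by (auto simp: e_def)
  then obtain m :: nat where m: "m > 0" "1 / real m < e" by (metis gr0I inverse_eq_divide real_arch_inverse)
  obtain l :: nat where l: "\<bar>x\<bar> + \<bar>y\<bar> + \<bar>z\<bar> < real l" using reals_Archimedean2 by blast
  define n where "n = max m l"
  have n: "n > 0" "1 / real n < e" "\<bar>x\<bar> + \<bar>y\<bar> + \<bar>z\<bar> < real n"
  proof -
    show "n > 0" using m by (simp add: n_def)
    have "1 / real n \<le> 1 / real m" using m by (intro divide_left_mono) (auto simp: n_def)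
    then show "1 / real n < e" using m by linarith
    show "\<bar>x\<bar> + \<bar>y\<bar> + \<bar>z\<bar> < real n" using l by (simp add: n_def)
  qed
  define N :: "point set" where "N = {q. 2 + 1 / real n < \<bar>snd (snd q)\<bar>} \<inter> {q. \<bar>fst q\<bar> < real n} \<inter>
    {q. \<bar>fst (snd q)\<bar> < real n} \<inter> {q. \<bar>snd (snd q)\<bar> < real n} \<inter>
    {q. 1 / real n < fst q * fst (snd q) * snd (snd q) - (fst q)\<^sup>2 - (fst (snd q))\<^sup>2}"
  have "open N" unfolding N_def
    by (intro open_Int open_Collect_less continuous_intros)
  moreover have "g p \<in> N" using n * by (auto simp: N_def xyz e_def)
  moreover have "N \<inter> orbit_set Gamma_group F'_C11 \<subseteq> {p. well_inside n p}" by (auto simp: N_def)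
  ultimately show "\<exists>g\<in>Gamma_group. \<exists>N C. open N \<and> g p \<in> N \<and> N \<inter> orbit_set Gamma_group F'_C11 \<subseteq> C \<and>
      (\<exists>n>0. C = {p. well_inside n p})"
    using g(1) n(1) by blast
next
  fix C D :: "point set"
  assume "\<exists>n>0. C = {p. well_inside n p}" "\<exists>n>0. D = {p. well_inside n p}"
  then obtain n1 n2 where n12: "n1 > 0" "n2 > 0" "C = {p. well_inside n1 p}" "D = {p. well_inside n2 p}" by blast
  define n where "n = max n1 n2"
  have CD: "C \<subseteq> {p. well_inside n p}" "D \<subseteq> {p. well_inside n p}" "n > 0"
    unfolding n12(3,4) n_def subset_iff mem_Collect_eq
    using well_inside_mono[OF _ n12(1), of _ "max n1 n2"] well_inside_mono[OF _ n12(2), of _ "max n1 n2"] n12(1)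
    by (blast intro: max.cobounded1 max.cobounded2, blast intro: max.cobounded1 max.cobounded2, simp)
  have "{g \<in> Gamma_group. g ` C \<inter> D \<noteq> {}} \<subseteq>
    (\<lambda>(u, w). u \<circ> word_act w) ` (sign_swaps \<times> {w. set w \<subseteq> UNIV \<and> length w \<le> 4 * n ^ 3 + 1})"
  proof (rule subsetI)
    fix g assume "g \<in> {g \<in> Gamma_group. g ` C \<inter> D \<noteq> {}}"
    then have g: "g \<in> Gamma_group" "g ` C \<inter> D \<noteq> {}" unfolding mem_Collect_eq by argo+
    from g(2) obtain p where "p \<in> C" "g p \<in> D" by blast
    then have p: "well_inside n p" "well_inside n (g p)" using CD by (simp_all only: subset_iff mem_Collect_eq)
    obtain u w where uw: "u \<in> sign_swaps" "distinct_adj w" "g = u \<circ> word_act w"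
      using Gamma_normal_form[OF g(1)] by blast
    then have wp: "well_inside n (word_act w p)" using p(2) well_inside_sign_swaps by simp
    then have "Lc \<notin> set w" using well_inside_no_Lc[OF uw(2) _ p(1) CD(3)] by blast
    then have "length w \<le> 4 * n ^ 3 + 1" using well_inside_length[OF uw(2) _ p(1) wp CD(3)] by blast
    then show "g \<in> (\<lambda>(u, w). u \<circ> word_act w) ` (sign_swaps \<times> {w. set w \<subseteq> UNIV \<and> length w \<le> 4 * n ^ 3 + 1})"
      using uw by (intro image_eqI[of _ _ "(u, w)"]) auto
  qed
  moreover have "finite {w :: letter list. set w \<subseteq> UNIV \<and> length w \<le> 4 * n ^ 3 + 1}"
    by (rule finite_lists_length_le) (simp add: UNIV_letter)
  ultimately show "finite {g \<in> Gamma_group. g ` C \<inter> D \<noteq> {}}"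
    by (rule finite_subset[OF _ finite_imageI[OF finite_SigmaI[OF finite_sign_swaps]]])
qed

subsection \<open>Descent on the level sets below 2\<close>

lemma Gamma_compE:
  assumes "g \<in> Gamma_group" "h \<in> Gamma_group"
  obtains f where "f \<in> Gamma_group" "\<And>p. f p = g (h p)"
  using Gamma_comp[OF assms] by (metis comp_apply)

text \<open>The sign condition on the two roots excludes overshooting, so |z| drops by the full
  amount |u|; used with u = xy.\<close>

lemma abs_flip: "\<bar>- u - z\<bar> = \<bar>z\<bar> - \<bar>u\<bar>" if "z * (- u - z) < 0" "u * z < 0" for u z :: real
  using that by (cases "z > 0") (auto simp: mult_less_0_iff abs_if)

text \<open>Apply the decrement to a point whose value is within e of the infimum. The restriction
  to values at most f p0 matters, since the decrements found later are uniform only on such sublevel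
  sets.\<close>

lemma no_uniform_descent:
  fixes f :: "'a \<Rightarrow> real"
  assumes "p0 \<in> S" "\<And>p. p \<in> S \<Longrightarrow> 0 \<le> f p"
    "\<And>p. p \<in> S \<Longrightarrow> f p \<le> f p0 \<Longrightarrow> \<exists>q\<in>S. f q \<le> f p - e" "e > 0"
  shows False
proof -
  define T where "T = {p \<in> S. f p \<le> f p0}"
  have bdd: "bdd_below (f ` T)" using assms(2) by (intro bdd_belowI[of _ 0]) (auto simp: T_def)
  have "p0 \<in> T" using assms by (simp add: T_def)
  then obtain p where p: "p \<in> T" "f p < Inf (f ` T) + e"
    using cInf_lessD[of "f ` T" "Inf (f ` T) + e"] assms(4) by auto
  then obtain q where q: "q \<in> S" "f q \<le> f p - e" using assms(3) by (auto simp: T_def)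
  then have "q \<in> T" using p(1) assms(4) by (auto simp: T_def)
  then have "Inf (f ` T) \<le> f q" using bdd by (intro cInf_lower) auto
  then show False using p q by linarith
qed

text \<open>The orbits that the ergodicity argument below 2 has to exclude: never meeting the
  elliptic region |z| < 2, the null set x = 0 or \<open>F_C02\<close>.\<close>

definition hyperbolic_orbit :: "point \<Rightarrow> bool" where
  "hyperbolic_orbit p \<longleftrightarrow> (\<forall>g\<in>Gamma_group. 2 \<le> \<bar>snd (snd (g p))\<bar> \<and> fst (g p) \<noteq> 0 \<and> g p \<notin> F_C02)"

lemma hyperbolic_orbit_Gamma:
  assumes "hyperbolic_orbit p" "g \<in> Gamma_group" shows "hyperbolic_orbit (g p)"
  unfolding hyperbolic_orbit_def
proof
  fix h assume "h \<in> Gamma_group"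
  then obtain f where "f \<in> Gamma_group" "\<forall>p. f p = h (g p)" using Gamma_comp_apply assms(2) by blast
  then show "2 \<le> \<bar>snd (snd (h (g p)))\<bar> \<and> fst (h (g p)) \<noteq> 0 \<and> h (g p) \<notin> F_C02"
    using assms(1) unfolding hyperbolic_orbit_def by metis
qed

lemma hyperbolic_orbitD:
  assumes "hyperbolic_orbit (x, y, z)"
  shows "2 \<le> \<bar>z\<bar>" "x \<noteq> 0" "y \<noteq> 0" "2 \<le> \<bar>- (x * y) - z\<bar>" "z * (- (x * y) - z) < 0"
proof -
  have *: "2 \<le> \<bar>snd (snd (g (x, y, z)))\<bar> \<and> fst (g (x, y, z)) \<noteq> 0 \<and> g (x, y, z) \<notin> F_C02"
    if "g \<in> Gamma_group" for g
    using assms that unfolding hyperbolic_orbit_def by blast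
  show 1: "2 \<le> \<bar>z\<bar>" "x \<noteq> 0" "y \<noteq> 0" "2 \<le> \<bar>- (x * y) - z\<bar>"
    using *[OF Gamma_id] *[OF gens_in_Gamma(7)] *[OF gens_in_Gamma(3)] by auto
  have "(x, y, z) \<notin> F_C02" "(- x, y, - z) \<notin> F_C02"
    using *[OF Gamma_id] *[OF gens_in_Gamma(5)] by auto
  \<comment> \<open>If z and z' were both negative the point would lie in \<open>F_C02\<close>; if
    both were positive, its image under \<open>S2\<close> would.\<close>
  then have "\<not> (z < 0 \<and> - (x * y) - z < 0)" "\<not> (z > 0 \<and> - (x * y) - z > 0)"
    using 1 by (auto simp: F_C02_def)
  then show "z * (- (x * y) - z) < 0" using 1 by (auto simp: mult_less_0_iff)
qed

text \<open>Moving only y and z, the trace z descends below 2 when x is small.\<close>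

lemma hyperbolic_orbit_x_large:
  assumes k: "k < 2" and p: "(x, y, z) \<in> level k" "hyperbolic_orbit (x, y, z)"
  shows "2 - k \<le> x\<^sup>2"
proof (rule ccontr)
  assume "\<not> 2 - k \<le> x\<^sup>2"
  then have d: "2 - k - x\<^sup>2 > 0" by simp
  define S where "S = {(y, z). (x, y, z) \<in> level k \<and> hyperbolic_orbit (x, y, z)}"
  have V2: "(x * c - b, c) \<in> S" if "(b, c) \<in> S" for b c
    using that hyperbolic_orbit_Gamma[OF _ gens_in_Gamma(2), of "(x, b, c)"]
      Gamma_level[OF gens_in_Gamma(2), of "(x, b, c)"] by (simp add: S_def)
  have V3: "(b, - (x * b) - c) \<in> S" if "(b, c) \<in> S" for b c
    using that hyperbolic_orbit_Gamma[OF _ gens_in_Gamma(3), of "(x, b, c)"]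
      Gamma_level[OF gens_in_Gamma(3), of "(x, b, c)"] by (simp add: S_def)
  have x0: "x \<noteq> 0" using hyperbolic_orbitD[OF p(2)] by simp
  \<comment> \<open>A lower bound for |b|: the level equation with c^2 >= 4 gives 2 - k - x^2 <= |b|
    (|b| + |x| |c|), and |c| <= |z| during the descent.\<close>
  define m where "m = min 1 ((2 - k - x\<^sup>2) / (\<bar>x\<bar> * \<bar>z\<bar> + 1))"
  have "\<bar>x\<bar> * \<bar>z\<bar> + 1 > 0" by (simp add: add_nonneg_pos)
  then have m: "m > 0" "m \<le> 1" "m * (\<bar>x\<bar> * \<bar>z\<bar> + 1) \<le> 2 - k - x\<^sup>2"
  proof -
    assume D: "\<bar>x\<bar> * \<bar>z\<bar> + 1 > 0"
    show "m > 0" "m \<le> 1" using d D by (simp_all add: m_def)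
    have "m \<le> (2 - k - x\<^sup>2) / (\<bar>x\<bar> * \<bar>z\<bar> + 1)" by (simp add: m_def)
    then show "m * (\<bar>x\<bar> * \<bar>z\<bar> + 1) \<le> 2 - k - x\<^sup>2" using D by (simp add: pos_le_divide_eq)
  qed
  have step: "\<bar>- (x * b) - c\<bar> \<le> \<bar>c\<bar> - \<bar>x\<bar> * m"
    if bc: "(b, c) \<in> S" "x * b * c < 0" "\<bar>c\<bar> \<le> \<bar>z\<bar>" for b c
  proof -
    have h: "hyperbolic_orbit (x, b, c)" "(x, b, c) \<in> level k" using bc(1) by (auto simp: S_def)
    note hD = hyperbolic_orbitD[OF h(1)]
    have "2 * 2 \<le> \<bar>c\<bar> * \<bar>c\<bar>" using hD(1) by (intro mult_mono) auto
    then have "4 \<le> c\<^sup>2" by (simp add: power2_eq_square)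
    moreover have xbc: "- (x * b * c) = \<bar>x\<bar> * \<bar>b\<bar> * \<bar>c\<bar>" using bc(2) by (metis abs_mult abs_of_neg)
    ultimately have "2 - k - x\<^sup>2 \<le> \<bar>b\<bar> * \<bar>b\<bar> + \<bar>x\<bar> * \<bar>b\<bar> * \<bar>c\<bar>"
      using h(2) by (simp add: level_def power2_eq_square)
    then have le: "2 - k - x\<^sup>2 \<le> \<bar>b\<bar> * (\<bar>b\<bar> + \<bar>x\<bar> * \<bar>c\<bar>)" by (simp add: algebra_simps)
    have "m \<le> \<bar>b\<bar>"
    proof (rule ccontr)
      assume "\<not> m \<le> \<bar>b\<bar>"
      then have b: "\<bar>b\<bar> < m" by simp
      have "\<bar>b\<bar> * (\<bar>b\<bar> + \<bar>x\<bar> * \<bar>c\<bar>) < m * (1 + \<bar>x\<bar> * \<bar>z\<bar>)"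
      proof (rule mult_strict_mono')
        have "\<bar>x\<bar> * \<bar>c\<bar> \<le> \<bar>x\<bar> * \<bar>z\<bar>" using bc(3) by (intro mult_left_mono) auto
        then show "\<bar>b\<bar> + \<bar>x\<bar> * \<bar>c\<bar> < 1 + \<bar>x\<bar> * \<bar>z\<bar>" using b m(2) by linarith
      qed (use b in auto)
      then show False using le m(3) by (simp add: algebra_simps)
    qed
    then have xm: "\<bar>x\<bar> * m \<le> \<bar>x\<bar> * \<bar>b\<bar>" by (intro mult_left_mono) auto
    have "\<bar>- (x * b) - c\<bar> = \<bar>c\<bar> - \<bar>x * b\<bar>"
      using hD(5) bc(2) by (rule abs_flip)
    then show ?thesis using xm by (simp add: abs_mult)
  qed
  show False
  proof (rule no_uniform_descent[of "(y, z)" S "\<lambda>(y, z). \<bar>z\<bar>" "\<bar>x\<bar> * m"])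
    show "(y, z) \<in> S" using p by (simp add: S_def)
    show "0 < \<bar>x\<bar> * m" using x0 m by simp
    fix q assume q: "q \<in> S" "(case q of (y, z) \<Rightarrow> \<bar>z\<bar>) \<le> (case (y, z) of (y, z) \<Rightarrow> \<bar>z\<bar>)"
    obtain b c where bc: "q = (b, c)" by (cases q)
    then have h: "hyperbolic_orbit (x, b, c)" "(x, b, c) \<in> level k" using q(1) by (auto simp: S_def)
    note hD = hyperbolic_orbitD[OF h(1)]
    show "\<exists>q'\<in>S. (case q' of (y, z) \<Rightarrow> \<bar>z\<bar>) \<le> (case q of (y, z) \<Rightarrow> \<bar>z\<bar>) - \<bar>x\<bar> * m"
    proof (cases "x * b * c < 0")
      case True
      then show ?thesis using step[of b c] V3[of b c] q bc by (intro bexI[of _ "(b, - (x * b) - c)"]) auto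
    next
      case False
      \<comment> \<open>Here \<open>V2\<close> comes first. The level equation gives xbc < b^2,
        hence |x| |c| < |b|, so \<open>V2\<close> makes the product negative without changing
        c.\<close>
      have "2 * 2 \<le> \<bar>c\<bar> * \<bar>c\<bar>" using hD(1) by (intro mult_mono) auto
      then have "4 \<le> c\<^sup>2" by (simp add: power2_eq_square)
      then have "x * b * c < b\<^sup>2" using d h(2) by (simp add: level_def)
      have "x * (x * c - b) * c < 0"
      proof -
        have b: "b \<noteq> 0" "x \<noteq> 0" "c \<noteq> 0" using hD by auto
        have xbc: "x * b * c = \<bar>b\<bar> * (\<bar>x\<bar> * \<bar>c\<bar>)" using False by (metis abs_mult abs_of_nonneg linorder_not_less mult.assoc mult.left_commute)
        have "\<bar>b\<bar> * (\<bar>x\<bar> * \<bar>c\<bar>) < \<bar>b\<bar> * \<bar>b\<bar>" unfolding xbc[symmetric] using \<open>x * b * c < b\<^sup>2\<close> by (simp add: power2_eq_square)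
        moreover have "\<bar>b\<bar> > 0" using b(1) by simp
        ultimately have lt: "\<bar>x\<bar> * \<bar>c\<bar> < \<bar>b\<bar>" by (simp only: mult_less_cancel_left_pos)
        have "x * (x * c - b) * c = (x * c) * (x * c) - x * b * c" by (simp add: algebra_simps)
        also have "\<dots> = (\<bar>x\<bar> * \<bar>c\<bar>) * (\<bar>x\<bar> * \<bar>c\<bar>) - \<bar>b\<bar> * (\<bar>x\<bar> * \<bar>c\<bar>)"
          unfolding xbc by (simp add: abs_mult[symmetric])
        also have "\<dots> = (\<bar>x\<bar> * \<bar>c\<bar>) * (\<bar>x\<bar> * \<bar>c\<bar> - \<bar>b\<bar>)" by (simp add: algebra_simps)
        also have "\<dots> < 0" using b lt by (intro mult_pos_neg) auto
        finally show ?thesis .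
      qed
      then show ?thesis
        using step[of "x * c - b" c] V3[OF V2[of b c]] V2[of b c] q bc
        by (intro bexI[of _ "(x * c - b, - (x * (x * c - b)) - c)"]) auto
    qed
  qed auto
qed

text \<open>The Dehn twists fixing z move (x, y) along a hyperbola on which the indefinite form
  x^2 + y^2 - xyz takes the positive value z^2 - k - 2; such a hyperbola meets the region xyz < 0.\<close>

lemma twist_sign_change:
  assumes R: "z\<^sup>2 > k + 2" and p: "(x, y, z) \<in> level k"
    and nz: "\<And>t a b. t \<in> Gamma_group \<Longrightarrow> t (x, y, z) = (a, b, z) \<Longrightarrow> a * b * z \<noteq> 0"
  obtains t a b where "t \<in> Gamma_group" "\<And>q. snd (snd (t q)) = snd (snd q)"
    "t (x, y, z) = (a, b, z)" "a * b * z < 0"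
proof (rule ccontr)
  note found = that
  assume nt: "\<not> thesis"
  have pos: "a * b * z > 0" if h: "h \<in> Gamma_group" "\<And>q. snd (snd (h q)) = snd (snd q)" "h (x, y, z) = (a, b, z)" for h a b
    using found[OF h] nt nz[OF h(1,3)] by (metis linorder_neqE_linordered_idom)
  \<comment> \<open>All pairs reachable without touching z. If the product stays positive on S, the
    larger coordinate can be lowered forever by a fixed amount.\<close>
  define S where "S = {(a, b). \<exists>h. h \<in> Gamma_group \<and> (\<forall>q. snd (snd (h q)) = snd (snd q)) \<and> h (x, y, z) = (a, b, z)}"
  have SI: "(a, b) \<in> S" if "h \<in> Gamma_group" "\<And>q. snd (snd (h q)) = snd (snd q)" "h (x, y, z) = (a, b, z)" for h a b
    unfolding S_def using that by blast
  define r where "r = z\<^sup>2 - k - 2"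
  have r: "r > 0" using R by (simp add: r_def)
  have S: "(c * z - a, c) \<in> S" "(c, a) \<in> S" "a * c * z > 0" "a\<^sup>2 + c\<^sup>2 - a * c * z = r"
    if ac: "(a, c) \<in> S" for a c
  proof -
    obtain h where h: "h \<in> Gamma_group" "\<forall>q. snd (snd (h q)) = snd (snd q)" "h (x, y, z) = (a, c, z)"
      using ac unfolding S_def by blast
    have hq: "snd (snd (h q)) = snd (snd q)" for q using h(2) by blast
    show "(c * z - a, c) \<in> S" "(c, a) \<in> S"
    proof -
      obtain f1 f2 where f: "f1 \<in> Gamma_group" "\<And>p. f1 p = V1 (h p)" "f2 \<in> Gamma_group" "\<And>p. f2 p = Sw (h p)"
        using Gamma_compE[OF gens_in_Gamma(1) h(1)] Gamma_compE[OF gens_in_Gamma(7) h(1)] by metis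
      have "f1 (x, y, z) = (c * z - a, c, z)" "f2 (x, y, z) = (c, a, z)" unfolding f h(3) by simp_all
      moreover have "snd (snd (f1 q)) = snd (snd q)" "snd (snd (f2 q)) = snd (snd q)" for q
        unfolding f using hq[of q] by (cases "h q"; simp)+
      ultimately show "(c * z - a, c) \<in> S" "(c, a) \<in> S" using SI f(1,3) by blast+
    qed
    show "a * c * z > 0" by (rule pos[OF h(1) hq h(3)])
    have "kappa (a, c, z) = k" using Gamma_kappa[OF h(1), of "(x, y, z)"] p h(3) by (simp add: level_def)
    then show "a\<^sup>2 + c\<^sup>2 - a * c * z = r" by (simp add: r_def)
  qed
  \<comment> \<open>Bounds the coordinates on the sublevel set of the starting point, so that the
    decrement r / |a| is at least r / B; the 1 keeps B positive.\<close>
  define B where "B = \<bar>x\<bar> + \<bar>y\<bar> + 1"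
  have B: "B > 0" by (simp add: B_def add_nonneg_pos)
  have main: "\<bar>c * z - a\<bar> \<le> \<bar>a\<bar> - r / B" if ac: "(a, c) \<in> S" "\<bar>c\<bar> \<le> \<bar>a\<bar>" "\<bar>a\<bar> + \<bar>c\<bar> \<le> \<bar>x\<bar> + \<bar>y\<bar>" for a c
  proof -
    have a0: "\<bar>a\<bar> > 0" using S(3)[OF ac(1)] by auto
    \<comment> \<open>a and cz - a are the two roots of the quadratic satisfied by a, and their
      product is c^2 - r. Positive products force both to have the sign of cz.\<close>
    have e: "a * (c * z - a) = c\<^sup>2 - r" using S(4)[OF ac(1)] by (simp add: power2_eq_square algebra_simps)
    have "(c * z - a) * c * z > 0" using S(3)[OF S(1)[OF ac(1)]] .
    then have "((c * z - a) * c * z) * (a * c * z) > 0" using S(3)[OF ac(1)] by (rule mult_pos_pos)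
    moreover have "((c * z - a) * c * z) * (a * c * z) = (a * (c * z - a)) * (c * z)\<^sup>2"
      by (simp add: power2_eq_square algebra_simps)
    ultimately have "a * (c * z - a) > 0" by (simp add: zero_less_mult_iff)
    then have "\<bar>a\<bar> * \<bar>c * z - a\<bar> = c\<^sup>2 - r" using e by (metis abs_mult abs_of_pos)
    moreover have "c\<^sup>2 \<le> \<bar>a\<bar> * \<bar>a\<bar>" using ac(2) by (metis abs_le_square_iff abs_mult_self_eq power2_eq_square)
    ultimately have "\<bar>a\<bar> * \<bar>c * z - a\<bar> \<le> \<bar>a\<bar> * (\<bar>a\<bar> - r / \<bar>a\<bar>)" using a0 by (simp add: right_diff_distrib)
    then have "\<bar>c * z - a\<bar> \<le> \<bar>a\<bar> - r / \<bar>a\<bar>" using a0 by (metis mult_le_cancel_left_pos)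
    moreover have "\<bar>a\<bar> \<le> B" using ac(3) abs_ge_zero[of c] unfolding B_def by linarith
    then have "r / B \<le> r / \<bar>a\<bar>" using r a0 B by (intro divide_left_mono) auto
    ultimately show ?thesis by linarith
  qed
  show False
  proof (rule no_uniform_descent[of "(x, y)" S "\<lambda>(a, b). \<bar>a\<bar> + \<bar>b\<bar>" "r / B"])
    show "(x, y) \<in> S" by (rule SI[OF Gamma_id]) simp_all
    show "0 < r / B" using r B by simp
    fix q assume q: "q \<in> S" "(case q of (a, b) \<Rightarrow> \<bar>a\<bar> + \<bar>b\<bar>) \<le> (case (x, y) of (a, b) \<Rightarrow> \<bar>a\<bar> + \<bar>b\<bar>)"
    obtain a c where ac: "q = (a, c)" by (cases q)
    show "\<exists>q'\<in>S. (case q' of (a, b) \<Rightarrow> \<bar>a\<bar> + \<bar>b\<bar>) \<le> (case q of (a, b) \<Rightarrow> \<bar>a\<bar> + \<bar>b\<bar>) - r / B"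
    proof (cases "\<bar>c\<bar> \<le> \<bar>a\<bar>")
      case True
      then show ?thesis using main[of a c] S(1)[of a c] q ac by (intro bexI[of _ "(c * z - a, c)"]) auto
    next
      case False
      then show ?thesis using main[of c a] S(1)[OF S(2)[of a c]] S(2)[of a c] q ac
        by (intro bexI[of _ "(a * z - c, a)"]) auto
    qed
  qed auto
qed

text \<open>A twist at fixed z makes the product negative. Then x^2 and y^2 are both at least 2 - k,
  by \<open>hyperbolic_orbit_x_large\<close> and its image under \<open>Sw\<close>, so
  \<open>V3\<close> lowers |z| by |xy| >= 2 - k.\<close>

lemma no_hyperbolic_orbit:
  assumes k: "k < 2" and p: "p \<in> level k" shows "\<not> hyperbolic_orbit p"
proof
  assume hp: "hyperbolic_orbit p"
  define S where "S = {g p |g. g \<in> Gamma_group}"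
  have S: "hyperbolic_orbit q" "q \<in> level k" if qS: "q \<in> S" for q
  proof -
    obtain g where g: "q = g p" "g \<in> Gamma_group" using qS unfolding S_def by blast
    show "hyperbolic_orbit q" "q \<in> level k"
      unfolding g(1) using hyperbolic_orbit_Gamma[OF hp g(2)] Gamma_level[OF g(2) p] by blast+
  qed
  have SG: "g q \<in> S" if qS: "q \<in> S" and g: "g \<in> Gamma_group" for q g
  proof -
    obtain h where h: "q = h p" "h \<in> Gamma_group" using qS unfolding S_def by blast
    obtain f where f: "f \<in> Gamma_group" "\<And>p. f p = g (h p)" using Gamma_compE[OF g h(2)] by blast
    have "g q = f p" unfolding f h(1) ..
    then show ?thesis using f(1) unfolding S_def by blast
  qed
  show False
  proof (rule no_uniform_descent[of p S "\<lambda>p. \<bar>snd (snd p)\<bar>" "2 - k"])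
    have "id p \<in> S" unfolding S_def using Gamma_id by blast
    then show "p \<in> S" by simp
    show "0 < 2 - k" using k by simp
    fix q assume q: "q \<in> S"
    obtain x y z where xyz: "q = (x, y, z)" by (cases q)
    have "2 * 2 \<le> \<bar>z\<bar> * \<bar>z\<bar>" using hyperbolic_orbitD(1)[of x y z] S(1)[OF q] xyz by (intro mult_mono) auto
    then have "z\<^sup>2 > k + 2" using k by (simp add: power2_eq_square)
    moreover have "a * b * z \<noteq> 0" if t: "t \<in> Gamma_group" "t (x, y, z) = (a, b, z)" for t a b
    proof -
      have "(a, b, z) \<in> S" using SG[OF q t(1)] unfolding xyz t(2) .
      then show ?thesis using hyperbolic_orbitD[of a b z] S(1) by auto
    qed
    ultimately obtain t a b where h: "t \<in> Gamma_group" "t (x, y, z) = (a, b, z)" "a * b * z < 0"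
      using twist_sign_change[of k z x y] S(2)[OF q] xyz by metis
    have abz: "(a, b, z) \<in> S" using SG[OF q h(1)] unfolding xyz h(2) .
    have "2 - k \<le> a\<^sup>2" using hyperbolic_orbit_x_large[OF k] S[OF abz] by blast
    moreover have "2 - k \<le> b\<^sup>2"
      using hyperbolic_orbit_x_large[OF k, of b a z] S[OF SG[OF abz gens_in_Gamma(7)]] by simp
    ultimately have "(2 - k) * (2 - k) \<le> a\<^sup>2 * b\<^sup>2" using k by (intro mult_mono) auto
    then have "(2 - k)\<^sup>2 \<le> (a * b)\<^sup>2" by (simp add: power2_eq_square algebra_simps)
    then have "2 - k \<le> \<bar>a * b\<bar>" using k by (metis abs_le_square_iff abs_of_pos diff_gt_0_iff_gt)
    moreover have "\<bar>- (a * b) - z\<bar> = \<bar>z\<bar> - \<bar>a * b\<bar>"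
      using hyperbolic_orbitD(5)[OF S(1)[OF abz]] h(3) by (rule abs_flip)
    ultimately show "\<exists>q'\<in>S. \<bar>snd (snd q')\<bar> \<le> \<bar>snd (snd q)\<bar> - (2 - k)"
      using SG[OF abz gens_in_Gamma(3)] xyz by (intro bexI[of _ "V3 (a, b, z)"]) auto
  qed auto
qed

subsection \<open>Zero-one laws on the line\<close>

lemma negligible_lborel_iff:
  fixes S :: "'a::euclidean_space set"
  shows "S \<in> sets borel \<Longrightarrow> negligible S \<longleftrightarrow> emeasure lborel S = 0"
proof -
  assume "S \<in> sets borel"
  then have "negligible S \<longleftrightarrow> emeasure (completion lborel) S = 0"
    unfolding negligible_iff_null_sets null_sets_def by (auto intro: sets_completionI_sets)
  also have "\<dots> \<longleftrightarrow> emeasure lborel S = 0" using \<open>S \<in> sets borel\<close> by simp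
  finally show ?thesis .
qed

lemma negligible_AE_slices:
  fixes S :: "(real \<times> real) set"
  assumes "S \<in> sets borel" "AE x in lborel. emeasure lborel (Pair x -` S) = 0"
  shows "negligible S"
proof -
  have S: "S \<in> sets (lborel \<Otimes>\<^sub>M lborel)" using assms(1) by (subst lborel_prod) simp
  have "emeasure (lborel \<Otimes>\<^sub>M lborel) S = (\<integral>\<^sup>+ x. emeasure lborel (Pair x -` S) \<partial>(lborel :: real measure))"
    by (rule lborel.emeasure_pair_measure_alt[OF S])
  also have "\<dots> = (\<integral>\<^sup>+ x. 0 \<partial>(lborel :: real measure))" by (rule nn_integral_cong_AE) (rule assms(2))
  finally show ?thesis using assms(1) by (simp add: lborel_prod negligible_lborel_iff)
qed

lemma negligible_times_UNIV:
  fixes E :: "real set"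
  assumes "E \<in> sets borel" "emeasure lborel E = 0"
  shows "negligible (E \<times> (UNIV :: real set))"
proof (rule negligible_AE_slices)
  have "AE x in lborel. x \<notin> E" using assms by (intro AE_not_in null_setsI) auto
  then show "AE x in lborel. emeasure lborel (Pair x -` (E \<times> (UNIV :: real set))) = 0"
    by (rule eventually_mono) (simp add: vimage_def)
qed (use assms in \<open>simp add: borel_Times\<close>)

lemma negligible_times_imp:
  fixes E F :: "real set"
  assumes "E \<in> sets borel" "F \<in> sets borel" "negligible (E \<times> F)"
  shows "emeasure lborel E = 0 \<or> emeasure lborel F = 0"
proof -
  have EF: "E \<times> F \<in> sets borel" using assms by (intro borel_Times)
  have "emeasure (lborel \<Otimes>\<^sub>M lborel) (E \<times> F) = emeasure lborel E * emeasure lborel F"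
    using assms by (intro lborel.emeasure_pair_measure_Times) auto
  moreover have "emeasure (lborel \<Otimes>\<^sub>M lborel) (E \<times> F) = 0"
    unfolding lborel_prod using negligible_lborel_iff[OF EF] assms(3) by simp
  ultimately show ?thesis by simp
qed

lemma emeasure_lborel_translate:
  fixes X :: "real set"
  assumes "X \<in> sets borel" shows "emeasure lborel ((+) c -` X) = emeasure lborel X"
proof -
  have "emeasure lborel X = emeasure (distr lborel borel ((+) c)) X" by (simp add: lborel_distr_plus)
  also have "\<dots> = emeasure lborel ((+) c -` X)" using assms by (subst emeasure_distr) auto
  finally show ?thesis by simp
qed

lemma emeasure_lborel_reflect:
  fixes X :: "real set"
  assumes "X \<in> sets borel" shows "emeasure lborel (uminus -` X) = emeasure lborel X"
proof -
  have "emeasure lborel X = emeasure (distr lborel borel uminus) X" by (simp add: lborel_distr_uminus)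
  also have "\<dots> = emeasure lborel (uminus -` X)" using assms by (subst emeasure_distr) auto
  finally show ?thesis by simp
qed

text \<open>A Lipschitz substitute for the indicator of E: invariance under a dense set of
  translations passes to all translations of the window measure. Half-open intervals make adjacent
  windows add up exactly.\<close>

definition window :: "real set \<Rightarrow> real \<Rightarrow> real \<Rightarrow> real" where
  "window E d t = measure lborel (E \<inter> {t<..t + d})"

lemma fmeasurable_window: "E \<in> sets borel \<Longrightarrow> E \<inter> {t<..t + d} \<in> fmeasurable lborel"
  for E :: "real set"
  by (rule fmeasurableI2[OF fmeasurable_cbox(1)[of t "t + d"]]) auto

lemma window_bounds:
  assumes "E \<in> sets borel" "0 \<le> d"
  shows "0 \<le> window E d t" "window E d t \<le> d"
proof -
  show "0 \<le> window E d t" by (simp add: window_def)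
  have "window E d t \<le> measure lborel (cbox t (t + d))"
    unfolding window_def using assms by (intro measure_mono_fmeasurable fmeasurable_cbox) auto
  then show "window E d t \<le> d" using assms(2) by simp
qed

lemma window_add:
  assumes "E \<in> sets borel" "0 \<le> d" "0 \<le> e"
  shows "window E (d + e) t = window E d t + window E e (t + d)"
proof -
  have "E \<inter> {t<..t + (d + e)} = (E \<inter> {t<..t + d}) \<union> (E \<inter> {t + d<..t + d + e})"
    using assms by auto
  then have "window E (d + e) t = measure lborel ((E \<inter> {t<..t + d}) \<union> (E \<inter> {t + d<..t + d + e}))"
    by (simp add: window_def)
  also have "\<dots> = window E d t + window E e (t + d)"
    unfolding window_def
    using fmeasurable_window[OF assms(1)] by (intro measure_Union) (auto simp: fmeasurable_def top.not_eq_extremum)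
  finally show ?thesis .
qed

lemma window_Lipschitz:
  assumes E: "E \<in> sets borel" and d: "0 \<le> d"
  shows "\<bar>window E d s - window E d t\<bar> \<le> \<bar>s - t\<bar>"
proof -
  have *: "\<bar>window E d s - window E d t\<bar> \<le> t - s" if "s \<le> t" for s t
  proof -
    have q: "s + (t - s) = t" by simp
    have "window E (d + (t - s)) s = window E d s + window E (t - s) (s + d)"
      using that by (intro window_add[OF E d]) simp
    moreover have "window E (d + (t - s)) s = window E (t - s) s + window E d t"
      using window_add[OF E _ d, of "t - s" s] that unfolding add.commute[of "t - s" d] q by simp
    ultimately have "window E d t - window E d s = window E (t - s) (s + d) - window E (t - s) s" by linarith
    then show ?thesis
      using window_bounds[OF E, of "t - s" s] window_bounds[OF E, of "t - s" "s + d"] that by linarith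
  qed
  show ?thesis using *[of s t] *[of t s] by linarith
qed

text \<open>c is additive on nonnegative lengths and satisfies 0 <= c d <= d, so it is linear, by
  comparing multiples of d with their integer parts.\<close>

lemma constant_window_linear:
  assumes E: "E \<in> sets borel" and c: "\<And>d t. 0 \<le> d \<Longrightarrow> window E d t = c d" and "0 \<le> d"
  shows "c d = d * c 1"
proof -
  have add: "c (d + e) = c d + c e" if "0 \<le> d" "0 \<le> e" for d e
    using window_add[OF E that, of 0] c that by simp
  have bd: "0 \<le> c d" "c d \<le> d" if "0 \<le> d" for d
    using window_bounds[OF E that, of 0] c[OF that, of 0] by auto
  have nat: "c (real n * d) = real n * c d" if "0 \<le> d" for n d
  proof (induction n)
    case 0
    then show ?case using bd[of 0] by simp
  next
    case (Suc n)
    have "c (real (Suc n) * d) = c (real n * d + d)" by (simp add: algebra_simps)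
    also have "\<dots> = c (real n * d) + c d" using that by (intro add) auto
    finally show ?case using Suc by (simp add: algebra_simps)
  qed
  \<comment> \<open>Writing n d = m + f with m an integer and 0 <= f < 1 leaves an error independent
    of n, which the Archimedean property then forces to vanish.\<close>
  have "real n * \<bar>c d - d * c 1\<bar> \<le> 2" for n
  proof -
    define m where "m = nat \<lfloor>real n * d\<rfloor>"
    define f where "f = real n * d - real m"
    have "real m \<le> real n * d" "real n * d < real m + 1"
      using assms(3) by (auto simp: m_def of_nat_floor)
    then have f: "0 \<le> f" "f < 1" by (auto simp: f_def)
    have "c (real n * d) = c (real m * 1 + f)" by (simp add: f_def)
    also have "\<dots> = real m * c 1 + c f" using add[of "real m * 1" f] nat[of 1 m] f by simp
    finally have "real n * c d = real m * c 1 + c f" using nat[OF assms(3)] by simp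
    moreover have "real n * (d * c 1) = real m * c 1 + f * c 1" by (simp add: f_def algebra_simps)
    moreover have "0 \<le> f * c 1" "f * c 1 \<le> 1"
      using f bd[of 1] by (auto intro: mult_le_one)
    ultimately have "\<bar>real n * c d - real n * (d * c 1)\<bar> \<le> 2" using f bd[of f] by linarith
    moreover have "real n * \<bar>c d - d * c 1\<bar> = \<bar>real n * c d - real n * (d * c 1)\<bar>"
      by (metis abs_mult abs_of_nat right_diff_distrib')
    ultimately show ?thesis by simp
  qed
  then have "\<not> (\<exists>n. real n * \<bar>c d - d * c 1\<bar> > 2)" by (simp add: not_less)
  then show ?thesis using reals_Archimedean3[of "\<bar>c d - d * c 1\<bar>"] by (cases "c d = d * c 1") auto
qed

text \<open>All windows having the same density c 1 means that E is equidistributed at every scale.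
  If c 1 is nonzero, Lebesgue measure restricted to E and divided by c 1 agrees with Lebesgue
  measure on intervals, hence everywhere, so the complement of E is null.\<close>

lemma constant_window_zero_one:
  fixes E :: "real set"
  assumes E: "E \<in> sets borel" and c: "\<And>d t. 0 \<le> d \<Longrightarrow> window E d t = c d"
  shows "c 1 = 0 \<Longrightarrow> emeasure lborel E = 0" "c 1 \<noteq> 0 \<Longrightarrow> emeasure lborel (- E) = 0"
proof -
  have lin: "c d = d * c 1" if "0 \<le> d" for d using constant_window_linear[OF E c that] by simp
  have Ioc: "emeasure lborel (E \<inter> {l<..u}) = ennreal ((u - l) * c 1)" if "l \<le> u" for l u
  proof -
    have "emeasure lborel (E \<inter> {l<..l + (u - l)}) = ennreal (window E (u - l) l)"
      unfolding window_def using fmeasurable_window[OF E, of l "u - l"]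
      by (intro emeasure_eq_measure2) (auto simp: fmeasurable_def)
    then show ?thesis using c[of "u - l" l] lin[of "u - l"] that by simp
  qed
  show "emeasure lborel E = 0" if "c 1 = 0"
  proof -
    have "E = (\<Union>n::nat. E \<inter> {- real n<..real n})"
    proof -
      have "\<exists>n::nat. x \<in> {- real n<..real n}" for x :: real
      proof -
        obtain n :: nat where "\<bar>x\<bar> < real n" using reals_Archimedean2 by blast
        then show ?thesis by (intro exI[of _ n]) auto
      qed
      then show ?thesis by auto
    qed
    moreover have "E \<inter> {- real n<..real n} \<in> null_sets lborel" for n :: nat
      using Ioc[of "- real n" "real n"] that E by (intro null_setsI) auto
    then have "(\<Union>n::nat. E \<inter> {- real n<..real n}) \<in> null_sets lborel" by (intro null_sets_UN)
    ultimately show ?thesis by (metis null_setsD1)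
  qed
  show "emeasure lborel (- E) = 0" if "c 1 \<noteq> 0"
  proof -
    have c1: "c 1 > 0" using that window_bounds(1)[OF E, of 1 0] c[of 1 0] by simp
    \<comment> \<open>The normalized restriction to E. It vanishes on the complement of E by
      construction.\<close>
    define M where "M = density lborel (\<lambda>x. ennreal (1 / c 1) * indicator E x)"
    have M: "emeasure M X = ennreal (1 / c 1) * emeasure lborel (E \<inter> X)" if "X \<in> sets borel" for X
    proof -
      have "emeasure M X = (\<integral>\<^sup>+x. ennreal (1 / c 1) * indicator E x * indicator X x \<partial>lborel)"
        unfolding M_def using E that by (subst emeasure_density) auto
      also have "\<dots> = (\<integral>\<^sup>+x. ennreal (1 / c 1) * indicator (E \<inter> X) x \<partial>lborel)"
        by (intro nn_integral_cong) (auto simp: indicator_def)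
      also have "\<dots> = ennreal (1 / c 1) * emeasure lborel (E \<inter> X)"
        using E that by (subst nn_integral_cmult_indicator) auto
      finally show ?thesis .
    qed
    have "lborel = M"
    proof (rule lborel_eqI)
      fix l u :: real assume "\<And>b. b \<in> Basis \<Longrightarrow> l \<bullet> b \<le> u \<bullet> b"
      then have lu: "l \<le> u" by simp
      have "E \<inter> {l<..u} = (E \<inter> box l u) \<union> (E \<inter> {u} \<inter> {l<..u})"
        by (auto simp: box_real)
      have "emeasure lborel (E \<inter> box l u) = emeasure lborel (E \<inter> {l<..u})"
      proof (rule emeasure_eq_AE)
        have "AE x in lborel. x \<noteq> u" by (rule AE_lborel_singleton)
        then show "AE x in lborel. x \<in> E \<inter> box l u \<longleftrightarrow> x \<in> E \<inter> {l<..u}"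
          by (rule eventually_mono) (auto simp: box_real)
      qed (use E in auto)
      then have "emeasure M (box l u) = ennreal (1 / c 1) * ennreal ((u - l) * c 1)"
        using M[of "box l u"] Ioc[OF lu] by simp
      also have "\<dots> = ennreal (u - l)" using c1 lu by (simp add: ennreal_mult[symmetric])
      finally show "emeasure M (box l u) = ennreal (\<Prod>b\<in>Basis. (u - l) \<bullet> b)" by simp
    qed (simp add: M_def)
    then have "emeasure lborel (- E) = emeasure M (- E)" by simp
    also have "\<dots> = 0" using M[of "- E"] E by simp
    finally show ?thesis .
  qed
qed

lemma window_translate:
  assumes E: "E \<in> sets borel" and "\<And>x. x + a \<in> E \<longleftrightarrow> x \<in> E"
  shows "window E d (t + a) = window E d t"
proof -
  have "a + x \<in> E \<longleftrightarrow> x \<in> E" for x using assms(2)[of x] by (simp only: add.commute)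
  then have "(+) a -` (E \<inter> {t + a<..t + a + d}) = E \<inter> {t<..t + d}" by auto
  moreover have "E \<inter> {t + a<..t + a + d} \<in> sets borel" using E by auto
  ultimately show ?thesis unfolding window_def measure_def
    using emeasure_lborel_translate[of "E \<inter> {t + a<..t + a + d}" a] by simp
qed

text \<open>Window measures are unchanged by integer multiples of a and natural multiples of b.
  Their sums are dense by Kronecker's theorem, so the Lipschitz bound makes the windows
  constant.\<close>

lemma irrational_rotation_zero_one:
  fixes E :: "real set"
  assumes E: "E \<in> sets borel" and a: "\<And>x. x + a \<in> E \<longleftrightarrow> x \<in> E" "a > 0"
    and b: "\<And>x. x + b \<in> E \<longleftrightarrow> x \<in> E" and irr: "b / a \<notin> \<rat>"
  shows "emeasure lborel E = 0 \<or> emeasure lborel (- E) = 0"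
proof -
  have ma: "window E d (t + real_of_int m * a) = window E d t" for d t m
  proof (rule window_translate[OF E])
    have nat: "x + real n * a \<in> E \<longleftrightarrow> x \<in> E" for n x
    proof (induction n)
      case (Suc n)
      have "x + real (Suc n) * a = (x + real n * a) + a" by (simp add: algebra_simps)
      then show ?case using Suc a(1) by metis
    qed simp
    fix x show "x + real_of_int m * a \<in> E \<longleftrightarrow> x \<in> E"
    proof (cases "m \<ge> 0")
      case True
      then show ?thesis using nat[of x "nat m"] by simp
    next
      case False
      then show ?thesis using nat[of "x + real_of_int m * a" "nat (- m)"] by simp
    qed
  qed
  have mb: "window E d (t + real n * b) = window E d t" for d t n
  proof (rule window_translate[OF E])
    fix x show "x + real n * b \<in> E \<longleftrightarrow> x \<in> E"
    proof (induction n)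
      case (Suc n)
      have "x + real (Suc n) * b = (x + real n * b) + b" by (simp add: algebra_simps)
      then show ?case using Suc b by metis
    qed simp
  qed
  have "window E d t = window E d 0" if "0 \<le> d" for d t
  proof -
    have "\<bar>window E d t - window E d 0\<bar> \<le> e" if "e > 0" for e
    proof -
      have "e / a > 0" using that a(2) by simp
      then obtain k where k: "k > 0" "\<bar>frac (real k * (b / a)) - frac (t / a)\<bar> < e / a"
        using Kronecker_approx_1_explicit[OF irr, of "frac (t / a)" "e / a"] frac_lt_1[of "t / a"] by auto
      \<comment> \<open>Kronecker approximation concerns fractional parts; m restores the difference
        of the integer parts.\<close>
      define m where "m = \<lfloor>t / a\<rfloor> - \<lfloor>real k * (b / a)\<rfloor>"
      have "\<bar>(real k * (b / a) + real_of_int m) - t / a\<bar> < e / a"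
        using k(2) by (simp add: frac_def m_def algebra_simps)
      then have "\<bar>(real k * (b / a) + real_of_int m) - t / a\<bar> * a < e" using a(2) by (simp add: pos_less_divide_eq)
      moreover have "\<bar>(real k * (b / a) + real_of_int m) - t / a\<bar> * a = \<bar>((real k * (b / a) + real_of_int m) - t / a) * a\<bar>"
        using a(2) by (simp add: abs_mult)
      moreover have "((real k * (b / a) + real_of_int m) - t / a) * a = (0 + real k * b + real_of_int m * a) - t"
        using a(2) by (simp add: field_simps)
      ultimately have "\<bar>(0 + real k * b + real_of_int m * a) - t\<bar> < e" by simp
      moreover have "window E d (0 + real k * b + real_of_int m * a) = window E d 0" using ma mb by metis
      ultimately show ?thesis using window_Lipschitz[OF E \<open>0 \<le> d\<close>, of "0 + real k * b + real_of_int m * a" t]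
        by linarith
    qed
    then show ?thesis by (metis abs_le_zero_iff dense_ge eq_iff_diff_eq_0)
  qed
  then show ?thesis using constant_window_zero_one[OF E, of "\<lambda>d. window E d 0"] by blast
qed

text \<open>The points near which E is null and those near which its complement is null form two
  open sets covering I. They are disjoint because a nonempty open set is not negligible, so
  connectedness leaves one of them.\<close>

lemma local_zero_one:
  fixes I E :: "real set"
  assumes I: "open I" "connected I"
    and loc: "\<And>t. t \<in> I \<Longrightarrow> \<exists>J. open J \<and> t \<in> J \<and> J \<subseteq> I \<and> (negligible (E \<inter> J) \<or> negligible (J - E))"
  shows "negligible (E \<inter> I) \<or> negligible (I - E)"
proof -
  define P where "P = \<Union>{J. open J \<and> J \<subseteq> I \<and> negligible (E \<inter> J)}"
  define Q where "Q = \<Union>{J. open J \<and> J \<subseteq> I \<and> negligible (J - E)}"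
  have "open P" unfolding P_def by (rule open_Union) blast
  moreover have "open Q" unfolding Q_def by (rule open_Union) blast
  moreover have "P \<inter> Q \<inter> I = {}"
  proof (rule ccontr)
    assume "P \<inter> Q \<inter> I \<noteq> {}"
    then obtain t J K where *: "t \<in> J" "open J" "negligible (E \<inter> J)" "t \<in> K" "open K" "negligible (K - E)"
      unfolding P_def Q_def by blast
    have "negligible (J \<inter> K)" using negligible_Un[OF *(3,6)] by (rule negligible_subset) auto
    moreover have "open (J \<inter> K)" "J \<inter> K \<noteq> {}" using * by auto
    ultimately show False using open_not_negligible by blast
  qed
  moreover have "I \<subseteq> P \<union> Q"
  proof
    fix t assume "t \<in> I"
    then obtain J where "open J" "t \<in> J" "J \<subseteq> I" "negligible (E \<inter> J) \<or> negligible (J - E)" using loc by blast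
    then show "t \<in> P \<union> Q" unfolding P_def Q_def by blast
  qed
  ultimately have "P \<inter> I = {} \<or> Q \<inter> I = {}" using connectedD[OF I(2), of P Q] by blast
  then consider "I \<subseteq> Q" | "I \<subseteq> P" using \<open>I \<subseteq> P \<union> Q\<close> by blast
  then show ?thesis
  proof cases
    case 1
    have "negligible (I - E)"
    proof (subst locally_negligible_alt, intro ballI)
      fix t assume t: "t \<in> I - E"
      then obtain J where J: "open J" "J \<subseteq> I" "negligible (J - E)" "t \<in> J" using 1 unfolding Q_def by blast
      then have "openin (top_of_set (I - E)) ((I - E) \<inter> J)" by (intro openin_open_Int)
      moreover have "negligible ((I - E) \<inter> J)" using J(3) by (rule negligible_subset) auto
      ultimately show "\<exists>U. openin (top_of_set (I - E)) U \<and> t \<in> U \<and> negligible U" using t J by blast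
    qed
    then show ?thesis by simp
  next
    case 2
    have "negligible (E \<inter> I)"
    proof (subst locally_negligible_alt, intro ballI)
      fix t assume t: "t \<in> E \<inter> I"
      then obtain J where J: "open J" "J \<subseteq> I" "negligible (E \<inter> J)" "t \<in> J" using 2 unfolding P_def by blast
      then have "openin (top_of_set (E \<inter> I)) ((E \<inter> I) \<inter> J)" by (intro openin_open_Int)
      moreover have "negligible ((E \<inter> I) \<inter> J)" using J(3) by (rule negligible_subset) auto
      ultimately show "\<exists>U. openin (top_of_set (E \<inter> I)) U \<and> t \<in> U \<and> negligible U" using t J by blast
    qed
    then show ?thesis by simp
  qed
qed

subsection \<open>Ergodicity below 2\<close>

definition Gamma_invariant :: "point set \<Rightarrow> bool" where
  "Gamma_invariant A \<longleftrightarrow> (\<forall>g\<in>Gamma_group. \<forall>p. g p \<in> A \<longleftrightarrow> p \<in> A)"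

lemma Gamma_invariantD: "Gamma_invariant A \<Longrightarrow> g \<in> Gamma_group \<Longrightarrow> g p \<in> A \<longleftrightarrow> p \<in> A"
  unfolding Gamma_invariant_def by blast

lemma ergodic_onI_invariant:
  assumes "S \<subseteq> level k"
    and *: "\<And>A. A \<in> sets borel \<Longrightarrow> A \<subseteq> S \<Longrightarrow> Gamma_invariant A \<Longrightarrow>
      negligible (pxy ` A) \<or> negligible (pxy ` (S - A))"
  shows "ergodic_on Gamma_group (completion (area_measure k)) S"
  using assms(1)
proof (rule ergodic_onI)
  fix A assume "A \<in> sets borel" "A \<subseteq> S" "\<And>g p. g \<in> Gamma_group \<Longrightarrow> g p \<in> A \<longleftrightarrow> p \<in> A"
  then show "negligible (pxy ` A) \<or> negligible (pxy ` (S - A))"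
    using *[of A] unfolding Gamma_invariant_def by blast
qed

text \<open>X lies in the union of the countably many translates of Y, each of which is
  null.\<close>

lemma negligible_pxy_cover:
  assumes X: "X \<subseteq> level k" and Y: "Y \<subseteq> level k" "negligible (pxy ` Y)"
    and cover: "\<And>p. p \<in> X \<Longrightarrow> \<exists>g\<in>Gamma_group. g p \<in> Y"
  shows "negligible (pxy ` X)"
proof (rule negligible_subset)
  show "negligible (\<Union>g\<in>Gamma_group. pxy ` g ` Y)"
    using countable_Gamma negligible_Gamma[OF _ Y] by (auto intro!: negligible_countable_Union)
  show "pxy ` X \<subseteq> (\<Union>g\<in>Gamma_group. pxy ` g ` Y)"
  proof (rule image_subsetI)
    fix p assume "p \<in> X"
    then obtain g where g: "g \<in> Gamma_group" "g p \<in> Y" using cover by blast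
    obtain h where h: "h \<in> Gamma_group" "\<And>p. h (g p) = p" using Gamma_inverse[OF g(1)] by metis
    have "pxy p = pxy (h (g p))" using h(2) by simp
    then show "pxy p \<in> (\<Union>g\<in>Gamma_group. pxy ` g ` Y)" using h(1) g(2) by blast
  qed
qed

text \<open>At z = 2 cos t the level set is x^2 + y^2 - 2 x y cos t = z^2 - 2 - k. This ellipse is
  traced by (r cos u, r cos (u + t)) with r the value defined here, the maximum of |x| on
  it.\<close>

definition amplitude :: "real \<Rightarrow> real \<Rightarrow> real" where
  "amplitude k t = sqrt (4 * (cos t)\<^sup>2 - 2 - k) / sin t"

definition ellipse :: "real \<Rightarrow> real \<times> real \<Rightarrow> point" where
  "ellipse k = (\<lambda>(t, u). (amplitude k t * cos u, amplitude k t * cos (u + t), 2 * cos t))"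

definition angles :: "real \<Rightarrow> real set" where
  "angles k = {t. 0 < t \<and> t < pi \<and> 2 + k < 4 * (cos t)\<^sup>2}"

lemma ellipse_apply: "ellipse k (t, u) = (amplitude k t * cos u, amplitude k t * cos (u + t), 2 * cos t)"
  by (simp add: ellipse_def)

lemma open_angles: "open (angles k)"
  unfolding angles_def by (intro open_Collect_conj open_Collect_less continuous_intros)

lemma ellipse_level:
  assumes "t \<in> angles k" shows "ellipse k (t, u) \<in> level k"
proof -
  have s: "sin t > 0" using assms by (auto simp: angles_def intro: sin_gt_zero)
  define r where "r = amplitude k t"
  have "(r * sin t)\<^sup>2 = 4 * (cos t)\<^sup>2 - 2 - k"
    using s assms by (simp add: r_def amplitude_def angles_def)
  moreover have "(r * cos u)\<^sup>2 + (r * cos (u + t))\<^sup>2 - r * cos u * (r * cos (u + t)) * (2 * cos t) = (r * sin t)\<^sup>2"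
  proof -
    have "(cos u)\<^sup>2 + (cos (u + t))\<^sup>2 - cos u * cos (u + t) * (2 * cos t) =
        (cos u)\<^sup>2 * (1 - (cos t)\<^sup>2) + (sin u)\<^sup>2 * (sin t)\<^sup>2"
      unfolding cos_add by (simp add: power2_eq_square algebra_simps)
    also have "\<dots> = ((cos u)\<^sup>2 + (sin u)\<^sup>2) * (sin t)\<^sup>2"
      unfolding sin_squared_eq[of t, symmetric] by (rule distrib_right[symmetric])
    also have "\<dots> = (sin t)\<^sup>2" by simp
    finally have "r\<^sup>2 * ((cos u)\<^sup>2 + (cos (u + t))\<^sup>2 - cos u * cos (u + t) * (2 * cos t)) = r\<^sup>2 * (sin t)\<^sup>2" by simp
    then show ?thesis by (simp add: power2_eq_square algebra_simps)
  qed
  ultimately show ?thesis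
    by (simp add: level_def ellipse_apply r_def[symmetric] power_mult_distrib)
qed

text \<open>Since cos u + cos (u + 2 t) = 2 cos t cos (u + t), the element \<open>Sw\<close> after
  \<open>V1\<close> is the rotation u to u + t in this parameter.\<close>

lemma ellipse_rotate: "ellipse k (t, u + t) = Sw (V1 (ellipse k (t, u)))"
proof -
  have "cos (u + t + t) = 2 * cos t * cos (u + t) - cos u"
    using cos_add[of "u + t" t] cos_diff[of "u + t" t] by simp
  then have "amplitude k t * cos (u + t + t) = amplitude k t * (2 * cos t * cos (u + t) - cos u)"
    by (simp only:)
  then show ?thesis by (simp add: ellipse_apply right_diff_distrib mult_ac)
qed

lemma ellipse_reflect: "ellipse k (pi - t, - u) = S1 (ellipse k (t, u))"
proof -
  have "cos (- u + (pi - t)) = - cos (u + t)"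
    using cos_pi_minus[of "u + t"] by (simp add: algebra_simps)
  moreover have "amplitude k (pi - t) = amplitude k t" by (simp add: amplitude_def)
  ultimately show ?thesis by (simp add: ellipse_apply)
qed

lemma ellipse_surj:
  assumes "(x, y, z) \<in> level k" "\<bar>z\<bar> < 2" "2 + k < z\<^sup>2"
  obtains t u where "t \<in> angles k" "(x, y, z) = ellipse k (t, u)" "t = arccos (z / 2)"
proof -
  define t where "t = arccos (z / 2)"
  have z: "-1 < z / 2" "z / 2 < 1" using assms(2) by auto
  have t: "0 < t" "t < pi" using arccos_lt_bounded[OF z] by (auto simp: t_def)
  have ct: "z = 2 * cos t" using z by (simp add: t_def)
  have tI: "t \<in> angles k" using t assms(3) by (simp add: angles_def ct power_mult_distrib)
  have s: "sin t > 0" using t by (rule sin_gt_zero)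
  define r where "r = amplitude k t"
  have r0: "r > 0" using tI s by (simp add: r_def amplitude_def angles_def)
  have rs: "(r * sin t)\<^sup>2 = z\<^sup>2 - 2 - k"
    using s tI by (simp add: r_def amplitude_def angles_def ct power_mult_distrib)
  have q: "(y - x * cos t)\<^sup>2 = (sin t)\<^sup>2 * (r\<^sup>2 - x\<^sup>2)"
  proof -
    have "x\<^sup>2 + y\<^sup>2 - x * y * z = z\<^sup>2 - 2 - k" using assms(1) by (simp add: level_def)
    then have "x\<^sup>2 + y\<^sup>2 - 2 * x * y * cos t = (r * sin t)\<^sup>2" using rs by (simp add: ct)
    then have "(y - x * cos t)\<^sup>2 = (r * sin t)\<^sup>2 - x\<^sup>2 * (1 - (cos t)\<^sup>2)"
      by (simp add: power2_eq_square algebra_simps)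
    also have "1 - (cos t)\<^sup>2 = (sin t)\<^sup>2" by (simp add: sin_squared_eq)
    finally show ?thesis by (simp add: power_mult_distrib algebra_simps)
  qed
  then have "0 \<le> (sin t)\<^sup>2 * (r\<^sup>2 - x\<^sup>2)" by (metis zero_le_power2)
  then have xr: "x\<^sup>2 \<le> r\<^sup>2" using s by (simp add: zero_le_mult_iff)
  then have "\<bar>x / r\<bar> \<le> 1" using r0 by (simp add: abs_le_square_iff[symmetric])
  then have x1: "- 1 \<le> x / r" "x / r \<le> 1" unfolding abs_le_iff by linarith+
  \<comment> \<open>x determines the parameter up to sign; the two signs give the two points of the
    ellipse with this x.\<close>
  define v where "v = arccos (x / r)"
  have cv: "r * cos v = x" using x1 r0 by (simp add: v_def)
  have sv: "r * \<bar>sin v\<bar> = sqrt (r\<^sup>2 - x\<^sup>2)"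
  proof -
    have "(r * \<bar>sin v\<bar>)\<^sup>2 = r\<^sup>2 - (r * cos v)\<^sup>2" by (simp add: power_mult_distrib sin_squared_eq algebra_simps)
    then show ?thesis using r0 cv by (metis abs_ge_zero less_imp_le mult_nonneg_nonneg real_sqrt_unique)
  qed
  have "\<bar>y - x * cos t\<bar> = sin t * sqrt (r\<^sup>2 - x\<^sup>2)"
    using q s by (metis abs_of_pos real_sqrt_abs real_sqrt_mult)
  moreover have "sin t * (r * \<bar>sin v\<bar>) = \<bar>r * sin v * sin t\<bar>" using r0 s by (simp add: abs_mult mult_ac)
  ultimately have "\<bar>y - x * cos t\<bar> = \<bar>r * sin v * sin t\<bar>" unfolding sv[symmetric] by simp
  then have "y - x * cos t = - (r * sin v * sin t) \<or> y - x * cos t = r * sin v * sin t" by (auto simp only: abs_eq_iff)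
  then consider "y = r * (cos v * cos t - sin v * sin t)" | "y = r * (cos v * cos t + sin v * sin t)"
    using cv by (auto simp: algebra_simps)
  then show ?thesis
  proof cases
    case 1
    then have "(x, y, z) = ellipse k (t, v)" using cv by (simp add: ellipse_apply r_def[symmetric] cos_add ct)
    then show ?thesis using that[OF tI, of v] t_def by simp
  next
    case 2
    moreover have "cos (- v + t) = cos v * cos t + sin v * sin t" unfolding cos_add by simp
    ultimately have "(x, y, z) = ellipse k (t, - v)" using cv by (simp add: ellipse_apply r_def[symmetric] ct)
    then show ?thesis using that[OF tI, of "- v"] t_def by simp
  qed
qed

lemma measurable_ellipse: "ellipse k \<in> borel_measurable borel"
proof -
  have "(\<lambda>p. (sqrt (4 * (cos (fst p))\<^sup>2 - 2 - k) / sin (fst p) * cos (snd p),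
      sqrt (4 * (cos (fst p))\<^sup>2 - 2 - k) / sin (fst p) * cos (snd p + fst p), 2 * cos (fst p)))
     \<in> borel_measurable (borel :: (real \<times> real) measure)"
  proof -
    have fs [measurable]: "fst \<in> borel_measurable (borel :: (real \<times> real) measure)" "snd \<in> borel_measurable (borel :: (real \<times> real) measure)"
      by (intro borel_measurable_continuous_onI continuous_intros)+
    have [measurable]: "(sin :: real \<Rightarrow> real) \<in> borel_measurable borel" "(cos :: real \<Rightarrow> real) \<in> borel_measurable borel"
      by (intro borel_measurable_continuous_onI continuous_intros)+
    show ?thesis by (intro borel_measurable_Pair; measurable)
  qed
  then show ?thesis by (simp add: ellipse_def amplitude_def case_prod_beta)
qed

lemma negligible_ellipse:
  assumes "negligible N" "N \<subseteq> angles k \<times> UNIV"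
  shows "negligible (pxy ` ellipse k ` N)"
proof -
  let ?f = "\<lambda>p. (sqrt (4 * (cos (fst p))\<^sup>2 - 2 - k) / sin (fst p) * cos (snd p),
      sqrt (4 * (cos (fst p))\<^sup>2 - 2 - k) / sin (fst p) * cos (snd p + fst p)) :: real \<times> real"
  have "negligible (?f ` N)"
  proof (rule negligible_differentiable_image[OF assms(1)])
    fix p assume "p \<in> N"
    then have t: "fst p \<in> angles k" using assms(2) by auto
    then have s: "sin (fst p) \<noteq> 0" "4 * (cos (fst p))\<^sup>2 - 2 - k > 0"
      using sin_gt_zero[of "fst p"] by (auto simp: angles_def)
    have fs: "fst differentiable (at p)" "snd differentiable (at p)" by (rule differentiable_fst_snd)+
    have c: "(\<lambda>p. cos (f p)) differentiable (at p)" "(\<lambda>p. sin (f p)) differentiable (at p)"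
      if "f differentiable (at p)" for f :: "real \<times> real \<Rightarrow> real"
      using that unfolding differentiable_def by (blast intro: has_derivative_cos has_derivative_sin)+
    have q: "(\<lambda>p. sqrt (f p)) differentiable (at p)" if "f differentiable (at p)" "f p > 0" for f :: "real \<times> real \<Rightarrow> real"
      using that unfolding differentiable_def by (blast intro: has_derivative_real_sqrt)
    show "?f differentiable (at p)"
      unfolding power2_eq_square
      by (intro differentiable_Pair differentiable_mult differentiable_divide q c fs differentiable_diff
        differentiable_add differentiable_const) (use s in \<open>simp_all add: power2_eq_square\<close>)
  qed
  moreover have "pxy ` ellipse k ` N = ?f ` N"
    by (simp add: image_image pxy_def ellipse_def amplitude_def case_prod_beta)
  ultimately show ?thesis by simp
qed

text \<open>For |z| < 2 the form x^2 + y^2 - xyz is positive definite, so a nonpositive value forces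
  x = y = 0.\<close>

lemma negligible_degenerate_ellipse:
  "negligible (pxy ` {p \<in> level k. \<bar>snd (snd p)\<bar> < 2 \<and> (snd (snd p))\<^sup>2 \<le> 2 + k})"
proof (rule negligible_subset)
  show "negligible {(0, 0) :: real \<times> real}" by simp
  show "pxy ` {p \<in> level k. \<bar>snd (snd p)\<bar> < 2 \<and> (snd (snd p))\<^sup>2 \<le> 2 + k} \<subseteq> {(0, 0)}"
  proof (rule image_subsetI)
    fix p assume p: "p \<in> {p \<in> level k. \<bar>snd (snd p)\<bar> < 2 \<and> (snd (snd p))\<^sup>2 \<le> 2 + k}"
    obtain x y z where xyz: "p = (x, y, z)" by (cases p)
    have le: "x\<^sup>2 + y\<^sup>2 - x * y * z \<le> 0" and z: "\<bar>z\<bar> < 2" using p by (auto simp: xyz level_def)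
    have "4 * (x\<^sup>2 + y\<^sup>2 - x * y * z) = (2 * x - y * z)\<^sup>2 + y\<^sup>2 * (4 - z\<^sup>2)"
      by (simp add: power2_eq_square algebra_simps)
    moreover have z2: "4 - z\<^sup>2 > 0" using z abs_square_less_1[of "z / 2"] by (simp add: power_divide)
    ultimately have "(2 * x - y * z)\<^sup>2 + y\<^sup>2 * (4 - z\<^sup>2) \<le> 0" using le by simp
    moreover have "0 \<le> y\<^sup>2 * (4 - z\<^sup>2)" using z2 by simp
    ultimately have 0: "(2 * x - y * z)\<^sup>2 = 0" "y\<^sup>2 * (4 - z\<^sup>2) = 0"
      using zero_le_power2[of "2 * x - y * z"] by linarith+
    then have "y = 0" using z2 by simp
    then show "pxy p \<in> {(0, 0)}" using 0(1) by (simp add: xyz)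
  qed
qed

text \<open>By the zero-one law for rotations, the ellipses of these angles lie in A up to null sets.\<close>

definition full_angles :: "real \<Rightarrow> point set \<Rightarrow> real set" where
  "full_angles k A = {t \<in> angles k. emeasure lborel {u. ellipse k (t, u) \<in> A} \<noteq> 0}"

lemma borel_slices:
  assumes "A \<in> sets borel"
  shows "{p. ellipse k p \<in> A} \<in> sets borel" "{u. ellipse k (t, u) \<in> A} \<in> sets borel"
    "full_angles k A \<in> sets borel"
proof -
  have 1: "ellipse k -` A \<in> sets borel"
    using measurable_sets[OF measurable_ellipse[of k] assms] by simp
  then show "{p. ellipse k p \<in> A} \<in> sets borel" by (simp add: vimage_def)
  have 2: "ellipse k -` A \<in> sets (lborel \<Otimes>\<^sub>M lborel)" using 1 by (subst lborel_prod) simp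
  have "Pair t -` (ellipse k -` A) \<in> sets lborel" by (rule sets_Pair1[OF 2])
  then show "{u. ellipse k (t, u) \<in> A} \<in> sets borel" by (simp add: vimage_def)
  have "(\<lambda>t. emeasure lborel (Pair t -` (ellipse k -` A))) \<in> borel_measurable lborel"
    by (rule lborel.measurable_emeasure_Pair[OF 2])
  then have m: "(\<lambda>t. emeasure lborel {u. ellipse k (t, u) \<in> A}) \<in> borel_measurable borel"
    by (simp add: vimage_def)
  have "{t \<in> space borel. emeasure lborel {u. ellipse k (t, u) \<in> A} \<noteq> 0} \<in> sets borel"
    using m by measurable
  then have "angles k \<inter> {t. emeasure lborel {u. ellipse k (t, u) \<in> A} \<noteq> 0} \<in> sets borel"
    using open_angles[of k] by auto
  moreover have "full_angles k A = angles k \<inter> {t. emeasure lborel {u. ellipse k (t, u) \<in> A} \<noteq> 0}"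
    unfolding full_angles_def by blast
  ultimately show "full_angles k A \<in> sets borel" by simp
qed

lemma ellipse_slice_zero_one:
  assumes A: "A \<in> sets borel" and inv: "Gamma_invariant A"
    and irr: "t / (2 * pi) \<notin> \<rat>"
  shows "emeasure lborel {u. ellipse k (t, u) \<in> A} = 0 \<or> emeasure lborel (- {u. ellipse k (t, u) \<in> A}) = 0"
proof (rule irrational_rotation_zero_one[OF _ _ _ _ irr])
  show "{u. ellipse k (t, u) \<in> A} \<in> sets borel" by (rule borel_slices[OF A])
  show "u + 2 * pi \<in> {u. ellipse k (t, u) \<in> A} \<longleftrightarrow> u \<in> {u. ellipse k (t, u) \<in> A}" for u
  proof -
    have "cos (u + 2 * pi + t) = cos (u + t)" by (metis add.assoc add.commute cos_periodic)
    then show ?thesis by (simp add: ellipse_apply)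
  qed
  show "u + t \<in> {u. ellipse k (t, u) \<in> A} \<longleftrightarrow> u \<in> {u. ellipse k (t, u) \<in> A}" for u
    by (simp add: ellipse_rotate Gamma_invariantD[OF inv gens_in_Gamma(1)] Gamma_invariantD[OF inv gens_in_Gamma(7)])
  show "0 < 2 * pi" by simp
qed

lemma AE_irrational_angle: "AE t in lborel. t / (2 * pi) \<notin> \<rat>"
proof -
  have "countable ((\<lambda>q. q * (2 * pi)) ` \<rat>)" by (rule countable_image[OF countable_rat])
  then have "AE t in lborel. t \<notin> (\<lambda>q. q * (2 * pi)) ` \<rat>"
    by (rule AE_not_in[OF countable_imp_null_set_lborel])
  then show ?thesis
  proof (rule eventually_mono)
    fix t :: real assume *: "t \<notin> (\<lambda>q. q * (2 * pi)) ` \<rat>"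
    have "t = t / (2 * pi) * (2 * pi)" by simp
    then show "t / (2 * pi) \<notin> \<rat>" using * by blast
  qed
qed

lemma negligible_bad_angles:
  assumes A: "A \<in> sets borel" and inv: "Gamma_invariant A"
  shows "negligible {p \<in> angles k \<times> UNIV. \<not> (ellipse k p \<in> A \<longleftrightarrow> fst p \<in> full_angles k A)}"
    (is "negligible ?B")
proof (rule negligible_AE_slices)
  have fst [measurable]: "fst \<in> borel_measurable (borel :: (real \<times> real) measure)"
    by (intro borel_measurable_continuous_onI continuous_intros)
  have 1: "{p. ellipse k p \<in> A} \<in> sets borel" by (rule borel_slices[OF A])
  have 2: "{p :: real \<times> real. fst p \<in> full_angles k A} \<in> sets borel"
    using measurable_sets[OF fst borel_slices(3)[OF A]] by (simp add: vimage_def)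
  have 3: "{p :: real \<times> real. fst p \<in> angles k} \<in> sets borel"
    using measurable_sets[OF fst borel_open[OF open_angles]] by (simp add: vimage_def)
  have "?B = {p. fst p \<in> angles k} \<inter> (({p. ellipse k p \<in> A} - {p. fst p \<in> full_angles k A}) \<union>
      ({p. fst p \<in> full_angles k A} - {p. ellipse k p \<in> A}))" by auto
  then show "?B \<in> sets borel" using 1 2 3 by auto
  show "AE t in lborel. emeasure lborel (Pair t -` ?B) = 0"
    using AE_irrational_angle
  proof (rule eventually_mono)
    fix t :: real assume "t / (2 * pi) \<notin> \<rat>"
    then have z: "emeasure lborel {u. ellipse k (t, u) \<in> A} = 0 \<or> emeasure lborel (- {u. ellipse k (t, u) \<in> A}) = 0"
      by (rule ellipse_slice_zero_one[OF A inv])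
    consider "t \<notin> angles k" | "t \<in> full_angles k A" | "t \<in> angles k" "t \<notin> full_angles k A" by blast
    then show "emeasure lborel (Pair t -` ?B) = 0"
    proof cases
      case 1
      then have e: "Pair t -` ?B = {}" by auto
      show ?thesis unfolding e by simp
    next
      case 2
      then have e: "Pair t -` ?B = - {u. ellipse k (t, u) \<in> A}" by (auto simp: full_angles_def)
      show ?thesis unfolding e using z 2 by (auto simp: full_angles_def)
    next
      case 3
      then have e: "Pair t -` ?B = {u. ellipse k (t, u) \<in> A}" by auto
      show ?thesis unfolding e using 3 by (auto simp: full_angles_def)
    qed
  qed
qed

text \<open>The points at which membership in A is not decided by the angle of z alone; null by
  Fubini in the coordinates (t, u).\<close>

definition bad_points :: "real \<Rightarrow> point set \<Rightarrow> point set" where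
  "bad_points k A = ellipse k ` {p \<in> angles k \<times> UNIV. \<not> (ellipse k p \<in> A \<longleftrightarrow> fst p \<in> full_angles k A)}"

lemma bad_points:
  assumes A: "A \<in> sets borel" and inv: "Gamma_invariant A"
  shows "bad_points k A \<subseteq> level k" "negligible (pxy ` bad_points k A)"
    "\<And>x y z. (x, y, z) \<in> level k \<Longrightarrow> \<bar>z\<bar> < 2 \<Longrightarrow> 2 + k < z\<^sup>2 \<Longrightarrow> (x, y, z) \<notin> bad_points k A \<Longrightarrow>
      (x, y, z) \<in> A \<longleftrightarrow> arccos (z / 2) \<in> full_angles k A"
proof -
  show "bad_points k A \<subseteq> level k" unfolding bad_points_def using ellipse_level by auto
  show "negligible (pxy ` bad_points k A)" unfolding bad_points_def
    by (rule negligible_ellipse[OF negligible_bad_angles[OF A inv]]) auto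
  fix x y z assume *: "(x, y, z) \<in> level k" "\<bar>z\<bar> < 2" "2 + k < z\<^sup>2" "(x, y, z) \<notin> bad_points k A"
  obtain t u where tu: "t \<in> angles k" "(x, y, z) = ellipse k (t, u)" "t = arccos (z / 2)"
    using ellipse_surj[OF *(1-3)] by blast
  have "ellipse k (t, u) \<in> A \<longleftrightarrow> t \<in> full_angles k A"
  proof (rule ccontr)
    assume "\<not> ?thesis"
    then have "(t, u) \<in> {p \<in> angles k \<times> UNIV. \<not> (ellipse k p \<in> A \<longleftrightarrow> fst p \<in> full_angles k A)}" using tu(1) by simp
    then have "ellipse k (t, u) \<in> bad_points k A" unfolding bad_points_def by (rule imageI)
    then show False using * tu by simp
  qed
  then show "(x, y, z) \<in> A \<longleftrightarrow> arccos (z / 2) \<in> full_angles k A" using tu by simp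
qed

text \<open>On each of the two graphs over the (x, y)-plane, the pair of angles of z and z + xy
  depends differentiably on (x, y). Null sets of points therefore give null sets of pairs.\<close>

lemma negligible_angle_pairs:
  assumes N: "N \<subseteq> level k" "negligible (pxy ` N)"
  shows "negligible {(arccos (z / 2), arccos ((z + x * y) / 2)) |x y z. (x, y, z) \<in> N \<and> \<bar>z\<bar> < 2 \<and> \<bar>z + x * y\<bar> < 2}"
    (is "negligible ?D")
proof -
  define d where "d = (\<lambda>p :: real \<times> real. (fst p)\<^sup>2 * (snd p)\<^sup>2 + 4 * ((fst p)\<^sup>2 + (snd p)\<^sup>2 + k + 2))"
  define r where "r = (\<lambda>e p. (- (fst p * snd p) + e * sqrt (d p)) / 2)"
  define F where "F = (\<lambda>e p. (arccos (r e p / 2), arccos ((r e p + fst p * snd p) / 2)))"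
  define M where "M = (\<lambda>e. {p \<in> pxy ` N. d p > 0 \<and> \<bar>r e p\<bar> < 2 \<and> \<bar>r e p + fst p * snd p\<bar> < 2})"
  have neg: "negligible (F e ` M e)" for e
  proof (rule negligible_differentiable_image)
    show "negligible (M e)" unfolding M_def by (rule negligible_subset[OF N(2)]) auto
    fix p assume p: "p \<in> M e"
    have fs: "fst differentiable (at p)" "snd differentiable (at p)" by (rule differentiable_fst_snd)+
    have q: "(\<lambda>p. sqrt (f p)) differentiable (at p)" if "f differentiable (at p)" "f p > 0" for f :: "real \<times> real \<Rightarrow> real"
      using that unfolding differentiable_def by (blast intro: has_derivative_real_sqrt)
    have ac: "(\<lambda>p. arccos (f p)) differentiable (at p)"
      if "f differentiable (at p)" "- 1 < f p" "f p < 1" for f :: "real \<times> real \<Rightarrow> real"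
      using that unfolding differentiable_def by (blast intro: has_derivative_arccos)
    have "d differentiable (at p)" unfolding d_def power2_eq_square
      by (intro differentiable_add differentiable_mult differentiable_const fs)
    then have s: "(\<lambda>p. sqrt (d p)) differentiable (at p)" using p by (intro q) (auto simp: M_def)
    have r: "(\<lambda>p. r e p) differentiable (at p)" unfolding r_def
      by (intro differentiable_divide differentiable_add differentiable_mult differentiable_minus differentiable_const fs s) simp
    show "F e differentiable (at p)" unfolding F_def
      by (intro differentiable_Pair ac differentiable_divide differentiable_add differentiable_mult r fs differentiable_const)
        (use p in \<open>auto simp: M_def\<close>)
  qed
  \<comment> \<open>Where \<open>Bxy\<close> vanishes the root z need not be differentiable in (x,
    y), but there z + xy = - z, so the pair of angles lies on this line.\<close>
  have line: "negligible {p :: real \<times> real. snd p = pi - fst p}"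
    by (rule negligible_finite_slices) (auto intro!: closed_Collect_eq continuous_intros)
  have "?D \<subseteq> F 1 ` M 1 \<union> F (- 1) ` M (- 1) \<union> {p. snd p = pi - fst p}"
  proof (rule subsetI)
    fix w assume "w \<in> ?D"
    then obtain x y z where *: "(x, y, z) \<in> N" "\<bar>z\<bar> < 2" "\<bar>z + x * y\<bar> < 2"
      and w: "w = (arccos (z / 2), arccos ((z + x * y) / 2))" by blast
    have d: "d (x, y) = (2 * z + x * y)\<^sup>2"
      using N(1) *(1) Bxy_square[of x y z k] by (auto simp: d_def)
    show "w \<in> F 1 ` M 1 \<union> F (- 1) ` M (- 1) \<union> {p. snd p = pi - fst p}"
    proof (cases "2 * z + x * y = 0")
      case True
      then have "z + x * y = - z" by simp
      moreover have "arccos (- (z / 2)) = pi - arccos (z / 2)" using *(2) by (intro arccos_minus) auto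
      ultimately have "arccos ((z + x * y) / 2) = pi - arccos (z / 2)" by (metis minus_divide_left)
      then show ?thesis unfolding w by simp
    next
      case False
      then have dp: "d (x, y) > 0" using d by simp
      have "sqrt (d (x, y)) = \<bar>2 * z + x * y\<bar>" using d by simp
      then have "z = r 1 (x, y) \<or> z = r (- 1) (x, y)" by (auto simp: r_def abs_if)
      then obtain e where e: "e = 1 \<or> e = - 1" "z = r e (x, y)" by blast
      have "pxy (x, y, z) \<in> pxy ` N" using *(1) by (rule imageI)
      then have "(x, y) \<in> M e" using dp * e(2) by (simp add: M_def)
      moreover have "w = F e (x, y)" by (simp add: w F_def e(2)[symmetric])
      ultimately show ?thesis using e(1) by blast
    qed
  qed
  then show ?thesis using neg line by (meson negligible_Un negligible_subset)
qed

text \<open>The prescribed data amount to (x + y)^2 = s + 2 p and (x - y)^2 = s - 2 p. It produces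
  points of the level set over a given pair of traces.\<close>

lemma real_sum_product:
  fixes p s :: real
  assumes "2 * \<bar>p\<bar> \<le> s"
  obtains x y where "x * y = p" "x\<^sup>2 + y\<^sup>2 = s"
proof -
  define a where "a = sqrt (s + 2 * p)"
  define b where "b = sqrt (s - 2 * p)"
  have ab: "a\<^sup>2 = s + 2 * p" "b\<^sup>2 = s - 2 * p" using assms by (auto simp: a_def b_def)
  have "((a + b) / 2) * ((a - b) / 2) = (a\<^sup>2 - b\<^sup>2) / 4" "((a + b) / 2)\<^sup>2 + ((a - b) / 2)\<^sup>2 = (a\<^sup>2 + b\<^sup>2) / 2"
    by (simp_all add: power2_eq_square field_simps)
  then show ?thesis using that[of "(a + b) / 2" "(a - b) / 2"] by (simp add: ab)
qed

text \<open>The element (x, y, z) to (-x, y, z + xy) moves between ellipses with nearby traces z.\<close>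

lemma negligible_angle_jumps:
  assumes A: "A \<in> sets borel" and inv: "Gamma_invariant A"
  shows "negligible {(t, s). t \<in> full_angles k A \<and> s \<in> angles k - full_angles k A \<and>
    2 * \<bar>2 * cos s - 2 * cos t\<bar> \<le> 2 * cos s * (2 * cos t) - 2 - k}" (is "negligible ?J")
proof -
  obtain f where f: "f \<in> Gamma_group" "\<And>p. f p = S2 (V3 p)"
    using Gamma_compE[OF gens_in_Gamma(5,3)] by blast
  obtain h where h: "h \<in> Gamma_group" "\<And>p. h (f p) = p" using Gamma_inverse[OF f(1)] by metis
  note bad = bad_points[OF A inv]
  \<comment> \<open>Points that are bad themselves or whose image under f is bad; off N membership
    in A is decided by the angle at both ends.\<close>
  define N where "N = bad_points k A \<union> h ` bad_points k A"
  have "h ` bad_points k A \<subseteq> level k"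
    using image_mono[OF bad(1), of h k] Gamma_image_level[OF h(1), of k] by simp
  then have N: "N \<subseteq> level k" "negligible (pxy ` N)"
    unfolding N_def image_Un using bad(1,2) negligible_Gamma[OF h(1) bad(1,2)]
    by (auto intro: negligible_Un)
  show ?thesis
  proof (rule negligible_subset[OF negligible_angle_pairs[OF N]], rule subsetI)
    fix w assume "w \<in> ?J"
    then obtain t s where w: "w = (t, s)" and ts: "t \<in> full_angles k A" "s \<in> angles k" "s \<notin> full_angles k A"
      "2 * \<bar>2 * cos s - 2 * cos t\<bar> \<le> 2 * cos s * (2 * cos t) - 2 - k" by auto
    have ta: "t \<in> angles k" using ts(1) by (simp add: full_angles_def)
    define z where "z = 2 * cos t"
    define z' where "z' = 2 * cos s"
    have z2: "\<bar>z\<bar> < 2 \<and> 2 + k < z\<^sup>2 \<and> arccos (z / 2) = t" if "z = 2 * cos t" "t \<in> angles k" for z t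
    proof -
      have t: "0 < t" "t < pi" "2 + k < 4 * (cos t)\<^sup>2" using that(2) by (auto simp: angles_def)
      then have "cos t < cos 0" "cos pi < cos t" by (auto simp: cos_mono_less_eq simp del: cos_zero cos_pi)
      then have "- 1 < cos t" "cos t < 1" by simp_all
      then show ?thesis using that(1) t arccos_cos[of t] by (auto simp: power_mult_distrib)
    qed
    note zt = z2[OF z_def ta] z2[OF z'_def ts(2)]
    \<comment> \<open>For f to send z to z' one needs xy = z' - z, and the level equation then reads
      x^2 + y^2 = z z' - 2 - k. The inequality defining the set of jumps is exactly the solvability
      condition.\<close>
    obtain x y where xy: "x * y = z' - z" "x\<^sup>2 + y\<^sup>2 = z' * z - 2 - k"
      using real_sum_product[of "z' - z" "z' * z - 2 - k"] ts(4) unfolding z_def z'_def by blast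
    have p: "(x, y, z) \<in> level k"
    proof -
      have "kappa (x, y, z) = - (x\<^sup>2 + y\<^sup>2) + z\<^sup>2 + (x * y) * z - 2" by simp
      also have "\<dots> = k" unfolding xy by (simp add: power2_eq_square algebra_simps)
      finally show ?thesis by (simp add: level_def)
    qed
    have fp: "f (x, y, z) = (- x, y, z')" using xy(1) by (simp add: f(2))
    then have q: "(- x, y, z') \<in> level k" using Gamma_level[OF f(1) p] by simp
    have "(x, y, z) \<in> N"
    proof (rule ccontr)
      assume "(x, y, z) \<notin> N"
      then have 1: "(x, y, z) \<notin> bad_points k A" "(x, y, z) \<notin> h ` bad_points k A" by (simp_all add: N_def)
      have "(- x, y, z') \<notin> bad_points k A"
      proof
        assume "(- x, y, z') \<in> bad_points k A"
        then have "h (f (x, y, z)) \<in> h ` bad_points k A" unfolding fp by (rule imageI)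
        then show False using 1(2) h(2) by simp
      qed
      then have "(- x, y, z') \<notin> A" using bad(3)[OF q] zt ts(3) by simp
      moreover have "(x, y, z) \<in> A" using bad(3)[OF p] zt ts(1) 1(1) by simp
      ultimately show False using Gamma_invariantD[OF inv f(1), of "(x, y, z)"] fp by simp
    qed
    moreover have "z + x * y = z'" using xy(1) by simp
    ultimately show "w \<in> {(arccos (z / 2), arccos ((z + x * y) / 2)) |x y z. (x, y, z) \<in> N \<and> \<bar>z\<bar> < 2 \<and> \<bar>z + x * y\<bar> < 2}"
      using zt w by (intro CollectI exI[of _ x] exI[of _ y] exI[of _ z]) simp
  qed
qed

text \<open>For k >= -2 the set \<open>angles k\<close> is separated at pi / 2. The reflection
  induced by \<open>S1\<close> carries the result for one half over to the other.\<close>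

lemma full_angles_reflect:
  assumes A: "A \<in> sets borel" and inv: "Gamma_invariant A"
  shows "pi - t \<in> full_angles k A \<longleftrightarrow> t \<in> full_angles k A"
proof -
  have "{u. ellipse k (pi - t, u) \<in> A} = uminus -` {u. ellipse k (t, u) \<in> A}"
  proof -
    have "ellipse k (pi - t, u) \<in> A \<longleftrightarrow> ellipse k (t, - u) \<in> A" for u
      using ellipse_reflect[of k t "- u"] Gamma_invariantD[OF inv gens_in_Gamma(4)] by simp
    then show ?thesis by auto
  qed
  then have "emeasure lborel {u. ellipse k (pi - t, u) \<in> A} = emeasure lborel {u. ellipse k (t, u) \<in> A}"
    using emeasure_lborel_reflect[OF borel_slices(2)[OF A, of k t]] by simp
  moreover have "pi - t \<in> angles k \<longleftrightarrow> t \<in> angles k" by (auto simp: angles_def)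
  ultimately show ?thesis by (simp add: full_angles_def)
qed

text \<open>Near the diagonal the set of jumps contains every pair of a full and a non-full angle.
  As it is null, Fubini forces one of the two factors to be null locally, and connectedness of the
  half below pi / 2 makes this global.\<close>

lemma full_angles_zero_one:
  assumes A: "A \<in> sets borel" and inv: "Gamma_invariant A"
  shows "negligible (full_angles k A) \<or> negligible (angles k - full_angles k A)"
proof -
  define E where "E = full_angles k A"
  have E: "E \<in> sets borel" "E \<subseteq> angles k" using borel_slices(3)[OF A] by (auto simp: E_def full_angles_def)
  define I where "I = angles k \<inter> {t. t < pi / 2}"
  have I: "open I" unfolding I_def using open_angles by (intro open_Int open_Collect_less continuous_intros)
  have "connected I"
  proof (rule is_interval_connected_1[THEN iffD1], unfold is_interval_1, intro ballI allI impI)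
    fix a b x assume ab: "a \<in> I" "b \<in> I" "a \<le> x \<and> x \<le> b"
    then have x: "0 < x" "x < pi / 2" "x \<le> b" "b < pi / 2" by (auto simp: I_def angles_def)
    have "cos b \<le> cos x" "0 < cos b"
      using x by (auto intro!: cos_monotone_0_pi_le cos_gt_zero)
    then have "(cos b)\<^sup>2 \<le> (cos x)\<^sup>2" by (intro power_mono) auto
    then show "x \<in> I" using ab x by (auto simp: I_def angles_def)
  qed
  have loc: "\<exists>J. open J \<and> t \<in> J \<and> J \<subseteq> I \<and> (negligible (E \<inter> J) \<or> negligible (J - E))" if t: "t \<in> I" for t
  proof -
    \<comment> \<open>On the diagonal the strict inequality is 2 + k < 4 (cos t)^2, which holds on
      \<open>angles k\<close>; so a whole square around (t, t) lies in G.\<close>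
    define G where "G = {p :: real \<times> real. 2 * \<bar>2 * cos (snd p) - 2 * cos (fst p)\<bar> < 2 * cos (snd p) * (2 * cos (fst p)) - 2 - k}"
    have "open G" unfolding G_def by (intro open_Collect_less continuous_intros)
    moreover have "(t, t) \<in> G" using t by (simp add: G_def I_def angles_def power2_eq_square)
    ultimately obtain U V where UV: "open U" "open V" "t \<in> U" "t \<in> V" "U \<times> V \<subseteq> G"
      by (elim open_prod_elim) auto
    define J where "J = U \<inter> V \<inter> I"
    have J: "open J" "t \<in> J" "J \<subseteq> I" using UV I t by (auto simp: J_def)
    have "(E \<inter> J) \<times> (J - E) \<subseteq> {(t, s). t \<in> full_angles k A \<and> s \<in> angles k - full_angles k A \<and>
      2 * \<bar>2 * cos s - 2 * cos t\<bar> \<le> 2 * cos s * (2 * cos t) - 2 - k}"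
    proof (rule subsetI)
      fix w assume "w \<in> (E \<inter> J) \<times> (J - E)"
      then obtain a b where w: "w = (a, b)" "a \<in> E" "a \<in> J" "b \<in> J" "b \<notin> E" by auto
      then have "(a, b) \<in> G" using UV(5) by (auto simp: J_def)
      then show "w \<in> {(t, s). t \<in> full_angles k A \<and> s \<in> angles k - full_angles k A \<and>
        2 * \<bar>2 * cos s - 2 * cos t\<bar> \<le> 2 * cos s * (2 * cos t) - 2 - k}"
        using w J(3) by (auto simp: G_def E_def I_def)
    qed
    then have "negligible ((E \<inter> J) \<times> (J - E))"
      using negligible_angle_jumps[OF A inv] negligible_subset by blast
    moreover have EJ: "E \<inter> J \<in> sets borel" "J - E \<in> sets borel" using E J by auto
    ultimately have "negligible (E \<inter> J) \<or> negligible (J - E)"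
      using negligible_times_imp[OF EJ] by (simp add: negligible_lborel_iff[OF EJ(1)] negligible_lborel_iff[OF EJ(2)])
    then show ?thesis using J by blast
  qed
  have refl: "negligible ((\<lambda>t. pi - t) ` X)" if "negligible X" for X :: "real set"
    by (rule negligible_differentiable_image_negligible[OF _ that])
      (auto simp: differentiable_on_def intro!: derivative_intros)
  have mid: "negligible {pi / 2 :: real}" by simp
  have "negligible (E \<inter> I) \<or> negligible (I - E)" by (rule local_zero_one[OF I \<open>connected I\<close> loc])
  then show ?thesis
  proof
    assume n: "negligible (E \<inter> I)"
    have "E \<subseteq> (E \<inter> I) \<union> (\<lambda>t. pi - t) ` (E \<inter> I) \<union> {pi / 2}"
    proof
      fix t assume t: "t \<in> E"
      consider "t < pi / 2" | "t > pi / 2" | "t = pi / 2" by linarith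
      then show "t \<in> (E \<inter> I) \<union> (\<lambda>t. pi - t) ` (E \<inter> I) \<union> {pi / 2}"
      proof cases
        case 2
        then have "pi - t \<in> E \<inter> I" using t E(2) full_angles_reflect[OF A inv, of t k]
          by (auto simp: E_def I_def full_angles_def)
        then have "pi - (pi - t) \<in> (\<lambda>t. pi - t) ` (E \<inter> I)" by (rule imageI)
        then show ?thesis by simp
      qed (use t E(2) in \<open>auto simp: I_def\<close>)
    qed
    then show ?thesis using n refl[OF n] mid unfolding E_def by (meson negligible_Un negligible_subset)
  next
    assume n: "negligible (I - E)"
    have "angles k - E \<subseteq> (I - E) \<union> (\<lambda>t. pi - t) ` (I - E) \<union> {pi / 2}"
    proof
      fix t assume t: "t \<in> angles k - E"
      consider "t < pi / 2" | "t > pi / 2" | "t = pi / 2" by linarith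
      then show "t \<in> (I - E) \<union> (\<lambda>t. pi - t) ` (I - E) \<union> {pi / 2}"
      proof cases
        case 2
        then have "pi - t \<in> I - E" using t full_angles_reflect[OF A inv, of t k]
          by (auto simp: E_def I_def angles_def)
        then have "pi - (pi - t) \<in> (\<lambda>t. pi - t) ` (I - E)" by (rule imageI)
        then show ?thesis by simp
      qed (use t in \<open>auto simp: I_def\<close>)
    qed
    then show ?thesis using n refl[OF n] mid unfolding E_def by (meson negligible_Un negligible_subset)
  qed
qed

lemma negligible_elliptic_part:
  assumes A: "A \<in> sets borel" and inv: "Gamma_invariant A"
  shows "negligible (pxy ` {p \<in> level k \<inter> A. \<bar>snd (snd p)\<bar> < 2}) \<or>
    negligible (pxy ` {p \<in> level k - A. \<bar>snd (snd p)\<bar> < 2})"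
proof -
  let ?D = "{p \<in> level k. \<bar>snd (snd p)\<bar> < 2 \<and> (snd (snd p))\<^sup>2 \<le> 2 + k}"
  note bad = bad_points[OF A inv]
  have neg: "negligible (pxy ` X)"
    if X: "X \<subseteq> level k \<inter> {p. \<bar>snd (snd p)\<bar> < 2}" and T: "negligible T" "T \<in> sets borel" "T \<subseteq> angles k"
      and XT: "\<And>x y z. (x, y, z) \<in> X \<Longrightarrow> 2 + k < z\<^sup>2 \<Longrightarrow> (x, y, z) \<notin> bad_points k A \<Longrightarrow>
        arccos (z / 2) \<in> angles k \<Longrightarrow> arccos (z / 2) \<in> T" for X T
  proof -
    have "negligible (T \<times> (UNIV :: real set))"
      using T(1,2) by (intro negligible_times_UNIV) (auto simp: negligible_lborel_iff)
    then have "negligible (pxy ` ellipse k ` (T \<times> UNIV))" using T(3) by (intro negligible_ellipse) auto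
    then have "negligible (pxy ` (ellipse k ` (T \<times> UNIV) \<union> bad_points k A \<union> ?D))"
      unfolding image_Un using bad(2) negligible_degenerate_ellipse by (intro negligible_Un)
    moreover have "X \<subseteq> ellipse k ` (T \<times> UNIV) \<union> bad_points k A \<union> ?D"
    proof
      fix p assume p: "p \<in> X"
      obtain x y z where xyz: "p = (x, y, z)" by (cases p)
      have l: "(x, y, z) \<in> level k" "\<bar>z\<bar> < 2" using p X xyz by auto
      show "p \<in> ellipse k ` (T \<times> UNIV) \<union> bad_points k A \<union> ?D"
      proof (cases "2 + k < z\<^sup>2 \<and> p \<notin> bad_points k A")
        case True
        then obtain t u where tu: "t \<in> angles k" "(x, y, z) = ellipse k (t, u)" "t = arccos (z / 2)"
          using ellipse_surj[OF l] by blast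
        then have "t \<in> T" using XT[of x y z] True p xyz by simp
        then have "ellipse k (t, u) \<in> ellipse k ` (T \<times> UNIV)" by (intro imageI) simp
        then show ?thesis using tu(2) xyz by simp
      next
        case False
        then show ?thesis using l xyz by auto
      qed
    qed
    ultimately show ?thesis by (meson image_mono negligible_subset)
  qed
  have E: "full_angles k A \<in> sets borel" "angles k - full_angles k A \<in> sets borel"
    using borel_slices(3)[OF A, of k] open_angles[of k] by auto
  from full_angles_zero_one[OF A inv, of k] show ?thesis
  proof
    assume n: "negligible (full_angles k A)"
    have "negligible (pxy ` {p \<in> level k \<inter> A. \<bar>snd (snd p)\<bar> < 2})"
      by (rule neg[OF _ n E(1)]) (auto simp: full_angles_def[of k A] dest: bad(3))
    then show ?thesis ..
  next
    assume n: "negligible (angles k - full_angles k A)"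
    have "negligible (pxy ` {p \<in> level k - A. \<bar>snd (snd p)\<bar> < 2})"
      by (rule neg[OF _ n E(2)]) (auto simp: bad(3))
    then show ?thesis ..
  qed
qed

theorem ergodic_below_2:
  assumes k: "k < 2"
  shows "ergodic_on Gamma_group (completion (area_measure k)) (level k - orbit_set Gamma_group F_C02)"
proof (rule ergodic_onI_invariant)
  fix A assume A: "A \<in> sets borel" "A \<subseteq> level k - orbit_set Gamma_group F_C02"
    and inv: "Gamma_invariant A"
  let ?S = "level k - orbit_set Gamma_group F_C02"
  have zero: "negligible (pxy ` {p \<in> level k. fst p = 0})"
  proof (rule negligible_subset)
    have "negligible {p :: real \<times> real. snd p = 0}"
      by (rule negligible_finite_slices) (auto intro!: closed_Collect_eq continuous_intros)
    then show "negligible (prod.swap ` {p :: real \<times> real. snd p = 0})" by (rule negligible_swap)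
    show "pxy ` {p \<in> level k. fst p = 0} \<subseteq> prod.swap ` {p :: real \<times> real. snd p = 0}"
    proof (rule image_subsetI)
      fix p assume p: "p \<in> {p \<in> level k. fst p = 0}"
      obtain x y z where xyz: "p = (x, y, z)" by (cases p)
      show "pxy p \<in> prod.swap ` {p :: real \<times> real. snd p = 0}"
        by (rule image_eqI[of _ _ "(y, 0)"]) (use p xyz in auto)
    qed
  qed
  have neg: "negligible (pxy ` X)"
    if X: "X \<subseteq> ?S" "\<And>g p. g \<in> Gamma_group \<Longrightarrow> p \<in> X \<Longrightarrow> g p \<in> X"
      and n: "negligible (pxy ` {p \<in> X. \<bar>snd (snd p)\<bar> < 2})" for X
  proof (rule negligible_pxy_cover)
    \<comment> \<open>\<open>no_hyperbolic_orbit\<close> lets an orbit escape through x = 0 as well,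
      which is a null set.\<close>
    let ?Y = "{p \<in> X. \<bar>snd (snd p)\<bar> < 2} \<union> {p \<in> level k. fst p = 0}"
    show "X \<subseteq> level k" "?Y \<subseteq> level k" using X by auto
    show "negligible (pxy ` ?Y)" unfolding image_Un using n zero by (rule negligible_Un)
    fix p assume p: "p \<in> X"
    then have pl: "p \<in> level k" using X by blast
    have "\<not> hyperbolic_orbit p" by (rule no_hyperbolic_orbit[OF k pl])
    then obtain g where g: "g \<in> Gamma_group" "\<bar>snd (snd (g p))\<bar> < 2 \<or> fst (g p) = 0 \<or> g p \<in> F_C02"
      unfolding hyperbolic_orbit_def by (meson not_le)
    have "g p \<notin> F_C02" using g(1) p X(1) orbit_set_mem[of p F_C02] by blast
    then have "g p \<in> ?Y" using g X(2)[OF g(1) p] Gamma_level[OF g(1) pl] by blast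
    then show "\<exists>g\<in>Gamma_group. g p \<in> ?Y" using g(1) by blast
  qed
  from negligible_elliptic_part[OF A(1) inv, of k]
  show "negligible (pxy ` A) \<or> negligible (pxy ` (?S - A))"
  proof
    assume n: "negligible (pxy ` {p \<in> level k \<inter> A. \<bar>snd (snd p)\<bar> < 2})"
    have "negligible (pxy ` A)"
    proof (rule neg)
      show "negligible (pxy ` {p \<in> A. \<bar>snd (snd p)\<bar> < 2})" using A(2) by (intro negligible_subset[OF n]) blast
    qed (use A Gamma_invariantD[OF inv] in blast)+
    then show ?thesis ..
  next
    assume n: "negligible (pxy ` {p \<in> level k - A. \<bar>snd (snd p)\<bar> < 2})"
    have "negligible (pxy ` (?S - A))"
    proof (rule neg)
      show "negligible (pxy ` {p \<in> ?S - A. \<bar>snd (snd p)\<bar> < 2})" by (intro negligible_subset[OF n]) blast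
      show "g p \<in> ?S - A" if "g \<in> Gamma_group" "p \<in> ?S - A" for g p
        using that Gamma_invariantD[OF inv] orbit_set_invariant[OF that(1)] Gamma_level[OF that(1)] by blast
    qed blast
    then show ?thesis ..
  qed
qed blast

subsection \<open>Farey cones\<close>

text \<open>The matrix with rows (a, b) and (c, d) runs through the monoid generated by R = (1 1; 0
  1) and L = (1 0; 1 1); appending R or L on the right adds one column to the other.\<close>

inductive farey :: "nat \<Rightarrow> nat \<Rightarrow> nat \<Rightarrow> nat \<Rightarrow> bool" where
  farey_id: "farey 1 0 0 1"
| farey_R: "farey a b c d \<Longrightarrow> farey a (a + b) c (c + d)"
| farey_L: "farey a b c d \<Longrightarrow> farey (a + b) b (c + d) d"

lemma farey_det: "farey a b c d \<Longrightarrow> real a * real d - real b * real c = 1"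
  by (induction rule: farey.induct) (simp_all add: algebra_simps)

lemma farey_pos: "farey a b c d \<Longrightarrow> 0 < a + c \<and> 0 < b + d"
  by (induction rule: farey.induct) linarith+

lemma farey_R_iterate: "farey a b c d \<Longrightarrow> farey a (b + m * a) c (d + m * c)"
proof (induction m)
  case (Suc m)
  have "a + (b + m * a) = b + Suc m * a" "c + (d + m * c) = d + Suc m * c" by simp_all
  then show ?case using farey_R[OF Suc.IH[OF Suc.prems]] by metis
qed simp

lemma farey_L_iterate: "farey a b c d \<Longrightarrow> farey (a + m * b) b (c + m * d) d"
proof (induction m)
  case (Suc m)
  have "(a + m * b) + b = a + Suc m * b" "(c + m * d) + d = c + Suc m * d" by simp_all
  then show ?case using farey_L[OF Suc.IH[OF Suc.prems]] by metis
qed simp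

text \<open>By Cramer's rule the two quantities are the coordinates of (1 - x, x) in the basis
  formed by the columns (a, c) and (b, d).\<close>

definition in_cone :: "nat \<Rightarrow> nat \<Rightarrow> nat \<Rightarrow> nat \<Rightarrow> real \<Rightarrow> bool" where
  "in_cone a b c d x \<longleftrightarrow> 0 < real d * (1 - x) - real b * x \<and> 0 < real a * x - real c * (1 - x)"

lemma irrational_not_in_ray:
  assumes "x \<notin> \<rat>" "p + q > (0 :: nat)"
  shows "real p * (1 - x) \<noteq> real q * x"
proof
  assume "real p * (1 - x) = real q * x"
  then have "real (p + q) * x = real p" by (simp add: algebra_simps)
  moreover have "real (p + q) \<noteq> 0" using assms(2) by linarith
  ultimately have "x = real p / real (p + q)" by (metis nonzero_mult_div_cancel_left)
  then show False using assms(1) by simp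
qed

text \<open>Following the continued fraction of x, the cone is balanced right after each change of direction.\<close>

lemma deeper_balanced_cone:
  assumes f: "farey a b c d" "in_cone a b c d x" and x: "x \<notin> \<rat>"
  shows "\<exists>a' b' c' d'. farey a' b' c' d' \<and> in_cone a' b' c' d' x \<and> a' + c' \<le> 2 * (b' + d') \<and>
    b' + d' \<le> 2 * (a' + c') \<and> a + c + (b + d) < a' + c' + (b' + d')"
proof -
  \<comment> \<open>The coordinates of (1 - x, x) in the columns. Appending R or L is one
    subtraction step of the Euclidean algorithm on them, and irrationality of x keeps them from
    vanishing.\<close>
  define \<alpha> where "\<alpha> = real d * (1 - x) - real b * x"
  define \<beta> where "\<beta> = real a * x - real c * (1 - x)"
  have pos: "\<alpha> > 0" "\<beta> > 0" using f(2) by (auto simp: in_cone_def \<alpha>_def \<beta>_def)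
  have n: "0 < a + c" "0 < b + d" using farey_pos[OF f(1)] by auto
  have fl: "\<exists>m\<ge>1. real m * v \<le> u \<and> u < real m * v + v" if "0 < v" "v \<le> u" for u v :: real
  proof -
    define m where "m = nat \<lfloor>u / v\<rfloor>"
    have "1 \<le> u / v" using that by simp
    then have "1 \<le> \<lfloor>u / v\<rfloor>" by simp
    moreover have "real_of_int \<lfloor>u / v\<rfloor> \<le> u / v" "u / v < real_of_int \<lfloor>u / v\<rfloor> + 1" by linarith+
    ultimately have "m \<ge> 1" "real m \<le> u / v" "u / v < real m + 1" unfolding m_def by linarith+
    then show ?thesis using that by (intro exI[of _ m]) (simp add: field_simps)
  qed
  show ?thesis
  proof (cases "\<beta> \<le> \<alpha>")
    case True
    then obtain m where m: "m \<ge> 1" "real m * \<beta> \<le> \<alpha>" "\<alpha> < real m * \<beta> + \<beta>" using fl pos by blast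
    define b' where "b' = b + m * a"
    define d' where "d' = d + m * c"
    \<comment> \<open>After R^m with m >= 1 the second column sum is at least the first, so the
      single L that follows yields a column sum at most twice the other one.\<close>
    have F: "farey (a + b') b' (c + d') d'" unfolding b'_def d'_def by (intro farey_L farey_R_iterate f)
    have e: "real d' * (1 - x) - real b' * x = \<alpha> - real m * \<beta>"
      by (simp add: b'_def d'_def \<alpha>_def \<beta>_def algebra_simps)
    have "real d' * (1 - x) \<noteq> real b' * x"
      using n by (intro irrational_not_in_ray x) (auto simp: b'_def d'_def)
    then have "0 < \<alpha> - real m * \<beta>" using e m(2) by auto
    moreover have "real (a + b') * x - real (c + d') * (1 - x) = \<beta> - (real d' * (1 - x) - real b' * x)"
      by (simp add: \<beta>_def algebra_simps)
    ultimately have "in_cone (a + b') b' (c + d') d' x"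
      unfolding in_cone_def using e m(3) by simp
    moreover have "a + c \<le> m * (a + c)" using m(1) by simp
    then have "a + c \<le> b' + d'" by (simp add: b'_def d'_def algebra_simps)
    moreover have "b + d \<le> b' + d'" by (simp add: b'_def d'_def)
    ultimately show ?thesis using F n by (intro exI[of _ "a + b'"] exI[of _ b'] exI[of _ "c + d'"] exI[of _ d']) auto
  next
    case False
    then obtain m where m: "m \<ge> 1" "real m * \<alpha> \<le> \<beta>" "\<beta> < real m * \<alpha> + \<alpha>" using fl[of \<alpha> \<beta>] pos by auto
    define a' where "a' = a + m * b"
    define c' where "c' = c + m * d"
    have F: "farey a' (a' + b) c' (c' + d)" unfolding a'_def c'_def by (intro farey_R farey_L_iterate f)
    have e: "real a' * x - real c' * (1 - x) = \<beta> - real m * \<alpha>"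
      by (simp add: a'_def c'_def \<alpha>_def \<beta>_def algebra_simps)
    have "real c' * (1 - x) \<noteq> real a' * x"
      using n by (intro irrational_not_in_ray x) (auto simp: a'_def c'_def)
    then have "0 < \<beta> - real m * \<alpha>" using e m(2) by auto
    moreover have "real (c' + d) * (1 - x) - real (a' + b) * x = \<alpha> - (real a' * x - real c' * (1 - x))"
      by (simp add: \<alpha>_def algebra_simps)
    ultimately have "in_cone a' (a' + b) c' (c' + d) x"
      unfolding in_cone_def using e m(3) by simp
    moreover have "b + d \<le> m * (b + d)" using m(1) by simp
    then have "b + d \<le> a' + c'" by (simp add: a'_def c'_def algebra_simps)
    moreover have "a + c \<le> a' + c'" by (simp add: a'_def c'_def)
    ultimately show ?thesis using F n by (intro exI[of _ a'] exI[of _ "a' + b"] exI[of _ c'] exI[of _ "c' + d"]) auto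
  qed
qed

text \<open>With comparable columns, a large total of the column sums forces a narrow cone of
  bounded distortion; such cones are available around every irrational direction.\<close>

lemma balanced_cone:
  assumes x: "x \<notin> \<rat>" "0 < x" "x < 1"
  shows "\<exists>a b c d. farey a b c d \<and> in_cone a b c d x \<and> a + c \<le> 2 * (b + d) \<and>
    b + d \<le> 2 * (a + c) \<and> N \<le> a + c + (b + d)"
proof (induction N)
  case 0
  have "farey 1 0 0 1" "in_cone 1 0 0 1 x" using x farey_id by (simp_all add: in_cone_def)
  from deeper_balanced_cone[OF this x(1)] show ?case by blast
next
  case (Suc N)
  then obtain a b c d where f: "farey a b c d" "in_cone a b c d x" "N \<le> a + c + (b + d)" by blast
  from deeper_balanced_cone[OF f(1,2) x(1)] f(3) show ?case by (metis Suc_leI le_less_trans)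
qed

subsection \<open>Sets in the plane invariant under the theta group\<close>

text \<open>The theta group consists of the integral matrices congruent modulo 2 to a permutation matrix;
  these are generators of its extension by reflections.\<close>

definition theta_invariant :: "(real \<times> real) set \<Rightarrow> bool" where
  "theta_invariant E \<longleftrightarrow> E \<in> sets borel \<and> (\<forall>s t. ((t, s) \<in> E \<longleftrightarrow> (s, t) \<in> E) \<and>
    ((- s, t) \<in> E \<longleftrightarrow> (s, t) \<in> E) \<and> ((- s - 2 * t, t) \<in> E \<longleftrightarrow> (s, t) \<in> E))"

definition preserves :: "(real \<times> real) set \<Rightarrow> real \<Rightarrow> real \<Rightarrow> real \<Rightarrow> real \<Rightarrow> bool" where
  "preserves E a b c d \<longleftrightarrow> (\<forall>s t. (a * s + b * t, c * s + d * t) \<in> E \<longleftrightarrow> (s, t) \<in> E)"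

lemma theta_invariantD:
  assumes "theta_invariant E"
  shows "(t, s) \<in> E \<longleftrightarrow> (s, t) \<in> E" "(- s, t) \<in> E \<longleftrightarrow> (s, t) \<in> E" "(s, - t) \<in> E \<longleftrightarrow> (s, t) \<in> E"
    "(s + 2 * t, t) \<in> E \<longleftrightarrow> (s, t) \<in> E" "(s, t + 2 * s) \<in> E \<longleftrightarrow> (s, t) \<in> E"
proof -
  show sw: "(t, s) \<in> E \<longleftrightarrow> (s, t) \<in> E" for s t using assms unfolding theta_invariant_def by blast
  show m: "(- s, t) \<in> E \<longleftrightarrow> (s, t) \<in> E" for s t using assms unfolding theta_invariant_def by blast
  show "(s, - t) \<in> E \<longleftrightarrow> (s, t) \<in> E" using sw[of s "- t"] m[of t s] sw[of t s] by blast
  have V: "(- s - 2 * t, t) \<in> E \<longleftrightarrow> (s, t) \<in> E" for s t using assms unfolding theta_invariant_def by blast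
  show sh: "(s + 2 * t, t) \<in> E \<longleftrightarrow> (s, t) \<in> E" for s t 
  proof -
    have "(- (s + 2 * t), t) \<in> E \<longleftrightarrow> (s, t) \<in> E" using V[of s t] by (simp add: algebra_simps)
    then show ?thesis using m[of "s + 2 * t" t] by blast
  qed
  show "(s, t + 2 * s) \<in> E \<longleftrightarrow> (s, t) \<in> E" using sh[of t s] sw[of s "t + 2 * s"] sw[of s t] by blast
qed

lemma preserves_comp:
  assumes "preserves E a b c d" "preserves E a' b' c' d'"
  shows "preserves E (a * a' + b * c') (a * b' + b * d') (c * a' + d * c') (c * b' + d * d')"
  unfolding preserves_def
proof (intro allI)
  fix s t
  have "(a * (a' * s + b' * t) + b * (c' * s + d' * t), c * (a' * s + b' * t) + d * (c' * s + d' * t)) \<in> E \<longleftrightarrow> (s, t) \<in> E"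
    using assms unfolding preserves_def by blast
  then show "((a * a' + b * c') * s + (a * b' + b * d') * t, (c * a' + d * c') * s + (c * b' + d * d') * t) \<in> E \<longleftrightarrow> (s, t) \<in> E"
    by (simp add: algebra_simps)
qed

text \<open>The theta group has index 3, with coset representatives 1, R and L.\<close>

lemma farey_coset:
  assumes E: "theta_invariant E" and "farey a b c d"
  shows "preserves E a b c d \<or> preserves E a (a + b) c (c + d) \<or> preserves E (a + b) b (c + d) d"
  using assms(2)
proof (induction rule: farey.induct)
  case farey_id
  show ?case by (simp add: preserves_def)
next
  note D = theta_invariantD[OF E]
  have M: "preserves E 1 2 0 1" "preserves E 1 0 2 1"
    using D(4,5) by (simp_all add: preserves_def add.commute)
  \<comment> \<open>In terms of R = (1 1; 0 1) and L = (1 0; 1 1) this matrix is L^-1 R L, and the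
    next one is R^-1 L R. They transfer the three coset alternatives from a word to its
    extension.\<close>
  have M1: "preserves E 2 1 (- 1) 0"
    unfolding preserves_def
  proof (intro allI)
    fix s t
    have "(2 * s + t, - s) \<in> E \<longleftrightarrow> (2 * s + t, s) \<in> E" by (rule D(3))
    also have "\<dots> \<longleftrightarrow> (t, s) \<in> E" using D(4)[of t s] by (simp add: add.commute)
    also have "\<dots> \<longleftrightarrow> (s, t) \<in> E" by (rule D(1))
    finally show "(2 * s + 1 * t, - 1 * s + 0 * t) \<in> E \<longleftrightarrow> (s, t) \<in> E" by simp
  qed
  have M2: "preserves E 0 (- 1) 1 2"
    unfolding preserves_def
  proof (intro allI)
    fix s t
    have "(- t, s + 2 * t) \<in> E \<longleftrightarrow> (t, s + 2 * t) \<in> E" by (rule D(2))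
    also have "\<dots> \<longleftrightarrow> (t, s) \<in> E" by (rule D(5))
    also have "\<dots> \<longleftrightarrow> (s, t) \<in> E" by (rule D(1))
    finally show "(0 * s + - 1 * t, 1 * s + 2 * t) \<in> E \<longleftrightarrow> (s, t) \<in> E" by simp
  qed
  {
    case (farey_R a b c d)
    from farey_R.IH show ?case
    proof (elim disjE)
      assume "preserves E a b c d"
      from preserves_comp[OF this M(1)] show ?case by (simp add: algebra_simps)
    next
      assume "preserves E (a + b) b (c + d) d"
      from preserves_comp[OF this M1] show ?case by (simp add: algebra_simps)
    qed simp
  next
    case (farey_L a b c d)
    from farey_L.IH show ?case
    proof (elim disjE)
      assume "preserves E a b c d"
      from preserves_comp[OF this M(2)] show ?case by (simp add: algebra_simps)
    next
      assume "preserves E a (a + b) c (c + d)"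
      from preserves_comp[OF this M2] show ?case by (simp add: algebra_simps)
    qed simp
  }
qed

text \<open>The action of a matrix on directions, with the direction of (1 - x, x) given by x.\<close>

definition mobius :: "real \<Rightarrow> real \<Rightarrow> real \<Rightarrow> real \<Rightarrow> real \<Rightarrow> real" where
  "mobius a b c d x = (c * (1 - x) + d * x) / ((a + c) * (1 - x) + (b + d) * x)"

text \<open>The derivative of \<open>mobius\<close> is 1 / n^2, where n interpolates between the
  column sums and is at most N. Pulling a set back to the unit interval thus enlarges its measure by
  at most N^2.\<close>

lemma mobius_pullback:
  assumes det: "a * d - b * c = 1" and n: "0 < a + c" "0 < b + d" "a + c \<le> N" "b + d \<le> N"
    and B: "B \<in> sets borel"
  shows "emeasure lborel {x \<in> {0..1}. mobius a b c d x \<notin> B} \<le>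
    ennreal (N\<^sup>2) * emeasure lborel ({c / (a + c)..d / (b + d)} - B)"
proof -
  define n where "n = (\<lambda>x. (a + c) * (1 - x) + (b + d) * x)"
  have npos: "0 < n x \<and> n x \<le> N" if "x \<in> {0..1}" for x
  proof -
    have "0 \<le> (a + c) * (1 - x)" "0 \<le> (b + d) * x" using that n by auto
    moreover have "0 < (a + c) * (1 - x) \<or> 0 < (b + d) * x" using that n by (cases "x = 0") auto
    moreover have "(a + c) * (1 - x) \<le> N * (1 - x)" "(b + d) * x \<le> N * x" using that n by (auto intro: mult_right_mono)
    then have "n x \<le> N * (1 - x) + N * x" unfolding n_def by linarith
    then have "n x \<le> N" by (simp add: algebra_simps)
    ultimately show ?thesis unfolding n_def by linarith
  qed
  have N: "N > 0" using n by linarith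
  have deriv: "(mobius a b c d has_real_derivative 1 / (n x)\<^sup>2) (at x)" if "x \<in> {0..1}" for x
  proof -
    have nz: "n x \<noteq> 0" using npos[OF that] by simp
    have "((\<lambda>x. (c * (1 - x) + d * x) / n x) has_real_derivative
        ((d - c) * n x - (c * (1 - x) + d * x) * ((b + d) - (a + c))) / (n x * n x)) (at x)"
      using nz unfolding n_def by (auto intro!: derivative_eq_intros)
    moreover have "(d - c) * n x - (c * (1 - x) + d * x) * ((b + d) - (a + c)) = a * d - b * c"
      by (simp add: n_def algebra_simps)
    ultimately show ?thesis using det by (simp add: mobius_def[abs_def] n_def power2_eq_square)
  qed
  have cont: "continuous_on {0..1} (mobius a b c d)"
    using deriv by (meson DERIV_continuous_on has_field_derivative_at_within)
  have contn: "continuous_on {0..1} (\<lambda>x. 1 / (n x)\<^sup>2)"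
  proof (intro continuous_on_divide continuous_on_const continuous_on_power ballI)
    show "continuous_on {0..1} n" unfolding n_def by (intro continuous_intros)
    show "(n x)\<^sup>2 \<noteq> 0" if "x \<in> {0..1}" for x using npos[OF that] by simp
  qed
  define S where "S = {x \<in> {0..1}. mobius a b c d x \<notin> B}"
  have S: "S \<in> sets borel"
  proof -
    have "mobius a b c d \<in> borel_measurable borel" unfolding mobius_def[abs_def] by measurable
    then have "mobius a b c d -` B \<in> sets borel" using measurable_sets[of "mobius a b c d" borel borel B] B by simp
    moreover have "S = {0..1} - mobius a b c d -` B" by (auto simp: S_def)
    ultimately show ?thesis by auto
  qed
  have ends: "mobius a b c d 0 = c / (a + c)" "mobius a b c d 1 = d / (b + d)" by (simp_all add: mobius_def)
  have sub: "(\<integral>\<^sup>+x. ennreal (indicator (- B) x * indicator {mobius a b c d 0..mobius a b c d 1} x) \<partial>lborel) =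
      (\<integral>\<^sup>+x. ennreal (indicator (- B) (mobius a b c d x) * (1 / (n x)\<^sup>2) * indicator {0..1} x) \<partial>lborel)"
    using nn_integral_substitution[of "mobius a b c d" 0 1 "indicator (- B)" "\<lambda>x. 1 / (n x)\<^sup>2"] deriv contn B
    by (simp only: atLeastAtMost_iff) (simp add: set_borel_measurable_def)
  have "emeasure lborel S = (\<integral>\<^sup>+x. indicator S x \<partial>lborel)" using S by simp
  also have "\<dots> \<le> (\<integral>\<^sup>+x. ennreal (N\<^sup>2) * (ennreal (indicator (- B) (mobius a b c d x) * (1 / (n x)\<^sup>2) * indicator {0..1} x)) \<partial>lborel)"
  proof (rule nn_integral_mono)
    fix x :: real
    show "indicator S x \<le> ennreal (N\<^sup>2) * (ennreal (indicator (- B) (mobius a b c d x) * (1 / (n x)\<^sup>2) * indicator {0..1} x))"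
    proof (cases "x \<in> S")
      case True
      then have x: "x \<in> {0..1}" "mobius a b c d x \<in> - B" by (auto simp: S_def)
      have "(n x)\<^sup>2 \<le> N\<^sup>2" using npos[OF x(1)] by (intro power_mono) auto
      then have "1 \<le> N\<^sup>2 * (1 / (n x)\<^sup>2)" using npos[OF x(1)] by (simp add: field_simps)
      then have "1 \<le> ennreal (N\<^sup>2 * (1 / (n x)\<^sup>2))" by (metis ennreal_1 ennreal_leI)
      moreover have "ennreal (N\<^sup>2 * (1 / (n x)\<^sup>2)) = ennreal (N\<^sup>2) * ennreal (1 / (n x)\<^sup>2)"
        by (rule ennreal_mult') simp
      ultimately have "1 \<le> ennreal (N\<^sup>2) * ennreal (1 / (n x)\<^sup>2)" by (simp only:)
      then show ?thesis using x True by simp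
    qed simp
  qed
  also have "\<dots> = ennreal (N\<^sup>2) * (\<integral>\<^sup>+x. ennreal (indicator (- B) (mobius a b c d x) * (1 / (n x)\<^sup>2) * indicator {0..1} x) \<partial>lborel)"
  proof (rule nn_integral_cmult)
    have [measurable]: "mobius a b c d \<in> borel_measurable borel" unfolding mobius_def[abs_def] by measurable
    have [measurable]: "n \<in> borel_measurable borel" unfolding n_def by measurable
    have [measurable]: "- B \<in> sets borel" using B by auto
    show "(\<lambda>x. ennreal (indicator (- B) (mobius a b c d x) * (1 / (n x)\<^sup>2) * indicator {0..1} x)) \<in> borel_measurable lborel"
      by measurable
  qed
  also have "\<dots> = ennreal (N\<^sup>2) * (\<integral>\<^sup>+x. indicator ({c / (a + c)..d / (b + d)} - B) x \<partial>lborel)"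
    unfolding sub[symmetric] ends
    by (intro arg_cong2[where f = "(*)"] nn_integral_cong) (auto simp: indicator_def)
  also have "\<dots> = ennreal (N\<^sup>2) * emeasure lborel ({c / (a + c)..d / (b + d)} - B)" using B by simp
  finally show ?thesis by (simp add: S_def)
qed

subsection \<open>Density in Farey cones\<close>

text \<open>A density theorem for Farey intervals. If every balanced interval had a share above
  \<eta> outside B, a disjoint Vitali family of them covering almost all of B inside a tight
  neighbourhood U would make U - B too large.\<close>

lemma dense_farey_interval:
  assumes B: "B \<in> sets borel" "B \<subseteq> {0<..<1}" "emeasure lborel B \<noteq> 0" and \<eta>: "\<eta> > 0"
  obtains a b c d where "farey a b c d" "a + c \<le> 2 * (b + d)" "b + d \<le> 2 * (a + c)"
    "emeasure lborel ({real c / real (a + c)..real d / real (b + d)} - B) \<le> ennreal (\<eta> / (real (a + c) * real (b + d)))"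
proof (rule ccontr)
  note found = that
  assume nt: "\<not> thesis"
  define I where "I = (\<lambda>(a, b, c, d). {real c / real (a + c)..real d / real (b + d)})"
  define len where "len = (\<lambda>(a, b, c, d). 1 / (real (a + c) * real (b + d)))"
  have Bf: "emeasure lborel B < \<infinity>"
  proof -
    have "emeasure lborel B \<le> emeasure lborel (cbox 0 (1::real))" using B by (intro emeasure_mono) auto
    also have "\<dots> < \<infinity>" by simp
    finally show ?thesis .
  qed
  define m where "m = measure lborel B"
  have m: "emeasure lborel B = ennreal m" "m > 0"
  proof -
    show 1: "emeasure lborel B = ennreal m" using Bf by (simp add: m_def emeasure_eq_ennreal_measure)
    show "m > 0" using 1 B(3) by (metis ennreal_eq_0_iff not_le)
  qed
  have "\<eta> * m > 0" using \<eta> m by simp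
  \<comment> \<open>The slack \<eta> m is exactly what the assumed shares outside B add up to at
    least.\<close>
  then obtain T where T: "open T" "B \<subseteq> T" "emeasure lebesgue (T - B) < ennreal (\<eta> * m)"
    using sets_lebesgue_outer_open[of B] B(1) by (metis sets_completionI_sets sets_lborel)
  define U where "U = T \<inter> {0<..<1}"
  have U: "open U" "B \<subseteq> U" using T B by (auto simp: U_def)
  have UB: "emeasure lborel (U - B) < ennreal (\<eta> * m)"
  proof -
    have "emeasure lborel (U - B) \<le> emeasure lborel (T - B)"
      using T(1) B(1) by (intro emeasure_mono) (auto simp: U_def)
    also have "\<dots> = emeasure lebesgue (T - B)" using T(1) B(1) by simp
    finally show ?thesis using T(3) by simp
  qed
  \<comment> \<open>The balanced Farey intervals inside U; \<open>ctr\<close> and \<open>len\<close>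
    present them as balls for the Vitali covering theorem. Since the determinant is 1, the length is
    the reciprocal of the product of the column sums.\<close>
  define K where "K = {(a, b, c, d) |a b c d. farey a b c d \<and> a + c \<le> 2 * (b + d) \<and> b + d \<le> 2 * (a + c) \<and> I (a, b, c, d) \<subseteq> U}"
  define ctr where "ctr = (\<lambda>(a, b, c, d). (real c / real (a + c) + real d / real (b + d)) / 2)"
  have Ilen: "real d / real (b + d) = real c / real (a + c) + len (a, b, c, d)" "len (a, b, c, d) > 0"
    if "farey a b c d" for a b c d
  proof -
    have p: "real (a + c) > 0" "real (b + d) > 0" using farey_pos[OF that] by linarith+
    then show "len (a, b, c, d) > 0" by (simp add: len_def)
    have "real d * real (a + c) = real c * real (b + d) + 1" using farey_det[OF that] by (simp add: algebra_simps)
    then have "real d * real (a + c) / (real (a + c) * real (b + d)) = (real c * real (b + d) + 1) / (real (a + c) * real (b + d))" by simp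
    then show "real d / real (b + d) = real c / real (a + c) + len (a, b, c, d)"
      using p by (simp add: len_def add_divide_distrib)
  qed
  have cb: "cball (ctr i) (len i / 2) = I i" if iK: "i \<in> K" for i
  proof -
    obtain a b c d where i: "i = (a, b, c, d)" "farey a b c d" using iK unfolding K_def by blast
    have avg: "(u + (u + L)) / 2 - L / 2 = u" "(u + (u + L)) / 2 + L / 2 = u + L" for u L :: real
      by (simp_all add: field_simps)
    have "ctr i - len i / 2 = real c / real (a + c)" "ctr i + len i / 2 = real d / real (b + d)"
      unfolding i(1) ctr_def split_conv Ilen(1)[OF i(2)] by (rule avg)+
    then show ?thesis unfolding cball_eq_atLeastAtMost by (simp add: i(1) I_def)
  qed
  have rpos: "0 < len i / 2" if iK: "i \<in> K" for i
  proof -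
    obtain a b c d where i: "i = (a, b, c, d)" "farey a b c d" using iK unfolding K_def by blast
    show ?thesis using Ilen(2)[OF i(2)] by (simp add: i(1))
  qed
  have cover: "\<exists>i. i \<in> K \<and> x \<in> cball (ctr i) (len i / 2) \<and> len i / 2 < e" if x: "x \<in> B - \<rat>" and e: "0 < e" for x e
  proof -
    have "x \<in> U" using x U by blast
    then obtain r where r: "r > 0" "cball x r \<subseteq> U" using U(1) open_contains_cball by blast
    define N where "N = nat \<lceil>9 / min r e\<rceil> + 1"
    have "0 < x" "x < 1" "x \<notin> \<rat>" using x B(2) by auto
    from balanced_cone[OF this(3,1,2), of N] obtain a b c d where
      f: "farey a b c d" "in_cone a b c d x" "a + c \<le> 2 * (b + d)" "b + d \<le> 2 * (a + c)" "N \<le> a + c + (b + d)" by blast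
    have p: "real (a + c) \<ge> 1" "real (b + d) \<ge> 1" using farey_pos[OF f(1)] by linarith+
    \<comment> \<open>In a balanced cone the total of the column sums is at most three times their
      product, so a large total makes the interval short.\<close>
    have lensmall: "len (a, b, c, d) < min r e"
    proof -
      have "9 / min r e < real N" unfolding N_def by linarith
      also have "\<dots> \<le> real (a + c) + real (b + d)" using f(5) by linarith
      also have "\<dots> \<le> 3 * real (a + c)" using of_nat_mono[OF f(4), where 'a = real] by simp
      also have "\<dots> \<le> 3 * (real (a + c) * real (b + d))" using p mult_left_mono[of 1 "real (b + d)" "real (a + c)"] by linarith
      finally have "9 / min r e < 3 * (real (a + c) * real (b + d))" .
      moreover have mp: "min r e > 0" using r e by simp
      ultimately have "9 < 3 * (real (a + c) * real (b + d)) * min r e" by (simp add: pos_divide_less_eq)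
      then have "1 < min r e * (real (a + c) * real (b + d))" by (simp add: algebra_simps)
      moreover have "real (a + c) * real (b + d) > 0" using p by simp
      ultimately show ?thesis by (simp only: len_def split_conv pos_divide_less_eq)
    qed
    have xin: "real c / real (a + c) \<le> x" "x \<le> real d / real (b + d)"
    proof -
      have "real c \<le> x * real (a + c)" using f(2) by (simp add: in_cone_def algebra_simps)
      then show "real c / real (a + c) \<le> x" using p by (simp add: pos_divide_le_eq)
      have "x * real (b + d) \<le> real d" using f(2) by (simp add: in_cone_def algebra_simps)
      then show "x \<le> real d / real (b + d)" using p by (simp add: pos_le_divide_eq)
    qed
    have "I (a, b, c, d) \<subseteq> cball x r"
      using xin Ilen(1)[OF f(1)] lensmall by (auto simp: I_def cball_eq_atLeastAtMost)
    then have iK: "(a, b, c, d) \<in> K" using f r(2) by (auto simp: K_def)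
    moreover have "x \<in> cball (ctr (a, b, c, d)) (len (a, b, c, d) / 2)"
      unfolding cb[OF iK] using xin by (simp add: I_def)
    moreover have "len (a, b, c, d) / 2 < e" using lensmall Ilen(2)[OF f(1)] by linarith
    ultimately show ?thesis by blast
  qed
  obtain C where C: "countable C" "C \<subseteq> K"
    "pairwise (\<lambda>i j. disjnt (cball (ctr i) (len i / 2)) (cball (ctr j) (len j / 2))) C"
    "negligible ((B - \<rat>) - (\<Union>i\<in>C. cball (ctr i) (len i / 2)))"
    by (rule Vitali_covering_theorem_cballs[of K "\<lambda>i. len i / 2" "B - \<rat>" ctr, OF rpos cover])
  have disj: "disjoint_family_on I C"
  proof (unfold disjoint_family_on_def, intro ballI impI)
    fix i j assume ij: "i \<in> C" "j \<in> C" "i \<noteq> j"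
    have "disjnt (cball (ctr i) (len i / 2)) (cball (ctr j) (len j / 2))" by (rule pairwiseD[OF C(3) ij])
    then show "I i \<inter> I j = {}" unfolding cb[OF subsetD[OF C(2) ij(1)]] cb[OF subsetD[OF C(2) ij(2)]] disjnt_def .
  qed
  have Iborel: "I i \<in> sets borel" for i by (cases i) (simp add: I_def)
  have big: "ennreal \<eta> * emeasure lborel (I i) \<le> emeasure lborel (I i - B)" if iC: "i \<in> C" for i
  proof -
    have "i \<in> K" using iC C(2) by blast
    then obtain a b c d where i: "i = (a, b, c, d)" "farey a b c d" "a + c \<le> 2 * (b + d)" "b + d \<le> 2 * (a + c)"
      unfolding K_def by blast
    have "\<not> emeasure lborel ({real c / real (a + c)..real d / real (b + d)} - B) \<le> ennreal (\<eta> / (real (a + c) * real (b + d)))"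
      using nt found[OF i(2-4)] by blast
    then have "ennreal (\<eta> / (real (a + c) * real (b + d))) \<le> emeasure lborel (I i - B)" by (simp add: i(1) I_def)
    moreover have "emeasure lborel (I i) = ennreal (len i)"
      using Ilen[OF i(2)] by (simp add: i(1) I_def)
    moreover have "ennreal \<eta> * ennreal (len i) = ennreal (\<eta> / (real (a + c) * real (b + d)))"
      using \<eta> by (subst ennreal_mult'[symmetric]) (auto simp: i(1) len_def)
    ultimately show ?thesis by simp
  qed
  have dB: "disjoint_family_on (\<lambda>i. I i - B) C" using disj unfolding disjoint_family_on_def by blast
  have "emeasure lborel B \<le> emeasure lborel (\<Union>i\<in>C. I i)"
  proof -
    have "(\<Union>i\<in>C. cball (ctr i) (len i / 2)) = (\<Union>i\<in>C. I i)"
      using cb C(2) by (intro SUP_cong) auto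
    then have "negligible ((B - \<rat>) - (\<Union>i\<in>C. I i))" using C(4) by simp
    moreover have "negligible (\<rat> :: real set)" 
      unfolding negligible_iff_null_sets
      by (rule null_sets_completionI[OF countable_imp_null_set_lborel[OF countable_rat]])
    ultimately have "negligible (((B - \<rat>) - (\<Union>i\<in>C. I i)) \<union> \<rat>)" by (rule negligible_Un)
    then have neg: "negligible (B - (\<Union>i\<in>C. I i))" by (rule negligible_subset) blast
    have Ub: "(\<Union>i\<in>C. I i) \<in> sets borel" using C(1) Iborel by (intro sets.countable_UN') auto
    have "B - (\<Union>i\<in>C. I i) \<in> sets borel" using B(1) Ub by auto
    then have "emeasure lborel (B - (\<Union>i\<in>C. I i)) = 0" using neg negligible_lborel_iff by blast
    moreover have "emeasure lborel B \<le> emeasure lborel ((\<Union>i\<in>C. I i) \<union> (B - (\<Union>i\<in>C. I i)))"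
      using B(1) Ub by (intro emeasure_mono) auto
    moreover have "\<dots> \<le> emeasure lborel (\<Union>i\<in>C. I i) + emeasure lborel (B - (\<Union>i\<in>C. I i))"
      using B(1) Ub by (intro emeasure_subadditive) auto
    ultimately show ?thesis by simp
  qed
  then have "ennreal \<eta> * emeasure lborel B \<le> ennreal \<eta> * emeasure lborel (\<Union>i\<in>C. I i)"
    by (intro mult_left_mono) auto
  also have "emeasure lborel (\<Union>i\<in>C. I i) = (\<integral>\<^sup>+i. emeasure lborel (I i) \<partial>count_space C)"
    using C(1) Iborel disj by (intro emeasure_UN_countable) auto
  also have "ennreal \<eta> * (\<integral>\<^sup>+i. emeasure lborel (I i) \<partial>count_space C) =
      (\<integral>\<^sup>+i. ennreal \<eta> * emeasure lborel (I i) \<partial>count_space C)"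
    by (rule nn_integral_cmult[symmetric]) simp
  also have "\<dots> \<le> (\<integral>\<^sup>+i. emeasure lborel (I i - B) \<partial>count_space C)"
    using big by (intro nn_integral_mono) simp
  also have "\<dots> = emeasure lborel (\<Union>i\<in>C. I i - B)"
    using C(1) Iborel B(1) dB by (intro emeasure_UN_countable[symmetric]) auto
  also have "\<dots> \<le> emeasure lborel (U - B)"
  proof (rule emeasure_mono)
    show "(\<Union>i\<in>C. I i - B) \<subseteq> U - B" using C(2) unfolding K_def by blast
  qed (use U B in auto)
  also have "\<dots> < ennreal (\<eta> * m)" by (rule UB)
  finally have "ennreal \<eta> * emeasure lborel B < ennreal (\<eta> * m)" .
  moreover have "ennreal (\<eta> * m) = ennreal \<eta> * emeasure lborel B" using \<eta> m by (simp add: ennreal_mult)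
  ultimately show False by simp
qed

text \<open>Among M, M R and M L for a Farey matrix M one preserves E, and its cone lies inside that
  of M. The product with the parabolic (1 2; 0 1) is controlled at the same time, since both
  matrices are later applied to one and the same direction.\<close>

lemma dense_theta_cone:
  assumes E: "theta_invariant E" and B: "B \<in> sets borel" "B \<subseteq> {0<..<1}" "emeasure lborel B \<noteq> 0" and \<epsilon>: "\<epsilon> > 0"
  obtains a b c d where "preserves E a b c d" "a * d - b * c = 1" "0 \<le> a" "0 \<le> b" "0 \<le> c" "0 \<le> d"
    "0 < a + c" "0 < b + d" "b + d \<le> 3 * (a + c)"
    "emeasure lborel {x \<in> {0..1}. mobius a b c d x \<notin> B} \<le> ennreal \<epsilon>"
    "emeasure lborel {x \<in> {0..1}. mobius a (2 * a + b) c (2 * c + d) x \<notin> B} \<le> ennreal \<epsilon>"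
proof -
  note found = that
  \<comment> \<open>With s the sum of the two column sums, the pullback costs (3 s)^2, which is at
    most 81 (a + c) (b + d) for balanced columns. So 100 is enough.\<close>
  define \<eta> where "\<eta> = \<epsilon> / 100"
  have \<eta>: "\<eta> > 0" using \<epsilon> by (simp add: \<eta>_def)
  obtain a b c d where f: "farey a b c d" "a + c \<le> 2 * (b + d)" "b + d \<le> 2 * (a + c)"
    "emeasure lborel ({real c / real (a + c)..real d / real (b + d)} - B) \<le> ennreal (\<eta> / (real (a + c) * real (b + d)))"
    by (rule dense_farey_interval[OF B \<eta>])
  define J where "J = {real c / real (a + c)..real d / real (b + d)}"
  have J: "J - B \<in> sets borel" using B(1) by (auto simp: J_def)
  \<comment> \<open>Treats the three cosets alike. Adding one column to the other turns the balance
    factor 2 into 3, and composing with (1 2; 0 1) gives column sums of at most 3 s.\<close>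
  have fin: thesis
    if p: "preserves E a' b' c' d'" "a' * d' - b' * c' = 1" "0 \<le> a'" "0 \<le> b'" "0 \<le> c'" "0 \<le> d'"
      "0 < a' + c'" "0 < b' + d'" "b' + d' \<le> 3 * (a' + c')" "a' + c' \<le> 3 * (b' + d')"
      and J': "{c' / (a' + c')..d' / (b' + d')} \<subseteq> J"
      and n: "a' + c' \<le> real (a + c) + real (b + d)" "b' + d' \<le> real (a + c) + real (b + d)" for a' b' c' d'
  proof (rule found[OF p(1-9)])
    have ab: "real (a + c) \<le> 2 * real (b + d)" "real (b + d) \<le> 2 * real (a + c)" using f(2,3) by linarith+
    define s where "s = real (a + c) + real (b + d)"
    have s: "0 < real (a + c)" "0 < real (b + d)" using farey_pos[OF f(1)] by linarith+
    have "s * s \<le> 9 * (real (a + c) * real (b + d))"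
    proof -
      have "s * s \<le> (3 * real (b + d)) * (3 * real (a + c))" using ab s by (intro mult_mono) (auto simp: s_def)
      then show ?thesis by (simp add: algebra_simps)
    qed
    then have bound: "ennreal ((3 * s)\<^sup>2) * emeasure lborel (J - B) \<le> ennreal \<epsilon>"
    proof -
      assume ss: "s * s \<le> 9 * (real (a + c) * real (b + d))"
      have "ennreal ((3 * s)\<^sup>2) * emeasure lborel (J - B) \<le> ennreal ((3 * s)\<^sup>2) * ennreal (\<eta> / (real (a + c) * real (b + d)))"
        using f(4) unfolding J_def by (intro mult_left_mono) auto
      also have "\<dots> = ennreal ((3 * s)\<^sup>2 * (\<eta> / (real (a + c) * real (b + d))))" by (rule ennreal_mult'[symmetric]) simp
      also have "\<dots> \<le> ennreal \<epsilon>"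
      proof (rule ennreal_leI)
        have "(3 * s)\<^sup>2 * \<eta> \<le> 81 * (real (a + c) * real (b + d)) * \<eta>"
          using ss \<eta> by (intro mult_right_mono) (auto simp: power2_eq_square)
        also have "\<dots> \<le> \<epsilon> * (real (a + c) * real (b + d))" using s \<epsilon> by (simp add: \<eta>_def)
        finally show "(3 * s)\<^sup>2 * (\<eta> / (real (a + c) * real (b + d))) \<le> \<epsilon>"
          using s by (simp add: pos_divide_le_eq)
      qed
      finally show ?thesis .
    qed
    have up: "emeasure lborel {x \<in> {0..1}. mobius a' b'' c' d'' x \<notin> B} \<le> ennreal \<epsilon>"
      if q: "a' * d'' - b'' * c' = 1" "0 < b'' + d''" "b'' + d'' \<le> 3 * s" "d'' / (b'' + d'') \<le> d' / (b' + d')" for b'' d''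
    proof -
      have "emeasure lborel {x \<in> {0..1}. mobius a' b'' c' d'' x \<notin> B} \<le>
          ennreal ((3 * s)\<^sup>2) * emeasure lborel ({c' / (a' + c')..d'' / (b'' + d'')} - B)"
        using n s q p(7) by (intro mobius_pullback B(1)) (auto simp: s_def)
      also have "\<dots> \<le> ennreal ((3 * s)\<^sup>2) * emeasure lborel (J - B)"
        using J J' q(4) by (intro mult_left_mono emeasure_mono) force+
      also have "\<dots> \<le> ennreal \<epsilon>" by (rule bound)
      finally show ?thesis .
    qed
    show "emeasure lborel {x \<in> {0..1}. mobius a' b' c' d' x \<notin> B} \<le> ennreal \<epsilon>"
      using up[OF p(2,8)] n s by (simp add: s_def)
    show "emeasure lborel {x \<in> {0..1}. mobius a' (2 * a' + b') c' (2 * c' + d') x \<notin> B} \<le> ennreal \<epsilon>"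
    proof (rule up)
      show "a' * (2 * c' + d') - (2 * a' + b') * c' = 1" using p(2) by (simp add: algebra_simps)
      show "0 < 2 * a' + b' + (2 * c' + d')" using p by linarith
      show "2 * a' + b' + (2 * c' + d') \<le> 3 * s" using n by (simp add: s_def)
      have "(2 * c' + d') * (b' + d') \<le> d' * (2 * a' + b' + (2 * c' + d'))"
        using p(2) by (simp add: algebra_simps)
      then show "(2 * c' + d') / (2 * a' + b' + (2 * c' + d')) \<le> d' / (b' + d')"
        using p by (simp add: divide_le_eq le_divide_eq field_simps)
    qed
  qed
  have det: "real a * real d - real b * real c = 1" by (rule farey_det[OF f(1)])
  have n: "0 < real a + real c" "0 < real b + real d" using farey_pos[OF f(1)] by linarith+
  have ab: "real a + real c \<le> 2 * (real b + real d)" "real b + real d \<le> 2 * (real a + real c)"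
    using of_nat_mono[OF f(2), where 'a = real] of_nat_mono[OF f(3), where 'a = real] by simp_all
  have mid: "real c / (real a + real c) \<le> (real c + real d) / (real a + real b + (real c + real d))"
    "(real c + real d) / (real a + real b + (real c + real d)) \<le> real d / (real b + real d)"
  proof -
    have s: "real a + real b + (real c + real d) > 0" using n by linarith
    have "real c * (real a + real b + (real c + real d)) \<le> (real c + real d) * (real a + real c)"
      using det by (simp add: algebra_simps)
    then show "real c / (real a + real c) \<le> (real c + real d) / (real a + real b + (real c + real d))"
      using n s by (simp add: divide_le_eq le_divide_eq field_simps)
    have "(real c + real d) * (real b + real d) \<le> real d * (real a + real b + (real c + real d))"
      using det by (simp add: algebra_simps)
    then show "(real c + real d) / (real a + real b + (real c + real d)) \<le> real d / (real b + real d)"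
      using n s by (simp add: divide_le_eq le_divide_eq field_simps)
  qed
  from farey_coset[OF E f(1), unfolded of_nat_add] show thesis
  proof (elim disjE)
    assume "preserves E (real a) (real b) (real c) (real d)"
    then show thesis using det n ab by (intro fin[of "real a" "real b" "real c" "real d"]) (auto simp: J_def)
  next
    assume "preserves E (real a) (real a + real b) (real c) (real c + real d)"
    then show thesis using det n ab mid
      by (intro fin[of "real a" "real a + real b" "real c" "real c + real d"]) (auto simp: J_def algebra_simps)
  next
    assume "preserves E (real a + real b) (real b) (real c + real d) (real d)"
    then show thesis using det n ab mid
      by (intro fin[of "real a + real b" "real b" "real c + real d" "real d"]) (auto simp: J_def algebra_simps)
  qed
qed

subsection \<open>Ergodicity of the theta group on the plane\<close>

text \<open>The slice of E along (1 - x, x) in the logarithm of the coordinate sum, so that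
  dilations of the plane act as translations of the line.\<close>

definition ray :: "(real \<times> real) set \<Rightarrow> real \<Rightarrow> real set" where
  "ray E x = {v. (exp v * (1 - x), exp v * x) \<in> E}"

lemma continuous_polar: "continuous_on UNIV (\<lambda>p :: real \<times> real. (exp (snd p) * (1 - fst p), exp (snd p) * fst p))"
  by (intro continuous_intros)

lemma borel_polar:
  assumes "E \<in> sets borel"
  shows "{p. snd p \<in> ray E (fst p)} \<in> sets borel" "ray E x \<in> sets borel"
proof -
  have "(\<lambda>p :: real \<times> real. (exp (snd p) * (1 - fst p), exp (snd p) * fst p)) -` E \<in> sets borel"
    using measurable_sets[OF borel_measurable_continuous_onI[OF continuous_polar] assms] by simp
  then show 1: "{p. snd p \<in> ray E (fst p)} \<in> sets borel" by (simp add: ray_def vimage_def)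
  have "{p. snd p \<in> ray E (fst p)} \<in> sets (lborel \<Otimes>\<^sub>M lborel)" using 1 by (subst lborel_prod) simp
  then have "Pair x -` {p. snd p \<in> ray E (fst p)} \<in> sets lborel" by (rule sets_Pair1)
  then show "ray E x \<in> sets borel" by (simp add: vimage_def)
qed

lemma measurable_window_ray:
  assumes "E \<in> sets borel"
  shows "(\<lambda>x. window (ray E x) d u) \<in> borel_measurable borel"
proof -
  define S where "S = {p. snd p \<in> ray E (fst p)} \<inter> UNIV \<times> {u<..u + d}"
  have "S \<in> sets borel" unfolding S_def using borel_polar(1)[OF assms] by (intro sets.Int borel_Times) auto
  then have "S \<in> sets (lborel \<Otimes>\<^sub>M lborel)" by (subst lborel_prod) simp
  then have "(\<lambda>x. emeasure lborel (Pair x -` S)) \<in> borel_measurable lborel"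
    by (rule lborel.measurable_emeasure_Pair)
  moreover have "Pair x -` S = ray E x \<inter> {u<..u + d}" for x by (auto simp: S_def)
  ultimately show ?thesis unfolding window_def measure_def by simp
qed

lemma window_shift:
  assumes F: "F \<in> sets borel" and "\<And>v. v + a \<in> F \<longleftrightarrow> v \<in> E"
  shows "window F d (t + a) = window E d t"
proof -
  have "a + v \<in> F \<longleftrightarrow> v \<in> E" for v using assms(2)[of v] by (simp only: add.commute)
  then have "(+) a -` (F \<inter> {t + a<..t + a + d}) = E \<inter> {t<..t + d}" by auto
  moreover have "F \<inter> {t + a<..t + a + d} \<in> sets borel" using F by auto
  ultimately show ?thesis unfolding window_def measure_def
    using emeasure_lborel_translate[of "F \<inter> {t + a<..t + a + d}" a] by simp
qed

text \<open>The matrix maps the ray of x onto the ray of its \<open>mobius\<close> image and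
  multiplies coordinate sums by the constant ?n; in log radius this is translation by ln ?n.\<close>

lemma window_ray_mobius:
  assumes E: "E \<in> sets borel" and p: "preserves E a b c d"
    and n: "0 < (a + c) * (1 - x) + (b + d) * x" (is "0 < ?n")
  shows "window (ray E (mobius a b c d x)) e (u + ln ?n) = window (ray E x) e u"
proof (rule window_shift)
  show "ray E (mobius a b c d x) \<in> sets borel" by (rule borel_polar[OF E])
  fix v
  have m: "mobius a b c d x = (c * (1 - x) + d * x) / ?n" by (simp add: mobius_def)
  have 1: "?n * mobius a b c d x = c * (1 - x) + d * x" using n unfolding m by simp
  have 2: "?n * (1 - mobius a b c d x) = a * (1 - x) + b * x"
  proof -
    have "?n * (1 - mobius a b c d x) = ?n * 1 - (c * (1 - x) + d * x)"
      using right_diff_distrib[of ?n 1 "mobius a b c d x"] unfolding 1 .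
    also have "\<dots> = a * (1 - x) + b * x" by (simp add: algebra_simps)
    finally show ?thesis .
  qed
  have e: "exp (v + ln ?n) = exp v * ?n" using n by (simp add: exp_add)
  have "(exp (v + ln ?n) * (1 - mobius a b c d x), exp (v + ln ?n) * mobius a b c d x) =
      (exp v * (a * (1 - x) + b * x), exp v * (c * (1 - x) + d * x))"
    unfolding e mult.assoc 1 2 by simp
  also have "\<dots> = (a * (exp v * (1 - x)) + b * (exp v * x), c * (exp v * (1 - x)) + d * (exp v * x))"
    by (simp add: algebra_simps)
  also have "\<dots> \<in> E \<longleftrightarrow> (exp v * (1 - x), exp v * x) \<in> E" using p unfolding preserves_def by blast
  finally show "v + ln ?n \<in> ray E (mobius a b c d x) \<longleftrightarrow> v \<in> ray E x" by (simp add: ray_def)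
qed

lemma abs_ln_diff_le: "\<bar>ln y - ln z\<bar> \<le> \<bar>y - z\<bar> / m" if "0 < m" "m \<le> y" "m \<le> z" for y z :: real
proof -
  have *: "ln y - ln z \<le> \<bar>y - z\<bar> / m" if "m \<le> y" "m \<le> z" for y z
  proof -
    have "ln y - ln z \<le> (y - z) / z" using that \<open>0 < m\<close> by (intro ln_diff_le) auto
    also have "\<dots> \<le> \<bar>y - z\<bar> / z" using that \<open>0 < m\<close> by (intro divide_right_mono) auto
    also have "\<dots> \<le> \<bar>y - z\<bar> / m" using that \<open>0 < m\<close> by (intro divide_left_mono) auto
    finally show ?thesis .
  qed
  show ?thesis using *[of y z] *[of z y] that by (simp add: abs_le_iff abs_minus_commute)
qed

lemma AE_zero_iff_null:
  fixes S :: "real set"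
  assumes "S \<in> sets borel"
  shows "(AE x in lborel. x \<notin> S) \<longleftrightarrow> emeasure lborel S = 0"
proof -
  have "{x \<in> space lborel. \<not> x \<notin> S} = S" by simp
  then show ?thesis using AE_iff_measurable[of S lborel "\<lambda>x. x \<notin> S"] assms by simp
qed

text \<open>If two values of u were distinguished on a set of directions of positive measure, then inside a
  cone where this is visible the parabolic element moves u by a prescribed amount l.\<close>

lemma window_ray_separated_null:
  assumes E: "theta_invariant E" and l: "0 < l" "l \<le> 1 / 5" and d: "0 \<le> d" and \<epsilon>: "0 < \<epsilon>" "3 * \<epsilon> \<le> \<bar>q - q'\<bar>"
  shows "emeasure lborel {x \<in> {0<..<1}. \<bar>window (ray E x) d u - q\<bar> < \<epsilon> \<and> \<bar>window (ray E x) d (u + l) - q'\<bar> < \<epsilon>} = 0"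
    (is "emeasure lborel ?B = 0")
proof (rule ccontr)
  assume nz: "emeasure lborel ?B \<noteq> 0"
  have Eb: "E \<in> sets borel" using E by (simp add: theta_invariant_def)
  note [measurable] = measurable_window_ray[OF Eb]
  have "{x \<in> space borel. \<bar>window (ray E x) d u - q\<bar> < \<epsilon> \<and> \<bar>window (ray E x) d (u + l) - q'\<bar> < \<epsilon>} \<in> sets borel"
    by measurable
  then have "{0<..<1} \<inter> {x \<in> space borel. \<bar>window (ray E x) d u - q\<bar> < \<epsilon> \<and> \<bar>window (ray E x) d (u + l) - q'\<bar> < \<epsilon>} \<in> sets borel"
    by (intro sets.Int) simp_all
  moreover have "?B = {0<..<1} \<inter> {x \<in> space borel. \<bar>window (ray E x) d u - q\<bar> < \<epsilon> \<and> \<bar>window (ray E x) d (u + l) - q'\<bar> < \<epsilon>}"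
    by auto
  ultimately have B: "?B \<in> sets borel" "?B \<subseteq> {0<..<1}" by (simp only:, blast)
  \<comment> \<open>The error in the displacement will be at most 8 \<rho> <= \<epsilon>, and \<rho>
    <= 1 / 8 keeps x <= 1 / 2.\<close>
  define \<rho> where "\<rho> = min (\<epsilon> / 8) (1 / 8)"
  have \<rho>: "0 < \<rho>" "8 * \<rho> \<le> \<epsilon>" "\<rho> \<le> 1 / 8" using \<epsilon> by (auto simp: \<rho>_def)
  have r4: "0 < \<rho> / 4" using \<rho>(1) by simp
  obtain a b c e where g: "preserves E a b c e" "a * e - b * c = 1" "0 \<le> a" "0 \<le> b" "0 \<le> c" "0 \<le> e"
    "0 < a + c" "0 < b + e" "b + e \<le> 3 * (a + c)"
    "emeasure lborel {x \<in> {0..1}. mobius a b c e x \<notin> ?B} \<le> ennreal (\<rho> / 4)"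
    "emeasure lborel {x \<in> {0..1}. mobius a (2 * a + b) c (2 * c + e) x \<notin> ?B} \<le> ennreal (\<rho> / 4)"
    by (rule dense_theta_cone[OF E B nz r4])
  \<comment> \<open>Up to the common factor a + c, the two matrices dilate the direction x by 1 - x
    + \<kappa> x and 1 + x + \<kappa> x.\<close>
  define \<kappa> where "\<kappa> = (b + e) / (a + c)"
  have \<kappa>: "0 < \<kappa>" "\<kappa> \<le> 3" using g by (auto simp: \<kappa>_def divide_le_eq)
  \<comment> \<open>The direction at which these two dilations differ by exactly the factor exp l.
    The bounds l <= 1 / 5 and \<kappa> <= 3 keep the denominator at least 1 and y at most 1 /
    4.\<close>
  define y where "y = (exp l - 1) / ((1 + exp l) - \<kappa> * (exp l - 1))"
  have el: "0 < exp l - 1" "exp l - 1 \<le> 1 / 4"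
  proof -
    show "0 < exp l - 1" using l by simp
    have "exp l \<le> 1 + l + l\<^sup>2" using l by (intro exp_bound) auto
    moreover have "l\<^sup>2 \<le> (1 / 5) * (1 / 5)" unfolding power2_eq_square using l by (intro mult_mono) auto
    ultimately show "exp l - 1 \<le> 1 / 4" using l by simp
  qed
  have den: "(1 + exp l) - \<kappa> * (exp l - 1) \<ge> 1"
  proof -
    have "\<kappa> * (exp l - 1) \<le> 3 * (1 / 4)" using \<kappa> el by (intro mult_mono) auto
    then show ?thesis using el by linarith
  qed
  have y: "0 < y" "y \<le> 1 / 4" "(1 + y + \<kappa> * y) = exp l * (1 - y + \<kappa> * y)"
  proof -
    show "0 < y" using el den by (simp add: y_def)
    have "y \<le> (exp l - 1) / 1" unfolding y_def using el den by (intro divide_left_mono) auto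
    then show "y \<le> 1 / 4" using el by simp
    have "y * ((1 + exp l) - \<kappa> * (exp l - 1)) = exp l - 1" using den by (simp add: y_def)
    then show "(1 + y + \<kappa> * y) = exp l * (1 - y + \<kappa> * y)" by (simp add: algebra_simps)
  qed
  \<comment> \<open>The two exceptional sets have total measure at most \<rho> / 2, less than the
    length \<rho> of the interval.\<close>
  have "\<exists>x\<in>{y<..<y + \<rho>}. mobius a b c e x \<in> ?B \<and> mobius a (2 * a + b) c (2 * c + e) x \<in> ?B"
  proof (rule ccontr)
    assume no: "\<not> ?thesis"
    let ?S = "{x \<in> {0..1}. mobius a b c e x \<notin> ?B}" and ?T = "{x \<in> {0..1}. mobius a (2 * a + b) c (2 * c + e) x \<notin> ?B}"
    have "{y<..<y + \<rho>} \<subseteq> ?S \<union> ?T" using no y \<rho> by auto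
    moreover have mob: "{x \<in> {0..1}. mobius a b c e x \<notin> ?B} \<in> sets borel" for a b c e
    proof -
      have "mobius a b c e \<in> borel_measurable borel" unfolding mobius_def[abs_def] by measurable
      then have "mobius a b c e -` ?B \<in> sets borel" using measurable_sets[of "mobius a b c e" borel borel ?B] B(1) by simp
      moreover have "{x \<in> {0..1}. mobius a b c e x \<notin> ?B} = {0..1} - mobius a b c e -` ?B" by auto
      ultimately show ?thesis by auto
    qed
    ultimately have "emeasure lborel {y<..<y + \<rho>} \<le> emeasure lborel (?S \<union> ?T)"
      by (intro emeasure_mono sets.Un) (simp_all only: sets_lborel mob)
    also have "\<dots> \<le> emeasure lborel ?S + emeasure lborel ?T"
      by (intro emeasure_subadditive) (simp_all only: sets_lborel mob)
    also have "\<dots> \<le> ennreal (\<rho> / 4) + ennreal (\<rho> / 4)" using g(10,11) by (rule add_mono)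
    also have "\<dots> = ennreal (\<rho> / 2)" using \<rho>(1) by (simp add: ennreal_plus[symmetric] del: ennreal_plus)
    finally have "ennreal \<rho> \<le> ennreal (\<rho> / 2)" using \<rho>(1) by simp
    then show False using \<rho>(1) by (simp add: ennreal_le_iff)
  qed
  then obtain x where x: "y < x" "x < y + \<rho>" "mobius a b c e x \<in> ?B" "mobius a (2 * a + b) c (2 * c + e) x \<in> ?B" by auto
  have x01: "0 < x" "x \<le> 1 / 2" using x y \<rho> by linarith+
  define n1 where "n1 = (a + c) * (1 - x) + (b + e) * x"
  define n2 where "n2 = (a + c) * (1 - x) + (2 * a + b + (2 * c + e)) * x"
  have \<kappa>n: "b + e = (a + c) * \<kappa>" using g(7) by (simp add: \<kappa>_def)
  have "2 * a + b + (2 * c + e) = 2 * (a + c) + (b + e)" by simp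
  then have n1: "n1 = (a + c) * (1 - x + \<kappa> * x)" "n2 = (a + c) * (1 + x + \<kappa> * x)"
    unfolding n1_def n2_def \<kappa>n by (simp_all only: \<kappa>n) (simp_all add: algebra_simps)
  have D: "1 / 2 \<le> 1 - x + \<kappa> * x" "1 / 2 \<le> 1 - y + \<kappa> * y" "1 \<le> 1 + x + \<kappa> * x" "1 \<le> 1 + y + \<kappa> * y"
  proof -
    have "0 \<le> \<kappa> * x" "0 \<le> \<kappa> * y" using \<kappa> x01 y by simp_all
    then show "1 / 2 \<le> 1 - x + \<kappa> * x" "1 / 2 \<le> 1 - y + \<kappa> * y" "1 \<le> 1 + x + \<kappa> * x" "1 \<le> 1 + y + \<kappa> * y"
      using x01 y by linarith+
  qed
  have npos: "0 < n1" "0 < n2" unfolding n1 using g(7) D by (auto intro!: mult_pos_pos)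
  \<comment> \<open>The actual displacement at x. It differs from l because x only approximates y,
    and the Lipschitz bound for windows absorbs the error.\<close>
  define l' where "l' = ln n2 - ln n1"
  have l': "l' = ln (1 + x + \<kappa> * x) - ln (1 - x + \<kappa> * x)"
    unfolding l'_def n1 using g(7) D by (simp add: ln_mult)
  have ll: "l = ln (1 + y + \<kappa> * y) - ln (1 - y + \<kappa> * y)"
    unfolding y(3) using D by (simp add: ln_mult)
  have "\<bar>ln (1 + x + \<kappa> * x) - ln (1 + y + \<kappa> * y)\<bar> \<le> \<bar>(1 + x + \<kappa> * x) - (1 + y + \<kappa> * y)\<bar> / 1"
    using D by (intro abs_ln_diff_le) auto
  also have "(1 + x + \<kappa> * x) - (1 + y + \<kappa> * y) = (1 + \<kappa>) * (x - y)" by (simp add: algebra_simps)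
  also have "\<bar>(1 + \<kappa>) * (x - y)\<bar> / 1 \<le> 4 * \<rho>"
    using \<kappa> x by (simp add: abs_mult) (intro mult_mono; simp)
  finally have 1: "\<bar>ln (1 + x + \<kappa> * x) - ln (1 + y + \<kappa> * y)\<bar> \<le> 4 * \<rho>" .
  have "\<bar>ln (1 - x + \<kappa> * x) - ln (1 - y + \<kappa> * y)\<bar> \<le> \<bar>(1 - x + \<kappa> * x) - (1 - y + \<kappa> * y)\<bar> / (1 / 2)"
    using D by (intro abs_ln_diff_le) auto
  also have "(1 - x + \<kappa> * x) - (1 - y + \<kappa> * y) = (\<kappa> - 1) * (x - y)" by (simp add: algebra_simps)
  also have "\<bar>(\<kappa> - 1) * (x - y)\<bar> \<le> 2 * \<rho>"
    unfolding abs_mult using \<kappa> x by (intro mult_mono) auto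
  finally have 2: "\<bar>ln (1 - x + \<kappa> * x) - ln (1 - y + \<kappa> * y)\<bar> \<le> 4 * \<rho>" by simp
  have close: "\<bar>l' - l\<bar> \<le> \<epsilon>" unfolding l' ll using 1 2 \<rho>(2) by linarith
  have p2: "preserves E a (2 * a + b) c (2 * c + e)"
  proof -
    have "preserves E 1 2 0 1" using theta_invariantD(4)[OF E] by (simp add: preserves_def)
    from preserves_comp[OF g(1) this] show ?thesis by (simp add: algebra_simps)
  qed
  have "window (ray E (mobius a b c e x)) d ((u - ln n1) + ln n1) = window (ray E x) d (u - ln n1)"
    unfolding n1_def by (rule window_ray_mobius[OF Eb g(1)]) (use npos n1_def in simp)
  moreover have "window (ray E (mobius a (2 * a + b) c (2 * c + e) x)) d ((u - ln n1) + ln n2) = window (ray E x) d (u - ln n1)"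
    unfolding n2_def by (rule window_ray_mobius[OF Eb p2]) (use npos n2_def in simp)
  ultimately have "window (ray E (mobius a b c e x)) d u = window (ray E (mobius a (2 * a + b) c (2 * c + e) x)) d (u + l')"
    by (simp add: l'_def algebra_simps)
  moreover have "\<bar>window (ray E (mobius a (2 * a + b) c (2 * c + e) x)) d (u + l') -
      window (ray E (mobius a (2 * a + b) c (2 * c + e) x)) d (u + l)\<bar> \<le> \<bar>(u + l') - (u + l)\<bar>"
    by (rule window_Lipschitz[OF borel_polar(2)[OF Eb] d])
  moreover have "\<bar>window (ray E (mobius a b c e x)) d u - q\<bar> < \<epsilon>" using x(3) by blast
  moreover have "\<bar>window (ray E (mobius a (2 * a + b) c (2 * c + e) x)) d (u + l) - q'\<bar> < \<epsilon>" using x(4) by blast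
  ultimately show False using close \<epsilon>(2) by linarith
qed

text \<open>If the two window values differ at x, suitable rationals near them put x into one of the
  countably many null sets of \<open>window_ray_separated_null\<close>.\<close>

lemma window_ray_shift_AE:
  assumes E: "theta_invariant E" and l: "0 < l" "l \<le> 1 / 5" and d: "0 \<le> d"
  shows "AE x in lborel. x \<in> {0<..<1} \<longrightarrow> window (ray E x) d u = window (ray E x) d (u + l)"
proof -
  have Eb: "E \<in> sets borel" using E by (simp add: theta_invariant_def)
  define B where "B n q q' = {x \<in> {0<..<1}. \<bar>window (ray E x) d u - real_of_rat q\<bar> < 1 / (real n + 1) \<and>
    \<bar>window (ray E x) d (u + l) - real_of_rat q'\<bar> < 1 / (real n + 1)}" for n :: nat and q q' :: rat
  have Bb: "B n q q' \<in> sets borel" for n q q'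
  proof -
    note [measurable] = measurable_window_ray[OF Eb]
    have "{x \<in> space borel. \<bar>window (ray E x) d u - real_of_rat q\<bar> < 1 / (real n + 1) \<and>
      \<bar>window (ray E x) d (u + l) - real_of_rat q'\<bar> < 1 / (real n + 1)} \<in> sets borel" (is "?S \<in> _") by measurable
    then have "{0<..<1} \<inter> ?S \<in> sets borel" by (intro sets.Int) simp_all
    moreover have "B n q q' = {0<..<1} \<inter> ?S" by (auto simp: B_def)
    ultimately show ?thesis by (simp only:)
  qed
  have "AE x in lborel. 3 * (1 / (real n + 1)) \<le> \<bar>real_of_rat q - real_of_rat q'\<bar> \<longrightarrow> x \<notin> B n q q'" for n q q'
  proof (cases "3 * (1 / (real n + 1)) \<le> \<bar>real_of_rat q - real_of_rat q'\<bar>")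
    case True
    have "0 < 1 / (real n + 1)" by simp
    from window_ray_separated_null[OF E l d this True, of u] have "emeasure lborel (B n q q') = 0"
      unfolding B_def .
    then have "AE x in lborel. x \<notin> B n q q'" using AE_zero_iff_null[OF Bb] by blast
    then show ?thesis by (rule eventually_mono) simp
  qed simp
  then have ae: "AE x in lborel. \<forall>n q q'. 3 * (1 / (real n + 1)) \<le> \<bar>real_of_rat q - real_of_rat q'\<bar> \<longrightarrow> x \<notin> B n q q'"
    by (simp add: AE_all_countable)
  have imp: "window (ray E x) d u = window (ray E x) d (u + l)"
    if x: "\<forall>n q q'. 3 * (1 / (real n + 1)) \<le> \<bar>real_of_rat q - real_of_rat q'\<bar> \<longrightarrow> x \<notin> B n q q'"
      "x \<in> {0<..<1}" for x
  proof (rule ccontr)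
    assume x3: "window (ray E x) d u \<noteq> window (ray E x) d (u + l)"
    define D where "D = \<bar>window (ray E x) d u - window (ray E x) d (u + l)\<bar>"
    \<comment> \<open>With 5 e < D, rationals within e of the two values are more than 3 e
      apart.\<close>
    have "D / 5 > 0" using x3 by (simp add: D_def)
    then obtain n where n: "1 / real (Suc n) < D / 5" using nat_approx_posE by metis
    define e where "e = 1 / (real n + 1)"
    have e: "e > 0" "5 * e < D" using n by (auto simp: e_def add.commute)
    have rat: "\<exists>q. \<bar>w - real_of_rat q\<bar> < e" for w
    proof -
      obtain q where "w - e < real_of_rat q" "real_of_rat q < w" using of_rat_dense[of "w - e" w] e(1) by auto
      then show ?thesis by (intro exI[of _ q]) linarith
    qed
    obtain q q' where q: "\<bar>window (ray E x) d u - real_of_rat q\<bar> < e" "\<bar>window (ray E x) d (u + l) - real_of_rat q'\<bar> < e"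
      using rat by metis
    then have "3 * e \<le> \<bar>real_of_rat q - real_of_rat q'\<bar>" using e(2) unfolding D_def by linarith
    then have "x \<notin> B n q q'" using x(1) unfolding e_def by blast
    then show False using q x(2) by (simp add: B_def e_def)
  qed
  show ?thesis by (rule eventually_mono[OF ae]) (use imp in blast)
qed

text \<open>Rational base points and shifts give a single exceptional null set of directions;
  density of the rationals and the Lipschitz bound then reach every u.\<close>

lemma window_ray_constant_AE:
  assumes E: "theta_invariant E" and d: "0 \<le> d"
  shows "AE x in lborel. x \<in> {0<..<1} \<longrightarrow> (\<forall>u. window (ray E x) d u = window (ray E x) d 0)"
proof -
  have Eb: "E \<in> sets borel" using E by (simp add: theta_invariant_def)
  have "AE x in lborel. (0 < l \<and> l \<le> 1 / 5) \<longrightarrow> x \<in> {0<..<1} \<longrightarrow>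
      window (ray E x) d (real_of_rat u) = window (ray E x) d (real_of_rat u + real_of_rat l)" for u l :: rat
  proof (cases "0 < l \<and> l \<le> 1 / 5")
    case True
    then have "0 < real_of_rat l" "real_of_rat l \<le> 1 / 5"
      by (simp, metis of_rat_less_eq of_rat_divide of_rat_1 of_rat_numeral_eq)
    from window_ray_shift_AE[OF E this d, of "real_of_rat u"] show ?thesis by (rule eventually_mono) blast
  next
    case False
    then show ?thesis by (intro AE_I2) blast
  qed
  then have "AE x in lborel. \<forall>u l :: rat. (0 < l \<and> l \<le> 1 / 5) \<longrightarrow> x \<in> {0<..<1} \<longrightarrow>
      window (ray E x) d (real_of_rat u) = window (ray E x) d (real_of_rat u + real_of_rat l)"
    unfolding AE_all_countable by blast
  then show ?thesis
  proof (rule eventually_mono, intro impI allI)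
    fix x u assume x: "\<forall>u l :: rat. (0 < l \<and> l \<le> 1 / 5) \<longrightarrow> x \<in> {0<..<1} \<longrightarrow>
      window (ray E x) d (real_of_rat u) = window (ray E x) d (real_of_rat u + real_of_rat l)" "x \<in> {0<..<1}"
    define f where "f u = window (ray E x) d u" for u
    have step: "f (real_of_rat r + real_of_rat l) = f (real_of_rat r)" if "0 < l" "l \<le> 1 / 5" for r l :: rat
      using x that by (simp add: f_def)
    have steps: "f (real_of_rat (r + of_nat j * l)) = f (real_of_rat r)" if "0 < l" "l \<le> 1 / 5" for r l :: rat and j
    proof (induction j)
      case (Suc j)
      have "r + of_nat (Suc j) * l = (r + of_nat j * l) + l" by (simp add: algebra_simps)
      then have "f (real_of_rat (r + of_nat (Suc j) * l)) = f (real_of_rat (r + of_nat j * l) + real_of_rat l)"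
        by (simp only: of_rat_add)
      then show ?case using step[OF that] Suc by simp
    qed simp
    \<comment> \<open>A shift longer than 1 / 5 is divided into N equal short ones.\<close>
    have up: "f (real_of_rat (r + l)) = f (real_of_rat r)" if "0 < l" for r l :: rat
    proof -
      obtain N :: nat where N: "5 * l < of_nat N" using reals_Archimedean2[of "5 * l"] by blast
      have "0 < 5 * l" using that by simp
      then have "(of_nat N :: rat) > 0" using N by (rule less_trans)
      then have N0: "N > 0" by simp
      have "0 < l / of_nat N" "l / of_nat N \<le> 1 / 5" using that N N0 by (auto simp: field_simps)
      from steps[OF this, of r N] show ?thesis using N0 by simp
    qed
    have rat: "f (real_of_rat r) = f 0" for r :: rat
    proof -
      consider "r > 0" | "r < 0" | "r = 0" by linarith
      then show ?thesis
      proof cases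
        case 1 then show ?thesis using up[of r 0] by simp
      next
        case 2 then show ?thesis using up[of "- r" r] by simp
      qed simp
    qed
    have "\<bar>f u - f 0\<bar> \<le> e" if e: "e > 0" for e
    proof -
      obtain r where "u - e < real_of_rat r" "real_of_rat r < u" using of_rat_dense[of "u - e" u] e by auto
      moreover have "\<bar>f u - f (real_of_rat r)\<bar> \<le> \<bar>u - real_of_rat r\<bar>"
        unfolding f_def by (rule window_Lipschitz[OF borel_polar(2)[OF Eb] d])
      ultimately show ?thesis using rat[of r] by linarith
    qed
    then have "\<bar>f u - f 0\<bar> \<le> 0" by (rule dense_ge) 
    then show "window (ray E x) d u = window (ray E x) d 0" by (simp add: f_def)
  qed
qed

text \<open>If both alternatives failed, two matrices preserving E would each send all but a quarter
  of the directions into one of the two sets. A generic common direction x would then have a window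
  value, constant along its ray, that is both above q and at most q.\<close>

lemma window_ray_level_zero_one:
  assumes E: "theta_invariant E" and d: "0 \<le> d"
  shows "(AE x in lborel. x \<in> {0<..<1} \<longrightarrow> window (ray E x) d 0 \<le> q) \<or>
    (AE x in lborel. x \<in> {0<..<1} \<longrightarrow> q < window (ray E x) d 0)"
proof (rule ccontr)
  have Eb: "E \<in> sets borel" using E by (simp add: theta_invariant_def)
  note [measurable] = measurable_window_ray[OF Eb]
  define B1 where "B1 = {0<..<1} \<inter> {x \<in> space borel. \<not> window (ray E x) d 0 \<le> q}"
  define B2 where "B2 = {0<..<1} \<inter> {x \<in> space borel. \<not> q < window (ray E x) d 0}"
  assume "\<not> ?thesis"
  moreover have "(x \<notin> B1) = (x \<in> {0<..<1} \<longrightarrow> window (ray E x) d 0 \<le> q)"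
    "(x \<notin> B2) = (x \<in> {0<..<1} \<longrightarrow> q < window (ray E x) d 0)" for x
    by (auto simp: B1_def B2_def)
  ultimately have n: "\<not> (AE x in lborel. x \<notin> B1)" "\<not> (AE x in lborel. x \<notin> B2)" by (simp_all only: de_Morgan_disj simp_thms)
  have "{x \<in> space borel. \<not> window (ray E x) d 0 \<le> q} \<in> sets borel"
    "{x \<in> space borel. \<not> q < window (ray E x) d 0} \<in> sets borel" by measurable
  then have B: "B1 \<in> sets borel" "B2 \<in> sets borel" "B1 \<subseteq> {0<..<1}" "B2 \<subseteq> {0<..<1}"
    unfolding B1_def B2_def by (auto intro!: sets.Int)
  have nz: "emeasure lborel B1 \<noteq> 0" "emeasure lborel B2 \<noteq> 0" using n AE_zero_iff_null B by blast+
  have e: "(0::real) < 1 / 4" by simp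
  obtain a b c f where g: "preserves E a b c f" "0 < a + c" "0 < b + f"
    "emeasure lborel {x \<in> {0..1}. mobius a b c f x \<notin> B1} \<le> ennreal (1 / 4)"
    by (rule dense_theta_cone[OF E B(1,3) nz(1) e]) blast
  obtain a' b' c' f' where g': "preserves E a' b' c' f'" "0 < a' + c'" "0 < b' + f'"
    "emeasure lborel {x \<in> {0..1}. mobius a' b' c' f' x \<notin> B2} \<le> ennreal (1 / 4)"
    by (rule dense_theta_cone[OF E B(2,4) nz(2) e]) blast
  let ?S = "{x \<in> {0..1}. mobius a b c f x \<notin> B1}" and ?T = "{x \<in> {0..1}. mobius a' b' c' f' x \<notin> B2}"
  have mob: "{x \<in> {0..1}. mobius a b c e x \<notin> X} \<in> sets borel" if "X \<in> sets borel" for a b c e X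
  proof -
    have "mobius a b c e \<in> borel_measurable borel" unfolding mobius_def[abs_def] by measurable
    then have "mobius a b c e -` X \<in> sets borel" using measurable_sets[of "mobius a b c e" borel borel X] that by simp
    moreover have "{x \<in> {0..1}. mobius a b c e x \<notin> X} = {0..1} - mobius a b c e -` X" by auto
    ultimately show ?thesis by auto
  qed
  have ST: "?S \<in> sets lborel" "?T \<in> sets lborel" using mob B by simp_all
  have "AE x in lborel. x \<in> {0<..<1::real} \<longrightarrow> x \<in> ?S \<union> ?T"
  proof (rule eventually_mono[OF window_ray_constant_AE[OF E d]], intro impI, rule ccontr)
    fix x assume x: "x \<in> {0<..<1} \<longrightarrow> (\<forall>u. window (ray E x) d u = window (ray E x) d 0)" "x \<in> {0<..<1}" "x \<notin> ?S \<union> ?T"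
    have np: "0 < p * (1 - x) + r * x" if "0 < p" "0 < r" for p r using that x(2) by (simp add: add_pos_pos)
    have w: "window (ray E (mobius a b c f x)) d 0 = window (ray E x) d 0"
      if "preserves E a b c f" "0 < a + c" "0 < b + f" for a b c f
    proof -
      have "window (ray E (mobius a b c f x)) d (- ln ((a + c) * (1 - x) + (b + f) * x) + ln ((a + c) * (1 - x) + (b + f) * x)) =
          window (ray E x) d (- ln ((a + c) * (1 - x) + (b + f) * x))"
        by (rule window_ray_mobius[OF Eb that(1) np[OF that(2,3)]])
      also have "\<dots> = window (ray E x) d 0" using x(1,2) by blast
      finally show ?thesis by simp
    qed
    have "x \<in> {0..1}" using x(2) by simp
    then have "mobius a b c f x \<in> B1" "mobius a' b' c' f' x \<in> B2"
      using x(3) unfolding Un_iff mem_Collect_eq by argo+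
    then have "\<not> window (ray E (mobius a b c f x)) d 0 \<le> q" "\<not> q < window (ray E (mobius a' b' c' f' x)) d 0"
      unfolding B1_def B2_def by blast+
    then have "\<not> window (ray E x) d 0 \<le> q" "\<not> q < window (ray E x) d 0"
      by (simp_all only: w[OF g(1-3)] w[OF g'(1-3)])
    then show False by simp
  qed
  then have "emeasure lborel {0<..<1::real} \<le> emeasure lborel (?S \<union> ?T)"
    using ST by (intro emeasure_mono_AE) auto
  also have "\<dots> \<le> emeasure lborel ?S + emeasure lborel ?T" using ST by (rule emeasure_subadditive)
  also have "\<dots> \<le> ennreal (1 / 4) + ennreal (1 / 4)" using g(4) g'(4) by (rule add_mono)
  also have "\<dots> = ennreal (1 / 2)" by (simp add: ennreal_plus[symmetric] del: ennreal_plus)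
  finally have "emeasure lborel {0<..<1::real} \<le> ennreal (1 / 2)" .
  moreover have "emeasure lborel {0<..<1::real} = ennreal 1" by simp
  ultimately have "ennreal 1 \<le> ennreal (1 / 2)" by (simp only:)
  then have "(1::real) \<le> 1 / 2" by (subst (asm) ennreal_le_iff) simp_all
  then show False by simp
qed

text \<open>C is the essential supremum of the window values. By the dichotomy every smaller
  threshold is exceeded almost everywhere.\<close>

lemma window_ray_constant:
  assumes E: "theta_invariant E" and d: "0 \<le> d"
  shows "\<exists>C. AE x in lborel. x \<in> {0<..<1} \<longrightarrow> (\<forall>u. window (ray E x) d u = C)"
proof -
  have Eb: "E \<in> sets borel" using E by (simp add: theta_invariant_def)
  define P where "P q \<longleftrightarrow> (AE x in lborel. x \<in> {0<..<1} \<longrightarrow> window (ray E x) d 0 \<le> q)" for q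
  have wb: "0 \<le> window (ray E x) d 0" "window (ray E x) d 0 \<le> d" for x
    using window_bounds[OF borel_polar(2)[OF Eb] d] by auto
  have Pd: "P d" unfolding P_def using wb by simp
  have lower: "0 \<le> q" if "P q" for q
  proof (rule ccontr)
    assume "\<not> 0 \<le> q"
    have "AE x in lborel. x \<notin> {0<..<1::real}"
      using that unfolding P_def
    proof (rule eventually_mono)
      fix x assume "x \<in> {0<..<1} \<longrightarrow> window (ray E x) d 0 \<le> q"
      then show "x \<notin> {0<..<1}" using wb(1)[of x] \<open>\<not> 0 \<le> q\<close> by force
    qed
    then have "emeasure lborel {0<..<1::real} = 0" using AE_zero_iff_null[of "{0<..<1::real}"] by simp
    then show False by simp
  qed
  define C where "C = Inf {q. P q}"
  have bdd: "bdd_below {q. P q}" by (intro bdd_belowI[of _ 0]) (simp add: lower)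
  have up: "P (C + 1 / real (Suc n))" for n
  proof -
    have "C < C + 1 / real (Suc n)" by simp
    then obtain q where q: "P q" "q < C + 1 / real (Suc n)"
      using cInf_lessD[of "{q. P q}" "C + 1 / real (Suc n)"] Pd unfolding C_def by blast
    from q(1) show ?thesis unfolding P_def by (rule eventually_mono) (use q(2) in force)
  qed
  have dn: "AE x in lborel. x \<in> {0<..<1} \<longrightarrow> C - 1 / real (Suc n) < window (ray E x) d 0" for n
  proof -
    have "\<not> P (C - 1 / real (Suc n))"
    proof
      assume "P (C - 1 / real (Suc n))"
      then have "C \<le> C - 1 / real (Suc n)" unfolding C_def by (intro cInf_lower bdd) simp
      then show False by simp
    qed
    then show ?thesis using window_ray_level_zero_one[OF E d] unfolding P_def by blast
  qed
  have "AE x in lborel. (\<forall>n. x \<in> {0<..<1} \<longrightarrow> window (ray E x) d 0 \<le> C + 1 / real (Suc n)) \<and>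
      (\<forall>n. x \<in> {0<..<1} \<longrightarrow> C - 1 / real (Suc n) < window (ray E x) d 0) \<and>
      (x \<in> {0<..<1} \<longrightarrow> (\<forall>u. window (ray E x) d u = window (ray E x) d 0))"
    using up dn window_ray_constant_AE[OF E d] unfolding P_def by (intro AE_conjI) (simp_all only: AE_all_countable, blast+)
  then have "AE x in lborel. x \<in> {0<..<1} \<longrightarrow> (\<forall>u. window (ray E x) d u = C)"
  proof (rule eventually_mono, intro impI allI)
    fix x u assume x: "(\<forall>n. x \<in> {0<..<1} \<longrightarrow> window (ray E x) d 0 \<le> C + 1 / real (Suc n)) \<and>
      (\<forall>n. x \<in> {0<..<1} \<longrightarrow> C - 1 / real (Suc n) < window (ray E x) d 0) \<and>
      (x \<in> {0<..<1} \<longrightarrow> (\<forall>u. window (ray E x) d u = window (ray E x) d 0))" "x \<in> {0<..<1}"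
    have "window (ray E x) d 0 = C"
    proof (rule ccontr)
      assume "window (ray E x) d 0 \<noteq> C"
      then have "0 < \<bar>window (ray E x) d 0 - C\<bar>" by simp
      then obtain n where n: "1 / real (Suc n) < \<bar>window (ray E x) d 0 - C\<bar>" using nat_approx_posE by metis
      have "window (ray E x) d 0 \<le> C + 1 / real (Suc n)" "C - 1 / real (Suc n) < window (ray E x) d 0" using x by blast+
      then show False using n by linarith
    qed
    then show "window (ray E x) d u = C" using x by metis
  qed
  then show ?thesis by blast
qed

lemma window_Lipschitz_length:
  assumes E: "E \<in> sets borel" and "0 \<le> d" "0 \<le> e"
  shows "\<bar>window E d t - window E e t\<bar> \<le> \<bar>d - e\<bar>"
proof -
  have *: "\<bar>window E d t - window E e t\<bar> \<le> e - d" if "0 \<le> d" "d \<le> e" for d e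
    using window_add[OF E that(1), of "e - d" t] window_bounds[OF E, of "e - d" "t + d"] that by simp
  show ?thesis using *[of d e] *[of e d] assms by linarith
qed

text \<open>Lengths are first taken rational, so that one null set of directions serves all of them.
  The constant C 1 is common to almost all rays, hence the same case of
  \<open>constant_window_zero_one\<close> occurs on each of them.\<close>

theorem theta_zero_one:
  assumes E: "theta_invariant E"
  shows "(AE x in lborel. x \<in> {0<..<1} \<longrightarrow> emeasure lborel (ray E x) = 0) \<or>
    (AE x in lborel. x \<in> {0<..<1} \<longrightarrow> emeasure lborel (- ray E x) = 0)"
proof -
  have Eb: "E \<in> sets borel" using E by (simp add: theta_invariant_def)
  have "\<forall>d::rat. \<exists>C. 0 \<le> d \<longrightarrow> (AE x in lborel. x \<in> {0<..<1} \<longrightarrow> (\<forall>u. window (ray E x) (real_of_rat d) u = C))"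
  proof
    fix d :: rat
    show "\<exists>C. 0 \<le> d \<longrightarrow> (AE x in lborel. x \<in> {0<..<1} \<longrightarrow> (\<forall>u. window (ray E x) (real_of_rat d) u = C))"
    proof (cases "0 \<le> d")
      case True
      then have "0 \<le> real_of_rat d" by simp
      from window_ray_constant[OF E this] show ?thesis by blast
    qed blast
  qed
  from choice[OF this] obtain C where C: "\<And>d::rat. 0 \<le> d \<Longrightarrow> AE x in lborel. x \<in> {0<..<1} \<longrightarrow> (\<forall>u. window (ray E x) (real_of_rat d) u = C d)"
    by blast
  have "AE x in lborel. \<forall>d::rat. 0 \<le> d \<longrightarrow> x \<in> {0<..<1} \<longrightarrow> (\<forall>u. window (ray E x) (real_of_rat d) u = C d)"
    unfolding AE_all_countable
  proof
    fix d :: rat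
    show "AE x in lborel. 0 \<le> d \<longrightarrow> x \<in> {0<..<1} \<longrightarrow> (\<forall>u. window (ray E x) (real_of_rat d) u = C d)"
      using C[of d] by (cases "0 \<le> d") simp_all
  qed
  moreover have main: "(C 1 = 0 \<longrightarrow> emeasure lborel (ray E x) = 0) \<and> (C 1 \<noteq> 0 \<longrightarrow> emeasure lborel (- ray E x) = 0)"
    if x: "\<forall>d::rat. 0 \<le> d \<longrightarrow> x \<in> {0<..<1} \<longrightarrow> (\<forall>u. window (ray E x) (real_of_rat d) u = C d)" "x \<in> {0<..<1}" for x
  proof -
    have F: "ray E x \<in> sets borel" by (rule borel_polar[OF Eb])
    have c: "window (ray E x) d t = window (ray E x) d 0" if d: "0 \<le> d" for d t
    proof -
      have "\<bar>window (ray E x) d t - window (ray E x) d 0\<bar> \<le> e" if e: "e > 0" for e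
      proof -
        obtain r where r: "d < real_of_rat r" "real_of_rat r < d + e / 2" using of_rat_dense[of d "d + e / 2"] e by auto
        have r0: "0 \<le> real_of_rat r" using r d by linarith
        then have "window (ray E x) (real_of_rat r) t = window (ray E x) (real_of_rat r) 0" using x by simp
        then show ?thesis
          using window_Lipschitz_length[OF F d r0, of t] window_Lipschitz_length[OF F d r0, of 0] r by linarith
      qed
      then have "\<bar>window (ray E x) d t - window (ray E x) d 0\<bar> \<le> 0" by (rule dense_ge)
      then show ?thesis by simp
    qed
    have "window (ray E x) 1 0 = C 1" using x(1)[rule_format, of 1] x(2) by simp
    then show ?thesis using constant_window_zero_one[OF F, of "\<lambda>d. window (ray E x) d 0", OF c] by auto
  qed
  ultimately show ?thesis
  proof (cases "C 1 = 0")
    case True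
    assume ae: "AE x in lborel. \<forall>d::rat. 0 \<le> d \<longrightarrow> x \<in> {0<..<1} \<longrightarrow> (\<forall>u. window (ray E x) (real_of_rat d) u = C d)"
    then have "AE x in lborel. x \<in> {0<..<1} \<longrightarrow> emeasure lborel (ray E x) = 0"
      by (rule eventually_mono) (use main True in blast)
    then show ?thesis ..
  next
    case False
    assume ae: "AE x in lborel. \<forall>d::rat. 0 \<le> d \<longrightarrow> x \<in> {0<..<1} \<longrightarrow> (\<forall>u. window (ray E x) (real_of_rat d) u = C d)"
    then have "AE x in lborel. x \<in> {0<..<1} \<longrightarrow> emeasure lborel (- ray E x) = 0"
      by (rule eventually_mono) (use main False in blast)
    then show ?thesis ..
  qed
qed

subsection \<open>Ergodicity on the level set 2\<close>

definition sheet2 :: "real \<times> real \<Rightarrow> point" where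
  "sheet2 = (\<lambda>(s, t). (2 * sinh s, 2 * sinh t, - 2 * cosh (s + t)))"

lemma sheet2_apply: "sheet2 (s, t) = (2 * sinh s, 2 * sinh t, - 2 * cosh (s + t))"
  by (simp add: sheet2_def)

lemma sinh_cosh_product: "2 * sinh t * cosh (s + t) = sinh (s + 2 * t) - sinh (s :: real)"
proof -
  have "sinh ((s + t) + t) - sinh ((s + t) - t) = 2 * sinh t * cosh (s + t)"
    unfolding sinh_add[of "s + t" t] sinh_diff[of "s + t" t] by simp
  moreover have "(s + t) + t = s + 2 * t" "(s + t) - t = s" by simp_all
  ultimately show ?thesis by (simp only:)
qed

lemma sheet2_level: "sheet2 (s, t) \<in> level 2"
proof -
  have c: "(cosh x)\<^sup>2 = 1 + (sinh x)\<^sup>2" for x :: real by (simp add: cosh_square_eq)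
  have "(cosh (s + t))\<^sup>2 - 2 * sinh s * sinh t * cosh (s + t) = 1 + (sinh s)\<^sup>2 + (sinh t)\<^sup>2"
  proof -
    have "(cosh (s + t))\<^sup>2 - 2 * sinh s * sinh t * cosh (s + t) =
        (cosh s * cosh t + sinh s * sinh t) * (cosh s * cosh t - sinh s * sinh t)"
      unfolding cosh_add by (simp add: power2_eq_square algebra_simps)
    also have "\<dots> = (cosh s)\<^sup>2 * (cosh t)\<^sup>2 - (sinh s)\<^sup>2 * (sinh t)\<^sup>2"
      by (simp add: power2_eq_square algebra_simps)
    also have "\<dots> = 1 + (sinh s)\<^sup>2 + (sinh t)\<^sup>2" unfolding c by (simp add: algebra_simps)
    finally show ?thesis .
  qed
  then show ?thesis by (simp add: sheet2_apply level_def power_mult_distrib algebra_simps)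
qed

text \<open>In the parameters (s, t), \<open>Sw\<close> exchanges s and t, \<open>S2\<close> after
  \<open>V3\<close> sends s to - s, and \<open>V1\<close> sends s to - s - 2 t.\<close>

lemma theta_invariant_sheet2:
  assumes A: "A \<in> sets borel" and inv: "Gamma_invariant A"
  shows "theta_invariant {p. sheet2 p \<in> A}"
proof -
  have "continuous_on UNIV sheet2" unfolding sheet2_def case_prod_beta by (intro continuous_intros)
  then have "sheet2 -` A \<in> sets borel"
    using measurable_sets[OF borel_measurable_continuous_onI A] by simp
  moreover have "sheet2 (t, s) \<in> A \<longleftrightarrow> sheet2 (s, t) \<in> A" for s t
  proof -
    have "sheet2 (t, s) = Sw (sheet2 (s, t))" by (simp add: sheet2_apply add.commute)
    then show ?thesis using Gamma_invariantD[OF inv gens_in_Gamma(7)] by simp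
  qed
  moreover have "sheet2 (- s, t) \<in> A \<longleftrightarrow> sheet2 (s, t) \<in> A" for s t
  proof -
    have "cosh (t - s) = cosh s * cosh t - sinh s * sinh t" by (simp add: cosh_diff mult.commute)
    then have "sheet2 (- s, t) = S2 (V3 (sheet2 (s, t)))" by (simp add: sheet2_apply cosh_add algebra_simps)
    then show ?thesis using Gamma_invariantD[OF inv gens_in_Gamma(5)] Gamma_invariantD[OF inv gens_in_Gamma(3)] by simp
  qed
  moreover have "sheet2 (- s - 2 * t, t) \<in> A \<longleftrightarrow> sheet2 (s, t) \<in> A" for s t
  proof -
    have "sinh (- s - 2 * t) = - sinh (s + 2 * t)" "cosh (- s - 2 * t + t) = cosh (s + t)"
      using sinh_minus[of "s + 2 * t"] cosh_minus[of "s + t"] by (simp_all add: algebra_simps)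
    then have "sheet2 (- s - 2 * t, t) = V1 (sheet2 (s, t))"
      using sinh_cosh_product[of t s] by (simp add: sheet2_apply algebra_simps)
    then show ?thesis using Gamma_invariantD[OF inv gens_in_Gamma(1)] by simp
  qed
  ultimately show ?thesis unfolding theta_invariant_def by (simp add: vimage_def)
qed

text \<open>Directions in the open unit interval see only the quadrant s, t > 0, that is x, y > 0 >
  z. Sign changes make x and y nonnegative, and \<open>V3\<close> then exchanges the two roots of
  opposite sign if z is positive.\<close>

lemma negligible_level_2:
  assumes A: "A \<in> sets borel" "A \<subseteq> level 2" and inv: "Gamma_invariant A"
    and null: "AE x in lborel. x \<in> {0<..<1} \<longrightarrow> emeasure lborel (ray {p. sheet2 p \<in> A} x) = 0"
  shows "negligible (pxy ` A)"
proof -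
  define E where "E = {p. sheet2 p \<in> A}"
  have E: "E \<in> sets borel" using theta_invariant_sheet2[OF A(1) inv] by (simp add: theta_invariant_def E_def)
  define N where "N = {p. snd p \<in> ray E (fst p)} \<inter> {0<..<1} \<times> UNIV"
  have "N \<in> sets borel" unfolding N_def using borel_polar(1)[OF E] by (intro sets.Int borel_Times) auto
  then have negN: "negligible N"
  proof (rule negligible_AE_slices)
    show "AE x in lborel. emeasure lborel (Pair x -` N) = 0"
      using null
    proof (rule eventually_mono)
      fix x assume x: "x \<in> {0<..<1} \<longrightarrow> emeasure lborel (ray {p. sheet2 p \<in> A} x) = 0"
      show "emeasure lborel (Pair x -` N) = 0"
      proof (cases "x \<in> {0<..<1}")
        case True
        then have "Pair x -` N = ray E x" by (auto simp: N_def)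
        then show ?thesis using x True by (simp add: E_def)
      next
        case False
        then have e: "Pair x -` N = {}" by (auto simp: N_def)
        show ?thesis unfolding e by simp
      qed
    qed
  qed
  let ?f = "\<lambda>p. (2 * sinh (exp (snd p) * (1 - fst p)), 2 * sinh (exp (snd p) * fst p)) :: real \<times> real"
  have negf: "negligible (?f ` N)"
  proof (rule negligible_differentiable_image[OF negN])
    fix p :: "real \<times> real"
    have fs: "fst differentiable (at p)" "snd differentiable (at p)" by (rule differentiable_fst_snd)+
    have ex: "(\<lambda>p. exp (f p)) differentiable (at p)" if "f differentiable (at p)" for f :: "real \<times> real \<Rightarrow> real"
      using that unfolding differentiable_def by (blast intro: has_derivative_exp)
    have sh: "(\<lambda>p. sinh (f p)) differentiable (at p)" if "f differentiable (at p)" for f :: "real \<times> real \<Rightarrow> real"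
      unfolding sinh_field_def
      by (intro differentiable_divide differentiable_diff differentiable_minus differentiable_const ex that) simp
    show "?f differentiable (at p)"
      by (intro differentiable_Pair differentiable_mult differentiable_const sh ex fs differentiable_diff)
  qed
  have line: "negligible {p :: real \<times> real. snd p = 0}"
    by (rule negligible_finite_slices) (auto intro!: closed_Collect_eq continuous_intros)
  let ?P = "{(x, y, z) \<in> A. 0 < x \<and> 0 < y \<and> z < 0}"
  let ?X = "{(x, y, z) \<in> A. x = 0}" and ?Y = "{(x, y, z) \<in> A. y = 0}"
  have "pxy ` ?P \<subseteq> ?f ` N"
  proof (rule image_subsetI)
    fix p assume "p \<in> ?P"
    then obtain x y z where p: "p = (x, y, z)" "(x, y, z) \<in> A" "0 < x" "0 < y" "z < 0" by auto
    define s where "s = arsinh (x / 2)"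
    define t where "t = arsinh (y / 2)"
    have st: "2 * sinh s = x" "2 * sinh t = y" by (simp_all add: s_def t_def)
    have pos: "0 < s" "0 < t" using p(3,4) by (simp_all add: s_def t_def)
    have "sheet2 (s, t) = (x, y, z)"
    proof -
      have "(x, y, - 2 * cosh (s + t)) \<in> level 2" using sheet2_level[of s t] by (simp add: sheet2_apply st)
      moreover have "(x, y, z) \<in> level 2" using p(2) A(2) by blast
      ultimately have "z\<^sup>2 + x * y * z = (- 2 * cosh (s + t))\<^sup>2 + x * y * (- 2 * cosh (s + t))"
        "z\<^sup>2 + x * y * z = x\<^sup>2 + y\<^sup>2 + 4"
        by (simp_all add: level_def)
      then have prod: "(z - (- 2 * cosh (s + t))) * (z + (- 2 * cosh (s + t)) + x * y) = 0"
        "z * (z + x * y) = x\<^sup>2 + y\<^sup>2 + 4"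
        by (simp_all add: power2_eq_square algebra_simps)
      define w where "w = - 2 * cosh (s + t)"
      have w: "w < 0" using cosh_real_pos[of "s + t"] by (simp add: w_def)
      \<comment> \<open>z and w solve the same quadratic, whose two roots have opposite signs; both
        are negative, so they are the same root.\<close>
      have "z + w + x * y \<noteq> 0"
      proof
        assume "z + w + x * y = 0"
        then have "z + x * y = - w" by simp
        moreover have "z * w > 0" using p(5) w by (rule mult_neg_neg)
        ultimately have "z * (z + x * y) < 0" by simp
        then show False using prod(2) sum_power2_ge_zero[of x y] by linarith
      qed
      then have "z = w" using prod(1) unfolding w_def[symmetric] by simp
      then show ?thesis by (simp add: sheet2_apply st w_def)
    qed
    then have inE: "(s, t) \<in> E" using p(2) by (simp add: E_def)
    define v where "v = ln (s + t)"
    have ev: "exp v = s + t" using pos by (simp add: v_def)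
    \<comment> \<open>Polar coordinates as in \<open>ray\<close>: \<xi> is the direction and v the
      logarithm of the coordinate sum.\<close>
    define \<xi> where "\<xi> = t / (s + t)"
    have \<xi>: "0 < \<xi>" "\<xi> < 1" "(s + t) * \<xi> = t" "(s + t) * (1 - \<xi>) = s"
      using pos by (simp_all add: \<xi>_def field_simps)
    have "(\<xi>, v) \<in> N" using \<xi> inE by (simp add: N_def ray_def ev)
    moreover have "pxy p = ?f (\<xi>, v)" using \<xi>(3,4) by (simp add: p(1) ev st)
    ultimately show "pxy p \<in> ?f ` N" by blast
  qed
  then have P: "negligible (pxy ` ?P)" using negf negligible_subset by blast
  have "pxy ` ?Y \<subseteq> {p. snd p = 0}" by auto
  then have Y: "negligible (pxy ` ?Y)" using line negligible_subset by blast
  have "pxy ` ?X \<subseteq> prod.swap ` {p. snd p = 0}"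
  proof (rule image_subsetI)
    fix p assume "p \<in> ?X"
    then obtain y z where "p = (0, y, z)" by auto
    then show "pxy p \<in> prod.swap ` {p. snd p = 0}" by (intro image_eqI[of _ _ "(y, 0)"]) auto
  qed
  then have X: "negligible (pxy ` ?X)" using negligible_swap[OF line] negligible_subset by blast
  show ?thesis
  proof (rule negligible_pxy_cover[OF A(2)])
    show "?P \<union> ?X \<union> ?Y \<subseteq> level 2" using A(2) by auto
    show "negligible (pxy ` (?P \<union> ?X \<union> ?Y))" unfolding image_Un using P X Y by (intro negligible_Un)
    fix p assume p: "p \<in> A"
    obtain x y z where xyz: "p = (x, y, z)" by (cases p)
    have zz: "z * (- (x * y) - z) < 0"
    proof -
      have "(x, y, z) \<in> level 2" using p A(2) xyz by blast
      then show ?thesis using zz'[of x y z 2] sum_power2_ge_zero[of x y] by linarith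
    qed
    have mem: "g (x, y, z) \<in> A" if "g \<in> Gamma_group" for g using Gamma_invariantD[OF inv that] p xyz by simp
    have "\<exists>g\<in>Gamma_group. \<exists>c. g (x, y, z) = (\<bar>x\<bar>, \<bar>y\<bar>, c)"
    proof -
      consider "0 \<le> x" "0 \<le> y" | "0 \<le> x" "y < 0" | "x < 0" "0 \<le> y" | "x < 0" "y < 0" by linarith
      then show ?thesis
      proof cases
        case 1 then show ?thesis by (intro bexI[OF _ Gamma_id]) simp
      next
        case 2 then show ?thesis by (intro bexI[OF _ gens_in_Gamma(4)]) simp
      next
        case 3 then show ?thesis by (intro bexI[OF _ gens_in_Gamma(5)]) simp
      next
        case 4 then show ?thesis by (intro bexI[OF _ gens_in_Gamma(6)]) simp
      qed
    qed
    then obtain g c where g: "g \<in> Gamma_group" "g (x, y, z) = (\<bar>x\<bar>, \<bar>y\<bar>, c)" by blast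
    have gA: "(\<bar>x\<bar>, \<bar>y\<bar>, c) \<in> A" using mem[OF g(1)] g(2) by simp
    then have cc: "c * (- (\<bar>x\<bar> * \<bar>y\<bar>) - c) < 0"
    proof -
      have "(\<bar>x\<bar>, \<bar>y\<bar>, c) \<in> level 2" using gA A(2) by blast
      then show ?thesis using zz'[of "\<bar>x\<bar>" "\<bar>y\<bar>" c 2] sum_power2_ge_zero[of "\<bar>x\<bar>" "\<bar>y\<bar>"] by linarith
    qed
    obtain h where h: "h \<in> Gamma_group" "\<And>p. h p = V3 (g p)" using Gamma_compE[OF gens_in_Gamma(3) g(1)] by blast
    have hA: "(\<bar>x\<bar>, \<bar>y\<bar>, - (\<bar>x\<bar> * \<bar>y\<bar>) - c) \<in> A" using mem[OF h(1)] by (simp add: h(2) g(2))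
    have "c < 0 \<or> - (\<bar>x\<bar> * \<bar>y\<bar>) - c < 0" using cc by (auto simp: mult_less_0_iff)
    then have "(\<bar>x\<bar>, \<bar>y\<bar>, c) \<in> ?P \<union> ?X \<union> ?Y \<or> (\<bar>x\<bar>, \<bar>y\<bar>, - (\<bar>x\<bar> * \<bar>y\<bar>) - c) \<in> ?P \<union> ?X \<union> ?Y"
      using gA hA by auto
    then have "g p \<in> ?P \<union> ?X \<union> ?Y \<or> h p \<in> ?P \<union> ?X \<union> ?Y"
      unfolding xyz h(2) g(2) gen_apply .
    then show "\<exists>g\<in>Gamma_group. g p \<in> ?P \<union> ?X \<union> ?Y"
      by (elim disjE[of "g p \<in> _"]) (rule bexI[OF _ g(1)], assumption, rule bexI[OF _ h(1)], assumption)
  qed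
qed

theorem ergodic_2: "ergodic_on Gamma_group (completion (area_measure 2)) (level 2)"
proof (rule ergodic_onI_invariant)
  fix A assume A: "A \<in> sets borel" "A \<subseteq> level 2" and inv: "Gamma_invariant A"
  have B: "level 2 - A \<in> sets borel" using A(1) closed_level[of 2] by auto
  have invB: "Gamma_invariant (level 2 - A)"
    unfolding Gamma_invariant_def level_def using Gamma_kappa Gamma_invariantD[OF inv]
    by (simp only: Diff_iff mem_Collect_eq) simp
  have "ray {p. sheet2 p \<in> level 2 - A} x = - ray {p. sheet2 p \<in> A} x" for x
    using sheet2_level by (auto simp: ray_def)
  then show "negligible (pxy ` A) \<or> negligible (pxy ` (level 2 - A))"
    using theta_zero_one[OF theta_invariant_sheet2[OF A(1) inv]]
      negligible_level_2[OF A inv] negligible_level_2[OF B _ invB] by auto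
qed simp

subsection \<open>Charts of the level sets above 2\<close>

definition chart_disc :: "real \<Rightarrow> real^2 \<Rightarrow> real" where
  "chart_disc k v = (v $ 1)\<^sup>2 * (v $ 2)\<^sup>2 + 4 * ((v $ 1)\<^sup>2 + (v $ 2)\<^sup>2 + k + 2)"

text \<open>For k > 2 the discriminant is positive everywhere, so each of the sheets z > 0 and z < 0
  is a global graph over the plane; e = 1 or e = -1 is the sign of z.\<close>

definition chart :: "real \<Rightarrow> real \<Rightarrow> real^2 \<Rightarrow> point" where
  "chart k e v = (v $ 1, v $ 2, (- (v $ 1 * v $ 2) + e * sqrt (chart_disc k v)) / 2)"

lemma chart_disc_ge: "4 * (k + 2) \<le> chart_disc k v"
proof -
  have "0 \<le> (v $ 1)\<^sup>2 * (v $ 2)\<^sup>2" by simp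
  moreover have "0 \<le> (v $ 1)\<^sup>2" "0 \<le> (v $ 2)\<^sup>2" by simp_all
  ultimately show ?thesis unfolding chart_disc_def by argo
qed

lemma Bxy_chart: "Bxy (chart k e v) = e * sqrt (chart_disc k v)"
  by (simp add: chart_def field_simps)

lemma chart_level:
  assumes "k > 2" "e\<^sup>2 = 1" shows "chart k e v \<in> level k"
proof -
  have "0 \<le> chart_disc k v" using chart_disc_ge[of k v] assms(1) by argo
  then have s: "(sqrt (chart_disc k v))\<^sup>2 = chart_disc k v" by simp
  define s where "s = sqrt (chart_disc k v)"
  have "(e * s)\<^sup>2 = (v $ 1)\<^sup>2 * (v $ 2)\<^sup>2 + 4 * ((v $ 1)\<^sup>2 + (v $ 2)\<^sup>2 + k + 2)"
    using s assms(2) by (simp add: power_mult_distrib chart_disc_def s_def)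
  then show ?thesis
    unfolding level_def chart_def s_def[symmetric] by (simp add: power2_eq_square field_simps)
qed

lemma level_sign:
  assumes "k > 2" "(x, y, z) \<in> level k"
  shows "z * Bxy (x, y, z) > 0" "z * (- (x * y) - z) < 0"
proof -
  have "z * (- (x * y) - z) = - (k + 2 + x\<^sup>2 + y\<^sup>2)" using zz'[OF assms(2)] .
  then show "z * (- (x * y) - z) < 0" using assms(1) sum_power2_ge_zero[of x y] by linarith
  moreover have "z * Bxy (x, y, z) = z * z - z * (- (x * y) - z)" by (simp add: algebra_simps)
  moreover have "z * z \<ge> 0" by simp
  ultimately show "z * Bxy (x, y, z) > 0" by linarith
qed

lemma chart_eqI:
  assumes k: "k > 2" and p: "(x, y, z) \<in> level k" and e: "e\<^sup>2 = 1" "0 < e * z"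
  shows "(x, y, z) = chart k e (vector [x, y])"
proof -
  have "(Bxy (x, y, z))\<^sup>2 = chart_disc k (vector [x, y])"
    using Bxy_square[OF p] by (simp add: chart_disc_def)
  then have "sqrt (chart_disc k (vector [x, y])) = \<bar>Bxy (x, y, z)\<bar>" by (metis real_sqrt_abs)
  moreover have e1: "e = 1 \<or> e = -1" using e(1) by (simp add: power2_eq_1_iff)
  moreover have "z * Bxy (x, y, z) > 0" by (rule level_sign(1)[OF k p])
  ultimately have "e * sqrt (chart_disc k (vector [x, y])) = 2 * z + x * y"
    using e(2) by (auto simp: zero_less_mult_iff abs_if)
  then show ?thesis by (simp add: chart_def)
qed

lemma chart_sign:
  assumes "k > 2" "e\<^sup>2 = 1" shows "0 < e * snd (snd (chart k e v))"
proof -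
  obtain x y z where xyz: "chart k e v = (x, y, z)" by (cases "chart k e v")
  have "z * Bxy (x, y, z) > 0" using level_sign(1)[OF assms(1)] chart_level[OF assms] xyz by metis
  then have "(z * e) * sqrt (chart_disc k v) > 0" using Bxy_chart[of k e v] xyz by (metis mult.assoc)
  moreover have "sqrt (chart_disc k v) > 0" using chart_disc_ge[of k v] assms(1) by simp
  ultimately have "z * e > 0" by (metis zero_less_mult_pos2)
  then show ?thesis by (simp add: xyz mult.commute)
qed

text \<open>The area form in a chart is dx dy / |Bxy|.\<close>

definition chart_area_preserving :: "real \<Rightarrow> (point \<Rightarrow> point) \<Rightarrow> bool" where
  "chart_area_preserving k g \<longleftrightarrow> (\<forall>e. e\<^sup>2 = 1 \<longrightarrow> (\<exists>e' G. e'\<^sup>2 = 1 \<and>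
     (\<forall>v. g (chart k e v) = chart k e' (G v) \<and> (\<exists>G'. (G has_derivative G') (at v) \<and>
       \<bar>det (matrix G')\<bar> * \<bar>Bxy (chart k e v)\<bar> = \<bar>Bxy (g (chart k e v))\<bar>))))"

lemma chart_area_preservingE:
  assumes "chart_area_preserving k g" "e\<^sup>2 = 1"
  obtains e' G G' where "e'\<^sup>2 = 1" "\<And>v. g (chart k e v) = chart k e' (G v)"
    "\<And>v. (G has_derivative G' v) (at v)"
    "\<And>v. \<bar>det (matrix (G' v))\<bar> * \<bar>Bxy (chart k e v)\<bar> = \<bar>Bxy (g (chart k e v))\<bar>"
proof -
  obtain e' G where *: "e'\<^sup>2 = 1" "\<forall>v. g (chart k e v) = chart k e' (G v) \<and> (\<exists>G'. (G has_derivative G') (at v) \<and>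
       \<bar>det (matrix G')\<bar> * \<bar>Bxy (chart k e v)\<bar> = \<bar>Bxy (g (chart k e v))\<bar>)"
    using assms unfolding chart_area_preserving_def by blast
  have "\<forall>v. \<exists>G'. (G has_derivative G') (at v) \<and>
       \<bar>det (matrix G')\<bar> * \<bar>Bxy (chart k e v)\<bar> = \<bar>Bxy (g (chart k e v))\<bar>" using *(2) by blast
  then obtain G' where "\<forall>v. (G has_derivative G' v) (at v) \<and>
       \<bar>det (matrix (G' v))\<bar> * \<bar>Bxy (chart k e v)\<bar> = \<bar>Bxy (g (chart k e v))\<bar>" by (rule choice[THEN exE])
  then show ?thesis using that[OF *(1)] *(2) by blast
qed

lemma chart_area_preserving_comp:
  assumes "chart_area_preserving k g" "chart_area_preserving k h"
  shows "chart_area_preserving k (g \<circ> h)"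
  unfolding chart_area_preserving_def
proof (intro allI impI)
  fix e :: real assume e: "e\<^sup>2 = 1"
  obtain e1 H H' where H: "e1\<^sup>2 = 1" "\<And>v. h (chart k e v) = chart k e1 (H v)"
    "\<And>v. (H has_derivative H' v) (at v)"
    "\<And>v. \<bar>det (matrix (H' v))\<bar> * \<bar>Bxy (chart k e v)\<bar> = \<bar>Bxy (h (chart k e v))\<bar>"
    using chart_area_preservingE[OF assms(2) e] by metis
  obtain e2 G G' where G: "e2\<^sup>2 = 1" "\<And>v. g (chart k e1 v) = chart k e2 (G v)"
    "\<And>v. (G has_derivative G' v) (at v)"
    "\<And>v. \<bar>det (matrix (G' v))\<bar> * \<bar>Bxy (chart k e1 v)\<bar> = \<bar>Bxy (g (chart k e1 v))\<bar>"
    using chart_area_preservingE[OF assms(1) H(1)] by metis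
  show "\<exists>e' F. e'\<^sup>2 = 1 \<and>
     (\<forall>v. (g \<circ> h) (chart k e v) = chart k e' (F v) \<and> (\<exists>F'. (F has_derivative F') (at v) \<and>
       \<bar>det (matrix F')\<bar> * \<bar>Bxy (chart k e v)\<bar> = \<bar>Bxy ((g \<circ> h) (chart k e v))\<bar>))"
  proof (intro exI conjI allI)
    show "e2\<^sup>2 = 1" by (rule G(1))
    fix v
    show "(g \<circ> h) (chart k e v) = chart k e2 ((G \<circ> H) v)" by (simp only: comp_apply H(2) G(2))
    show "(G \<circ> H has_derivative G' (H v) \<circ> H' v) (at v)"
      by (rule diff_chain_at[OF H(3) G(3)])
    have "matrix (G' (H v) \<circ> H' v) = matrix (G' (H v)) ** matrix (H' v)"
      by (rule matrix_compose[OF has_derivative_linear[OF H(3)] has_derivative_linear[OF G(3)]])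
    then have d: "\<bar>det (matrix (G' (H v) \<circ> H' v))\<bar> = \<bar>det (matrix (G' (H v)))\<bar> * \<bar>det (matrix (H' v))\<bar>"
      by (simp only: det_mul abs_mult)
    show "\<bar>det (matrix (G' (H v) \<circ> H' v))\<bar> * \<bar>Bxy (chart k e v)\<bar> = \<bar>Bxy ((g \<circ> h) (chart k e v))\<bar>"
      using H(4)[of v] G(4)[of "H v"] unfolding d comp_apply H(2) mult.assoc by metis
  qed
qed

lemma has_derivative_vector_2:
  fixes a b :: "real^2 \<Rightarrow> real"
  assumes "(a has_derivative (\<lambda>h. a1 * h $ 1 + a2 * h $ 2)) (at v)"
    "(b has_derivative (\<lambda>h. b1 * h $ 1 + b2 * h $ 2)) (at v)"
  shows "((\<lambda>v. vector [a v, b v] :: real^2) has_derivative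
      (\<lambda>h. vector [a1 * h $ 1 + a2 * h $ 2, b1 * h $ 1 + b2 * h $ 2])) (at v)"
    "det (matrix (\<lambda>h :: real^2. vector [a1 * h $ 1 + a2 * h $ 2, b1 * h $ 1 + b2 * h $ 2] :: real^2)) = a1 * b2 - a2 * b1"
proof -
  have v: "(vector [s, t] :: real^2) = s *\<^sub>R axis 1 1 + t *\<^sub>R axis 2 1" for s t
    by (simp add: vec_eq_iff forall_2 axis_def)
  show "((\<lambda>v. vector [a v, b v] :: real^2) has_derivative
      (\<lambda>h. vector [a1 * h $ 1 + a2 * h $ 2, b1 * h $ 1 + b2 * h $ 2])) (at v)"
    unfolding v by (rule has_derivative_add[OF assms[THEN has_derivative_scaleR_left]])
  show "det (matrix (\<lambda>h :: real^2. vector [a1 * h $ 1 + a2 * h $ 2, b1 * h $ 1 + b2 * h $ 2] :: real^2)) = a1 * b2 - a2 * b1"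
    by (simp add: det_2 matrix_def axis_def)
qed

text \<open>c tells whether g preserves or exchanges the two sheets. Once the image sheet is known,
  g is determined in charts by its first two coordinates, and the Jacobian by four partial
  derivatives.\<close>

lemma chart_area_preservingI:
  assumes k: "k > 2" and g: "\<And>p. p \<in> level k \<Longrightarrow> g p \<in> level k"
    and c: "c = 1 \<or> c = - 1" "\<And>p. p \<in> level k \<Longrightarrow> 0 < c * (snd (snd p) * snd (snd (g p)))"
    and der: "\<And>e. e\<^sup>2 = 1 \<Longrightarrow> \<exists>a b. (\<forall>v. fst (g (chart k e v)) = a v \<and> fst (snd (g (chart k e v))) = b v) \<and>
      (\<forall>v. \<exists>a1 a2 b1 b2. (a has_derivative (\<lambda>h. a1 * h $ 1 + a2 * h $ 2)) (at v) \<and>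
        (b has_derivative (\<lambda>h. b1 * h $ 1 + b2 * h $ 2)) (at v) \<and>
        \<bar>a1 * b2 - a2 * b1\<bar> * \<bar>Bxy (chart k e v)\<bar> = \<bar>Bxy (g (chart k e v))\<bar>)"
  shows "chart_area_preserving k g"
  unfolding chart_area_preserving_def
proof (intro allI impI)
  fix e :: real assume e: "e\<^sup>2 = 1"
  obtain a b where ab: "\<forall>v. fst (g (chart k e v)) = a v \<and> fst (snd (g (chart k e v))) = b v"
      and D: "\<forall>v. \<exists>a1 a2 b1 b2. (a has_derivative (\<lambda>h. a1 * h $ 1 + a2 * h $ 2)) (at v) \<and>
        (b has_derivative (\<lambda>h. b1 * h $ 1 + b2 * h $ 2)) (at v) \<and>
        \<bar>a1 * b2 - a2 * b1\<bar> * \<bar>Bxy (chart k e v)\<bar> = \<bar>Bxy (g (chart k e v))\<bar>"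
    using der[OF e] by blast
  have ce: "(c * e)\<^sup>2 = 1" using c(1) e by (auto simp: power_mult_distrib)
  show "\<exists>e' G. e'\<^sup>2 = 1 \<and>
     (\<forall>v. g (chart k e v) = chart k e' (G v) \<and> (\<exists>G'. (G has_derivative G') (at v) \<and>
       \<bar>det (matrix G')\<bar> * \<bar>Bxy (chart k e v)\<bar> = \<bar>Bxy (g (chart k e v))\<bar>))"
  proof (rule exI[of _ "c * e"], rule exI[of _ "\<lambda>v. vector [a v, b v]"], intro conjI allI)
    show "(c * e)\<^sup>2 = 1" by (rule ce)
    fix v
    obtain z where z: "g (chart k e v) = (a v, b v, z)"
      using ab by (metis prod.collapse)
    have lev: "(a v, b v, z) \<in> level k" using g[OF chart_level[OF k e], of v] z by simp
    have "0 < (c * (snd (snd (chart k e v)) * z)) * (e * snd (snd (chart k e v)))"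
      using c(2)[OF chart_level[OF k e], of v] chart_sign[OF k e, of v] z by (intro mult_pos_pos[of "c * _"]) simp_all
    also have "\<dots> = (c * e * z) * (snd (snd (chart k e v)))\<^sup>2" by (simp add: power2_eq_square)
    finally have "0 < c * e * z" by (simp add: zero_less_mult_iff)
    then show "g (chart k e v) = chart k (c * e) (vector [a v, b v])"
      using chart_eqI[OF k lev ce] z by simp
    obtain a1 a2 b1 b2 where d: "(a has_derivative (\<lambda>h. a1 * h $ 1 + a2 * h $ 2)) (at v)"
        "(b has_derivative (\<lambda>h. b1 * h $ 1 + b2 * h $ 2)) (at v)"
        "\<bar>a1 * b2 - a2 * b1\<bar> * \<bar>Bxy (chart k e v)\<bar> = \<bar>Bxy (g (chart k e v))\<bar>"
      using D by blast
    show "\<exists>G'. ((\<lambda>v. vector [a v, b v]) has_derivative G') (at v) \<and>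
       \<bar>det (matrix G')\<bar> * \<bar>Bxy (chart k e v)\<bar> = \<bar>Bxy (g (chart k e v))\<bar>"
      by (intro exI conjI, rule has_derivative_vector_2(1)[OF d(1,2)])
        (unfold has_derivative_vector_2(2)[OF d(1,2)], rule d(3))
  qed
qed

text \<open>The x-derivative alone is made explicit: in a chart the derivative of \<open>V1\<close>
  is triangular, with determinant y z1 - 1.\<close>

lemma has_derivative_chart_z:
  assumes k: "k > 2" and e: "e\<^sup>2 = 1"
  obtains z1 z2 where "((\<lambda>v. snd (snd (chart k e v))) has_derivative (\<lambda>h. z1 * h $ 1 + z2 * h $ 2)) (at v)"
    "z1 = (- v $ 2 + e * (v $ 1 * (v $ 2)\<^sup>2 + 4 * v $ 1) / sqrt (chart_disc k v)) / 2"
proof -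
  have d: "chart_disc k v > 0" using chart_disc_ge[of k v] k by simp
  define c1 c2 where "c1 = 2 * (v $ 1 * (v $ 2)\<^sup>2 + 4 * v $ 1)" and "c2 = 2 * ((v $ 1)\<^sup>2 * v $ 2 + 4 * v $ 2)"
  have coord: "((\<lambda>v :: real^2. v $ i) has_derivative (\<lambda>h. h $ i)) (at v)" for i
    by (rule bounded_linear_imp_has_derivative) (rule bounded_linear_vec_nth)
  have D: "(chart_disc k has_derivative (\<lambda>h. c1 * h $ 1 + c2 * h $ 2)) (at v)"
    unfolding chart_disc_def
    by (rule derivative_eq_intros coord refl)+ (simp add: fun_eq_iff c1_def c2_def power2_eq_square algebra_simps)
  have "(sqrt has_derivative (\<lambda>h. h * (inverse (sqrt (chart_disc k v)) / 2))) (at (chart_disc k v))"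
    by (rule has_derivative_eq_rhs[OF DERIV_real_sqrt[OF d, unfolded has_field_derivative_def]])
      (simp add: fun_eq_iff)
  then have S: "((\<lambda>v. sqrt (chart_disc k v)) has_derivative
      (\<lambda>h. (c1 * h $ 1 + c2 * h $ 2) * (inverse (sqrt (chart_disc k v)) / 2))) (at v)"
    using diff_chain_at[OF D] by (simp add: o_def)
  define z1 z2 where "z1 = (- v $ 2 + e * (c1 * (inverse (sqrt (chart_disc k v)) / 2))) / 2"
    and "z2 = (- v $ 1 + e * (c2 * (inverse (sqrt (chart_disc k v)) / 2))) / 2"
  have 1: "((\<lambda>v. 1 / 2 * (e * sqrt (chart_disc k v) - v $ 1 * v $ 2)) has_derivative
      (\<lambda>h. 1 / 2 * (e * ((c1 * h $ 1 + c2 * h $ 2) * (inverse (sqrt (chart_disc k v)) / 2)) -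
        (v $ 1 * h $ 2 + h $ 1 * v $ 2)))) (at v)"
    by (intro has_derivative_mult_right has_derivative_diff S has_derivative_mult coord)
  have 2: "(\<lambda>v. 1 / 2 * (e * sqrt (chart_disc k v) - v $ 1 * v $ 2)) = (\<lambda>v. snd (snd (chart k e v)))"
    by (simp add: chart_def fun_eq_iff field_simps)
  have 3: "1 / 2 * (e * ((c1 * h $ 1 + c2 * h $ 2) * (inverse (sqrt (chart_disc k v)) / 2)) -
        (v $ 1 * h $ 2 + h $ 1 * v $ 2)) = z1 * h $ 1 + z2 * h $ 2" for h :: "real^2"
    unfolding z1_def z2_def by (simp add: algebra_simps add_divide_distrib diff_divide_distrib)
  show ?thesis
  proof (rule that[of z1 z2])
    show "((\<lambda>v. snd (snd (chart k e v))) has_derivative (\<lambda>h. z1 * h $ 1 + z2 * h $ 2)) (at v)"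
      using 1 unfolding 2 3 .
    show "z1 = (- v $ 2 + e * (v $ 1 * (v $ 2)\<^sup>2 + 4 * v $ 1) / sqrt (chart_disc k v)) / 2"
      using d by (simp add: z1_def c1_def field_simps)
  qed
qed

lemma chart_area_preserving_gens:
  assumes k: "k > 2" and g: "g \<in> Gamma_gens"
  shows "chart_area_preserving k g"
proof -
  have coord: "((\<lambda>v :: real^2. v $ i) has_derivative (\<lambda>h. h $ i)) (at v)" for i v
    by (rule bounded_linear_imp_has_derivative) (rule bounded_linear_vec_nth)
  have lin: "((\<lambda>v :: real^2. s * v $ 1 + t * v $ 2) has_derivative (\<lambda>h. s * h $ 1 + t * h $ 2)) (at v)" for s t v
    by (rule derivative_eq_intros coord refl)+ simp
  have linear: "chart_area_preserving k g"
    if g: "g \<in> Gamma_group" and c: "c = 1 \<or> c = - 1"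
      "\<And>p. p \<in> level k \<Longrightarrow> 0 < c * (snd (snd p) * snd (snd (g p)))"
      and f: "\<And>x y z. fst (g (x, y, z)) = s * x + t * y" "\<And>x y z. fst (snd (g (x, y, z))) = s' * x + t' * y"
      and B: "\<And>p. \<bar>s * t' - t * s'\<bar> * \<bar>Bxy p\<bar> = \<bar>Bxy (g p)\<bar>" for g c s t s' t'
  proof (rule chart_area_preservingI[where g = g and c = c, OF k _ c])
    fix e :: real
    show "\<exists>a b. (\<forall>v. fst (g (chart k e v)) = a v \<and> fst (snd (g (chart k e v))) = b v) \<and>
      (\<forall>v. \<exists>a1 a2 b1 b2. (a has_derivative (\<lambda>h. a1 * h $ 1 + a2 * h $ 2)) (at v) \<and>
        (b has_derivative (\<lambda>h. b1 * h $ 1 + b2 * h $ 2)) (at v) \<and>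
        \<bar>a1 * b2 - a2 * b1\<bar> * \<bar>Bxy (chart k e v)\<bar> = \<bar>Bxy (g (chart k e v))\<bar>)"
    proof (rule exI[of _ "\<lambda>v. s * v $ 1 + t * v $ 2"], rule exI[of _ "\<lambda>v. s' * v $ 1 + t' * v $ 2"], intro conjI allI)
      fix v
      show "fst (g (chart k e v)) = s * v $ 1 + t * v $ 2" "fst (snd (g (chart k e v))) = s' * v $ 1 + t' * v $ 2"
        unfolding chart_def f by simp_all
      show "\<exists>a1 a2 b1 b2. ((\<lambda>v. s * v $ 1 + t * v $ 2) has_derivative (\<lambda>h. a1 * h $ 1 + a2 * h $ 2)) (at v) \<and>
        ((\<lambda>v. s' * v $ 1 + t' * v $ 2) has_derivative (\<lambda>h. b1 * h $ 1 + b2 * h $ 2)) (at v) \<and>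
        \<bar>a1 * b2 - a2 * b1\<bar> * \<bar>Bxy (chart k e v)\<bar> = \<bar>Bxy (g (chart k e v))\<bar>"
        by (intro exI conjI, rule lin, rule lin, rule B)
    qed
  qed (rule Gamma_level[OF g])
  have sq: "0 < snd (snd p) * snd (snd p)" "0 < - 1 * (snd (snd p) * snd (snd (V3 p)))" if p: "p \<in> level k" for p
  proof -
    obtain x y z where xyz: "p = (x, y, z)" by (cases p)
    have "z * (- (x * y) - z) < 0" using level_sign(2)[OF k, of x y z] p xyz by simp
    then show "0 < - 1 * (snd (snd p) * snd (snd (V3 p)))" by (simp add: xyz)
    have "z \<noteq> 0" using \<open>z * (- (x * y) - z) < 0\<close> by auto
    then show "0 < snd (snd p) * snd (snd p)" unfolding xyz by (simp add: zero_less_mult_iff) linarith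
  qed
  have gz: "snd (snd (V1 p)) = snd (snd p)" "snd (snd (S1 p)) = - snd (snd p)" "snd (snd (S2 p)) = - snd (snd p)"
    "snd (snd (S3 p)) = snd (snd p)" "snd (snd (Sw p)) = snd (snd p)" for p
    by (cases p; simp)+
  have gB: "\<bar>Bxy (S1 p)\<bar> = \<bar>Bxy p\<bar>" "\<bar>Bxy (S2 p)\<bar> = \<bar>Bxy p\<bar>" "\<bar>Bxy (S3 p)\<bar> = \<bar>Bxy p\<bar>"
    "\<bar>Bxy (Sw p)\<bar> = \<bar>Bxy p\<bar>" "\<bar>Bxy (V3 p)\<bar> = \<bar>Bxy p\<bar>" for p
  proof -
    obtain x y z where xyz: "p = (x, y, z)" by (cases p)
    show "\<bar>Bxy (S1 p)\<bar> = \<bar>Bxy p\<bar>" "\<bar>Bxy (S2 p)\<bar> = \<bar>Bxy p\<bar>" "\<bar>Bxy (S3 p)\<bar> = \<bar>Bxy p\<bar>"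
      "\<bar>Bxy (Sw p)\<bar> = \<bar>Bxy p\<bar>" "\<bar>Bxy (V3 p)\<bar> = \<bar>Bxy p\<bar>"
      unfolding xyz gen_apply Bxy.simps by argo+
  qed
  have V3: "chart_area_preserving k V3"
    by (rule linear[OF gens_in_Gamma(3), where c = "- 1" and s = 1 and t = 0 and s' = 0 and t' = 1]) (use sq gB in simp_all)
  have S1: "chart_area_preserving k S1"
    by (rule linear[OF gens_in_Gamma(4), where c = "- 1" and s = 1 and t = 0 and s' = 0 and t' = "- 1"]) (use sq gB in \<open>simp_all add: gz\<close>)
  have S2: "chart_area_preserving k S2"
    by (rule linear[OF gens_in_Gamma(5), where c = "- 1" and s = "- 1" and t = 0 and s' = 0 and t' = 1]) (use sq gB in \<open>simp_all add: gz\<close>)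
  have S3: "chart_area_preserving k S3"
    by (rule linear[OF gens_in_Gamma(6), where c = 1 and s = "- 1" and t = 0 and s' = 0 and t' = "- 1"]) (use sq gB in \<open>simp_all add: gz\<close>)
  have Sw: "chart_area_preserving k Sw"
    by (rule linear[OF gens_in_Gamma(7), where c = 1 and s = 0 and t = 1 and s' = 1 and t' = 0]) (use sq gB in \<open>simp_all add: gz\<close>)
  have V1: "chart_area_preserving k V1"
  proof (rule chart_area_preservingI[where g = V1 and c = 1, OF k])
    fix e :: real assume e: "e\<^sup>2 = 1"
    let ?z = "\<lambda>v. snd (snd (chart k e v))"
    show "\<exists>a b. (\<forall>v. fst (V1 (chart k e v)) = a v \<and> fst (snd (V1 (chart k e v))) = b v) \<and>
      (\<forall>v. \<exists>a1 a2 b1 b2. (a has_derivative (\<lambda>h. a1 * h $ 1 + a2 * h $ 2)) (at v) \<and>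
        (b has_derivative (\<lambda>h. b1 * h $ 1 + b2 * h $ 2)) (at v) \<and>
        \<bar>a1 * b2 - a2 * b1\<bar> * \<bar>Bxy (chart k e v)\<bar> = \<bar>Bxy (V1 (chart k e v))\<bar>)"
    proof (rule exI[of _ "\<lambda>v. v $ 2 * ?z v - v $ 1"], rule exI[of _ "\<lambda>v. 0 * v $ 1 + 1 * v $ 2"], intro conjI allI)
      fix v
      show "fst (V1 (chart k e v)) = v $ 2 * ?z v - v $ 1" "fst (snd (V1 (chart k e v))) = 0 * v $ 1 + 1 * v $ 2"
        by (simp_all add: chart_def)
      obtain z1 z2 where Z: "(?z has_derivative (\<lambda>h. z1 * h $ 1 + z2 * h $ 2)) (at v)"
        "z1 = (- v $ 2 + e * (v $ 1 * (v $ 2)\<^sup>2 + 4 * v $ 1) / sqrt (chart_disc k v)) / 2"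
        by (rule has_derivative_chart_z[OF k e, where v = v])
      define x y s z where "x = v $ 1" and "y = v $ 2" and "s = sqrt (chart_disc k v)" and "z = ?z v"
      have A: "((\<lambda>v. v $ 2 * ?z v - v $ 1) has_derivative
          (\<lambda>h. (y * z1 - 1) * h $ 1 + (y * z2 + z) * h $ 2)) (at v)"
        by (rule has_derivative_eq_rhs[OF has_derivative_diff[OF has_derivative_mult[OF coord Z(1)] coord]])
          (simp add: fun_eq_iff y_def z_def algebra_simps)
      have s: "s > 0" using chart_disc_ge[of k v] k by (simp add: s_def)
      have z: "z = (- (x * y) + e * s) / 2" by (simp add: z_def x_def y_def s_def chart_def)
      have Z1: "z1 * s = (- (y * s) + e * (x * y\<^sup>2 + 4 * x)) / 2"
        using s unfolding Z(2) x_def[symmetric] y_def[symmetric] s_def[symmetric] by (simp add: field_simps)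
      have e1: "e = 1 \<or> e = - 1" using e by (simp add: power2_eq_1_iff)
      have ce: "chart k e v = (x, y, z)" by (simp add: z_def x_def y_def chart_def)
      have es: "e * s = 2 * z + x * y" using z by simp
      \<comment> \<open>Multiplying by s = |\<open>Bxy\<close>| clears the denominator of z1; the
        resulting polynomial identity is checked for each sign e.\<close>
      have "(y * z1 - 1) * s = y * (z1 * s) - s" by (simp add: algebra_simps)
      also have "\<dots> = - (e * Bxy (V1 (x, y, z)))"
        unfolding Z1 gen_apply Bxy.simps using e1
      proof
        assume e: "e = 1"
        then have s': "s = 2 * z + x * y" using es by simp
        show "y * ((- (y * s) + e * (x * y\<^sup>2 + 4 * x)) / 2) - s = - (e * (2 * z + (y * z - x) * y))"
          unfolding e s' by (simp add: power2_eq_square field_simps)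
      next
        assume e: "e = - 1"
        then have s': "s = - (2 * z + x * y)" using es by simp
        show "y * ((- (y * s) + e * (x * y\<^sup>2 + 4 * x)) / 2) - s = - (e * (2 * z + (y * z - x) * y))"
          unfolding e s' by (simp add: power2_eq_square field_simps)
      qed
      finally have "\<bar>(y * z1 - 1) * s\<bar> = \<bar>e * Bxy (V1 (x, y, z))\<bar>" by (simp only: abs_minus_cancel)
      then have "\<bar>y * z1 - 1\<bar> * s = \<bar>Bxy (V1 (x, y, z))\<bar>"
        using e1 s by (auto simp: abs_mult)
      moreover have "\<bar>Bxy (chart k e v)\<bar> = s" using e1 s unfolding Bxy_chart s_def by auto
      ultimately have J: "\<bar>(y * z1 - 1) * 1 - (y * z2 + z) * 0\<bar> * \<bar>Bxy (chart k e v)\<bar> = \<bar>Bxy (V1 (chart k e v))\<bar>"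
        by (simp add: ce)
      show "\<exists>a1 a2 b1 b2. ((\<lambda>v. v $ 2 * ?z v - v $ 1) has_derivative (\<lambda>h. a1 * h $ 1 + a2 * h $ 2)) (at v) \<and>
        ((\<lambda>v. 0 * v $ 1 + 1 * v $ 2) has_derivative (\<lambda>h. b1 * h $ 1 + b2 * h $ 2)) (at v) \<and>
        \<bar>a1 * b2 - a2 * b1\<bar> * \<bar>Bxy (chart k e v)\<bar> = \<bar>Bxy (V1 (chart k e v))\<bar>"
        by (intro exI conjI, rule A, rule lin, rule J)
    qed
  qed (use sq Gamma_level[OF gens_in_Gamma(1)] in \<open>simp_all add: gz\<close>)
  have "V2 = Sw \<circ> (V1 \<circ> Sw)"
  proof
    fix p show "V2 p = (Sw \<circ> (V1 \<circ> Sw)) p" by (cases p) (simp add: mult.commute)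
  qed
  then have V2: "chart_area_preserving k V2" using chart_area_preserving_comp[OF Sw chart_area_preserving_comp[OF V1 Sw]] by simp
  show ?thesis using g V1 V2 V3 S1 S2 S3 Sw unfolding Gamma_gens_eq by blast
qed

lemma chart_area_preserving_Gamma:
  assumes k: "k > 2" and g: "g \<in> Gamma_group" shows "chart_area_preserving k g"
  using g
proof (induction rule: Gamma_induct)
  case id
  have M: "det (matrix (\<lambda>v :: real^2. v)) = 1"
    by (simp add: det_2 matrix_def axis_def)
  show ?case unfolding chart_area_preserving_def
  proof (intro allI impI)
    fix e :: real assume "e\<^sup>2 = 1"
    then show "\<exists>e' G. e'\<^sup>2 = 1 \<and> (\<forall>v. id (chart k e v) = chart k e' (G v) \<and>
      (\<exists>G'. (G has_derivative G') (at v) \<and>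
        \<bar>det (matrix G')\<bar> * \<bar>Bxy (chart k e v)\<bar> = \<bar>Bxy (id (chart k e v))\<bar>))"
      by (intro exI[of _ e] exI[of _ "\<lambda>v. v"] conjI allI) (simp_all add: M has_derivative_ident)
  qed
next
  case (gen g h)
  show ?case by (rule chart_area_preserving_comp[OF chart_area_preserving_gens[OF k gen(1)] gen(2)])
qed

subsection \<open>Inner points of the complement above 2\<close>

text \<open>On the level set z^2 < k + 2 amounts to xyz > x^2 + y^2. As x^2 + y^2 >= 2 |xy| this
  forces |z| > 2, and \<open>S1\<close> corrects the sign of z.\<close>

lemma orbit_set_F'_C11I:
  assumes k: "k > 2" and p: "(x, y, z) \<in> level k" and z: "z\<^sup>2 < k + 2"
  shows "(x, y, z) \<in> orbit_set Gamma_group F'_C11"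
proof -
  have "z * (- (x * y) - z) = - (k + 2 + x\<^sup>2 + y\<^sup>2)" by (rule zz'[OF p])
  then have gt: "x * y * z > x\<^sup>2 + y\<^sup>2" using z by (simp add: power2_eq_square algebra_simps)
  have "(\<bar>x\<bar> - \<bar>y\<bar>)\<^sup>2 \<ge> 0" by simp
  then have "2 * (\<bar>x\<bar> * \<bar>y\<bar>) \<le> x\<^sup>2 + y\<^sup>2" by (simp add: power2_diff)
  also have "\<dots> < x * y * z" by (rule gt)
  also have "\<dots> \<le> (\<bar>x\<bar> * \<bar>y\<bar>) * \<bar>z\<bar>" by (metis abs_ge_self abs_mult)
  finally have "(\<bar>x\<bar> * \<bar>y\<bar>) * (\<bar>z\<bar> - 2) > 0" by (simp add: algebra_simps)
  moreover have "0 \<le> \<bar>x\<bar> * \<bar>y\<bar>" by simp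
  ultimately have "\<bar>z\<bar> > 2" by (simp add: zero_less_mult_iff)
  then consider "z < - 2" | "z > 2" by linarith
  then show ?thesis
  proof cases
    case 1
    then have "id (x, y, z) \<in> F'_C11" using gt by (simp add: F'_C11_def)
    then show ?thesis unfolding orbit_set_mem using Gamma_id by blast
  next
    case 2
    then have "S1 (x, y, z) \<in> F'_C11" using gt by (simp add: F'_C11_def)
    then show ?thesis unfolding orbit_set_mem using gens_in_Gamma(4) by blast
  qed
qed

text \<open>An interior point of the complement relative to the level set. Such points are shown to
  be absent; until then every constraint on them applies to all their translates.\<close>

definition inner_point :: "real \<Rightarrow> point \<Rightarrow> bool" where
  "inner_point k p \<longleftrightarrow> p \<in> level k \<and>
    (\<exists>T. open T \<and> p \<in> T \<and> level k \<inter> T \<inter> orbit_set Gamma_group F'_C11 = {})"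

lemma inner_pointD:
  assumes "inner_point k p"
  obtains T where "p \<in> level k" "open T" "p \<in> T"
    "\<And>q. q \<in> level k \<Longrightarrow> q \<in> T \<Longrightarrow> q \<notin> orbit_set Gamma_group F'_C11"
  using assms unfolding inner_point_def by blast

lemma inner_point_Gamma:
  assumes p: "inner_point k p" and g: "g \<in> Gamma_group" shows "inner_point k (g p)"
proof -
  obtain T where T: "p \<in> level k" "open T" "p \<in> T"
    "\<And>q. q \<in> level k \<Longrightarrow> q \<in> T \<Longrightarrow> q \<notin> orbit_set Gamma_group F'_C11" using inner_pointD[OF p] by metis
  obtain h where h: "h \<in> Gamma_group" "\<And>p. h (g p) = p" using Gamma_inverse[OF g] by metis
  have "open (h -` T)" using continuous_Gamma[OF h(1)] T(2) by (simp add: open_vimage continuous_on_eq_continuous_at)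
  moreover have "g p \<in> h -` T" using h(2) T(3) by simp
  moreover have "q \<notin> orbit_set Gamma_group F'_C11" if "q \<in> level k" "q \<in> h -` T" for q
    using T(4)[OF Gamma_level[OF h(1)]] that orbit_set_invariant[OF h(1), of q F'_C11] by blast
  ultimately show ?thesis unfolding inner_point_def using Gamma_level[OF g T(1)] by blast
qed

text \<open>Parametrizes the sheet z > 0 so that S1 V3 V2 preserves s and translates t by - 2 s.\<close>

definition fibre_point :: "real \<Rightarrow> real \<Rightarrow> real \<Rightarrow> point" where
  "fibre_point k s t = (2 * sinh s,
    sqrt (k + 2 + 4 * (sinh s)\<^sup>2) / cosh s * sinh (t + s), sqrt (k + 2 + 4 * (sinh s)\<^sup>2) / cosh s * cosh t)"

lemma fibre_point_level:
  assumes "k > 2" shows "fibre_point k s t \<in> level k"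
proof -
  define r where "r = sqrt (k + 2 + 4 * (sinh s)\<^sup>2) / cosh s"
  have "k + 2 + 4 * (sinh s)\<^sup>2 \<ge> 0" using assms zero_le_power2[of "sinh s"] by linarith
  then have r: "r\<^sup>2 * (cosh s)\<^sup>2 = k + 2 + 4 * (sinh s)\<^sup>2" by (simp add: r_def power_divide)
  have ct: "cosh t = cosh (t + s) * cosh s - sinh (t + s) * sinh s"
    using cosh_diff[of "t + s" s] by simp
  define C S where "C = cosh (t + s)" and "S = sinh (t + s)"
  have 1: "C\<^sup>2 = 1 + S\<^sup>2" "(cosh s)\<^sup>2 = 1 + (sinh s)\<^sup>2" by (simp_all add: C_def S_def cosh_square_eq)
  have "(cosh t)\<^sup>2 + 2 * sinh s * S * cosh t - S\<^sup>2
      = C\<^sup>2 * (cosh s)\<^sup>2 - S\<^sup>2 * (sinh s)\<^sup>2 - S\<^sup>2"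
    unfolding ct C_def[symmetric] S_def[symmetric] by (simp add: power2_eq_square algebra_simps)
  also have "\<dots> = (cosh s)\<^sup>2" unfolding 1 by (simp add: algebra_simps)
  finally have e: "(cosh t)\<^sup>2 + 2 * sinh s * S * cosh t - S\<^sup>2 = (cosh s)\<^sup>2" .
  have "r\<^sup>2 * ((cosh t)\<^sup>2 + 2 * sinh s * S * cosh t - S\<^sup>2) - 4 * (sinh s)\<^sup>2 - 2 = k"
    unfolding e r by simp
  then show ?thesis
    unfolding fibre_point_def level_def r_def[symmetric] S_def[symmetric]
    by (simp add: power2_eq_square algebra_simps)
qed

lemma fibre_point_shift: "S1 (V3 (V2 (fibre_point k s t))) = fibre_point k s (t - 2 * s)"
proof -
  define r where "r = sqrt (k + 2 + 4 * (sinh s)\<^sup>2) / cosh s"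
  have f: "fibre_point k s t = (2 * sinh s, r * sinh (t + s), r * cosh t)" for t
    by (simp add: fibre_point_def r_def)
  have V2: "V2 (fibre_point k s t) = fibre_point k s (- t)" for t
  proof -
    have "2 * sinh s * cosh t - sinh (t + s) = sinh (- t + s)"
      using sinh_add[of t s] sinh_diff[of s t] by (simp add: algebra_simps)
    moreover have "2 * sinh s * (r * cosh t) - r * sinh (t + s) = r * (2 * sinh s * cosh t - sinh (t + s))"
      by (simp add: algebra_simps)
    ultimately show ?thesis by (simp add: f)
  qed
  have "S1 (V3 (fibre_point k s t)) = fibre_point k s (- t - 2 * s)" for t
  proof -
    have "- t - 2 * s + s = - (t + s)" by simp
    then have 1: "sinh (- t - 2 * s + s) = - sinh (t + s)" by (simp only: sinh_minus)
    have "- t - 2 * s = - ((t + s) + s)" by simp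
    then have "cosh (- t - 2 * s) = cosh ((t + s) + s)" by (simp only: cosh_minus)
    also have "\<dots> = 2 * sinh s * sinh (t + s) + cosh t"
      using cosh_add[of "t + s" s] cosh_diff[of "t + s" s] by simp
    finally have 2: "cosh (- t - 2 * s) = 2 * sinh s * sinh (t + s) + cosh t" .
    show ?thesis unfolding f 1 2 by (simp add: algebra_simps)
  qed
  then show ?thesis by (simp add: V2)
qed

text \<open>The shifts reduce t to 0. There z^2 = (k + 2 + 4 (sinh s)^2) / (1 + (sinh s)^2), which
  is below k + 2 because k + 2 > 4.\<close>

lemma fibre_point_orbit:
  assumes k: "k > 2" and s: "s \<noteq> 0" and t: "t = 2 * s * real n"
  shows "fibre_point k s t \<in> orbit_set Gamma_group F'_C11"
  using t
proof (induction n arbitrary: t)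
  case 0
  define a where "a = (sinh s)\<^sup>2"
  have a: "a > 0" using s by (simp add: a_def)
  have "k + 2 + 4 * a < (k + 2) * (1 + a)" using k a by (simp add: algebra_simps)
  then have "(k + 2 + 4 * a) / (1 + a) < k + 2" using a by (simp add: pos_divide_less_eq)
  moreover have "(sqrt (k + 2 + 4 * a) / cosh s * cosh t)\<^sup>2 = (k + 2 + 4 * a) / (1 + a)"
    using 0 k a by (simp add: power_divide cosh_square_eq a_def)
  ultimately show ?case
    using orbit_set_F'_C11I[OF k fibre_point_level[OF k, of s t, unfolded fibre_point_def]]
    unfolding fibre_point_def a_def by simp
next
  case (Suc n)
  have "t - 2 * s = 2 * s * real n" using Suc(2) by (simp add: algebra_simps)
  then have "S1 (V3 (V2 (fibre_point k s t))) \<in> orbit_set Gamma_group F'_C11"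
    unfolding fibre_point_shift by (rule Suc(1))
  then show ?case using gens_in_Gamma by (simp only: orbit_set_invariant)
qed

text \<open>A point with x = 0 is a limit of points of the orbit: keep t and let s tend to 0 through
  values for which t is a multiple of 2 s.\<close>

lemma inner_point_x_nonzero_pos:
  assumes k: "k > 2" and z: "z > 0" shows "\<not> inner_point k (0, y, z)"
proof
  assume p: "inner_point k (0, y, z)"
  obtain T where T: "(0, y, z) \<in> level k" "open T" "(0, y, z) \<in> T"
    "\<And>q. q \<in> level k \<Longrightarrow> q \<in> T \<Longrightarrow> q \<notin> orbit_set Gamma_group F'_C11" using inner_pointD[OF p] by metis
  define m where "m = sqrt (k + 2)"
  have m: "m > 0" "m\<^sup>2 = k + 2" using k by (simp_all add: m_def)
  define t where "t = arsinh (y / m)"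
  have y: "y = m * sinh t" using m by (simp add: t_def)
  have "z\<^sup>2 = k + 2 + y\<^sup>2" using T(1) by (simp add: level_def)
  also have "\<dots> = (m * cosh t)\<^sup>2" unfolding y by (simp add: power_mult_distrib cosh_square_eq m algebra_simps)
  finally have zt: "z = m * cosh t" using z m by (metis abs_of_pos cosh_real_pos less_imp_le mult_pos_pos power2_eq_iff_nonneg)
  \<comment> \<open>For nonzero t this makes t = 2 s n' with n' = \<open>Suc n\<close>; for t = 0
    any nonzero s serves, with multiplier 0.\<close>
  define s where "s n = (if t = 0 then 1 / real (Suc n) else t / 2 / real (Suc n))" for n
  have s0: "s n \<noteq> 0" for n by (simp add: s_def)
  have sq: "s = (\<lambda>n. (if t = 0 then 1 else t / 2) * inverse (real (Suc n)))"
    by (rule ext) (simp add: s_def inverse_eq_divide)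
  have s_lim: "s \<longlonglongrightarrow> 0"
    unfolding sq by (rule tendsto_mult_right_zero[OF LIMSEQ_inverse_real_of_nat])
  have lim: "(\<lambda>n. fibre_point k (s n) t) \<longlonglongrightarrow> fibre_point k 0 t"
    unfolding fibre_point_def
    by (intro tendsto_Pair tendsto_mult tendsto_divide tendsto_add tendsto_power tendsto_real_sqrt
      tendsto_sinh tendsto_cosh tendsto_const s_lim cosh_real_nonzero)
  have "fibre_point k 0 t = (0, y, z)" by (simp add: fibre_point_def y zt m_def)
  then have "\<forall>\<^sub>F n in sequentially. fibre_point k (s n) t \<in> T"
    using topological_tendstoD[OF lim T(2)] T(3) by simp
  then obtain n where n: "fibre_point k (s n) t \<in> T"
    unfolding eventually_sequentially by blast
  have "\<exists>j. t = 2 * s n * real j"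
  proof (cases "t = 0")
    case True
    then have "t = 2 * s n * real 0" by simp
    then show ?thesis by (rule exI)
  next
    case False
    then have "t = 2 * s n * real (Suc n)" unfolding s_def by (simp del: of_nat_Suc)
    then show ?thesis by (rule exI)
  qed
  then have "fibre_point k (s n) t \<in> orbit_set Gamma_group F'_C11" using fibre_point_orbit[OF k s0] by blast
  then show False using T(4)[OF fibre_point_level[OF k] n] by blast
qed

lemma inner_point_nonzero:
  assumes k: "k > 2" and p: "inner_point k (x, y, z)" shows "x \<noteq> 0" "y \<noteq> 0"
proof -
  have x: "x \<noteq> 0" if q: "inner_point k (x, y, z)" for x y z
  proof
    assume x0: "x = 0"
    have "z \<noteq> 0"
    proof
      assume "z = 0"
      then have "- (y\<^sup>2) - 2 = k" using inner_pointD[OF q] x0 by (auto simp: level_def)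
      then show False using k zero_le_power2[of y] by linarith
    qed
    then consider "z > 0" | "- z > 0" by linarith
    then show False
    proof cases
      case 1 then show False using inner_point_x_nonzero_pos[OF k 1] q x0 by blast
    next
      case 2 then show False
        using inner_point_x_nonzero_pos[OF k 2, of "- y"] inner_point_Gamma[OF q gens_in_Gamma(4)] x0 by simp
    qed
  qed
  show "x \<noteq> 0" by (rule x[OF p])
  show "y \<noteq> 0" using x[of y x z] inner_point_Gamma[OF p gens_in_Gamma(7)] by simp
qed

text \<open>z^2 < k + 2 would put the point into the orbit. In the case of equality, shrinking z
  slightly and solving for y gives nearby points of the level set with z^2 < k + 2.\<close>

lemma inner_point_z:
  assumes k: "k > 2" and p: "inner_point k (x, y, z)" shows "k + 2 < z\<^sup>2"
proof (rule ccontr)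
  assume n: "\<not> k + 2 < z\<^sup>2"
  obtain T where T: "(x, y, z) \<in> level k" "open T" "(x, y, z) \<in> T"
    "\<And>q. q \<in> level k \<Longrightarrow> q \<in> T \<Longrightarrow> q \<notin> orbit_set Gamma_group F'_C11" using inner_pointD[OF p] by metis
  have z: "z\<^sup>2 = k + 2" using n orbit_set_F'_C11I[OF k T(1)] T(4)[OF T(1,3)] by linarith
  have x0: "x\<^sup>2 > 0" using inner_point_nonzero[OF k p] by simp
  \<comment> \<open>The discriminant of the quadratic in y after z is replaced by cz. At c = 1 it is
    x^2 (k - 2) > 0, so the root through the given y continues to nearby c.\<close>
  define D where "D c = (c * z)\<^sup>2 * (x\<^sup>2 + 4) - 4 * (k + 2) - 4 * x\<^sup>2" for c
  have D1: "D 1 = x\<^sup>2 * (k - 2)" by (simp add: D_def z algebra_simps)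
  then have D1p: "D 1 > 0" using x0 k by simp
  have yz: "(2 * y - x * z)\<^sup>2 = D 1"
    using T(1) z unfolding D_def level_def by (simp add: power2_eq_square algebra_simps)
  define e :: real where "e = (if 2 * y - x * z \<ge> 0 then 1 else - 1)"
  have e: "e\<^sup>2 = 1" by (simp add: e_def)
  have "sqrt (D 1) = \<bar>2 * y - x * z\<bar>" by (metis yz real_sqrt_abs)
  then have y: "y = (x * z + e * sqrt (D 1)) / 2" by (simp add: e_def field_simps)
  define q where "q c = (x, (x * (c * z) + e * sqrt (D c)) / 2, c * z)" for c
  have q1: "q 1 = (x, y, z)" using y by (simp add: q_def)
  have "isCont D 1" unfolding D_def by (intro continuous_intros)
  moreover from this have "isCont q 1" unfolding q_def by (intro continuous_intros) simp_all
  ultimately have "q \<midarrow>1\<rightarrow> q 1" "D \<midarrow>1\<rightarrow> D 1" by (simp_all only: isCont_def)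
  then have "\<forall>\<^sub>F c in at 1. q c \<in> T" "\<forall>\<^sub>F c in at 1. D c > 0"
    using T(2,3) D1p unfolding q1 by (auto dest: topological_tendstoD order_tendstoD)
  then have "\<forall>\<^sub>F c in at_left 1. q c \<in> T \<and> D c > 0" "\<forall>\<^sub>F c in at_left (1::real). c \<in> {0<..<1}"
    using eventually_at_left_real[of 0 1] by (auto simp: eventually_at_split eventually_conj_iff)
  then have "\<forall>\<^sub>F c in at_left (1::real). (q c \<in> T \<and> D c > 0) \<and> c \<in> {0<..<1}"
    by (rule eventually_conj)
  then obtain c where c: "q c \<in> T" "D c > 0" "0 < c" "c < 1"
    using eventually_happens[of _ "at_left (1::real)"] by auto
  have s: "(sqrt (D c))\<^sup>2 = D c" using c(2) by simp
  have es: "(e * sqrt (D c))\<^sup>2 = D c" using e s by (simp add: power_mult_distrib)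
  have lev: "q c \<in> level k"
  proof -
    define r where "r = e * sqrt (D c)"
    have r: "r\<^sup>2 = (c * z)\<^sup>2 * (x\<^sup>2 + 4) - 4 * (k + 2) - 4 * x\<^sup>2" using es by (simp only: r_def D_def)
    then show ?thesis unfolding q_def r_def[symmetric] level_def
      by (simp add: power2_eq_square field_simps)
  qed
  have "(c * z)\<^sup>2 < k + 2"
  proof -
    have "c\<^sup>2 < 1" using c(3,4) by (simp add: power_less_one_iff)
    then have "c\<^sup>2 * (k + 2) < 1 * (k + 2)" using k by (intro mult_strict_right_mono) auto
    then show ?thesis by (simp add: power_mult_distrib z)
  qed
  then have "q c \<in> orbit_set Gamma_group F'_C11" using orbit_set_F'_C11I[OF k] lev unfolding q_def by blast
  then show False using T(4)[OF lev c(1)] by blast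
qed

subsection \<open>Descent and contraction of area above 2\<close>

abbreviation coord_prod :: "point \<Rightarrow> real" where
  "coord_prod p \<equiv> fst p * fst (snd p) * snd (snd p)"

fun descent_step :: "point \<Rightarrow> point \<Rightarrow> bool" where
  "descent_step (x, y, z) (x', y', z') \<longleftrightarrow> \<bar>z'\<bar> = \<bar>z\<bar> - \<bar>x\<bar> * \<bar>y\<bar> \<and>
    (\<bar>x\<bar> * \<bar>z'\<bar> < \<bar>y\<bar> \<longrightarrow> \<bar>x'\<bar> = \<bar>x\<bar> \<and> \<bar>y'\<bar> = \<bar>y\<bar> - \<bar>x\<bar> * \<bar>z'\<bar>) \<and>
    (\<bar>y\<bar> * \<bar>z'\<bar> < \<bar>x\<bar> \<longrightarrow> \<bar>y'\<bar> = \<bar>y\<bar> \<and> \<bar>x'\<bar> = \<bar>x\<bar> - \<bar>y\<bar> * \<bar>z'\<bar>)"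

lemma same_sign_abs_diff:
  fixes u y :: real
  assumes "u * y > 0"
  shows "u * (u - y) < 0 \<longleftrightarrow> \<bar>u\<bar> < \<bar>y\<bar>" "\<bar>u\<bar> < \<bar>y\<bar> \<Longrightarrow> \<bar>u - y\<bar> = \<bar>y\<bar> - \<bar>u\<bar>"
  using assms by (auto simp: zero_less_mult_iff mult_less_0_iff)

lemma descent_step_cases:
  fixes x y z w :: real
  assumes neg: "x * y * z < 0" and zw: "z * w < 0" "w = - (x * y) - z" and w: "\<bar>w\<bar> > 1"
  shows "x * (x * w - y) * w < 0 \<Longrightarrow> descent_step (x, y, z) (x, x * w - y, w)"
    "(y * w - x) * y * w < 0 \<Longrightarrow> descent_step (x, y, z) (y * w - x, y, w)"
    "\<not> x * (x * w - y) * w < 0 \<Longrightarrow> \<not> (y * w - x) * y * w < 0 \<Longrightarrow> descent_step (x, y, z) (a, b, w)"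
proof -
  have wz: "\<bar>w\<bar> = \<bar>z\<bar> - \<bar>x\<bar> * \<bar>y\<bar>"
    using abs_flip[of z "x * y"] zw neg by (simp add: abs_mult)
  have "(x * y * z) * (z * w) > 0" using neg zw(1) by (rule mult_neg_neg)
  moreover have "(x * y * z) * (z * w) = (x * y * w) * z\<^sup>2" by (simp add: power2_eq_square)
  ultimately have xyw: "x * y * w > 0" by (simp add: zero_less_mult_iff)
  have 1: "x * w * y > 0" "y * w * x > 0" using xyw by (simp_all add: mult_ac)
  have X: "x * (x * w - y) * w < 0 \<longleftrightarrow> \<bar>x\<bar> * \<bar>w\<bar> < \<bar>y\<bar>"
    "\<bar>x\<bar> * \<bar>w\<bar> < \<bar>y\<bar> \<Longrightarrow> \<bar>x * w - y\<bar> = \<bar>y\<bar> - \<bar>x\<bar> * \<bar>w\<bar>"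
    using same_sign_abs_diff[OF 1(1)] by (simp_all add: abs_mult mult_ac)
  have Y: "(y * w - x) * y * w < 0 \<longleftrightarrow> \<bar>y\<bar> * \<bar>w\<bar> < \<bar>x\<bar>"
    "\<bar>y\<bar> * \<bar>w\<bar> < \<bar>x\<bar> \<Longrightarrow> \<bar>y * w - x\<bar> = \<bar>x\<bar> - \<bar>y\<bar> * \<bar>w\<bar>"
    using same_sign_abs_diff[OF 1(2)] by (simp_all add: abs_mult mult_ac)
  have excl: "\<not> (\<bar>x\<bar> * \<bar>w\<bar> < \<bar>y\<bar> \<and> \<bar>y\<bar> * \<bar>w\<bar> < \<bar>x\<bar>)"
  proof -
    have "\<bar>x\<bar> * 1 \<le> \<bar>x\<bar> * \<bar>w\<bar>" "\<bar>y\<bar> * 1 \<le> \<bar>y\<bar> * \<bar>w\<bar>" using w by (intro mult_left_mono; simp)+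
    then show ?thesis by linarith
  qed
  show "x * (x * w - y) * w < 0 \<Longrightarrow> descent_step (x, y, z) (x, x * w - y, w)"
    using wz X excl unfolding descent_step.simps by blast
  show "(y * w - x) * y * w < 0 \<Longrightarrow> descent_step (x, y, z) (y * w - x, y, w)"
    using wz Y excl unfolding descent_step.simps by blast
  show "\<not> x * (x * w - y) * w < 0 \<Longrightarrow> \<not> (y * w - x) * y * w < 0 \<Longrightarrow> descent_step (x, y, z) (a, b, w)"
    using wz X Y unfolding descent_step.simps by blast
qed

text \<open>Small products XY together with a lower bound for the whole expression force one
  coordinate to dominate. The dominating one then loses at least 2 X 0 at every step while the other
  stays fixed, which cannot go on forever.\<close>

lemma descent_stuck:
  fixes X Y Z :: "nat \<Rightarrow> real"
  assumes pos: "\<And>n. X n > 0" "\<And>n. Y n > 0" "\<And>n. 2 < Z n" "\<And>n. Z n \<le> B"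
    and small: "\<And>n. 8 * (X n * Y n * B) \<le> r" "\<And>n. r \<le> (X n)\<^sup>2 + (Y n)\<^sup>2 + X n * Y n * Z n"
    and step: "\<And>n. X n * Z (Suc n) < Y n \<Longrightarrow> X (Suc n) = X n \<and> Y (Suc n) = Y n - X n * Z (Suc n)"
    and start: "X 0 \<le> Y 0"
  shows False
proof -
  have key: "X n * B < Y n" if le: "X n \<le> Y n" for n
  proof -
    have "X n * Y n * Z n \<le> X n * Y n * B" using pos by (intro mult_left_mono) (simp_all add: less_imp_le)
    moreover have "X n * X n \<le> X n * Y n" using le pos(1)[of n] by (intro mult_left_mono) auto
    moreover have "X n * Y n * 1 \<le> X n * Y n * B"
      using pos(1,2)[of n] pos(3,4)[of n] by (intro mult_left_mono) auto
    moreover have "X n * Y n * B > 0" using pos(1,2)[of n] pos(3,4)[of n] by (intro mult_pos_pos) auto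
    ultimately have "X n * Y n * B < Y n * Y n"
      using small[of n] unfolding power2_eq_square by linarith
    then have "Y n * (X n * B) < Y n * Y n" by (simp add: mult_ac)
    then show ?thesis using pos(2)[of n] by (simp only: mult_less_cancel_left_pos)
  qed
  have I: "X n = X 0 \<and> Y n \<le> Y 0 - 2 * X 0 * real n \<and> X n \<le> Y n" for n
  proof (induction n)
    case 0 show ?case using start by simp
  next
    case (Suc n)
    have "X n * Z (Suc n) \<le> X n * B" using pos(1)[of n] pos(4) by (intro mult_left_mono) auto
    then have s: "X (Suc n) = X n" "Y (Suc n) = Y n - X n * Z (Suc n)" using step[of n] key[of n] Suc by auto
    have "2 * X n \<le> X n * Z (Suc n)"
      using mult_left_mono[of 2 "Z (Suc n)" "X n"] pos(1)[of n] pos(3)[of "Suc n"] by (simp add: mult.commute)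
    then have "Y (Suc n) \<le> Y 0 - 2 * X 0 * real (Suc n)" using s Suc by (simp add: algebra_simps)
    \<comment> \<open>If the order were reversed, both squares would be bounded by products XY at
      the old or the new step, and each summand would be at most r / 8.\<close>
    moreover have "X (Suc n) \<le> Y (Suc n)"
    proof (rule ccontr)
      assume n: "\<not> X (Suc n) \<le> Y (Suc n)"
      let ?x = "X (Suc n)" and ?y = "Y (Suc n)"
      have p: "?x > 0" "?y > 0" using pos by auto
      have "?y * ?y \<le> ?x * ?y" using n p by (intro mult_right_mono) auto
      moreover have "?x * ?x \<le> X n * Y n" unfolding s using Suc pos(1)[of n] by (intro mult_left_mono) auto
      moreover have "?x * ?y * Z (Suc n) \<le> ?x * ?y * B" using pos by (intro mult_left_mono) (simp_all add: less_imp_le)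
      moreover have "?x * ?y * 1 \<le> ?x * ?y * B" "X n * Y n * 1 \<le> X n * Y n * B"
        using pos(1,2) pos(3,4)[of n] by (intro mult_left_mono; simp add: less_imp_le)+
      moreover have "?x * ?y * B > 0" using p pos(3,4)[of n] by simp
      ultimately show False using small(1)[of "Suc n"] small(2)[of "Suc n"] small(1)[of n]
        unfolding power2_eq_square by linarith
    qed
    ultimately show ?case using s Suc by simp
  qed
  obtain n where "Y 0 / (2 * X 0) < real n" using reals_Archimedean2 by blast
  then have "Y 0 < 2 * X 0 * real n" using pos(1)[of 0] by (simp add: field_simps)
  then show False using I[of n] pos(2)[of n] pos(1)[of n] by linarith
qed

text \<open>The decreasing sequence |z| converges, so its decrements |xy| tend to 0. If |z| stayed
  at least L, x^2 + y^2 + |xyz| = z^2 - (k + 2) would stay bounded away from 0, the situation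
  excluded by \<open>descent_stuck\<close>.\<close>

lemma descent_limit:
  assumes k: "k > 2" and p: "\<And>n. p n \<in> level k" "\<And>n. coord_prod (p n) < 0"
      "\<And>n. k + 2 < (snd (snd (p n)))\<^sup>2"
    and step: "\<And>n. descent_step (p n) (p (Suc n))" and L: "sqrt (k + 2) < L"
  shows "\<exists>n. \<bar>snd (snd (p n))\<bar> < L"
proof (rule ccontr)
  assume "\<not> (\<exists>n. \<bar>snd (snd (p n))\<bar> < L)"
  then have far: "L \<le> \<bar>snd (snd (p n))\<bar>" for n by (metis not_le)
  define X Y Z where "X n = \<bar>fst (p n)\<bar>" and "Y n = \<bar>fst (snd (p n))\<bar>" and "Z n = \<bar>snd (snd (p n))\<bar>" for n
  have pos: "X n > 0" "Y n > 0" for n using p(2)[of n] by (auto simp: X_def Y_def)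
  have "sqrt 4 < sqrt (k + 2)" using k by (intro real_sqrt_less_mono) simp
  then have L2: "2 < L" using L by simp
  then have Z2: "2 < Z n" for n using far[of n] by (simp add: Z_def)
  have st: "Z (Suc n) = Z n - X n * Y n"
    "X n * Z (Suc n) < Y n \<Longrightarrow> X (Suc n) = X n \<and> Y (Suc n) = Y n - X n * Z (Suc n)"
    "Y n * Z (Suc n) < X n \<Longrightarrow> Y (Suc n) = Y n \<and> X (Suc n) = X n - Y n * Z (Suc n)" for n
    using step[of n] unfolding X_def Y_def Z_def by (cases "p n"; cases "p (Suc n)"; simp)+
  have eq: "(X n)\<^sup>2 + (Y n)\<^sup>2 + X n * Y n * Z n = (Z n)\<^sup>2 - (k + 2)" for n
  proof -
    obtain x y z where xyz: "p n = (x, y, z)" by (cases "p n")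
    have "\<bar>x\<bar> * \<bar>y\<bar> * \<bar>z\<bar> = - (x * y * z)" using p(2)[of n] unfolding xyz by (simp add: abs_mult[symmetric])
    then show ?thesis using p(1)[of n] unfolding X_def Y_def Z_def xyz by (simp add: level_def)
  qed
  have dec: "decseq Z" using st(1) pos by (intro decseq_SucI) (simp add: less_imp_le)
  define r where "r = L\<^sup>2 - (k + 2)"
  have "(sqrt (k + 2))\<^sup>2 < L\<^sup>2" using L k by (intro power_strict_mono) auto
  then have r: "r > 0" using k by (simp add: r_def)
  have rle: "r \<le> (X n)\<^sup>2 + (Y n)\<^sup>2 + X n * Y n * Z n" for n
  proof -
    have "L\<^sup>2 \<le> (Z n)\<^sup>2" using far[of n] L2 by (intro power_mono) (auto simp: Z_def)
    then show ?thesis unfolding eq r_def by simp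
  qed
  obtain l where l: "Z \<longlonglongrightarrow> l" using decseq_convergent[OF dec, of 2] Z2 less_imp_le by metis
  have "(\<lambda>n. Z n - Z (Suc n)) \<longlonglongrightarrow> l - l" by (intro tendsto_diff l LIMSEQ_Suc)
  then have "(\<lambda>n. X n * Y n) \<longlonglongrightarrow> 0" by (simp add: st(1))
  moreover have B: "Z 0 > 0" using Z2[of 0] by simp
  ultimately have "\<forall>\<^sub>F n in sequentially. X n * Y n < r / (8 * Z 0)" using r by (intro order_tendstoD) auto
  then obtain N where N: "\<And>n. n \<ge> N \<Longrightarrow> X n * Y n < r / (8 * Z 0)" unfolding eventually_sequentially by blast
  have sm: "8 * (X (N + n) * Y (N + n) * Z 0) \<le> r" for n
    using N[of "N + n"] B by (simp add: field_simps)
  have ZB: "Z n \<le> Z 0" for n using dec by (simp add: decseqD)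
  show False
  proof (cases "X N \<le> Y N")
    case True
    show False
      by (rule descent_stuck[of "\<lambda>n. X (N + n)" "\<lambda>n. Y (N + n)" "\<lambda>n. Z (N + n)" "Z 0" r])
        (use pos Z2 ZB sm rle st(2) True in simp_all)
  next
    case False
    show False
    proof (rule descent_stuck[of "\<lambda>n. Y (N + n)" "\<lambda>n. X (N + n)" "\<lambda>n. Z (N + n)" "Z 0" r])
      show "r \<le> (Y (N + n))\<^sup>2 + (X (N + n))\<^sup>2 + Y (N + n) * X (N + n) * Z (N + n)" for n
        using rle[of "N + n"] by (simp add: algebra_simps)
      show "8 * (Y (N + n) * X (N + n) * Z 0) \<le> r" for n using sm[of n] by (simp add: algebra_simps)
    qed (use pos Z2 ZB st(3) False in simp_all)
  qed
qed

lemma continuous_chart: "k > 2 \<Longrightarrow> continuous_on UNIV (chart k e)"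
  unfolding chart_def chart_disc_def by (intro continuous_intros) auto

lemma continuous_on_Gamma_chart:
  assumes "k > 2" "g \<in> Gamma_group" shows "continuous_on S (\<lambda>v. g (chart k e v))"
  using continuous_on_compose2[OF continuous_Gamma[OF assms(2)] continuous_chart[OF assms(1)]]
    continuous_on_subset by blast

lemma negative_on_connected:
  fixes f :: "'a::topological_space \<Rightarrow> real"
  assumes "connected U" "continuous_on U f" "\<And>v. v \<in> U \<Longrightarrow> f v \<noteq> 0" "u \<in> U" "f u < 0" "v \<in> U"
  shows "f v < 0"
proof (rule ccontr)
  assume "\<not> f v < 0"
  then have "{f u..f v} \<subseteq> f ` U"
    using connected_contains_Icc[OF connected_continuous_image[OF assms(2,1)]] assms(4,6) by blast
  moreover have "0 \<in> {f u..f v}" using assms(5) \<open>\<not> f v < 0\<close> by simp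
  ultimately show False using assms(3) by (metis imageE subsetD)
qed

lemma inner_point_coord_prod:
  assumes "k > 2" "inner_point k p" shows "coord_prod p \<noteq> 0"
proof -
  obtain x y z where "p = (x, y, z)" by (cases p)
  then show ?thesis using inner_point_nonzero[OF assms(1), of x y z] inner_point_z[OF assms(1), of x y z] assms by auto
qed

text \<open>No translate of an inner point has a vanishing coordinate, so by the intermediate value
  theorem the sign is constant on U. Choices made at one point therefore hold on all of U.\<close>

lemma coord_prod_uniform:
  assumes k: "k > 2" and U: "connected U" "\<And>v. v \<in> U \<Longrightarrow> inner_point k (chart k e v)"
    and g: "g \<in> Gamma_group" and u: "u \<in> U" "coord_prod (g (chart k e u)) < 0" and v: "v \<in> U"
  shows "coord_prod (g (chart k e v)) < 0"
proof (rule negative_on_connected[where f = "\<lambda>v. coord_prod (g (chart k e v))", OF U(1) _ _ u v])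
  show "continuous_on U (\<lambda>v. coord_prod (g (chart k e v)))"
    using continuous_on_Gamma_chart[OF k g, of U e] by (intro continuous_intros)
  show "coord_prod (g (chart k e v)) \<noteq> 0" if "v \<in> U" for v
    by (rule inner_point_coord_prod[OF k inner_point_Gamma[OF U(2)[OF that] g]])
qed

lemma inner_point_twist:
  assumes k: "k > 2" and p: "inner_point k p"
  obtains t where "t \<in> Gamma_group" "\<And>q. snd (snd (t q)) = snd (snd q)" "coord_prod (t p) < 0"
proof -
  obtain x y z where xyz: "p = (x, y, z)" by (cases p)
  have lev: "(x, y, z) \<in> level k" using inner_pointD[OF p] xyz by metis
  have z: "z\<^sup>2 > k + 2" using inner_point_z[OF k, of x y z] p xyz by simp
  have nz: "a * b * z \<noteq> 0" if t: "t \<in> Gamma_group" "t (x, y, z) = (a, b, z)" for t a b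
    using inner_point_coord_prod[OF k inner_point_Gamma[OF p t(1)]] unfolding xyz t(2) by simp
  obtain t a b where t: "t \<in> Gamma_group" "\<And>q. snd (snd (t q)) = snd (snd q)"
    "t (x, y, z) = (a, b, z)" "a * b * z < 0"
    using twist_sign_change[OF z lev] nz by metis
  show ?thesis by (rule that[OF t(1,2)]) (use t(4) in \<open>simp add: xyz t(3)\<close>)
qed

text \<open>Which of the three continuations applies is decided by signs at u, hence is the same on
  all of U, and one group element performs the step everywhere.\<close>

lemma descent_step_exists:
  assumes k: "k > 2" and U: "connected U" "\<And>v. v \<in> U \<Longrightarrow> inner_point k (chart k e v)" and u: "u \<in> U"
    and g: "g \<in> Gamma_group" "\<And>v. v \<in> U \<Longrightarrow> coord_prod (g (chart k e v)) < 0"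
  shows "\<exists>h. (h \<in> Gamma_group \<and> (\<forall>v\<in>U. coord_prod (h (chart k e v)) < 0)) \<and>
    (\<forall>v\<in>U. descent_step (g (chart k e v)) (h (chart k e v)))"
proof -
  have uni: "coord_prod (h (chart k e v)) < 0"
    if "h \<in> Gamma_group" "coord_prod (h (chart k e u)) < 0" "v \<in> U" for h v
    by (rule coord_prod_uniform[OF k U(1) _ that(1) u that(2,3)]) (rule U(2))
  obtain d where d: "d \<in> Gamma_group" "\<And>p. d p = V3 (g p)" using Gamma_compE[OF gens_in_Gamma(3) g(1)] by metis
  obtain d1 where d1: "d1 \<in> Gamma_group" "\<And>p. d1 p = V1 (d p)" using Gamma_compE[OF gens_in_Gamma(1) d(1)] by metis
  obtain d2 where d2: "d2 \<in> Gamma_group" "\<And>p. d2 p = V2 (d p)" using Gamma_compE[OF gens_in_Gamma(2) d(1)] by metis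
  obtain t where t: "t \<in> Gamma_group" "\<And>q. snd (snd (t q)) = snd (snd q)" "coord_prod (t (d (chart k e u))) < 0"
    using inner_point_twist[OF k inner_point_Gamma[OF U(2)[OF u] d(1)]] by metis
  obtain d3 where d3: "d3 \<in> Gamma_group" "\<And>p. d3 p = t (d p)" using Gamma_compE[OF t(1) d(1)] by metis
  have info: "\<exists>x y z w. g (chart k e v) = (x, y, z) \<and> w = - (x * y) - z \<and> x * y * z < 0 \<and> z * w < 0 \<and> \<bar>w\<bar> > 1"
    if v: "v \<in> U" for v
  proof -
    obtain x y z where xyz: "g (chart k e v) = (x, y, z)" by (cases "g (chart k e v)")
    have "inner_point k (d (chart k e v))" by (rule inner_point_Gamma[OF U(2)[OF v] d(1)])
    then have i: "inner_point k (x, y, - (x * y) - z)" unfolding d(2) xyz by simp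
    have lev: "(x, y, z) \<in> level k"
      using inner_pointD[OF inner_point_Gamma[OF U(2)[OF v] g(1)]] xyz by metis
    have "1\<^sup>2 < \<bar>- (x * y) - z\<bar>\<^sup>2" using inner_point_z[OF k i] k unfolding power2_abs by simp
    then have "1 < \<bar>- (x * y) - z\<bar>" by (rule power_less_imp_less_base) simp
    moreover have "x * y * z < 0" using g(2)[OF v] by (simp add: xyz)
    ultimately show ?thesis using xyz level_sign(2)[OF k lev] by blast
  qed
  show ?thesis
  proof (cases "coord_prod (d2 (chart k e u)) < 0")
    case True
    have neg: "coord_prod (d2 (chart k e v)) < 0" if "v \<in> U" for v by (rule uni[OF d2(1) True that])
    have "descent_step (g (chart k e v)) (d2 (chart k e v))" if v: "v \<in> U" for v
    proof -
      obtain x y z w where i: "g (chart k e v) = (x, y, z)" "w = - (x * y) - z" "x * y * z < 0" "z * w < 0" "\<bar>w\<bar> > 1"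
        using info[OF v] by blast
      have e: "d2 (chart k e v) = (x, x * w - y, w)" unfolding d2(2) d(2) i(1) i(2) by simp
      have "x * (x * w - y) * w < 0" using neg[OF v] unfolding e by simp
      then show ?thesis unfolding e i(1) by (rule descent_step_cases(1)[OF i(3,4,2,5)])
    qed
    then show ?thesis using d2(1) neg by blast
  next
    case F2: False
    \<comment> \<open>Sign constancy with the roles exchanged: a negative product at v would give
      one at u.\<close>
    have n2: "\<not> coord_prod (d2 (chart k e v)) < 0" if v: "v \<in> U" for v
      using coord_prod_uniform[OF k U(1) _ d2(1) v _ u] U(2) F2 by blast
    show ?thesis
    proof (cases "coord_prod (d1 (chart k e u)) < 0")
      case True
      have neg: "coord_prod (d1 (chart k e v)) < 0" if "v \<in> U" for v by (rule uni[OF d1(1) True that])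
      have "descent_step (g (chart k e v)) (d1 (chart k e v))" if v: "v \<in> U" for v
      proof -
        obtain x y z w where i: "g (chart k e v) = (x, y, z)" "w = - (x * y) - z" "x * y * z < 0" "z * w < 0" "\<bar>w\<bar> > 1"
          using info[OF v] by blast
        have e: "d1 (chart k e v) = (y * w - x, y, w)" unfolding d1(2) d(2) i(1) i(2) by simp
        have "(y * w - x) * y * w < 0" using neg[OF v] unfolding e by simp
        then show ?thesis unfolding e i(1) by (rule descent_step_cases(2)[OF i(3,4,2,5)])
      qed
      then show ?thesis using d1(1) neg by blast
    next
      case F1: False
      have n1: "\<not> coord_prod (d1 (chart k e v)) < 0" if v: "v \<in> U" for v
      using coord_prod_uniform[OF k U(1) _ d1(1) v _ u] U(2) F1 by blast
      have neg: "coord_prod (d3 (chart k e v)) < 0" if "v \<in> U" for v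
        by (rule uni[OF d3(1) _ that]) (unfold d3(2), rule t(3))
      have "descent_step (g (chart k e v)) (d3 (chart k e v))" if v: "v \<in> U" for v
      proof -
        obtain x y z w where i: "g (chart k e v) = (x, y, z)" "w = - (x * y) - z" "x * y * z < 0" "z * w < 0" "\<bar>w\<bar> > 1"
          using info[OF v] by blast
        have e: "d1 (chart k e v) = (y * w - x, y, w)" "d2 (chart k e v) = (x, x * w - y, w)" "d (chart k e v) = (x, y, w)"
          unfolding d1(2) d2(2) d(2) i(1) i(2) by simp_all
        have "snd (snd (d3 (chart k e v))) = w" unfolding d3(2) t(2) e(3) by simp
        then obtain a b where ab: "d3 (chart k e v) = (a, b, w)" by (metis prod.collapse)
        have "\<not> x * (x * w - y) * w < 0" "\<not> (y * w - x) * y * w < 0"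
          using n1[OF v] n2[OF v] unfolding e by simp_all
        then show ?thesis unfolding ab i(1) by (rule descent_step_cases(3)[OF i(3,4,2,5)])
      qed
      then show ?thesis using d3(1) neg by blast
    qed
  qed
qed

text \<open>Pointwise convergence becomes uniform as in Dini's theorem: the sets where |z| is still
  at least L are compact and nested, and \<open>descent_limit\<close> makes their intersection
  empty.\<close>

lemma uniform_descent:
  assumes k: "k > 2" and U: "connected U" "compact U" "\<And>v. v \<in> U \<Longrightarrow> inner_point k (chart k e v)" and u: "u \<in> U"
    and L: "sqrt (k + 2) < L"
  obtains g where "g \<in> Gamma_group" "\<And>v. v \<in> U \<Longrightarrow> coord_prod (g (chart k e v)) < 0"
    "\<And>v. v \<in> U \<Longrightarrow> \<bar>snd (snd (g (chart k e v)))\<bar> < L"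
proof -
  have inn: "inner_point k (g (chart k e v))" if "g \<in> Gamma_group" "v \<in> U" for g v
    by (rule inner_point_Gamma[OF U(3)[OF that(2)] that(1)])
  obtain t where t: "t \<in> Gamma_group" "coord_prod (t (chart k e u)) < 0"
    using inner_point_twist[OF k U(3)[OF u]] by metis
  define Q where "Q g \<longleftrightarrow> g \<in> Gamma_group \<and> (\<forall>v\<in>U. coord_prod (g (chart k e v)) < 0)" for g
  have "\<exists>f. \<forall>n. Q (f n) \<and> (\<forall>v\<in>U. descent_step (f n (chart k e v)) (f (Suc n) (chart k e v)))"
  proof (rule dependent_nat_choice)
    show "\<exists>g. Q g" unfolding Q_def using t(1) coord_prod_uniform[OF k U(1) _ t(1) u t(2)] U(3) by blast
    show "\<exists>h. Q h \<and> (\<forall>v\<in>U. descent_step (g (chart k e v)) (h (chart k e v)))" if "Q g" for g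
      unfolding Q_def using descent_step_exists[OF k U(1) _ u, of e g] U(3) that unfolding Q_def by blast
  qed
  then obtain f where f: "\<And>n. f n \<in> Gamma_group" "\<And>n v. v \<in> U \<Longrightarrow> coord_prod (f n (chart k e v)) < 0"
    "\<And>n v. v \<in> U \<Longrightarrow> descent_step (f n (chart k e v)) (f (Suc n) (chart k e v))"
    unfolding Q_def by blast
  define Z where "Z n v = \<bar>snd (snd (f n (chart k e v)))\<bar>" for n v
  have Zmono: "Z n v \<le> Z m v" if v: "v \<in> U" and "m \<le> n" for m n v
  proof (rule lift_Suc_antimono_le[OF _ \<open>m \<le> n\<close>])
    fix n
    show "Z (Suc n) v \<le> Z n v"
      using f(3)[OF v, of n] unfolding Z_def
      by (cases "f n (chart k e v)"; cases "f (Suc n) (chart k e v)") simp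
  qed
  have "\<exists>n. \<forall>v\<in>U. Z n v < L"
  proof (rule ccontr)
    assume "\<not> (\<exists>n. \<forall>v\<in>U. Z n v < L)"
    then have ne: "{v \<in> U. L \<le> Z n v} \<noteq> {}" for n by (metis (mono_tags, lifting) empty_iff mem_Collect_eq not_le)
    have "continuous_on U (Z n)" for n
      unfolding Z_def using continuous_on_Gamma_chart[OF k f(1), of U n e] by (intro continuous_intros)
    then have "compact (U \<inter> Z n -` {L..})" for n
      using U(2) by (metis closed_atLeast compact_Int_closed compact_imp_closed continuous_on_closed_vimage inf.absorb2 inf_commute inf_le1)
    then have cp: "compact {v \<in> U. L \<le> Z n v}" for n
      by (simp add: vimage_def Int_def)
    have "{v \<in> U. L \<le> Z n v} \<subseteq> {v \<in> U. L \<le> Z m v}" if "m \<le> n" for m n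
      using Zmono[OF _ that] by force
    then have "\<Inter> (range (\<lambda>n. {v \<in> U. L \<le> Z n v})) \<noteq> {}" using cp ne by (intro compact_nest)
    then obtain v where v: "\<And>n. v \<in> U" "\<And>n. L \<le> Z n v" by auto
    have "\<exists>n. \<bar>snd (snd (f n (chart k e v)))\<bar> < L"
    proof (rule descent_limit[where p = "\<lambda>n. f n (chart k e v)", OF k _ f(2)[OF v(1)] _ f(3)[OF v(1)] L])
      fix n
      obtain x y z where xyz: "f n (chart k e v) = (x, y, z)" by (cases "f n (chart k e v)")
      have i: "inner_point k (x, y, z)" using inn[OF f(1) v(1), of n] xyz by simp
      show "f n (chart k e v) \<in> level k" using inner_pointD[OF i] xyz by metis
      show "k + 2 < (snd (snd (f n (chart k e v))))\<^sup>2" using inner_point_z[OF k i] xyz by simp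
    qed
    then show False using v(2) unfolding Z_def by (metis not_le)
  qed
  then obtain n where n: "\<And>v. v \<in> U \<Longrightarrow> Z n v < L" by blast
  show ?thesis by (rule that[OF f(1) f(2)]) (use n in \<open>simp_all add: Z_def\<close>)
qed

text \<open>By area preservation the Jacobian of G is a ratio of two values of |\<open>Bxy\<close>|,
  bounded below by s / C on the box. The uniform descent, however, moves the box into an arbitrarily
  small square.\<close>

lemma no_inner_box:
  fixes a b :: "real^2"
  assumes k: "k > 2" and e: "e\<^sup>2 = 1" and box: "box a b \<noteq> {}"
    and inner: "\<And>v. v \<in> cbox a b \<Longrightarrow> inner_point k (chart k e v)"
  shows False
proof -
  let ?U = "cbox a b"
  have ne: "?U \<noteq> {}" using box box_subset_cbox by blast
  have vol: "measure lborel ?U > 0" using box by (simp add: content_pos_lt_eq box_ne_empty)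
  have "compact ((\<lambda>v. Bxy (chart k e v)) ` ?U)"
  proof (rule compact_continuous_image)
    show "continuous_on ?U (\<lambda>v. Bxy (chart k e v))"
      unfolding Bxy_chart chart_disc_def by (intro continuous_intros)
  qed simp
  then obtain C where C: "\<And>v. v \<in> ?U \<Longrightarrow> \<bar>Bxy (chart k e v)\<bar> \<le> C"
    using compact_imp_bounded by (metis bounded_iff imageI real_norm_def)
  define s where "s = sqrt (4 * (k + 2))"
  have s: "s > 0" using k by (simp add: s_def)
  have Blow: "s \<le> \<bar>Bxy (chart k e' v)\<bar>" if "e'\<^sup>2 = 1" for e' v
  proof -
    have "s \<le> sqrt (chart_disc k v)" unfolding s_def using chart_disc_ge[of k v] by (intro real_sqrt_le_mono)
    moreover have "\<bar>e'\<bar> = 1" using that by (simp add: power2_eq_1_iff) auto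
    ultimately show ?thesis using s by (simp add: Bxy_chart abs_mult)
  qed
  have C0: "C > 0"
  proof -
    obtain v where "v \<in> ?U" using ne by blast
    then show ?thesis using C[of v] Blow[OF e, of v] s by linarith
  qed
  \<comment> \<open>With 8 d^2 = s / C times the area of the box, the square of side 2 d has half
    the area that the image must have at least.\<close>
  define d where "d = sqrt (s / C * measure lborel ?U / 8)"
  have d: "d > 0" "8 * d\<^sup>2 = s / C * measure lborel ?U" using s C0 vol by (simp_all add: d_def)
  have lt: "sqrt (k + 2) < sqrt (k + 2 + d\<^sup>2)" using d(1) by (intro real_sqrt_less_mono) simp
  obtain u where u: "u \<in> ?U" using ne by blast
  obtain g where g: "g \<in> Gamma_group" "\<And>v. v \<in> ?U \<Longrightarrow> coord_prod (g (chart k e v)) < 0"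
    "\<And>v. v \<in> ?U \<Longrightarrow> \<bar>snd (snd (g (chart k e v)))\<bar> < sqrt (k + 2 + d\<^sup>2)"
    by (rule uniform_descent[OF k convex_connected[OF convex_box(1)] compact_cbox _ u lt, where e = e])
      (rule inner, assumption, rule that)
  obtain e' G G' where G: "e'\<^sup>2 = 1" "\<And>v. g (chart k e v) = chart k e' (G v)"
    "\<And>v. (G has_derivative G' v) (at v)"
    "\<And>v. \<bar>det (matrix (G' v))\<bar> * \<bar>Bxy (chart k e v)\<bar> = \<bar>Bxy (g (chart k e v))\<bar>"
    using chart_area_preservingE[OF chart_area_preserving_Gamma[OF k g(1)] e] by metis
  have det: "\<bar>det (matrix (G' v))\<bar> = \<bar>Bxy (g (chart k e v))\<bar> / \<bar>Bxy (chart k e v)\<bar>" for v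
    using G(4)[of v] Blow[OF e, of v] s by (simp add: field_simps)
  have cont: "continuous_on ?U (\<lambda>v. \<bar>det (matrix (G' v))\<bar>)"
  proof -
    have B: "Bxy = (\<lambda>p. 2 * snd (snd p) + fst p * fst (snd p))" by (rule ext, case_tac p) simp
    have "Bxy (chart k e v) \<noteq> 0" for v using Blow[OF e, of v] s by auto
    then show ?thesis
      unfolding det using continuous_on_Gamma_chart[OF k g(1), of ?U e] continuous_on_Gamma_chart[OF k Gamma_id, of ?U e]
      by (simp add: B) (intro continuous_intros; simp)
  qed
  have int: "(\<lambda>v. \<bar>det (matrix (G' v))\<bar>) integrable_on ?U" by (rule integrable_continuous[OF cont])
  have inj: "inj_on G ?U"
  proof (rule inj_onI)
    fix v w assume "G v = G w"
    then have "g (chart k e v) = g (chart k e w)" by (simp only: G(2))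
    moreover obtain h where "\<And>p. h (g p) = p" using Gamma_inverse[OF g(1)] by metis
    ultimately have "chart k e v = chart k e w" by metis
    then show "v = w" by (simp add: chart_def vec_eq_iff forall_2)
  qed
  have "s / C * measure lborel ?U = integral ?U (\<lambda>v. s / C)" by (simp add: mult.commute)
  also have "\<dots> \<le> integral ?U (\<lambda>v. \<bar>det (matrix (G' v))\<bar>)"
  proof (rule integral_le[OF integrable_const int])
    fix v assume v: "v \<in> ?U"
    show "s / C \<le> \<bar>det (matrix (G' v))\<bar>"
      unfolding det G(2) using Blow[OF G(1)] Blow[OF e, of v] C[OF v] s by (intro frac_le) auto
  qed
  also have "\<dots> = measure lebesgue (G ` ?U)"
    by (rule measure_differentiable_image_eq[symmetric, OF _ has_derivative_at_withinI[OF G(3)] inj int]) simp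
  also have "\<dots> \<le> measure lebesgue (cbox (vector [- d, - d]) (vector [d, d]) :: (real^2) set)"
  proof (rule measure_mono_fmeasurable)
    show "G ` ?U \<subseteq> cbox (vector [- d, - d]) (vector [d, d])"
    proof (rule image_subsetI)
      fix v assume v: "v \<in> ?U"
      obtain z where z: "g (chart k e v) = (G v $ 1, G v $ 2, z)" using G(2)[of v] unfolding chart_def[of k e'] by blast
      have lev: "(G v $ 1, G v $ 2, z) \<in> level k"
        using Gamma_level[OF g(1) chart_level[OF k e], of v] z by simp
      have "z\<^sup>2 < k + 2 + d\<^sup>2"
      proof -
        have "\<bar>z\<bar>\<^sup>2 < (sqrt (k + 2 + d\<^sup>2))\<^sup>2" using g(3)[OF v] z by (intro power_strict_mono) auto
        then show ?thesis using k by simp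
      qed
      moreover have "G v $ 1 * G v $ 2 * z < 0" using g(2)[OF v] z by simp
      \<comment> \<open>The level equation is x^2 + y^2 = z^2 - (k + 2) + xyz, and the last term is
        negative.\<close>
      ultimately have "(G v $ 1)\<^sup>2 + (G v $ 2)\<^sup>2 < d\<^sup>2" using lev by (simp add: level_def)
      then have "\<bar>G v $ 1\<bar>\<^sup>2 \<le> d\<^sup>2" "\<bar>G v $ 2\<bar>\<^sup>2 \<le> d\<^sup>2"
        unfolding power2_abs using zero_le_power2[of "G v $ 1"] zero_le_power2[of "G v $ 2"] by linarith+
      then have "\<bar>G v $ 1\<bar> \<le> d" "\<bar>G v $ 2\<bar> \<le> d" using less_imp_le[OF d(1)] by (blast intro: power2_le_imp_le)+
      then show "G v \<in> cbox (vector [- d, - d]) (vector [d, d])" by (simp add: mem_box_cart forall_2 abs_le_iff)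
    qed
    have "continuous_on ?U G" using G(3) by (meson continuous_at_imp_continuous_on has_derivative_continuous)
    then have "compact (G ` ?U)" using compact_cbox by (rule compact_continuous_image)
    then show "G ` ?U \<in> sets lebesgue" using lmeasurable_compact fmeasurableD by blast
  qed simp
  also have "\<dots> = 4 * d\<^sup>2"
  proof -
    have "cbox (vector [- d, - d]) (vector [d, d] :: real^2) \<noteq> {}" using d(1) by (simp add: interval_ne_empty_cart forall_2)
    then show ?thesis
      using content_cbox_cart[of "vector [- d, - d]" "vector [d, d] :: real^2"]
      by (simp add: prod_2 UNIV_2 power2_eq_square)
  qed
  finally have "s / C * measure lborel ?U \<le> 4 * d\<^sup>2" .
  moreover have "d\<^sup>2 > 0" using d(1) by simp
  ultimately show False using d(2) by linarith
qed

theorem empty_interior_above_2: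
  assumes k: "k > 2"
  shows "(top_of_set (level k)) interior_of (level k - orbit_set Gamma_group F'_C11) = {}"
proof (rule ccontr)
  assume "(top_of_set (level k)) interior_of (level k - orbit_set Gamma_group F'_C11) \<noteq> {}"
  then obtain p S where S: "openin (top_of_set (level k)) S" "p \<in> S" "S \<subseteq> level k - orbit_set Gamma_group F'_C11"
    unfolding interior_of_def by blast
  obtain T where T: "open T" "S = level k \<inter> T" using S(1) by (meson openin_open)
  have inner: "inner_point k q" if "q \<in> level k" "q \<in> T" for q
    unfolding inner_point_def using that T S(3) by blast
  obtain x y z where xyz: "p = (x, y, z)" by (cases p)
  have lev: "(x, y, z) \<in> level k" using S(2) T(2) xyz by blast
  define e :: real where "e = (if z > 0 then 1 else - 1)"
  have e: "e\<^sup>2 = 1" by (simp add: e_def)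
  have "z \<noteq> 0" using level_sign(2)[OF k lev] by auto
  then have ez: "0 < e * z" by (simp add: e_def)
  have "open (chart k e -` T)" using continuous_chart[OF k, of e] T(1) by (simp add: open_vimage)
  moreover have "vector [x, y] \<in> chart k e -` T"
    using chart_eqI[OF k lev e ez] S(2) T(2) xyz by simp
  ultimately obtain a b where ab: "cbox a b \<subseteq> chart k e -` T" "vector [x, y] \<in> box a b"
    by (rule open_contains_cbox)
  show False
  proof (rule no_inner_box[OF k e, of a b])
    show "box a b \<noteq> {}" using ab(2) by blast
    show "inner_point k (chart k e v)" if "v \<in> cbox a b" for v
      using inner[OF chart_level[OF k e]] ab(1) that by blast
  qed
qed

theorem mainTheorem1:
  shows
    "(\<forall>k<2.
        acts_properly Gamma_group (orbit_set Gamma_group F_C02) \<and>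
        ergodic_on Gamma_group (completion (area_measure k)) (level k - orbit_set Gamma_group F_C02)) \<and>
     ergodic_on Gamma_group (completion (area_measure 2)) (level 2) \<and>
     (\<forall>k>2.
        acts_properly Gamma_group (orbit_set Gamma_group F'_C11) \<and>
        (top_of_set (level k)) interior_of (level k - orbit_set Gamma_group F'_C11) = {})"
  by (intro conjI allI impI acts_properly_F_C02 ergodic_below_2 ergodic_2 acts_properly_F'_C11 empty_interior_above_2)


end
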